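(* Let $C$ and $C'$ be comonoids, and let $A$ and $A'$ be monoids, in a twistable monoidal category $\mathcal M$ endowed with a right twisting structure $(B,E,\widetilde E,\delta,\mu)$. Let $g:C\to BA$ and $g':C'\to BA'$ be classifying morphisms (morphisms of comonoids). Let $$(g,g')_*:{}_C\mathbf{Comod}_{C'}\to{}_A\mathbf{Mod}_{A'},\qquad (g,g')_*(N)=A\otimes_gN\otimes_{g'}A',$$ and $$(g,g')^*:{}_A\mathbf{Mod}_{A'}\to{}_C\mathbf{Comod}_{C'},\qquad (g,g')^*(M)=C\otimes_gM\otimes_{g'}C'.$$ Then the functors $(g,g')_*:{}_C\mathbf{Comod}_{C'}\rightleftarrows{}_A\mathbf{Mod}_{A'}:(g,g')^*$ form an adjunction, with $(g,g')_*$ left adjoint to $(g,g')^*$.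
   Context: $(\mathcal M,\otimes,I)$ is a monoidal category with equalizers and coequalizers; $\mathbf{Mon}$, $\mathbf{Comon}$ are its categories of monoids and comonoids. For a monoid $A$, a right $A$-module $(M,\rho)$ and a left $A$-module $(N,\lambda)$, $M\otimes_AN$ is the coequalizer of $\rho\otimes N, M\otimes\lambda:M\otimes A\otimes N\rightrightarrows M\otimes N$. For a comonoid $C$, a right $C$-comodule $(M,\rho)$ and a left $C$-comodule $(N,\lambda)$, $M\square_CN$ is the equalizer of $\rho\otimes N,M\otimes\lambda:M\otimes N\rightrightarrows M\otimes C\otimes N$. If each of $X,Y$ is a monoid or a comonoid, ${}_X\mathbf{Mix}_Y$ is the category of objects of $\mathcal M$ with a left $X$-structure (action if $X$ is a monoid, coaction if $X$ is a comonoid) and a right $Y$-structure which commute with each other. For $X,Y$ monoids it is the bimodule category ${}_X\mathbf{Mod}_Y$; for $X,Y$ comonoids the bicomodule category ${}_X\mathbf{Comod}_Y$. $\mathcal M$ is *twistable* if for all monoids $A$, comonoids $C$ and (co)monoids $X,Y$ the tensor product over $A$ (the coequalizer $M\otimes_AN$) and the cotensor product over $C$ (the equalizer $M\square_CN$) define bifunctors $-\otimes_A-:{}_X\mathbf{Mix}_A\times{}_A\mathbf{Mix}_Y\to{}_X\mathbf{Mix}_Y$ and $-\square_C-:{}_X\mathbf{Mix}_C\times{}_C\mathbf{Mix}_Y\to{}_X\mathbf{Mix}_Y$, and all iterated tensorings over monoids and cotensorings over comonoids are associative up to isomorphism (in the obvious sense, including mixed ones). A *right twisting structure* $(B,E,\widetilde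 E,\delta,\mu)$ on a twistable $\mathcal M$ consists of: a functor $B:\mathbf{Mon}\to\mathbf{Comon}$; for each monoid $A$ objects $EA\in{}_{BA}\mathbf{Mix}_A$ and $\widetilde EA\in{}_A\mathbf{Mix}_{BA}$, natural in the sense that for every monoid morphism $f:A\to A'$, $EA\otimes_A({}_fA')\cong (BA)_{Bf}\square_{BA'}EA'$ and $A'_f\otimes_A\widetilde EA\cong\widetilde EA'\square_{BA'}({}_{Bf}BA)$ (subscripts indicate structures obtained via the given morphism); natural morphisms $\delta_A:BA\to EA\otimes_A\widetilde EA$ of $BA$-bicomodules and $\mu_A:\widetilde EA\square_{BA}EA\to A$ of $A$-bimodules, such that the composites $\widetilde EA\cong\widetilde EA\square_{BA}BA\xrightarrow{\widetilde EA\square\delta_A}\widetilde EA\square_{BA}EA\otimes_A\widetilde EA\xrightarrow{\mu_A\otimes_A\widetilde EA}\widetilde EA$ and $EA\cong BA\square_{BA}EA\xrightarrow{\delta_A\square EA}EA\otimes_A\widetilde EA\square_{BA}EA\xrightarrow{EA\otimes_A\mu_A}EA$ are identities. A *classifying morphism* is a comonoid morphism $g:C\to BA$. For a right $C$-comodule $V$ and left $A$-module $W$, $V\otimes_gW=V_g\square_{BA}EA\otimes_AW$; for a right $A$-module $X$ and left $C$-comodule $Y$, $X\otimes_gY=X\otimes_A\widetilde EA\square_{BA}({}_gY)$, where $V_g$ and ${}_gY$ are viewed as $BA$-comodules via $g$. *)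

theory Defs
  imports Main
begin

section \<open>Categories, functors, adjunctions\<close>

text \<open>
  Composition is a single operation on arrows, but hom-sets need not be disjoint: an arrow of
  a category of bimodules is just an arrow of the ambient category, and does not record the
  actions on its source and target.  For this reason arrow maps of functors and of natural
  bijections take the source and target as additional arguments.
\<close>

record ('o, 'a) category =
  obj :: "'o set"
  hom :: "'o \<Rightarrow> 'o \<Rightarrow> 'a set"
  ident :: "'o \<Rightarrow> 'a"
  comp :: "'a \<Rightarrow> 'a \<Rightarrow> 'a"  (infixr "\<cdot>\<index>" 70)

definition category :: "('o, 'a, 'r) category_scheme \<Rightarrow> bool" where
  "category C \<longleftrightarrow>
    (\<forall>x\<in>obj C. ident C x \<in> hom C x x) \<and>
    (\<forall>x\<in>obj C. \<forall>y\<in>obj C. \<forall>z\<in>obj C. \<forall>f\<in>hom C x y. \<forall>g\<in>hom C y z. g \<cdot>\<^bsub>C\<^esub> f \<in> hom C x z) \<and>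
    (\<forall>x\<in>obj C. \<forall>y\<in>obj C. \<forall>f\<in>hom C x y. f \<cdot>\<^bsub>C\<^esub> ident C x = f \<and> ident C y \<cdot>\<^bsub>C\<^esub> f = f) \<and>
    (\<forall>w\<in>obj C. \<forall>x\<in>obj C. \<forall>y\<in>obj C. \<forall>z\<in>obj C.
      \<forall>f\<in>hom C w x. \<forall>g\<in>hom C x y. \<forall>h\<in>hom C y z.
        (h \<cdot>\<^bsub>C\<^esub> g) \<cdot>\<^bsub>C\<^esub> f = h \<cdot>\<^bsub>C\<^esub> (g \<cdot>\<^bsub>C\<^esub> f))"

definition prod_cat ::
  "('o, 'a, 'r) category_scheme \<Rightarrow> ('p, 'b, 's) category_scheme \<Rightarrow> ('o \<times> 'p, 'a \<times> 'b) category" where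
  "prod_cat C D =
    \<lparr> obj = obj C \<times> obj D,
      hom = (\<lambda>x y. hom C (fst x) (fst y) \<times> hom D (snd x) (snd y)),
      ident = (\<lambda>x. (ident C (fst x), ident D (snd x))),
      comp = (\<lambda>g f. (fst g \<cdot>\<^bsub>C\<^esub> fst f, snd g \<cdot>\<^bsub>D\<^esub> snd f)) \<rparr>"

definition inverse_arrows ::
  "('o, 'a, 'r) category_scheme \<Rightarrow> 'o \<Rightarrow> 'o \<Rightarrow> 'a \<Rightarrow> 'a \<Rightarrow> bool" where
  "inverse_arrows C x y f g \<longleftrightarrow> f \<in> hom C x y \<and> g \<in> hom C y x \<and>
    g \<cdot>\<^bsub>C\<^esub> f = ident C x \<and> f \<cdot>\<^bsub>C\<^esub> g = ident C y"

definition is_iso :: "('o, 'a, 'r) category_scheme \<Rightarrow> 'o \<Rightarrow> 'o \<Rightarrow> 'a \<Rightarrow> bool" where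
  "is_iso C x y f \<longleftrightarrow> (\<exists>g. inverse_arrows C x y f g)"

definition inv_arr :: "('o, 'a, 'r) category_scheme \<Rightarrow> 'o \<Rightarrow> 'o \<Rightarrow> 'a \<Rightarrow> 'a" where
  "inv_arr C x y f = (THE g. inverse_arrows C x y f g)"

record ('o, 'a, 'p, 'b) ftor =
  fob :: "'o \<Rightarrow> 'p"
  far :: "'o \<Rightarrow> 'o \<Rightarrow> 'a \<Rightarrow> 'b"

definition is_functor ::
  "('o, 'a, 'r) category_scheme \<Rightarrow> ('p, 'b, 's) category_scheme \<Rightarrow> ('o, 'a, 'p, 'b) ftor \<Rightarrow> bool" where
  "is_functor C D F \<longleftrightarrow> category C \<and> category D \<and>
    (\<forall>x\<in>obj C. fob F x \<in> obj D) \<and>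
    (\<forall>x\<in>obj C. \<forall>y\<in>obj C. \<forall>f\<in>hom C x y. far F x y f \<in> hom D (fob F x) (fob F y)) \<and>
    (\<forall>x\<in>obj C. far F x x (ident C x) = ident D (fob F x)) \<and>
    (\<forall>x\<in>obj C. \<forall>y\<in>obj C. \<forall>z\<in>obj C. \<forall>f\<in>hom C x y. \<forall>g\<in>hom C y z.
      far F x z (g \<cdot>\<^bsub>C\<^esub> f) = far F y z g \<cdot>\<^bsub>D\<^esub> far F x y f)"

text \<open>\<open>adjunction C D F G\<close>: the functor \<open>F : C \<rightarrow> D\<close> is left adjoint to \<open>G : D \<rightarrow> C\<close>.\<close>

definition adjunction ::
  "('o, 'a, 'r) category_scheme \<Rightarrow> ('p, 'b, 's) category_scheme \<Rightarrow>
   ('o, 'a, 'p, 'b) ftor \<Rightarrow> ('p, 'b, 'o, 'a) ftor \<Rightarrow> bool" where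
  "adjunction C D F G \<longleftrightarrow> is_functor C D F \<and> is_functor D C G \<and>
    (\<exists>\<Phi>.
      (\<forall>x\<in>obj C. \<forall>y\<in>obj D. bij_betw (\<Phi> x y) (hom D (fob F x) y) (hom C x (fob G y))) \<and>
      (\<forall>x\<in>obj C. \<forall>x'\<in>obj C. \<forall>y\<in>obj D. \<forall>y'\<in>obj D.
        \<forall>u\<in>hom C x' x. \<forall>v\<in>hom D y y'. \<forall>h\<in>hom D (fob F x) y.
          \<Phi> x' y' (v \<cdot>\<^bsub>D\<^esub> h \<cdot>\<^bsub>D\<^esub> far F x' x u) = far G y y' v \<cdot>\<^bsub>C\<^esub> \<Phi> x y h \<cdot>\<^bsub>C\<^esub> u))"

definition is_coequalizer ::
  "('o, 'a, 'r) category_scheme \<Rightarrow> 'o \<Rightarrow> 'o \<Rightarrow> 'a \<Rightarrow> 'a \<Rightarrow> 'o \<Rightarrow> 'a \<Rightarrow> bool" where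
  "is_coequalizer C x y f g c q \<longleftrightarrow> c \<in> obj C \<and> q \<in> hom C y c \<and> q \<cdot>\<^bsub>C\<^esub> f = q \<cdot>\<^bsub>C\<^esub> g \<and>
    (\<forall>z\<in>obj C. \<forall>h\<in>hom C y z. h \<cdot>\<^bsub>C\<^esub> f = h \<cdot>\<^bsub>C\<^esub> g \<longrightarrow> (\<exists>!k. k \<in> hom C c z \<and> k \<cdot>\<^bsub>C\<^esub> q = h))"

definition is_equalizer ::
  "('o, 'a, 'r) category_scheme \<Rightarrow> 'o \<Rightarrow> 'o \<Rightarrow> 'a \<Rightarrow> 'a \<Rightarrow> 'o \<Rightarrow> 'a \<Rightarrow> bool" where
  "is_equalizer C x y f g e i \<longleftrightarrow> e \<in> obj C \<and> i \<in> hom C e x \<and> f \<cdot>\<^bsub>C\<^esub> i = g \<cdot>\<^bsub>C\<^esub> i \<and>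
    (\<forall>z\<in>obj C. \<forall>h\<in>hom C z x. f \<cdot>\<^bsub>C\<^esub> h = g \<cdot>\<^bsub>C\<^esub> h \<longrightarrow> (\<exists>!k. k \<in> hom C z e \<and> i \<cdot>\<^bsub>C\<^esub> k = h))"

definition has_coequalizers :: "('o, 'a, 'r) category_scheme \<Rightarrow> bool" where
  "has_coequalizers C \<longleftrightarrow> (\<forall>x\<in>obj C. \<forall>y\<in>obj C. \<forall>f\<in>hom C x y. \<forall>g\<in>hom C x y.
    \<exists>c q. is_coequalizer C x y f g c q)"

definition has_equalizers :: "('o, 'a, 'r) category_scheme \<Rightarrow> bool" where
  "has_equalizers C \<longleftrightarrow> (\<forall>x\<in>obj C. \<forall>y\<in>obj C. \<forall>f\<in>hom C x y. \<forall>g\<in>hom C x y.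
    \<exists>e i. is_equalizer C x y f g e i)"

text \<open>A choice of coequalizer, resp. equalizer, of a parallel pair, together with its
  structure map.\<close>

definition coeq :: "('o, 'a, 'r) category_scheme \<Rightarrow> 'o \<Rightarrow> 'o \<Rightarrow> 'a \<Rightarrow> 'a \<Rightarrow> 'o \<times> 'a" where
  "coeq C x y f g = (SOME cq. is_coequalizer C x y f g (fst cq) (snd cq))"

definition equ :: "('o, 'a, 'r) category_scheme \<Rightarrow> 'o \<Rightarrow> 'o \<Rightarrow> 'a \<Rightarrow> 'a \<Rightarrow> 'o \<times> 'a" where
  "equ C x y f g = (SOME ei. is_equalizer C x y f g (fst ei) (snd ei))"


section \<open>Monoidal categories\<close>

text \<open>The tensor product is written \<open>\<otimes>\<close> on objects and \<open>\<boxtimes>\<close> on arrows.  The associator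
  \<open>asc x y z\<close> goes from \<open>(x \<otimes> y) \<otimes> z\<close> to \<open>x \<otimes> (y \<otimes> z)\<close>.\<close>

record ('o, 'a) moncat = "('o, 'a) category" +
  tens :: "'o \<Rightarrow> 'o \<Rightarrow> 'o"  (infixl "\<otimes>\<index>" 75)
  tensa :: "'a \<Rightarrow> 'a \<Rightarrow> 'a"  (infixl "\<boxtimes>\<index>" 75)
  uno :: 'o  ("\<one>\<index>")
  asc :: "'o \<Rightarrow> 'o \<Rightarrow> 'o \<Rightarrow> 'a"
  lun :: "'o \<Rightarrow> 'a"
  run :: "'o \<Rightarrow> 'a"

context
  fixes K :: "('o, 'a) moncat" (structure)
begin

definition monoidal_category :: bool where
  "monoidal_category \<longleftrightarrow>
    is_functor (prod_cat K K) K
      \<lparr> fob = (\<lambda>(x, y). x \<otimes> y), far = (\<lambda>_ _ (f, g). f \<boxtimes> g) \<rparr> \<and>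
    \<one> \<in> obj K \<and>
    (\<forall>x\<in>obj K. \<forall>y\<in>obj K. \<forall>z\<in>obj K. is_iso K ((x \<otimes> y) \<otimes> z) (x \<otimes> (y \<otimes> z)) (asc K x y z)) \<and>
    (\<forall>x\<in>obj K. is_iso K (\<one> \<otimes> x) x (lun K x)) \<and>
    (\<forall>x\<in>obj K. is_iso K (x \<otimes> \<one>) x (run K x)) \<and>
    (\<forall>x\<in>obj K. \<forall>x'\<in>obj K. \<forall>y\<in>obj K. \<forall>y'\<in>obj K. \<forall>z\<in>obj K. \<forall>z'\<in>obj K.
      \<forall>f\<in>hom K x x'. \<forall>g\<in>hom K y y'. \<forall>h\<in>hom K z z'.
        asc K x' y' z' \<cdot> ((f \<boxtimes> g) \<boxtimes> h) = (f \<boxtimes> (g \<boxtimes> h)) \<cdot> asc K x y z) \<and>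
    (\<forall>x\<in>obj K. \<forall>x'\<in>obj K. \<forall>f\<in>hom K x x'.
        lun K x' \<cdot> (ident K \<one> \<boxtimes> f) = f \<cdot> lun K x \<and>
        run K x' \<cdot> (f \<boxtimes> ident K \<one>) = f \<cdot> run K x) \<and>
    (\<forall>w\<in>obj K. \<forall>x\<in>obj K. \<forall>y\<in>obj K. \<forall>z\<in>obj K.
      asc K w x (y \<otimes> z) \<cdot> asc K (w \<otimes> x) y z =
        (ident K w \<boxtimes> asc K x y z) \<cdot> asc K w (x \<otimes> y) z \<cdot> (asc K w x y \<boxtimes> ident K z)) \<and>
    (\<forall>x\<in>obj K. \<forall>y\<in>obj K.
      (ident K x \<boxtimes> lun K y) \<cdot> asc K x \<one> y = run K x \<boxtimes> ident K y)"

definition asci :: "'o \<Rightarrow> 'o \<Rightarrow> 'o \<Rightarrow> 'a" where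
  "asci x y z = inv_arr K ((x \<otimes> y) \<otimes> z) (x \<otimes> (y \<otimes> z)) (asc K x y z)"

definition luni :: "'o \<Rightarrow> 'a" where
  "luni x = inv_arr K (\<one> \<otimes> x) x (lun K x)"

definition runi :: "'o \<Rightarrow> 'a" where
  "runi x = inv_arr K (x \<otimes> \<one>) x (run K x)"

end


section \<open>Monoids, comonoids, and mixed bi(co)modules\<close>

text \<open>Monoids and comonoids share one type, so that \<open>Mix X Y\<close> below can take either kind on
  either side.  The second argument is the (co)multiplication, the third the (co)unit.\<close>

datatype ('o, 'a) comon =
    Monoid (und: 'o) (mlt: 'a) (unt: 'a)
  | Comonoid (und: 'o) (mlt: 'a) (unt: 'a)

text \<open>An object with a left and a right structure map.\<close>

datatype ('o, 'a) bi = Bi (carr: 'o) (lact: 'a) (ract: 'a)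

text \<open>A (co)monoid as a bi(co)module over itself.\<close>

definition regular :: "('o, 'a) comon \<Rightarrow> ('o, 'a) bi" where
  "regular X = Bi (und X) (mlt X) (mlt X)"

context
  fixes K :: "('o, 'a) moncat" (structure)
begin

definition Mon :: "(('o, 'a) comon, 'a) category" where
  "Mon =
    \<lparr> obj = {Monoid a m e | a m e. a \<in> obj K \<and> m \<in> hom K (a \<otimes> a) a \<and> e \<in> hom K \<one> a \<and>
        m \<cdot> (m \<boxtimes> ident K a) = m \<cdot> (ident K a \<boxtimes> m) \<cdot> asc K a a a \<and>
        m \<cdot> (e \<boxtimes> ident K a) = lun K a \<and>
        m \<cdot> (ident K a \<boxtimes> e) = run K a},
      hom = (\<lambda>A A'. {f \<in> hom K (und A) (und A').
        f \<cdot> mlt A = mlt A' \<cdot> (f \<boxtimes> f) \<and> f \<cdot> unt A = unt A'}),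
      ident = (\<lambda>A. ident K (und A)),
      comp = comp K \<rparr>"

definition Comon :: "(('o, 'a) comon, 'a) category" where
  "Comon =
    \<lparr> obj = {Comonoid c d e | c d e. c \<in> obj K \<and> d \<in> hom K c (c \<otimes> c) \<and> e \<in> hom K c \<one> \<and>
        asc K c c c \<cdot> (d \<boxtimes> ident K c) \<cdot> d = (ident K c \<boxtimes> d) \<cdot> d \<and>
        lun K c \<cdot> (e \<boxtimes> ident K c) \<cdot> d = ident K c \<and>
        run K c \<cdot> (ident K c \<boxtimes> e) \<cdot> d = ident K c},
      hom = (\<lambda>C C'. {f \<in> hom K (und C) (und C').
        (f \<boxtimes> f) \<cdot> mlt C = mlt C' \<cdot> f \<and> unt C' \<cdot> f = unt C}),
      ident = (\<lambda>C. ident K (und C)),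
      comp = comp K \<rparr>"

definition lact_hom :: "('o, 'a) comon \<Rightarrow> 'o \<Rightarrow> 'a set" where
  "lact_hom X m = (case X of
      Monoid a _ _ \<Rightarrow> hom K (a \<otimes> m) m
    | Comonoid c _ _ \<Rightarrow> hom K m (c \<otimes> m))"

definition ract_hom :: "('o, 'a) comon \<Rightarrow> 'o \<Rightarrow> 'a set" where
  "ract_hom Y m = (case Y of
      Monoid a _ _ \<Rightarrow> hom K (m \<otimes> a) m
    | Comonoid c _ _ \<Rightarrow> hom K m (m \<otimes> c))"

definition left_structure :: "('o, 'a) comon \<Rightarrow> 'o \<Rightarrow> 'a \<Rightarrow> bool" where
  "left_structure X m l \<longleftrightarrow> l \<in> lact_hom X m \<and> (case X of
      Monoid a p e \<Rightarrow>
        l \<cdot> (p \<boxtimes> ident K m) = l \<cdot> (ident K a \<boxtimes> l) \<cdot> asc K a a m \<and>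
        l \<cdot> (e \<boxtimes> ident K m) = lun K m
    | Comonoid c d e \<Rightarrow>
        asc K c c m \<cdot> (d \<boxtimes> ident K m) \<cdot> l = (ident K c \<boxtimes> l) \<cdot> l \<and>
        lun K m \<cdot> (e \<boxtimes> ident K m) \<cdot> l = ident K m)"

definition right_structure :: "('o, 'a) comon \<Rightarrow> 'o \<Rightarrow> 'a \<Rightarrow> bool" where
  "right_structure Y m r \<longleftrightarrow> r \<in> ract_hom Y m \<and> (case Y of
      Monoid a p e \<Rightarrow>
        r \<cdot> (r \<boxtimes> ident K a) = r \<cdot> (ident K m \<boxtimes> p) \<cdot> asc K m a a \<and>
        r \<cdot> (ident K m \<boxtimes> e) = run K m
    | Comonoid c d e \<Rightarrow>
        asc K m c c \<cdot> (r \<boxtimes> ident K c) \<cdot> r = (ident K m \<boxtimes> d) \<cdot> r \<and>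
        run K m \<cdot> (ident K m \<boxtimes> e) \<cdot> r = ident K m)"

definition structures_commute ::
  "('o, 'a) comon \<Rightarrow> ('o, 'a) comon \<Rightarrow> 'o \<Rightarrow> 'a \<Rightarrow> 'a \<Rightarrow> bool" where
  "structures_commute X Y m l r \<longleftrightarrow> (case X of
      Monoid x _ _ \<Rightarrow> (case Y of
          Monoid y _ _ \<Rightarrow>
            r \<cdot> (l \<boxtimes> ident K y) = l \<cdot> (ident K x \<boxtimes> r) \<cdot> asc K x m y
        | Comonoid y _ _ \<Rightarrow>
            r \<cdot> l = (l \<boxtimes> ident K y) \<cdot> asci K x m y \<cdot> (ident K x \<boxtimes> r))
    | Comonoid x _ _ \<Rightarrow> (case Y of
          Monoid y _ _ \<Rightarrow>
            l \<cdot> r = (ident K x \<boxtimes> r) \<cdot> asc K x m y \<cdot> (l \<boxtimes> ident K y)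
        | Comonoid y _ _ \<Rightarrow>
            asc K x m y \<cdot> (l \<boxtimes> ident K y) \<cdot> r = (ident K x \<boxtimes> r) \<cdot> l))"

text \<open>\<open>left_equivariant X l l' f\<close>: the arrow \<open>f\<close> is compatible with the left \<open>X\<close>-structure map
  \<open>l\<close> on its source and \<open>l'\<close> on its target.\<close>

definition left_equivariant :: "('o, 'a) comon \<Rightarrow> 'a \<Rightarrow> 'a \<Rightarrow> 'a \<Rightarrow> bool" where
  "left_equivariant X l l' f \<longleftrightarrow> (case X of
      Monoid a _ _ \<Rightarrow> f \<cdot> l = l' \<cdot> (ident K a \<boxtimes> f)
    | Comonoid c _ _ \<Rightarrow> l' \<cdot> f = (ident K c \<boxtimes> f) \<cdot> l)"

definition right_equivariant :: "('o, 'a) comon \<Rightarrow> 'a \<Rightarrow> 'a \<Rightarrow> 'a \<Rightarrow> bool" where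
  "right_equivariant Y r r' f \<longleftrightarrow> (case Y of
      Monoid a _ _ \<Rightarrow> f \<cdot> r = r' \<cdot> (f \<boxtimes> ident K a)
    | Comonoid c _ _ \<Rightarrow> r' \<cdot> f = (f \<boxtimes> ident K c) \<cdot> r)"

definition Mix :: "('o, 'a) comon \<Rightarrow> ('o, 'a) comon \<Rightarrow> (('o, 'a) bi, 'a) category" where
  "Mix X Y =
    \<lparr> obj = {M. carr M \<in> obj K \<and> left_structure X (carr M) (lact M) \<and>
        right_structure Y (carr M) (ract M) \<and>
        structures_commute X Y (carr M) (lact M) (ract M)},
      hom = (\<lambda>M N. {f \<in> hom K (carr M) (carr N).
        left_equivariant X (lact M) (lact N) f \<and> right_equivariant Y (ract M) (ract N) f}),
      ident = (\<lambda>M. ident K (carr M)),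
      comp = comp K \<rparr>"

text \<open>Change of (co)monoid: modules are restricted along a morphism of monoids into the acting
  monoid, comodules are pushed forward along a morphism of comonoids out of the coacting one.\<close>

definition mod_left_via :: "'a \<Rightarrow> ('o, 'a) bi \<Rightarrow> ('o, 'a) bi" where
  "mod_left_via f M = Bi (carr M) (lact M \<cdot> (f \<boxtimes> ident K (carr M))) (ract M)"

definition mod_right_via :: "'a \<Rightarrow> ('o, 'a) bi \<Rightarrow> ('o, 'a) bi" where
  "mod_right_via f M = Bi (carr M) (lact M) (ract M \<cdot> (ident K (carr M) \<boxtimes> f))"

definition comod_left_via :: "'a \<Rightarrow> ('o, 'a) bi \<Rightarrow> ('o, 'a) bi" where
  "comod_left_via g N = Bi (carr N) ((g \<boxtimes> ident K (carr N)) \<cdot> lact N) (ract N)"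

definition comod_right_via :: "'a \<Rightarrow> ('o, 'a) bi \<Rightarrow> ('o, 'a) bi" where
  "comod_right_via g N = Bi (carr N) (lact N) ((ident K (carr N) \<boxtimes> g) \<cdot> ract N)"


section \<open>Tensor and cotensor products\<close>

text \<open>\<open>bal P M N\<close> is \<open>M \<otimes>\<^sub>P N\<close> if \<open>P\<close> is a monoid and the cotensor product of \<open>M\<close> and \<open>N\<close> over
  \<open>P\<close> if \<open>P\<close> is a comonoid, paired with its structure map: the projection from
  \<open>carr M \<otimes> carr N\<close> in the first case, the inclusion into \<open>carr M \<otimes> carr N\<close> in the second.
  Only the right structure of \<open>M\<close> and the left structure of \<open>N\<close> enter.\<close>

definition bal :: "('o, 'a) comon \<Rightarrow> ('o, 'a) bi \<Rightarrow> ('o, 'a) bi \<Rightarrow> 'o \<times> 'a" where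
  "bal P M N = (let m = carr M; n = carr N in case P of
      Monoid a _ _ \<Rightarrow> coeq K ((m \<otimes> a) \<otimes> n) (m \<otimes> n)
        (ract M \<boxtimes> ident K n) ((ident K m \<boxtimes> lact N) \<cdot> asc K m a n)
    | Comonoid c _ _ \<Rightarrow> equ K (m \<otimes> n) (m \<otimes> (c \<otimes> n))
        (asc K m c n \<cdot> (ract M \<boxtimes> ident K n)) (ident K m \<boxtimes> lact N))"

definition bal_obj :: "('o, 'a) comon \<Rightarrow> ('o, 'a) bi \<Rightarrow> ('o, 'a) bi \<Rightarrow> 'o" where
  "bal_obj P M N = fst (bal P M N)"

definition bal_arr :: "('o, 'a) comon \<Rightarrow> ('o, 'a) bi \<Rightarrow> ('o, 'a) bi \<Rightarrow> 'a" where
  "bal_arr P M N = snd (bal P M N)"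

text \<open>The left \<open>X\<close>-structure of \<open>M\<close>, resp. the right \<open>Y\<close>-structure of \<open>N\<close>, as a structure on
  \<open>carr M \<otimes> carr N\<close>.\<close>

definition tens_lact :: "('o, 'a) comon \<Rightarrow> ('o, 'a) bi \<Rightarrow> ('o, 'a) bi \<Rightarrow> 'a" where
  "tens_lact X M N = (case X of
      Monoid a _ _ \<Rightarrow> (lact M \<boxtimes> ident K (carr N)) \<cdot> asci K a (carr M) (carr N)
    | Comonoid c _ _ \<Rightarrow> asc K c (carr M) (carr N) \<cdot> (lact M \<boxtimes> ident K (carr N)))"

definition tens_ract :: "('o, 'a) comon \<Rightarrow> ('o, 'a) bi \<Rightarrow> ('o, 'a) bi \<Rightarrow> 'a" where
  "tens_ract Y M N = (case Y of
      Monoid a _ _ \<Rightarrow> (ident K (carr M) \<boxtimes> ract N) \<cdot> asc K (carr M) (carr N) a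
    | Comonoid c _ _ \<Rightarrow> asci K (carr M) (carr N) c \<cdot> (ident K (carr M) \<boxtimes> ract N))"

text \<open>Structure maps on the (co)tensor product that make the projection, resp. the inclusion,
  equivariant.\<close>

definition induced_lact ::
  "('o, 'a) comon \<Rightarrow> ('o, 'a) comon \<Rightarrow> ('o, 'a) bi \<Rightarrow> ('o, 'a) bi \<Rightarrow> 'a \<Rightarrow> bool" where
  "induced_lact X P M N l \<longleftrightarrow> l \<in> lact_hom X (bal_obj P M N) \<and> (case P of
      Monoid _ _ _ \<Rightarrow> left_equivariant X (tens_lact X M N) l (bal_arr P M N)
    | Comonoid _ _ _ \<Rightarrow> left_equivariant X l (tens_lact X M N) (bal_arr P M N))"

definition induced_ract ::
  "('o, 'a) comon \<Rightarrow> ('o, 'a) comon \<Rightarrow> ('o, 'a) bi \<Rightarrow> ('o, 'a) bi \<Rightarrow> 'a \<Rightarrow> bool" where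
  "induced_ract Y P M N r \<longleftrightarrow> r \<in> ract_hom Y (bal_obj P M N) \<and> (case P of
      Monoid _ _ _ \<Rightarrow> right_equivariant Y (tens_ract Y M N) r (bal_arr P M N)
    | Comonoid _ _ _ \<Rightarrow> right_equivariant Y r (tens_ract Y M N) (bal_arr P M N))"

definition mten ::
  "('o, 'a) comon \<Rightarrow> ('o, 'a) comon \<Rightarrow> ('o, 'a) comon \<Rightarrow> ('o, 'a) bi \<Rightarrow> ('o, 'a) bi \<Rightarrow> ('o, 'a) bi" where
  "mten X P Y M N = Bi (bal_obj P M N) (THE l. induced_lact X P M N l) (THE r. induced_ract Y P M N r)"

text \<open>\<open>bal_map P M N P' M' N' f h\<close> is the arrow from \<open>bal_obj P M N\<close> to \<open>bal_obj P' M' N'\<close>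
  induced by \<open>f : M \<rightarrow> M'\<close> and \<open>h : N \<rightarrow> N'\<close>.  The two bases are of the same kind, but may
  differ, which is needed for maps that are linear over a morphism \<open>P \<rightarrow> P'\<close>.\<close>

definition bal_map ::
  "('o, 'a) comon \<Rightarrow> ('o, 'a) bi \<Rightarrow> ('o, 'a) bi \<Rightarrow>
   ('o, 'a) comon \<Rightarrow> ('o, 'a) bi \<Rightarrow> ('o, 'a) bi \<Rightarrow> 'a \<Rightarrow> 'a \<Rightarrow> 'a" where
  "bal_map P M N P' M' N' f h = (THE k. k \<in> hom K (bal_obj P M N) (bal_obj P' M' N') \<and> (case P of
      Monoid _ _ _ \<Rightarrow> k \<cdot> bal_arr P M N = bal_arr P' M' N' \<cdot> (f \<boxtimes> h)
    | Comonoid _ _ _ \<Rightarrow> bal_arr P' M' N' \<cdot> k = (f \<boxtimes> h) \<cdot> bal_arr P M N))"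

definition mten_functor ::
  "('o, 'a) comon \<Rightarrow> ('o, 'a) comon \<Rightarrow> ('o, 'a) comon \<Rightarrow>
   (('o, 'a) bi \<times> ('o, 'a) bi, 'a \<times> 'a, ('o, 'a) bi, 'a) ftor" where
  "mten_functor X P Y =
    \<lparr> fob = (\<lambda>(M, N). mten X P Y M N),
      far = (\<lambda>(M, N) (M', N') (f, h). bal_map P M N P M' N' f h) \<rparr>"

text \<open>The canonical comparison \<open>a : (M \<otimes>\<^sub>P N) \<otimes>\<^sub>Q R \<rightarrow> M \<otimes>\<^sub>P (N \<otimes>\<^sub>Q R)\<close>, where each of the two
  products is a tensor or a cotensor product: \<open>a\<close> is compatible with the associator of \<open>K\<close> via
  the projections and inclusions.  If \<open>P\<close> is a monoid and \<open>Q\<close> a comonoid, the comparison map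
  that the universal properties provide is the inverse of \<open>a\<close>.\<close>

definition assoc_compatible ::
  "('o, 'a) comon \<Rightarrow> ('o, 'a) comon \<Rightarrow> ('o, 'a) comon \<Rightarrow> ('o, 'a) comon \<Rightarrow>
   ('o, 'a) bi \<Rightarrow> ('o, 'a) bi \<Rightarrow> ('o, 'a) bi \<Rightarrow> 'a \<Rightarrow> bool" where
  "assoc_compatible X P Q Y M N R a \<longleftrightarrow>
    (let m = carr M; n = carr N; r = carr R;
         MN = mten X P Q M N; NR = mten P Q Y N R;
         mn = bal_arr P M N; nr = bal_arr Q N R;
         mn_r = bal_arr Q MN R; m_nr = bal_arr P M NR
     in case P of
        Monoid _ _ _ \<Rightarrow> (case Q of
            Monoid _ _ _ \<Rightarrow>
              a \<cdot> mn_r \<cdot> (mn \<boxtimes> ident K r) = m_nr \<cdot> (ident K m \<boxtimes> nr) \<cdot> asc K m n r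
          | Comonoid _ _ _ \<Rightarrow>
              mn_r \<cdot> inv_arr K (bal_obj Q MN R) (bal_obj P M NR) a \<cdot> m_nr
                = (mn \<boxtimes> ident K r) \<cdot> asci K m n r \<cdot> (ident K m \<boxtimes> nr))
      | Comonoid _ _ _ \<Rightarrow> (case Q of
            Monoid _ _ _ \<Rightarrow>
              m_nr \<cdot> a \<cdot> mn_r = (ident K m \<boxtimes> nr) \<cdot> asc K m n r \<cdot> (mn \<boxtimes> ident K r)
          | Comonoid _ _ _ \<Rightarrow>
              (ident K m \<boxtimes> nr) \<cdot> m_nr \<cdot> a = asc K m n r \<cdot> (mn \<boxtimes> ident K r) \<cdot> mn_r))"

definition is_associativity ::
  "('o, 'a) comon \<Rightarrow> ('o, 'a) comon \<Rightarrow> ('o, 'a) comon \<Rightarrow> ('o, 'a) comon \<Rightarrow>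
   ('o, 'a) bi \<Rightarrow> ('o, 'a) bi \<Rightarrow> ('o, 'a) bi \<Rightarrow> 'a \<Rightarrow> bool" where
  "is_associativity X P Q Y M N R a \<longleftrightarrow>
    is_iso (Mix X Y) (mten X Q Y (mten X P Q M N) R) (mten X P Y M (mten P Q Y N R)) a \<and>
    assoc_compatible X P Q Y M N R a"

text \<open>Associativity isomorphisms for longer iterated products are composites of those for
  triples.  The bases include the unit object, both as a monoid and as a comonoid, so that the
  second conjunct also covers products such as \<open>(M \<otimes>\<^sub>P N) \<otimes> R\<close>.\<close>

definition twistable :: bool where
  "twistable \<longleftrightarrow>
    (\<forall>X P Y. {X, P, Y} \<subseteq> obj Mon \<union> obj Comon \<longrightarrow>
      (\<forall>M\<in>obj (Mix X P). \<forall>N\<in>obj (Mix P Y).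
        (\<exists>!l. induced_lact X P M N l) \<and> (\<exists>!r. induced_ract Y P M N r)) \<and>
      is_functor (prod_cat (Mix X P) (Mix P Y)) (Mix X Y) (mten_functor X P Y)) \<and>
    (\<forall>X P Q Y. {X, P, Q, Y} \<subseteq> obj Mon \<union> obj Comon \<longrightarrow>
      (\<forall>M\<in>obj (Mix X P). \<forall>N\<in>obj (Mix P Q). \<forall>R\<in>obj (Mix Q Y).
        \<exists>a. is_associativity X P Q Y M N R a))"

definition associativity ::
  "('o, 'a) comon \<Rightarrow> ('o, 'a) comon \<Rightarrow> ('o, 'a) comon \<Rightarrow> ('o, 'a) comon \<Rightarrow>
   ('o, 'a) bi \<Rightarrow> ('o, 'a) bi \<Rightarrow> ('o, 'a) bi \<Rightarrow> 'a" where
  "associativity X P Q Y M N R = (THE a. is_associativity X P Q Y M N R a)"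

definition associativity_inv ::
  "('o, 'a) comon \<Rightarrow> ('o, 'a) comon \<Rightarrow> ('o, 'a) comon \<Rightarrow> ('o, 'a) comon \<Rightarrow>
   ('o, 'a) bi \<Rightarrow> ('o, 'a) bi \<Rightarrow> ('o, 'a) bi \<Rightarrow> 'a" where
  "associativity_inv X P Q Y M N R =
    inv_arr K (carr (mten X Q Y (mten X P Q M N) R)) (carr (mten X P Y M (mten P Q Y N R)))
      (associativity X P Q Y M N R)"

text \<open>The canonical isomorphisms \<open>A \<otimes>\<^sub>A N \<rightarrow> N\<close> and \<open>M \<otimes>\<^sub>A A \<rightarrow> M\<close> over a monoid \<open>A\<close>, and from
  \<open>N\<close>, resp. \<open>M\<close>, to its cotensor product with \<open>C\<close> over a comonoid \<open>C\<close>.\<close>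

definition tensor_unit_left :: "('o, 'a) comon \<Rightarrow> ('o, 'a) bi \<Rightarrow> 'a" where
  "tensor_unit_left A N = (THE k. k \<in> hom K (bal_obj A (regular A) N) (carr N) \<and>
    k \<cdot> bal_arr A (regular A) N = lact N)"

definition tensor_unit_right :: "('o, 'a) comon \<Rightarrow> ('o, 'a) bi \<Rightarrow> 'a" where
  "tensor_unit_right A M = (THE k. k \<in> hom K (bal_obj A M (regular A)) (carr M) \<and>
    k \<cdot> bal_arr A M (regular A) = ract M)"

definition cotensor_unit_left :: "('o, 'a) comon \<Rightarrow> ('o, 'a) bi \<Rightarrow> 'a" where
  "cotensor_unit_left C N = (THE k. k \<in> hom K (carr N) (bal_obj C (regular C) N) \<and>
    bal_arr C (regular C) N \<cdot> k = lact N)"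

definition cotensor_unit_right :: "('o, 'a) comon \<Rightarrow> ('o, 'a) bi \<Rightarrow> 'a" where
  "cotensor_unit_right C M = (THE k. k \<in> hom K (carr M) (bal_obj C M (regular C)) \<and>
    bal_arr C M (regular C) \<cdot> k = ract M)"

end


section \<open>Twisting structures\<close>

record ('o, 'a) twisting =
  tB :: "(('o, 'a) comon, 'a, ('o, 'a) comon, 'a) ftor"
  tE :: "('o, 'a) comon \<Rightarrow> ('o, 'a) bi"
  tEt :: "('o, 'a) comon \<Rightarrow> ('o, 'a) bi"
  tdelta :: "('o, 'a) comon \<Rightarrow> 'a"
  tmu :: "('o, 'a) comon \<Rightarrow> 'a"

context
  fixes K :: "('o, 'a) moncat" (structure)
    and T :: "('o, 'a) twisting"
begin

text \<open>The two composites
  \<open>Et A \<cong> Et A \<box> BA \<rightarrow> Et A \<box> (EA \<otimes> Et A) \<cong> (Et A \<box> EA) \<otimes> Et A \<rightarrow> A \<otimes> Et A \<cong> Et A\<close> and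
  \<open>EA \<cong> BA \<box> EA \<rightarrow> (EA \<otimes> Et A) \<box> EA \<cong> EA \<otimes> (Et A \<box> EA) \<rightarrow> EA \<otimes> A \<cong> EA\<close>.\<close>

definition zigzag_Et :: "('o, 'a) comon \<Rightarrow> 'a" where
  "zigzag_Et A = (let BA = fob (tB T) A; E = tE T A; Et = tEt T A in
    tensor_unit_left K A Et \<cdot>
    bal_map K A (mten K A BA A Et E) Et A (regular A) Et (tmu T A) (ident K (carr Et)) \<cdot>
    associativity_inv K A BA A BA Et E Et \<cdot>
    bal_map K BA Et (regular BA) BA Et (mten K BA A BA E Et) (ident K (carr Et)) (tdelta T A) \<cdot>
    cotensor_unit_right K BA Et)"

definition zigzag_E :: "('o, 'a) comon \<Rightarrow> 'a" where
  "zigzag_E A = (let BA = fob (tB T) A; E = tE T A; Et = tEt T A in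
    tensor_unit_right K A E \<cdot>
    bal_map K A E (mten K A BA A Et E) A E (regular A) (ident K (carr E)) (tmu T A) \<cdot>
    associativity K BA A BA A E Et E \<cdot>
    bal_map K BA (regular BA) E BA (mten K BA A BA E Et) E (tdelta T A) (ident K (carr E)) \<cdot>
    cotensor_unit_left K BA E)"

text \<open>Sources and targets of the naturality isomorphisms of \<open>E\<close> and \<open>Et\<close> at a monoid morphism
  \<open>f : A \<rightarrow> A'\<close>.\<close>

definition E_src :: "('o, 'a) comon \<Rightarrow> ('o, 'a) comon \<Rightarrow> 'a \<Rightarrow> ('o, 'a) bi" where
  "E_src A A' f = mten K (fob (tB T) A) A A' (tE T A) (mod_left_via K f (regular A'))"

definition E_tgt :: "('o, 'a) comon \<Rightarrow> ('o, 'a) comon \<Rightarrow> 'a \<Rightarrow> ('o, 'a) bi" where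
  "E_tgt A A' f = mten K (fob (tB T) A) (fob (tB T) A') A'
    (comod_right_via K (far (tB T) A A' f) (regular (fob (tB T) A))) (tE T A')"

definition Et_src :: "('o, 'a) comon \<Rightarrow> ('o, 'a) comon \<Rightarrow> 'a \<Rightarrow> ('o, 'a) bi" where
  "Et_src A A' f = mten K A' A (fob (tB T) A) (mod_right_via K f (regular A')) (tEt T A)"

definition Et_tgt :: "('o, 'a) comon \<Rightarrow> ('o, 'a) comon \<Rightarrow> 'a \<Rightarrow> ('o, 'a) bi" where
  "Et_tgt A A' f = mten K A' (fob (tB T) A') (fob (tB T) A)
    (tEt T A') (comod_left_via K (far (tB T) A A' f) (regular (fob (tB T) A)))"

text \<open>The map \<open>EA \<rightarrow> EA'\<close> over \<open>(Bf, f)\<close> that corresponds to \<open>\<phi> : E_src A A' f \<rightarrow> E_tgt A A' f\<close>: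
  insert the unit of \<open>A'\<close>, apply \<open>\<phi>\<close>, and apply the counit of \<open>BA\<close>.  Likewise for \<open>Et\<close>.\<close>

definition E_map :: "('o, 'a) comon \<Rightarrow> ('o, 'a) comon \<Rightarrow> 'a \<Rightarrow> 'a \<Rightarrow> 'a" where
  "E_map A A' f \<phi> = (let BA = fob (tB T) A; BA' = fob (tB T) A'; e = carr (tE T A); e' = carr (tE T A') in
    lun K e' \<cdot> (unt BA \<boxtimes> ident K e') \<cdot>
    bal_arr K BA' (comod_right_via K (far (tB T) A A' f) (regular BA)) (tE T A') \<cdot> \<phi> \<cdot>
    bal_arr K A (tE T A) (mod_left_via K f (regular A')) \<cdot>
    (ident K e \<boxtimes> unt A') \<cdot> runi K e)"

definition Et_map :: "('o, 'a) comon \<Rightarrow> ('o, 'a) comon \<Rightarrow> 'a \<Rightarrow> 'a \<Rightarrow> 'a" where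
  "Et_map A A' f \<psi> = (let BA = fob (tB T) A; BA' = fob (tB T) A'; e = carr (tEt T A); e' = carr (tEt T A') in
    run K e' \<cdot> (ident K e' \<boxtimes> unt BA) \<cdot>
    bal_arr K BA' (tEt T A') (comod_left_via K (far (tB T) A A' f) (regular BA)) \<cdot> \<psi> \<cdot>
    bal_arr K A (mod_right_via K f (regular A')) (tEt T A) \<cdot>
    (unt A' \<boxtimes> ident K e) \<cdot> luni K e)"

definition twisting_natural :: "('o, 'a) comon \<Rightarrow> ('o, 'a) comon \<Rightarrow> 'a \<Rightarrow> bool" where
  "twisting_natural A A' f \<longleftrightarrow>
    (let BA = fob (tB T) A; BA' = fob (tB T) A'; Bf = far (tB T) A A' f in
    \<exists>\<phi> \<psi>.
      is_iso (Mix K BA A') (E_src A A' f) (E_tgt A A' f) \<phi> \<and>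
      is_iso (Mix K A' BA) (Et_src A A' f) (Et_tgt A A' f) \<psi> \<and>
      tdelta T A' \<cdot> Bf =
        bal_map K A (tE T A) (tEt T A) A' (tE T A') (tEt T A') (E_map A A' f \<phi>) (Et_map A A' f \<psi>)
          \<cdot> tdelta T A \<and>
      f \<cdot> tmu T A =
        tmu T A' \<cdot>
        bal_map K BA (tEt T A) (tE T A) BA' (tEt T A') (tE T A') (Et_map A A' f \<psi>) (E_map A A' f \<phi>))"

definition right_twisting_structure :: bool where
  "right_twisting_structure \<longleftrightarrow>
    is_functor (Mon K) (Comon K) (tB T) \<and>
    (\<forall>A\<in>obj (Mon K). let BA = fob (tB T) A; E = tE T A; Et = tEt T A in
      E \<in> obj (Mix K BA A) \<and>
      Et \<in> obj (Mix K A BA) \<and>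
      tdelta T A \<in> hom (Mix K BA BA) (regular BA) (mten K BA A BA E Et) \<and>
      tmu T A \<in> hom (Mix K A A) (mten K A BA A Et E) (regular A) \<and>
      zigzag_Et A = ident K (carr Et) \<and>
      zigzag_E A = ident K (carr E)) \<and>
    (\<forall>A\<in>obj (Mon K). \<forall>A'\<in>obj (Mon K). \<forall>f\<in>hom (Mon K) A A'. twisting_natural A A' f)"

text \<open>For a classifying morphism \<open>g : C \<rightarrow> BA\<close>, the two products written \<open>\<otimes>\<^sub>g\<close>, bracketed to the
  left: \<open>twist_EA X A Y g V W\<close> is \<open>(V\<^sub>g \<box> EA) \<otimes>\<^sub>A W\<close> for \<open>V\<close> in \<open>Mix X C\<close> and \<open>W\<close> in \<open>Mix A Y\<close>, and
  \<open>twist_EtA X A Y g V W\<close> is \<open>(V \<otimes>\<^sub>A Et A) \<box> \<^sub>gW\<close> for \<open>V\<close> in \<open>Mix X A\<close> and \<open>W\<close> in \<open>Mix C Y\<close>;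
  both are in \<open>Mix X Y\<close>.\<close>

definition twist_E ::
  "('o, 'a) comon \<Rightarrow> ('o, 'a) comon \<Rightarrow> ('o, 'a) comon \<Rightarrow> 'a \<Rightarrow> ('o, 'a) bi \<Rightarrow> ('o, 'a) bi \<Rightarrow> ('o, 'a) bi" where
  "twist_E X A Y g V W =
    mten K X A Y (mten K X (fob (tB T) A) A (comod_right_via K g V) (tE T A)) W"

definition twist_E_map ::
  "('o, 'a) comon \<Rightarrow> ('o, 'a) comon \<Rightarrow> 'a \<Rightarrow> ('o, 'a) bi \<Rightarrow> ('o, 'a) bi \<Rightarrow> ('o, 'a) bi \<Rightarrow> ('o, 'a) bi \<Rightarrow>
   'a \<Rightarrow> 'a \<Rightarrow> 'a" where
  "twist_E_map X A g V W V' W' v w = (let BA = fob (tB T) A; E = tE T A in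
    bal_map K
      A (mten K X BA A (comod_right_via K g V) E) W
      A (mten K X BA A (comod_right_via K g V') E) W'
      (bal_map K BA (comod_right_via K g V) E BA (comod_right_via K g V') E v (ident K (carr E)))
      w)"

definition twist_Et ::
  "('o, 'a) comon \<Rightarrow> ('o, 'a) comon \<Rightarrow> ('o, 'a) comon \<Rightarrow> 'a \<Rightarrow> ('o, 'a) bi \<Rightarrow> ('o, 'a) bi \<Rightarrow> ('o, 'a) bi" where
  "twist_Et X A Y g V W =
    mten K X (fob (tB T) A) Y (mten K X A (fob (tB T) A) V (tEt T A)) (comod_left_via K g W)"

definition twist_Et_map ::
  "('o, 'a) comon \<Rightarrow> ('o, 'a) comon \<Rightarrow> 'a \<Rightarrow> ('o, 'a) bi \<Rightarrow> ('o, 'a) bi \<Rightarrow> ('o, 'a) bi \<Rightarrow> ('o, 'a) bi \<Rightarrow>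
   'a \<Rightarrow> 'a \<Rightarrow> 'a" where
  "twist_Et_map X A g V W V' W' v w = (let BA = fob (tB T) A; Et = tEt T A in
    bal_map K
      BA (mten K X A BA V Et) (comod_left_via K g W)
      BA (mten K X A BA V' Et) (comod_left_via K g W')
      (bal_map K A V Et A V' Et v (ident K (carr Et)))
      w)"

text \<open>\<open>N \<mapsto> (A \<otimes>\<^sub>g N) \<otimes>\<^sub>g\<^sub>' A'\<close> and \<open>M \<mapsto> (C \<otimes>\<^sub>g M) \<otimes>\<^sub>g\<^sub>' C'\<close>.\<close>

definition lower_star ::
  "('o, 'a) comon \<Rightarrow> ('o, 'a) comon \<Rightarrow> ('o, 'a) comon \<Rightarrow> ('o, 'a) comon \<Rightarrow> 'a \<Rightarrow> 'a \<Rightarrow>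
   (('o, 'a) bi, 'a, ('o, 'a) bi, 'a) ftor" where
  "lower_star C C' A A' g g' = (let L = twist_Et A A C' g (regular A) in
    \<lparr> fob = (\<lambda>N. twist_E A A' A' g' (L N) (regular A')),
      far = (\<lambda>N N' f. twist_E_map A A' g' (L N) (regular A') (L N') (regular A')
        (twist_Et_map A A g (regular A) N (regular A) N' (ident K (und A)) f) (ident K (und A'))) \<rparr>)"

definition upper_star ::
  "('o, 'a) comon \<Rightarrow> ('o, 'a) comon \<Rightarrow> ('o, 'a) comon \<Rightarrow> ('o, 'a) comon \<Rightarrow> 'a \<Rightarrow> 'a \<Rightarrow>
   (('o, 'a) bi, 'a, ('o, 'a) bi, 'a) ftor" where
  "upper_star C C' A A' g g' = (let L = twist_E C A A' g (regular C) in
    \<lparr> fob = (\<lambda>M. twist_Et C A' C' g' (L M) (regular C')),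
      far = (\<lambda>M M' f. twist_Et_map C A' g' (L M) (regular C') (L M') (regular C')
        (twist_E_map C A g (regular C) M (regular C) M' (ident K (und C)) f) (ident K (und C'))) \<rparr>)"

end

end

theory Submission
  imports Defs
begin

text \<open>The theorem holds because \<open>(g, g')\<^sub>*\<close> is, up to isomorphism, a composite of four left adjoints, two on
each side, and \<open>(g, g')\<^sup>*\<close> is, up to isomorphism, the composite of their right adjoints.  On the
left side, with \<open>B\<close> short for \<open>BA\<close>:

\<^item> Pushing a left \<open>C\<close>-comodule \<open>N\<close> forward to a left \<open>B\<close>-comodule \<open>\<^sub>gN\<close> is left adjoint to cotensoring
  over \<open>B\<close> with \<open>C\<^sub>g\<close>.  The unit \<open>N \<rightarrow> C\<^sub>g \<box> \<^sub>gN\<close> is the coaction, and the counit applies the counit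
  of \<open>C\<close> (\<open>change_adjunction_left\<close>).

\<^item> Cotensoring over \<open>B\<close> with \<open>Et A\<close> is left adjoint to tensoring over \<open>A\<close> with \<open>EA\<close>.  Monoids and
  comonoids, mixed bimodules between them, and their (co)tensor products behave like a bicategory; in
  it \<open>\<delta>\<close> and \<open>\<mu>\<close> are the unit and the counit of an adjunction between \<open>EA\<close> and \<open>Et A\<close>, and the two
  zigzag identities are its triangle identities.  Products with adjoint \<open>1\<close>-cells are adjoint
  functors (\<open>tensor_left_adjunction\<close>).

So \<open>N \<mapsto> Et A \<box> \<^sub>gN\<close>, which is \<open>A \<otimes>\<^sub>g N\<close> up to the isomorphism \<open>A \<otimes>\<^sub>A Et A \<cong> Et A\<close>, is left adjoint to
\<open>M \<mapsto> C\<^sub>g \<box> (EA \<otimes>\<^sub>A M)\<close>, which is \<open>C \<otimes>\<^sub>g M\<close> up to associativity.  The right side is the mirror image, with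
\<open>g'\<close> in place of \<open>g\<close>, and the two sides are composed (\<open>two_sided_adjunction\<close>).

The work is in the coherence of this quasi-bicategory, since twistability provides associativity
isomorphisms that are compatible with the projections and inclusions, but no equations among them.
Every equation needed is one between maps of (co)tensor products, and is tested after composing with
projections, which are epic, and inclusions, which are monic.  For threefold products this requires
that \<open>q \<otimes> x\<close> and \<open>x \<otimes> q\<close> are again epic, resp. monic, for such a structure map \<open>q\<close> and any object
\<open>x\<close>.  This follows from twistability as well: the unit object is a monoid, tensoring with \<open>x\<close> is
tensoring over this monoid, and the compatibility of the associativity isomorphisms with the
structure maps expresses \<open>q \<otimes> x\<close> through epic, resp. monic, maps (\<open>Q_ten_epic\<close>, \<open>Q_ten_monic\<close>).
The pentagon is only needed for sequences of bases that alternate between monoids and comonoids.  Then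
each of its sides is determined by composing with one inclusion and with epic maps.\<close>

section \<open>Arrows that know their source and target\<close>

text \<open>An arrow of a category of bimodules is just an arrow of the ambient category, and hom-sets may overlap.
Bundling an arrow with its source and target, and sending undefined composites to \<open>Null\<close>, makes
composition a total operation that is associative without side conditions.\<close>

datatype ('x, 'b) tarr = Null | Arr (src: 'x) (raw: 'b) (tgt: 'x)

definition arr :: "('x, 'b, 'r) category_scheme \<Rightarrow> ('x, 'b) tarr \<Rightarrow> bool" where
  "arr C t \<longleftrightarrow> t \<noteq> Null \<and> src t \<in> obj C \<and> tgt t \<in> obj C \<and> raw t \<in> hom C (src t) (tgt t)"

definition cmp :: "('x, 'b, 'r) category_scheme \<Rightarrow> ('x, 'b) tarr \<Rightarrow> ('x, 'b) tarr \<Rightarrow> ('x, 'b) tarr" where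
  "cmp C g f = (if arr C g \<and> arr C f \<and> src g = tgt f
     then Arr (src f) (raw g \<cdot>\<^bsub>C\<^esub> raw f) (tgt g) else Null)"

definition idt :: "('x, 'b, 'r) category_scheme \<Rightarrow> 'x \<Rightarrow> ('x, 'b) tarr" where
  "idt C x = Arr x (ident C x) x"

text \<open>The guard on one composite suffices: a composite other than \<open>Null\<close> is one of composable arrows, so
equality of the two composites makes \<open>g\<close> composable with \<open>m\<close> as well.\<close>

definition monic :: "('x, 'b, 'r) category_scheme \<Rightarrow> ('x, 'b) tarr \<Rightarrow> bool" where
  "monic C m \<longleftrightarrow> arr C m \<and> (\<forall>f g. arr C (cmp C m f) \<longrightarrow> cmp C m f = cmp C m g \<longrightarrow> f = g)"

definition epic :: "('x, 'b, 'r) category_scheme \<Rightarrow> ('x, 'b) tarr \<Rightarrow> bool" where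
  "epic C e \<longleftrightarrow> arr C e \<and> (\<forall>f g. arr C (cmp C f e) \<longrightarrow> cmp C f e = cmp C g e \<longrightarrow> f = g)"

definition invs :: "('x, 'b, 'r) category_scheme \<Rightarrow> ('x, 'b) tarr \<Rightarrow> ('x, 'b) tarr \<Rightarrow> bool" where
  "invs C f g \<longleftrightarrow> arr C f \<and> arr C g \<and> src g = tgt f \<and> tgt g = src f \<and>
    cmp C g f = idt C (src f) \<and> cmp C f g = idt C (tgt f)"

lemma src_idt [simp]: "src (idt C x) = x" and tgt_idt [simp]: "tgt (idt C x) = x"
  and raw_idt [simp]: "raw (idt C x) = ident C x"
  by (simp_all add: idt_def)

lemma arr_Arr [simp]: "arr C (Arr x f y) \<longleftrightarrow> x \<in> obj C \<and> y \<in> obj C \<and> f \<in> hom C x y"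
  by (simp add: arr_def)

lemma not_arr_Null [simp]: "\<not> arr C Null"
  by (simp add: arr_def)

lemma arr_src [simp]: "arr C f \<Longrightarrow> src f \<in> obj C" and arr_tgt [simp]: "arr C f \<Longrightarrow> tgt f \<in> obj C"
  and arr_raw: "arr C f \<Longrightarrow> raw f \<in> hom C (src f) (tgt f)"
  by (simp_all add: arr_def)

lemma tarr_eqI:
  assumes "arr C f" "arr C g" "src f = src g" "tgt f = tgt g" "raw f = raw g"
  shows "f = g"
  using assms by (cases f; cases g) auto

locale cat =
  fixes C :: "('x, 'b, 'r) category_scheme"
  assumes category: "category C"
begin

abbreviation cmp_C  (infixr "\<bullet>" 70) where "g \<bullet> f \<equiv> cmp C g f"

lemma arr_idt [simp]: "arr C (idt C x) \<longleftrightarrow> x \<in> obj C"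
  using category by (auto simp: idt_def category_def)

lemma comp_hom:
  "x \<in> obj C \<Longrightarrow> y \<in> obj C \<Longrightarrow> z \<in> obj C \<Longrightarrow> f \<in> hom C x y \<Longrightarrow> g \<in> hom C y z \<Longrightarrow> g \<cdot>\<^bsub>C\<^esub> f \<in> hom C x z"
  using category unfolding category_def by blast

lemma comp_ident:
  "x \<in> obj C \<Longrightarrow> y \<in> obj C \<Longrightarrow> f \<in> hom C x y \<Longrightarrow> f \<cdot>\<^bsub>C\<^esub> ident C x = f"
  "x \<in> obj C \<Longrightarrow> y \<in> obj C \<Longrightarrow> f \<in> hom C x y \<Longrightarrow> ident C y \<cdot>\<^bsub>C\<^esub> f = f"
  using category unfolding category_def by blast+

lemma comp_assoc:
  "w \<in> obj C \<Longrightarrow> x \<in> obj C \<Longrightarrow> y \<in> obj C \<Longrightarrow> z \<in> obj C \<Longrightarrow>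
    f \<in> hom C w x \<Longrightarrow> g \<in> hom C x y \<Longrightarrow> h \<in> hom C y z \<Longrightarrow>
    (h \<cdot>\<^bsub>C\<^esub> g) \<cdot>\<^bsub>C\<^esub> f = h \<cdot>\<^bsub>C\<^esub> (g \<cdot>\<^bsub>C\<^esub> f)"
  using category unfolding category_def by blast

lemma arr_cmp [simp]: "arr C (g \<bullet> f) \<longleftrightarrow> arr C g \<and> arr C f \<and> src g = tgt f"
proof -
  have "arr C (g \<bullet> f)" if "arr C g" "arr C f" "src g = tgt f"
    using comp_hom[of "src f" "tgt f" "tgt g" "raw f" "raw g"] arr_raw[of C f] arr_raw[of C g] that
    by (simp add: cmp_def)
  then show ?thesis
    by (auto simp: cmp_def split: if_splits)
qed

lemma src_cmp [simp]: "arr C g \<Longrightarrow> arr C f \<Longrightarrow> src g = tgt f \<Longrightarrow> src (g \<bullet> f) = src f"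
  and tgt_cmp [simp]: "arr C g \<Longrightarrow> arr C f \<Longrightarrow> src g = tgt f \<Longrightarrow> tgt (g \<bullet> f) = tgt g"
  and raw_cmp [simp]: "arr C g \<Longrightarrow> arr C f \<Longrightarrow> src g = tgt f \<Longrightarrow> raw (g \<bullet> f) = raw g \<cdot>\<^bsub>C\<^esub> raw f"
  by (simp_all add: cmp_def)

lemma cmp_assoc: "(h \<bullet> g) \<bullet> f = h \<bullet> (g \<bullet> f)"
proof (cases "arr C h \<and> arr C g \<and> arr C f \<and> src h = tgt g \<and> src g = tgt f")
  case True
  then have "(raw h \<cdot>\<^bsub>C\<^esub> raw g) \<cdot>\<^bsub>C\<^esub> raw f = raw h \<cdot>\<^bsub>C\<^esub> (raw g \<cdot>\<^bsub>C\<^esub> raw f)"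
    using comp_assoc[of "src f" "tgt f" "tgt g" "tgt h" "raw f" "raw g" "raw h"]
      arr_raw[of C f] arr_raw[of C g] arr_raw[of C h] by simp
  with True show ?thesis
    by (intro tarr_eqI[of C]) simp_all
next
  case False
  have null: "b \<bullet> a = Null" if "\<not> (arr C b \<and> arr C a \<and> src b = tgt a)" for a b
    using that by (auto simp: cmp_def)
  have "\<not> (arr C (h \<bullet> g) \<and> arr C f \<and> src (h \<bullet> g) = tgt f)"
    using False by auto
  moreover have "\<not> (arr C h \<and> arr C (g \<bullet> f) \<and> src h = tgt (g \<bullet> f))"
    using False by auto
  ultimately show ?thesis
    using null[of "h \<bullet> g" f] null[of h "g \<bullet> f"] by metis
qed

lemma cmp_idt_left [simp]: "arr C f \<Longrightarrow> tgt f = x \<Longrightarrow> idt C x \<bullet> f = f"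
  using comp_ident[of "src f" "tgt f" "raw f"] arr_raw[of C f]
  by (intro tarr_eqI[of C]) auto

lemma cmp_idt_right [simp]: "arr C f \<Longrightarrow> src f = x \<Longrightarrow> f \<bullet> idt C x = f"
  using comp_ident[of "src f" "tgt f" "raw f"] arr_raw[of C f]
  by (intro tarr_eqI[of C]) auto

text \<open>Composites are kept bracketed to the right; an equation between composites can be used
  inside a longer one after appending an arbitrary tail.\<close>

lemma tail: "g \<bullet> f = k \<Longrightarrow> g \<bullet> (f \<bullet> t) = k \<bullet> t"
  by (metis cmp_assoc)

lemma tail3: "h \<bullet> g \<bullet> f = k \<Longrightarrow> h \<bullet> (g \<bullet> (f \<bullet> t)) = k \<bullet> t"
  by (metis cmp_assoc)

lemma monic_arr: "monic C m \<Longrightarrow> arr C m" and epic_arr: "epic C m \<Longrightarrow> arr C m"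
  by (simp_all add: monic_def epic_def)

lemma monicD: "monic C m \<Longrightarrow> m \<bullet> f = m \<bullet> g \<Longrightarrow> arr C f \<Longrightarrow> src m = tgt f \<Longrightarrow> f = g"
  by (auto simp: monic_def)

lemma epicD: "epic C e \<Longrightarrow> f \<bullet> e = g \<bullet> e \<Longrightarrow> arr C f \<Longrightarrow> src f = tgt e \<Longrightarrow> f = g"
  by (auto simp: epic_def)

lemma monicI:
  assumes "arr C m"
    and "\<And>f g. arr C f \<Longrightarrow> arr C g \<Longrightarrow> tgt f = src m \<Longrightarrow> tgt g = src m \<Longrightarrow> src f = src g \<Longrightarrow>
      m \<bullet> f = m \<bullet> g \<Longrightarrow> f = g"
  shows "monic C m"
  unfolding monic_def
proof (intro conjI allI impI assms(1))
  fix f g assume f: "arr C (m \<bullet> f)" and eq: "m \<bullet> f = m \<bullet> g"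
  then have g: "arr C (m \<bullet> g)" by simp
  have "src f = src g"
    using f g arg_cong[OF eq, of src] by simp
  then show "f = g"
    using f[unfolded arr_cmp] g[unfolded arr_cmp] eq by (auto intro: assms(2)[of f g])
qed

lemma epicI:
  assumes "arr C m"
    and "\<And>f g. arr C f \<Longrightarrow> arr C g \<Longrightarrow> src f = tgt m \<Longrightarrow> src g = tgt m \<Longrightarrow> tgt f = tgt g \<Longrightarrow>
      f \<bullet> m = g \<bullet> m \<Longrightarrow> f = g"
  shows "epic C m"
  unfolding epic_def
proof (intro conjI allI impI assms(1))
  fix f g assume f: "arr C (f \<bullet> m)" and eq: "f \<bullet> m = g \<bullet> m"
  then have g: "arr C (g \<bullet> m)" by simp
  have "tgt f = tgt g"
    using f g arg_cong[OF eq, of tgt] by simp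
  then show "f = g"
    using f[unfolded arr_cmp] g[unfolded arr_cmp] eq by (auto intro: assms(2)[of f g])
qed

lemma monic_cmp:
  assumes "monic C m" "monic C n" "src m = tgt n"
  shows "monic C (m \<bullet> n)"
proof (rule monicI)
  show "arr C (m \<bullet> n)" using assms by (simp add: monic_arr)
  fix f g assume "arr C f" "arr C g" "tgt f = src (m \<bullet> n)" "(m \<bullet> n) \<bullet> f = (m \<bullet> n) \<bullet> g"
  then show "f = g"
    using assms monicD[of m "n \<bullet> f" "n \<bullet> g"] monicD[of n f g] by (simp add: cmp_assoc monic_arr)
qed

lemma epic_cmp:
  assumes "epic C m" "epic C n" "src m = tgt n"
  shows "epic C (m \<bullet> n)"
proof (rule epicI)
  show "arr C (m \<bullet> n)" using assms by (simp add: epic_arr)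
  fix f g assume "arr C f" "arr C g" "src f = tgt (m \<bullet> n)" "f \<bullet> (m \<bullet> n) = g \<bullet> (m \<bullet> n)"
  then show "f = g"
    using assms epicD[of n "f \<bullet> m" "g \<bullet> m"] epicD[of m f g] by (simp add: cmp_assoc epic_arr)
qed

lemma monic_second: "monic C (m \<bullet> n) \<Longrightarrow> monic C n"
proof (rule monicI)
  assume m: "monic C (m \<bullet> n)"
  then show "arr C n" by (auto dest: monic_arr)
  fix f g assume "arr C f" "tgt f = src n" "n \<bullet> f = n \<bullet> g"
  then show "f = g"
    using monicD[OF m, of f g] monic_arr[OF m] by (simp add: cmp_assoc)
qed

lemma epic_first: "epic C (m \<bullet> n) \<Longrightarrow> epic C m"
proof (rule epicI)
  assume m: "epic C (m \<bullet> n)"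
  then show "arr C m" by (auto dest: epic_arr)
  fix f g assume "arr C f" "src f = tgt m" "f \<bullet> m = g \<bullet> m"
  then show "f = g"
    using epicD[OF m, of f g] epic_arr[OF m] by (simp add: cmp_assoc[symmetric])
qed

lemma invs_sym: "invs C f g \<Longrightarrow> invs C g f"
  by (simp add: invs_def)

lemma invsD:
  assumes "invs C f g"
  shows "arr C f" "arr C g" "src g = tgt f" "tgt g = src f"
    "g \<bullet> f = idt C (src f)" "f \<bullet> g = idt C (tgt f)"
  using assms by (simp_all add: invs_def)

lemma split_monic:
  assumes "g \<bullet> f = idt C (src f)" "arr C g" "arr C f" "src g = tgt f" "tgt g = src f"
  shows "monic C f"
proof (rule monicI)
  fix h k assume "f \<bullet> h = f \<bullet> k" "arr C h" "arr C k" "tgt h = src f" "tgt k = src f"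
  then have "(g \<bullet> f) \<bullet> h = (g \<bullet> f) \<bullet> k"
    by (simp only: cmp_assoc)
  then show "h = k"
    using \<open>arr C h\<close> \<open>arr C k\<close> \<open>tgt h = src f\<close> \<open>tgt k = src f\<close> by (simp add: assms(1))
qed (rule assms)

lemma split_epic:
  assumes "g \<bullet> f = idt C (src f)" "arr C g" "arr C f" "src g = tgt f" "tgt g = src f"
  shows "epic C g"
proof (rule epicI)
  fix h k assume "h \<bullet> g = k \<bullet> g" "arr C h" "arr C k" "src h = tgt g" "src k = tgt g"
  moreover from this have "h \<bullet> (g \<bullet> f) = k \<bullet> (g \<bullet> f)"
    by (simp only: cmp_assoc[symmetric])
  ultimately show "h = k"
    by (simp add: assms)
qed (rule assms)

lemma invs_monic: "invs C f g \<Longrightarrow> monic C f"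
  by (rule split_monic[of g]) (simp_all add: invs_def)

lemma invs_epic: "invs C f g \<Longrightarrow> epic C f"
  by (rule split_epic[of _ g]) (simp_all add: invs_def)

lemma invs_cmp: "invs C g g' \<Longrightarrow> invs C f f' \<Longrightarrow> src g = tgt f \<Longrightarrow> invs C (g \<bullet> f) (f' \<bullet> g')"
  unfolding invs_def by (auto simp: cmp_assoc) (simp_all add: cmp_assoc[symmetric])

lemma epic_iso_cancel: "epic C (j \<bullet> f) \<Longrightarrow> invs C j k \<Longrightarrow> epic C f"
proof -
  assume e: "epic C (j \<bullet> f)" and i: "invs C j k"
  have "epic C (k \<bullet> (j \<bullet> f))"
    using invs_epic[OF invs_sym[OF i]] e i epic_arr[OF e] by (intro epic_cmp[of k]) (simp_all add: invs_def)
  moreover have "k \<bullet> (j \<bullet> f) = f"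
    using epic_arr[OF e] i by (simp add: invs_def tail)
  ultimately show ?thesis
    by simp
qed

lemma inverse_arrows_invs:
  assumes "inverse_arrows C x y f g" "x \<in> obj C" "y \<in> obj C"
  shows "invs C (Arr x f y) (Arr y g x)"
proof -
  have a: "arr C (Arr x f y)" "arr C (Arr y g x)" "g \<cdot>\<^bsub>C\<^esub> f = ident C x" "f \<cdot>\<^bsub>C\<^esub> g = ident C y"
    using assms by (simp_all add: inverse_arrows_def)
  then show ?thesis
    unfolding invs_def by (intro conjI tarr_eqI[of C]) simp_all
qed

lemma invs_inverse_arrows:
  assumes "invs C (Arr x f y) (Arr y g x)"
  shows "inverse_arrows C x y f g"
proof -
  note i = invsD[OF assms]
  have "raw (Arr y g x \<bullet> Arr x f y) = g \<cdot>\<^bsub>C\<^esub> f" "raw (Arr x f y \<bullet> Arr y g x) = f \<cdot>\<^bsub>C\<^esub> g"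
    using i(1,2) by simp_all
  then show ?thesis
    unfolding i(5,6) using i(1,2) by (simp add: inverse_arrows_def)
qed

lemma inverse_arrows_unique:
  assumes "inverse_arrows C x y f g" "inverse_arrows C x y f g'" "x \<in> obj C" "y \<in> obj C"
  shows "g = g'"
proof -
  note i = invsD[OF inverse_arrows_invs[OF assms(1,3,4)]]
    and i' = invsD[OF inverse_arrows_invs[OF assms(2,3,4)]]
  have "Arr y g x = Arr y g x \<bullet> (Arr x f y \<bullet> Arr y g' x)"
    using i(2) by (simp add: i'(6))
  also have "\<dots> = Arr y g' x"
    using i'(2) by (simp add: tail[OF i(5)])
  finally show ?thesis
    by simp
qed

lemma inv_arr_eq:
  assumes "inverse_arrows C x y f g" "x \<in> obj C" "y \<in> obj C"
  shows "inv_arr C x y f = g"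
  unfolding inv_arr_def by (rule the_equality) (rule assms(1), erule inverse_arrows_unique[OF _ assms])

lemma is_iso_invs:
  assumes "is_iso C x y f" "x \<in> obj C" "y \<in> obj C"
  shows "invs C (Arr x f y) (Arr y (inv_arr C x y f) x)"
proof -
  obtain g where "inverse_arrows C x y f g"
    using assms(1) by (auto simp: is_iso_def)
  with inv_arr_eq[OF this assms(2,3)] inverse_arrows_invs[OF this assms(2,3)] show ?thesis
    by simp
qed

end

section \<open>Functors and adjunctions\<close>

lemma is_functorD:
  assumes "is_functor C D F"
  shows "category C" "category D"
    "x \<in> obj C \<Longrightarrow> fob F x \<in> obj D"
    "x \<in> obj C \<Longrightarrow> y \<in> obj C \<Longrightarrow> f \<in> hom C x y \<Longrightarrow> far F x y f \<in> hom D (fob F x) (fob F y)"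
    "x \<in> obj C \<Longrightarrow> far F x x (ident C x) = ident D (fob F x)"
    "x \<in> obj C \<Longrightarrow> y \<in> obj C \<Longrightarrow> z \<in> obj C \<Longrightarrow> f \<in> hom C x y \<Longrightarrow> g \<in> hom C y z \<Longrightarrow>
      far F x z (g \<cdot>\<^bsub>C\<^esub> f) = far F y z g \<cdot>\<^bsub>D\<^esub> far F x y f"
  using assms by (auto simp: is_functor_def)

definition tmap :: "('x, 'b, 'y, 'c) ftor \<Rightarrow> ('x, 'b) tarr \<Rightarrow> ('y, 'c) tarr" where
  "tmap F t = Arr (fob F (src t)) (far F (src t) (tgt t) (raw t)) (fob F (tgt t))"

lemma src_tmap [simp]: "src (tmap F t) = fob F (src t)" and tgt_tmap [simp]: "tgt (tmap F t) = fob F (tgt t)"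
  and raw_tmap [simp]: "raw (tmap F t) = far F (src t) (tgt t) (raw t)"
  by (simp_all add: tmap_def)

locale functor_between = C: cat C + D: cat D
  for C :: "('x, 'b, 'r) category_scheme" and D :: "('y, 'c, 's) category_scheme" +
  fixes F :: "('x, 'b, 'y, 'c) ftor"
  assumes is_functor: "is_functor C D F"
begin

lemma fob_obj [simp]: "x \<in> obj C \<Longrightarrow> fob F x \<in> obj D"
  using is_functor by (simp add: is_functorD)

lemma arr_tmap [simp]: "arr C t \<Longrightarrow> arr D (tmap F t)"
  using is_functorD(4)[OF is_functor] arr_raw[of C t] by (simp add: tmap_def)

lemma tmap_idt [simp]: "x \<in> obj C \<Longrightarrow> tmap F (idt C x) = idt D (fob F x)"
  using is_functorD(5)[OF is_functor] by (simp add: tmap_def idt_def)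

lemma tmap_cmp: "arr C g \<Longrightarrow> arr C f \<Longrightarrow> src g = tgt f \<Longrightarrow> tmap F (cmp C g f) = cmp D (tmap F g) (tmap F f)"
  using is_functorD(6)[OF is_functor] arr_raw[of C f] arr_raw[of C g]
  by (intro tarr_eqI[of D]) simp_all

end

lemma functor_betweenI: "is_functor C D F \<Longrightarrow> functor_between C D F"
  by unfold_locales (auto simp: is_functor_def)

text \<open>A unit and a counit satisfying the triangle identities give an adjunction: \<open>h\<close> corresponds to
  \<open>G h \<cdot> \<eta>\<close>, and \<open>k\<close> to \<open>\<epsilon> \<cdot> F k\<close>.\<close>

lemma adjunction_unit_counit:
  assumes F: "is_functor C D F" and G: "is_functor D C G"
    and \<eta>: "\<And>x. x \<in> obj C \<Longrightarrow> \<eta> x \<in> hom C x (fob G (fob F x))"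
    and \<epsilon>: "\<And>y. y \<in> obj D \<Longrightarrow> \<epsilon> y \<in> hom D (fob F (fob G y)) y"
    and \<eta>_nat: "\<And>x x' u. x \<in> obj C \<Longrightarrow> x' \<in> obj C \<Longrightarrow> u \<in> hom C x x' \<Longrightarrow>
      \<eta> x' \<cdot>\<^bsub>C\<^esub> u = far G (fob F x) (fob F x') (far F x x' u) \<cdot>\<^bsub>C\<^esub> \<eta> x"
    and \<epsilon>_nat: "\<And>y y' v. y \<in> obj D \<Longrightarrow> y' \<in> obj D \<Longrightarrow> v \<in> hom D y y' \<Longrightarrow>
      \<epsilon> y' \<cdot>\<^bsub>D\<^esub> far F (fob G y) (fob G y') (far G y y' v) = v \<cdot>\<^bsub>D\<^esub> \<epsilon> y"
    and zigF: "\<And>x. x \<in> obj C \<Longrightarrow>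
      \<epsilon> (fob F x) \<cdot>\<^bsub>D\<^esub> far F x (fob G (fob F x)) (\<eta> x) = ident D (fob F x)"
    and zigG: "\<And>y. y \<in> obj D \<Longrightarrow>
      far G (fob F (fob G y)) y (\<epsilon> y) \<cdot>\<^bsub>C\<^esub> \<eta> (fob G y) = ident C (fob G y)"
  shows "adjunction C D F G"
proof -
  interpret F: functor_between C D F by (rule functor_betweenI[OF F])
  interpret G: functor_between D C G by (rule functor_betweenI[OF G])
  let ?h = "\<lambda>x. Arr x (\<eta> x) (fob G (fob F x))"
  let ?e = "\<lambda>y. Arr (fob F (fob G y)) (\<epsilon> y) y"
  have nat_h: "cmp C (?h (tgt u)) u = cmp C (tmap G (tmap F u)) (?h (src u))" if "arr C u" for u
    using that \<eta> \<eta>_nat arr_raw[OF that] by (intro tarr_eqI[of C]) simp_all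
  have nat_e: "cmp D (?e (tgt v)) (tmap F (tmap G v)) = cmp D v (?e (src v))" if "arr D v" for v
    using that \<epsilon> \<epsilon>_nat arr_raw[OF that] by (intro tarr_eqI[of D]) simp_all
  have zF: "cmp D (?e (fob F x)) (tmap F (?h x)) = idt D (fob F x)" if "x \<in> obj C" for x
    using that \<eta> \<epsilon> zigF by (intro tarr_eqI[of D]) simp_all
  have zG: "cmp C (tmap G (?e y)) (?h (fob G y)) = idt C (fob G y)" if "y \<in> obj D" for y
    using that \<eta> \<epsilon> zigG by (intro tarr_eqI[of C]) simp_all
  define \<Phi> where "\<Phi> x y h = raw (cmp C (tmap G (Arr (fob F x) h y)) (?h x))" for x y h
  define \<Psi> where "\<Psi> x y k = raw (cmp D (?e y) (tmap F (Arr x k (fob G y))))" for x y k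
  have \<Phi>t: "Arr x (\<Phi> x y h) (fob G y) = cmp C (tmap G (Arr (fob F x) h y)) (?h x)"
    "arr C (Arr x (\<Phi> x y h) (fob G y))"
    if "x \<in> obj C" "y \<in> obj D" "h \<in> hom D (fob F x) y" for x y h
  proof -
    have a: "arr C (cmp C (tmap G (Arr (fob F x) h y)) (?h x))"
      using that \<eta> by simp
    moreover have "src (cmp C (tmap G (Arr (fob F x) h y)) (?h x)) = x"
      "tgt (cmp C (tmap G (Arr (fob F x) h y)) (?h x)) = fob G y"
      using that \<eta> by simp_all
    ultimately show "Arr x (\<Phi> x y h) (fob G y) = cmp C (tmap G (Arr (fob F x) h y)) (?h x)"
      unfolding \<Phi>_def by (metis not_arr_Null tarr.collapse)
    then show "arr C (Arr x (\<Phi> x y h) (fob G y))"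
      using a by simp
  qed
  have \<Psi>t: "Arr (fob F x) (\<Psi> x y k) y = cmp D (?e y) (tmap F (Arr x k (fob G y)))"
    "arr D (Arr (fob F x) (\<Psi> x y k) y)"
    if "x \<in> obj C" "y \<in> obj D" "k \<in> hom C x (fob G y)" for x y k
  proof -
    have a: "arr D (cmp D (?e y) (tmap F (Arr x k (fob G y))))"
      using that \<epsilon> by simp
    moreover have "src (cmp D (?e y) (tmap F (Arr x k (fob G y)))) = fob F x"
      "tgt (cmp D (?e y) (tmap F (Arr x k (fob G y)))) = y"
      using that \<epsilon> by simp_all
    ultimately show "Arr (fob F x) (\<Psi> x y k) y = cmp D (?e y) (tmap F (Arr x k (fob G y)))"
      unfolding \<Psi>_def by (metis not_arr_Null tarr.collapse)
    then show "arr D (Arr (fob F x) (\<Psi> x y k) y)"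
      using a by simp
  qed
  have \<Psi>\<Phi>: "\<Psi> x y (\<Phi> x y h) = h" if "x \<in> obj C" "y \<in> obj D" "h \<in> hom D (fob F x) y" for x y h
  proof -
    let ?t = "Arr (fob F x) h y"
    have t: "arr D ?t" using that by simp
    have m: "\<Phi> x y h \<in> hom C x (fob G y)" using \<Phi>t(2)[OF that] by simp
    have "Arr (fob F x) (\<Psi> x y (\<Phi> x y h)) y = cmp D (?e y) (cmp D (tmap F (tmap G ?t)) (tmap F (?h x)))"
      using \<Psi>t(1)[OF that(1,2) m] \<Phi>t(1)[OF that] that \<eta> t by (simp add: F.tmap_cmp)
    also have "\<dots> = cmp D ?t (cmp D (?e (fob F x)) (tmap F (?h x)))"
      using F.D.tail[OF nat_e[OF t]] by (simp add: F.D.cmp_assoc)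
    also have "\<dots> = ?t"
      using t that by (simp add: zF)
    finally show ?thesis by simp
  qed
  have \<Phi>\<Psi>: "\<Phi> x y (\<Psi> x y k) = k" if "x \<in> obj C" "y \<in> obj D" "k \<in> hom C x (fob G y)" for x y k
  proof -
    let ?t = "Arr x k (fob G y)"
    have t: "arr C ?t" using that by simp
    have m: "\<Psi> x y k \<in> hom D (fob F x) y" using \<Psi>t(2)[OF that] by simp
    have "Arr x (\<Phi> x y (\<Psi> x y k)) (fob G y) = cmp C (cmp C (tmap G (?e y)) (tmap G (tmap F ?t))) (?h x)"
      using \<Phi>t(1)[OF that(1,2) m] \<Psi>t(1)[OF that] that \<epsilon> t by (simp add: G.tmap_cmp)
    also have "\<dots> = cmp C (tmap G (?e y)) (cmp C (?h (fob G y)) ?t)"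
      using nat_h[OF t] by (simp add: F.C.cmp_assoc)
    also have "\<dots> = ?t"
      using t that by (simp add: zG F.C.cmp_assoc[symmetric])
    finally show ?thesis by simp
  qed
  show ?thesis
    unfolding adjunction_def
  proof (intro conjI F G exI[of _ \<Phi>] ballI)
    fix x y assume x: "x \<in> obj C" and y: "y \<in> obj D"
    show "bij_betw (\<Phi> x y) (hom D (fob F x) y) (hom C x (fob G y))"
      using \<Phi>t(2) \<Psi>t(2) \<Psi>\<Phi> \<Phi>\<Psi> x y by (intro bij_betw_byWitness[of _ "\<Psi> x y"]) auto
  next
    fix x x' y y' u v h
    assume x: "x \<in> obj C" "x' \<in> obj C" and y: "y \<in> obj D" "y' \<in> obj D"
      and u: "u \<in> hom C x' x" and v: "v \<in> hom D y y'" and h: "h \<in> hom D (fob F x) y"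
    let ?u = "Arr x' u x" and ?v = "Arr y v y'" and ?t = "Arr (fob F x) h y"
    have a: "arr C ?u" "arr D ?v" "arr D ?t"
      using x y u v h by simp_all
    let ?w = "cmp D ?v (cmp D ?t (tmap F ?u))"
    have w: "?w = Arr (fob F x') (v \<cdot>\<^bsub>D\<^esub> h \<cdot>\<^bsub>D\<^esub> far F x' x u) y'"
      using a by (intro tarr_eqI[of D]) (simp_all add: arr_raw[of D ?w, simplified])
    have "arr D ?w" using a by simp
    then have w': "v \<cdot>\<^bsub>D\<^esub> h \<cdot>\<^bsub>D\<^esub> far F x' x u \<in> hom D (fob F x') y'"
      unfolding w by simp
    have "Arr x' (\<Phi> x' y' (v \<cdot>\<^bsub>D\<^esub> h \<cdot>\<^bsub>D\<^esub> far F x' x u)) (fob G y') = cmp C (tmap G ?w) (?h x')"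
      using \<Phi>t(1)[OF x(2) y(2) w'] w by simp
    also have "\<dots> = cmp C (tmap G ?v) (cmp C (tmap G ?t) (cmp C (tmap G (tmap F ?u)) (?h x')))"
      using a by (simp add: G.tmap_cmp F.C.cmp_assoc)
    also have "\<dots> = cmp C (tmap G ?v) (cmp C (cmp C (tmap G ?t) (?h x)) ?u)"
      using nat_h[OF a(1)] by (simp add: F.C.cmp_assoc)
    also have "\<dots> = cmp C (tmap G ?v) (cmp C (Arr x (\<Phi> x y h) (fob G y)) ?u)"
      using \<Phi>t(1)[OF x(1) y(1) h] by simp
    finally have "raw (Arr x' (\<Phi> x' y' (v \<cdot>\<^bsub>D\<^esub> h \<cdot>\<^bsub>D\<^esub> far F x' x u)) (fob G y')) =
        raw (cmp C (tmap G ?v) (cmp C (Arr x (\<Phi> x y h) (fob G y)) ?u))"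
      by (rule arg_cong)
    then show "\<Phi> x' y' (v \<cdot>\<^bsub>D\<^esub> h \<cdot>\<^bsub>D\<^esub> far F x' x u) = far G y y' v \<cdot>\<^bsub>C\<^esub> \<Phi> x y h \<cdot>\<^bsub>C\<^esub> u"
      using a \<Phi>t(2)[OF x(1) y(1) h] by simp
  qed
qed

definition comp_ftor :: "('y, 'c, 'z, 'd) ftor \<Rightarrow> ('x, 'b, 'y, 'c) ftor \<Rightarrow> ('x, 'b, 'z, 'd) ftor" where
  "comp_ftor G F = \<lparr> fob = (\<lambda>x. fob G (fob F x)),
     far = (\<lambda>x y f. far G (fob F x) (fob F y) (far F x y f)) \<rparr>"

lemma is_functor_comp: "is_functor C D F \<Longrightarrow> is_functor D E G \<Longrightarrow> is_functor C E (comp_ftor G F)"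
  unfolding is_functor_def comp_ftor_def by simp

lemma adjunction_compose:
  assumes "adjunction C D F G" "adjunction D E F' G'"
  shows "adjunction C E (comp_ftor F' F) (comp_ftor G G')"
proof -
  have F: "is_functor C D F" and G: "is_functor D C G" and F': "is_functor D E F'" and G': "is_functor E D G'"
    using assms by (auto simp: adjunction_def)
  obtain \<Phi> where b: "\<And>x y. x \<in> obj C \<Longrightarrow> y \<in> obj D \<Longrightarrow> bij_betw (\<Phi> x y) (hom D (fob F x) y) (hom C x (fob G y))"
    and n: "\<And>x x' y y' u v h. x \<in> obj C \<Longrightarrow> x' \<in> obj C \<Longrightarrow> y \<in> obj D \<Longrightarrow> y' \<in> obj D \<Longrightarrow>
      u \<in> hom C x' x \<Longrightarrow> v \<in> hom D y y' \<Longrightarrow> h \<in> hom D (fob F x) y \<Longrightarrow>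
      \<Phi> x' y' (v \<cdot>\<^bsub>D\<^esub> h \<cdot>\<^bsub>D\<^esub> far F x' x u) = far G y y' v \<cdot>\<^bsub>C\<^esub> \<Phi> x y h \<cdot>\<^bsub>C\<^esub> u"
    using assms(1) unfolding adjunction_def by blast
  obtain \<Phi>' where b': "\<And>x y. x \<in> obj D \<Longrightarrow> y \<in> obj E \<Longrightarrow> bij_betw (\<Phi>' x y) (hom E (fob F' x) y) (hom D x (fob G' y))"
    and n': "\<And>x x' y y' u v h. x \<in> obj D \<Longrightarrow> x' \<in> obj D \<Longrightarrow> y \<in> obj E \<Longrightarrow> y' \<in> obj E \<Longrightarrow>
      u \<in> hom D x' x \<Longrightarrow> v \<in> hom E y y' \<Longrightarrow> h \<in> hom E (fob F' x) y \<Longrightarrow>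
      \<Phi>' x' y' (v \<cdot>\<^bsub>E\<^esub> h \<cdot>\<^bsub>E\<^esub> far F' x' x u) = far G' y y' v \<cdot>\<^bsub>D\<^esub> \<Phi>' x y h \<cdot>\<^bsub>D\<^esub> u"
    using assms(2) unfolding adjunction_def by blast
  note [simp] = is_functorD(3,4)[OF F] is_functorD(3,4)[OF G'] is_functorD(3,4)[OF F'] is_functorD(3,4)[OF G]
  show ?thesis
    unfolding adjunction_def
  proof (intro conjI is_functor_comp[OF F F'] is_functor_comp[OF G' G]
      exI[of _ "\<lambda>x y h. \<Phi> x (fob G' y) (\<Phi>' (fob F x) y h)"] ballI)
    fix x y assume "x \<in> obj C" "y \<in> obj E"
    then show "bij_betw (\<lambda>h. \<Phi> x (fob G' y) (\<Phi>' (fob F x) y h))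
        (hom E (fob (comp_ftor F' F) x) y) (hom C x (fob (comp_ftor G G') y))"
      using bij_betw_trans[OF b'[of "fob F x" y] b[of x "fob G' y"]] by (simp add: comp_ftor_def o_def)
  next
    fix x x' y y' u v h
    assume *: "x \<in> obj C" "x' \<in> obj C" "y \<in> obj E" "y' \<in> obj E" "u \<in> hom C x' x" "v \<in> hom E y y'"
      "h \<in> hom E (fob (comp_ftor F' F) x) y"
    have m: "\<Phi>' (fob F x) y h \<in> hom D (fob F x) (fob G' y)"
      using bij_betwE[OF b'[of "fob F x" y]] * by (simp add: comp_ftor_def)
    show "\<Phi> x' (fob G' y') (\<Phi>' (fob F x') y' (v \<cdot>\<^bsub>E\<^esub> h \<cdot>\<^bsub>E\<^esub> far (comp_ftor F' F) x' x u)) =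
        far (comp_ftor G G') y y' v \<cdot>\<^bsub>C\<^esub> \<Phi> x (fob G' y) (\<Phi>' (fob F x) y h) \<cdot>\<^bsub>C\<^esub> u"
      using * m by (simp add: comp_ftor_def n' n)
  qed
qed

text \<open>The arrow maps of \<open>F'\<close> are those of \<open>F\<close> conjugated by the invertible \<open>\<theta>\<close>, so naturality of \<open>\<theta>\<close> and
functoriality of \<open>F\<close> force \<open>F'\<close> to be a functor.\<close>

lemma is_functor_transport:
  assumes F: "is_functor C D F"
    and ob: "\<And>x. x \<in> obj C \<Longrightarrow> fob F' x \<in> obj D"
    and ar: "\<And>x x' f. x \<in> obj C \<Longrightarrow> x' \<in> obj C \<Longrightarrow> f \<in> hom C x x' \<Longrightarrow> far F' x x' f \<in> hom D (fob F' x) (fob F' x')"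
    and iso: "\<And>x. x \<in> obj C \<Longrightarrow> invs D (Arr (fob F x) (\<theta> x) (fob F' x)) (Arr (fob F' x) (\<theta>' x) (fob F x))"
    and nat: "\<And>x x' f. x \<in> obj C \<Longrightarrow> x' \<in> obj C \<Longrightarrow> f \<in> hom C x x' \<Longrightarrow>
      far F' x x' f \<cdot>\<^bsub>D\<^esub> \<theta> x = \<theta> x' \<cdot>\<^bsub>D\<^esub> far F x x' f"
  shows "is_functor C D F'"
proof -
  interpret F: functor_between C D F by (rule functor_betweenI[OF F])
  let ?i = "\<lambda>x. Arr (fob F x) (\<theta> x) (fob F' x)" and ?j = "\<lambda>x. Arr (fob F' x) (\<theta>' x) (fob F x)"
  have far: "tmap F' t = cmp D (?i (tgt t)) (cmp D (tmap F t) (?j (src t)))" if t: "arr C t" for t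
  proof -
    have a: "arr D (tmap F' t)"
      using t ob ar arr_raw[OF t] by (simp add: tmap_def)
    note i = F.D.invsD[OF iso[of "src t"]] F.D.invsD[OF iso[of "tgt t"]]
    have "cmp D (tmap F' t) (?i (src t)) = cmp D (?i (tgt t)) (tmap F t)"
      using t i a nat[of "src t" "tgt t" "raw t"] arr_raw[OF t] by (intro tarr_eqI[of D]) simp_all
    from F.D.tail[OF this, of "?j (src t)"] show ?thesis
      using t i a by (simp add: F.D.cmp_assoc)
  qed
  show ?thesis
    unfolding is_functor_def
  proof (intro conjI F.C.category F.D.category ballI)
    show "fob F' x \<in> obj D" if "x \<in> obj C" for x
      using that by (rule ob)
    show "far F' x y f \<in> hom D (fob F' x) (fob F' y)" if "x \<in> obj C" "y \<in> obj C" "f \<in> hom C x y" for x y f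
      using that by (rule ar)
    show "far F' x x (ident C x) = ident D (fob F' x)" if x: "x \<in> obj C" for x
      using arg_cong[OF far[of "idt C x"], of raw] x F.D.invsD[OF iso[OF x]]
      by simp
    show "far F' x z (g \<cdot>\<^bsub>C\<^esub> f) = far F' y z g \<cdot>\<^bsub>D\<^esub> far F' x y f"
      if xyz: "x \<in> obj C" "y \<in> obj C" "z \<in> obj C" and f: "f \<in> hom C x y" and g: "g \<in> hom C y z" for x y z f g
    proof -
      let ?f = "Arr x f y" and ?g = "Arr y g z"
      have a: "arr C ?f" "arr C ?g" using xyz f g by simp_all
      note i = F.D.invsD[OF iso[OF xyz(1)]] F.D.invsD[OF iso[OF xyz(2)]] F.D.invsD[OF iso[OF xyz(3)]]
      have c: "tmap F' (cmp C ?g ?f) = cmp D (tmap F' ?g) (tmap F' ?f)"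
        using a i(1-4,7-10,13-16) by (simp add: far F.tmap_cmp F.D.cmp_assoc F.D.tail[OF i(11)])
      have "arr D (tmap F' ?f)" "arr D (tmap F' ?g)"
        using xyz f g ob ar by (simp_all add: tmap_def)
      then show ?thesis
        using arg_cong[OF c, of raw] a by simp
    qed
  qed
qed

text \<open>A functor that is naturally isomorphic to an adjoint is an adjoint: precomposing with \<open>\<theta> x\<close>, resp.
postcomposing in the variant for right adjoints, is a natural bijection of hom-sets.\<close>

lemma adjunction_transport_left:
  assumes adj: "adjunction C D F G"
    and ob: "\<And>x. x \<in> obj C \<Longrightarrow> fob F' x \<in> obj D"
    and ar: "\<And>x x' f. x \<in> obj C \<Longrightarrow> x' \<in> obj C \<Longrightarrow> f \<in> hom C x x' \<Longrightarrow> far F' x x' f \<in> hom D (fob F' x) (fob F' x')"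
    and iso: "\<And>x. x \<in> obj C \<Longrightarrow> invs D (Arr (fob F x) (\<theta> x) (fob F' x)) (Arr (fob F' x) (\<theta>' x) (fob F x))"
    and nat: "\<And>x x' f. x \<in> obj C \<Longrightarrow> x' \<in> obj C \<Longrightarrow> f \<in> hom C x x' \<Longrightarrow>
      far F' x x' f \<cdot>\<^bsub>D\<^esub> \<theta> x = \<theta> x' \<cdot>\<^bsub>D\<^esub> far F x x' f"
  shows "adjunction C D F' G"
proof -
  have F: "is_functor C D F" and G: "is_functor D C G"
    using adj by (auto simp: adjunction_def)
  have F': "is_functor C D F'"
    by (rule is_functor_transport[OF F ob ar iso nat])
  interpret F: functor_between C D F by (rule functor_betweenI[OF F])
  obtain \<Phi> where b: "\<And>x y. x \<in> obj C \<Longrightarrow> y \<in> obj D \<Longrightarrow> bij_betw (\<Phi> x y) (hom D (fob F x) y) (hom C x (fob G y))"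
    and n: "\<And>x x' y y' u v h. x \<in> obj C \<Longrightarrow> x' \<in> obj C \<Longrightarrow> y \<in> obj D \<Longrightarrow> y' \<in> obj D \<Longrightarrow>
      u \<in> hom C x' x \<Longrightarrow> v \<in> hom D y y' \<Longrightarrow> h \<in> hom D (fob F x) y \<Longrightarrow>
      \<Phi> x' y' (v \<cdot>\<^bsub>D\<^esub> h \<cdot>\<^bsub>D\<^esub> far F x' x u) = far G y y' v \<cdot>\<^bsub>C\<^esub> \<Phi> x y h \<cdot>\<^bsub>C\<^esub> u"
    using adj unfolding adjunction_def by blast
  have i: "\<theta> x \<in> hom D (fob F x) (fob F' x)" "\<theta>' x \<in> hom D (fob F' x) (fob F x)"
    "\<theta> x \<cdot>\<^bsub>D\<^esub> \<theta>' x = ident D (fob F' x)" "\<theta>' x \<cdot>\<^bsub>D\<^esub> \<theta> x = ident D (fob F x)" if "x \<in> obj C" for x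
    using F.D.invs_inverse_arrows[OF iso[OF that]] by (simp_all add: inverse_arrows_def)
  have pre: "bij_betw (\<lambda>h. h \<cdot>\<^bsub>D\<^esub> \<theta> x) (hom D (fob F' x) y) (hom D (fob F x) y)"
    if x: "x \<in> obj C" and y: "y \<in> obj D" for x y
  proof (rule bij_betw_byWitness[of _ "\<lambda>h. h \<cdot>\<^bsub>D\<^esub> \<theta>' x"])
    have o: "fob F x \<in> obj D" "fob F' x \<in> obj D" using ob x by simp_all
    show "\<forall>h\<in>hom D (fob F' x) y. (h \<cdot>\<^bsub>D\<^esub> \<theta> x) \<cdot>\<^bsub>D\<^esub> \<theta>' x = h"
      using F.D.comp_assoc[OF o(2) o(1) o(2) y i(2)[OF x] i(1)[OF x]] F.D.comp_ident(1)[OF o(2) y] i[OF x] by simp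
    show "\<forall>h\<in>hom D (fob F x) y. (h \<cdot>\<^bsub>D\<^esub> \<theta>' x) \<cdot>\<^bsub>D\<^esub> \<theta> x = h"
      using F.D.comp_assoc[OF o(1) o(2) o(1) y i(1)[OF x] i(2)[OF x]] F.D.comp_ident(1)[OF o(1) y] i[OF x] by simp
    show "(\<lambda>h. h \<cdot>\<^bsub>D\<^esub> \<theta> x) ` hom D (fob F' x) y \<subseteq> hom D (fob F x) y"
      using F.D.comp_hom[OF o(1) o(2) y i(1)[OF x]] by blast
    show "(\<lambda>h. h \<cdot>\<^bsub>D\<^esub> \<theta>' x) ` hom D (fob F x) y \<subseteq> hom D (fob F' x) y"
      using F.D.comp_hom[OF o(2) o(1) y i(2)[OF x]] by blast
  qed
  show ?thesis
    unfolding adjunction_def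
  proof (intro conjI F' G exI[of _ "\<lambda>x y h. \<Phi> x y (h \<cdot>\<^bsub>D\<^esub> \<theta> x)"] ballI)
    fix x y assume "x \<in> obj C" "y \<in> obj D"
    then show "bij_betw (\<lambda>h. \<Phi> x y (h \<cdot>\<^bsub>D\<^esub> \<theta> x)) (hom D (fob F' x) y) (hom C x (fob G y))"
      using bij_betw_trans[OF pre[of x y] b[of x y]] by (simp add: o_def)
  next
    fix x x' y y' u v h
    assume *: "x \<in> obj C" "x' \<in> obj C" "y \<in> obj D" "y' \<in> obj D" "u \<in> hom C x' x" "v \<in> hom D y y'"
      "h \<in> hom D (fob F' x) y"
    have m: "h \<cdot>\<^bsub>D\<^esub> \<theta> x \<in> hom D (fob F x) y"
      using bij_betwE[OF pre[of x y]] * by simp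
    have o: "fob F x \<in> obj D" "fob F' x \<in> obj D" "fob F x' \<in> obj D" "fob F' x' \<in> obj D" using ob * by simp_all
    have fu: "far F' x' x u \<in> hom D (fob F' x') (fob F' x)" "far F x' x u \<in> hom D (fob F x') (fob F x)"
      using ar * is_functorD(4)[OF F] by simp_all
    have "(v \<cdot>\<^bsub>D\<^esub> h \<cdot>\<^bsub>D\<^esub> far F' x' x u) \<cdot>\<^bsub>D\<^esub> \<theta> x' = v \<cdot>\<^bsub>D\<^esub> h \<cdot>\<^bsub>D\<^esub> (far F' x' x u \<cdot>\<^bsub>D\<^esub> \<theta> x')"
      using F.D.comp_assoc[OF o(3,4) *(3,4) i(1)[OF *(2)] F.D.comp_hom[OF o(4,2) *(3) fu(1) *(7)] *(6)]
        F.D.comp_assoc[OF o(3,4,2) *(3) i(1)[OF *(2)] fu(1) *(7)] by simp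
    also have "\<dots> = v \<cdot>\<^bsub>D\<^esub> (h \<cdot>\<^bsub>D\<^esub> \<theta> x) \<cdot>\<^bsub>D\<^esub> far F x' x u"
      using nat[OF *(2,1,5)] F.D.comp_assoc[OF o(3,1,2) *(3) fu(2) i(1)[OF *(1)] *(7)] by simp
    finally show "\<Phi> x' y' ((v \<cdot>\<^bsub>D\<^esub> h \<cdot>\<^bsub>D\<^esub> far F' x' x u) \<cdot>\<^bsub>D\<^esub> \<theta> x') = far G y y' v \<cdot>\<^bsub>C\<^esub> \<Phi> x y (h \<cdot>\<^bsub>D\<^esub> \<theta> x) \<cdot>\<^bsub>C\<^esub> u"
      using n[OF *(1-6) m] by simp
  qed
qed

lemma adjunction_transport_right:
  assumes adj: "adjunction C D F G"
    and ob: "\<And>y. y \<in> obj D \<Longrightarrow> fob G' y \<in> obj C"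
    and ar: "\<And>y y' f. y \<in> obj D \<Longrightarrow> y' \<in> obj D \<Longrightarrow> f \<in> hom D y y' \<Longrightarrow> far G' y y' f \<in> hom C (fob G' y) (fob G' y')"
    and iso: "\<And>y. y \<in> obj D \<Longrightarrow> invs C (Arr (fob G y) (\<theta> y) (fob G' y)) (Arr (fob G' y) (\<theta>' y) (fob G y))"
    and nat: "\<And>y y' f. y \<in> obj D \<Longrightarrow> y' \<in> obj D \<Longrightarrow> f \<in> hom D y y' \<Longrightarrow>
      far G' y y' f \<cdot>\<^bsub>C\<^esub> \<theta> y = \<theta> y' \<cdot>\<^bsub>C\<^esub> far G y y' f"
  shows "adjunction C D F G'"
proof -
  have F: "is_functor C D F" and G: "is_functor D C G"
    using adj by (auto simp: adjunction_def)
  have G': "is_functor D C G'"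
    by (rule is_functor_transport[OF G ob ar iso nat])
  interpret G: functor_between D C G by (rule functor_betweenI[OF G])
  obtain \<Phi> where b: "\<And>x y. x \<in> obj C \<Longrightarrow> y \<in> obj D \<Longrightarrow> bij_betw (\<Phi> x y) (hom D (fob F x) y) (hom C x (fob G y))"
    and n: "\<And>x x' y y' u v h. x \<in> obj C \<Longrightarrow> x' \<in> obj C \<Longrightarrow> y \<in> obj D \<Longrightarrow> y' \<in> obj D \<Longrightarrow>
      u \<in> hom C x' x \<Longrightarrow> v \<in> hom D y y' \<Longrightarrow> h \<in> hom D (fob F x) y \<Longrightarrow>
      \<Phi> x' y' (v \<cdot>\<^bsub>D\<^esub> h \<cdot>\<^bsub>D\<^esub> far F x' x u) = far G y y' v \<cdot>\<^bsub>C\<^esub> \<Phi> x y h \<cdot>\<^bsub>C\<^esub> u"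
    using adj unfolding adjunction_def by blast
  have i: "\<theta> y \<in> hom C (fob G y) (fob G' y)" "\<theta>' y \<in> hom C (fob G' y) (fob G y)"
    "\<theta> y \<cdot>\<^bsub>C\<^esub> \<theta>' y = ident C (fob G' y)" "\<theta>' y \<cdot>\<^bsub>C\<^esub> \<theta> y = ident C (fob G y)" if "y \<in> obj D" for y
    using G.D.invs_inverse_arrows[OF iso[OF that]] by (simp_all add: inverse_arrows_def)
  have post: "bij_betw (\<lambda>h. \<theta> y \<cdot>\<^bsub>C\<^esub> h) (hom C x (fob G y)) (hom C x (fob G' y))"
    if x: "x \<in> obj C" and y: "y \<in> obj D" for x y
  proof (rule bij_betw_byWitness[of _ "\<lambda>h. \<theta>' y \<cdot>\<^bsub>C\<^esub> h"])
    have o: "fob G y \<in> obj C" "fob G' y \<in> obj C" using ob y by simp_all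
    show "\<forall>h\<in>hom C x (fob G y). \<theta>' y \<cdot>\<^bsub>C\<^esub> \<theta> y \<cdot>\<^bsub>C\<^esub> h = h"
      using G.D.comp_assoc[OF x o(1) o(2) o(1) _ i(1)[OF y] i(2)[OF y]] G.D.comp_ident(2)[OF x o(1)] i[OF y] by simp
    show "\<forall>h\<in>hom C x (fob G' y). \<theta> y \<cdot>\<^bsub>C\<^esub> \<theta>' y \<cdot>\<^bsub>C\<^esub> h = h"
      using G.D.comp_assoc[OF x o(2) o(1) o(2) _ i(2)[OF y] i(1)[OF y]] G.D.comp_ident(2)[OF x o(2)] i[OF y] by simp
    show "(\<lambda>h. \<theta> y \<cdot>\<^bsub>C\<^esub> h) ` hom C x (fob G y) \<subseteq> hom C x (fob G' y)"
      using G.D.comp_hom[OF x o(1) o(2) _ i(1)[OF y]] by blast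
    show "(\<lambda>h. \<theta>' y \<cdot>\<^bsub>C\<^esub> h) ` hom C x (fob G' y) \<subseteq> hom C x (fob G y)"
      using G.D.comp_hom[OF x o(2) o(1) _ i(2)[OF y]] by blast
  qed
  show ?thesis
    unfolding adjunction_def
  proof (intro conjI F G' exI[of _ "\<lambda>x y h. \<theta> y \<cdot>\<^bsub>C\<^esub> \<Phi> x y h"] ballI)
    fix x y assume "x \<in> obj C" "y \<in> obj D"
    then show "bij_betw (\<lambda>h. \<theta> y \<cdot>\<^bsub>C\<^esub> \<Phi> x y h) (hom D (fob F x) y) (hom C x (fob G' y))"
      using bij_betw_trans[OF b[of x y] post[of x y]] by (simp add: o_def)
  next
    fix x x' y y' u v h
    assume *: "x \<in> obj C" "x' \<in> obj C" "y \<in> obj D" "y' \<in> obj D" "u \<in> hom C x' x" "v \<in> hom D y y'"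
      "h \<in> hom D (fob F x) y"
    have m: "\<Phi> x y h \<in> hom C x (fob G y)"
      using bij_betwE[OF b[of x y]] * by simp
    have o: "fob G y \<in> obj C" "fob G' y \<in> obj C" "fob G y' \<in> obj C" "fob G' y' \<in> obj C" using ob * by simp_all
    have gv: "far G' y y' v \<in> hom C (fob G' y) (fob G' y')" "far G y y' v \<in> hom C (fob G y) (fob G y')"
      using ar * is_functorD(4)[OF G] by simp_all
    have mu: "\<Phi> x y h \<cdot>\<^bsub>C\<^esub> u \<in> hom C x' (fob G y)"
      using G.D.comp_hom[OF *(2,1) o(1) *(5) m] .
    have "\<theta> y' \<cdot>\<^bsub>C\<^esub> far G y y' v \<cdot>\<^bsub>C\<^esub> \<Phi> x y h \<cdot>\<^bsub>C\<^esub> u = far G' y y' v \<cdot>\<^bsub>C\<^esub> \<theta> y \<cdot>\<^bsub>C\<^esub> \<Phi> x y h \<cdot>\<^bsub>C\<^esub> u"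
      using nat[OF *(3,4,6)] G.D.comp_assoc[OF *(2) o(1,3,4) mu gv(2) i(1)[OF *(4)]]
        G.D.comp_assoc[OF *(2) o(1,2,4) mu i(1)[OF *(3)] gv(1)] by simp
    also have "\<dots> = far G' y y' v \<cdot>\<^bsub>C\<^esub> (\<theta> y \<cdot>\<^bsub>C\<^esub> \<Phi> x y h) \<cdot>\<^bsub>C\<^esub> u"
      using G.D.comp_assoc[OF *(2,1) o(1,2) *(5) m i(1)[OF *(3)]] by simp
    finally show "\<theta> y' \<cdot>\<^bsub>C\<^esub> \<Phi> x' y' (v \<cdot>\<^bsub>D\<^esub> h \<cdot>\<^bsub>D\<^esub> far F x' x u) = far G' y y' v \<cdot>\<^bsub>C\<^esub> (\<theta> y \<cdot>\<^bsub>C\<^esub> \<Phi> x y h) \<cdot>\<^bsub>C\<^esub> u"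
      using n[OF *] by simp
  qed
qed

section \<open>Monoidal categories\<close>

locale monoidal_cat =
  fixes K :: "('o, 'a) moncat" (structure)
  assumes monoidal: "monoidal_category K"
begin

lemma tensor_functor: "is_functor (prod_cat K K) K \<lparr> fob = (\<lambda>(x, y). x \<otimes> y), far = (\<lambda>_ _ (f, g). f \<boxtimes> g) \<rparr>"
  using monoidal unfolding monoidal_category_def by blast

sublocale cat K
  by unfold_locales (rule is_functorD(2)[OF tensor_functor])

abbreviation cmp_K  (infixr "\<bullet>" 70) where "g \<bullet> f \<equiv> cmp K g f"

definition ten :: "('o, 'a) tarr \<Rightarrow> ('o, 'a) tarr \<Rightarrow> ('o, 'a) tarr"  (infixl "\<odot>" 75) where
  "f \<odot> g = (if arr K f \<and> arr K g then Arr (src f \<otimes> src g) (raw f \<boxtimes> raw g) (tgt f \<otimes> tgt g) else Null)"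

abbreviation Id :: "'o \<Rightarrow> ('o, 'a) tarr" where "Id x \<equiv> idt K x"

definition Asc :: "'o \<Rightarrow> 'o \<Rightarrow> 'o \<Rightarrow> ('o, 'a) tarr" where
  "Asc x y z = Arr ((x \<otimes> y) \<otimes> z) (asc K x y z) (x \<otimes> (y \<otimes> z))"

definition Asi :: "'o \<Rightarrow> 'o \<Rightarrow> 'o \<Rightarrow> ('o, 'a) tarr" where
  "Asi x y z = Arr (x \<otimes> (y \<otimes> z)) (asci K x y z) ((x \<otimes> y) \<otimes> z)"

definition Lu :: "'o \<Rightarrow> ('o, 'a) tarr" where "Lu x = Arr (\<one> \<otimes> x) (lun K x) x"
definition Lui :: "'o \<Rightarrow> ('o, 'a) tarr" where "Lui x = Arr x (luni K x) (\<one> \<otimes> x)"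
definition Ru :: "'o \<Rightarrow> ('o, 'a) tarr" where "Ru x = Arr (x \<otimes> \<one>) (run K x) x"
definition Rui :: "'o \<Rightarrow> ('o, 'a) tarr" where "Rui x = Arr x (runi K x) (x \<otimes> \<one>)"

lemma ob_tens [simp]: "x \<in> obj K \<Longrightarrow> y \<in> obj K \<Longrightarrow> x \<otimes> y \<in> obj K"
  using is_functorD(3)[OF tensor_functor, of "(x, y)"] by (simp add: prod_cat_def)

lemma ob_one [simp]: "\<one> \<in> obj K"
  using monoidal unfolding monoidal_category_def by blast

lemma tensa_hom:
  "x \<in> obj K \<Longrightarrow> y \<in> obj K \<Longrightarrow> x' \<in> obj K \<Longrightarrow> y' \<in> obj K \<Longrightarrow> f \<in> hom K x x' \<Longrightarrow> g \<in> hom K y y' \<Longrightarrow>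
    f \<boxtimes> g \<in> hom K (x \<otimes> y) (x' \<otimes> y')"
  using is_functorD(4)[OF tensor_functor, of "(x, y)" "(x', y')" "(f, g)"] by (simp add: prod_cat_def)

lemma arr_ten [simp]: "arr K (f \<odot> g) \<longleftrightarrow> arr K f \<and> arr K g"
proof (cases "arr K f \<and> arr K g")
  case True
  then show ?thesis
    using tensa_hom[of "src f" "src g" "tgt f" "tgt g" "raw f" "raw g"] arr_raw[of K f] arr_raw[of K g]
    by (simp add: ten_def)
qed (auto simp: ten_def)

lemma src_ten [simp]: "arr K f \<Longrightarrow> arr K g \<Longrightarrow> src (f \<odot> g) = src f \<otimes> src g"
  and tgt_ten [simp]: "arr K f \<Longrightarrow> arr K g \<Longrightarrow> tgt (f \<odot> g) = tgt f \<otimes> tgt g"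
  and raw_ten [simp]: "arr K f \<Longrightarrow> arr K g \<Longrightarrow> raw (f \<odot> g) = raw f \<boxtimes> raw g"
  by (simp_all add: ten_def)

lemma Id_ten [simp]: "x \<in> obj K \<Longrightarrow> y \<in> obj K \<Longrightarrow> Id x \<odot> Id y = Id (x \<otimes> y)"
  using is_functorD(5)[OF tensor_functor, of "(x, y)"]
  by (intro tarr_eqI[of K]) (simp_all add: prod_cat_def)

lemma interchange:
  assumes "arr K g" "arr K f" "src g = tgt f" "arr K k" "arr K h" "src k = tgt h"
  shows "(g \<odot> k) \<bullet> (f \<odot> h) = (g \<bullet> f) \<odot> (k \<bullet> h)"
  using is_functorD(6)[OF tensor_functor, of "(src f, src h)" "(tgt f, tgt h)" "(tgt g, tgt k)" "(raw f, raw h)" "(raw g, raw k)"]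
    assms arr_raw[of K f] arr_raw[of K g] arr_raw[of K k] arr_raw[of K h]
  by (intro tarr_eqI[of K]) (simp_all add: prod_cat_def)

lemma interchange':
  assumes "arr K g" "arr K f" "src g = tgt f" "arr K k" "arr K h" "src k = tgt h"
  shows "(g \<odot> k) \<bullet> ((f \<odot> h) \<bullet> t) = ((g \<bullet> f) \<odot> (k \<bullet> h)) \<bullet> t"
  using interchange[OF assms] by (rule tail)

lemmas merge = interchange interchange'

lemmas monoidal_conjuncts = monoidal[unfolded monoidal_category_def, THEN conjunct2, THEN conjunct2]

lemma iso_facts:
  shows "x \<in> obj K \<Longrightarrow> y \<in> obj K \<Longrightarrow> z \<in> obj K \<Longrightarrow> is_iso K ((x \<otimes> y) \<otimes> z) (x \<otimes> (y \<otimes> z)) (asc K x y z)"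
    and "x \<in> obj K \<Longrightarrow> is_iso K (\<one> \<otimes> x) x (lun K x)"
    and "x \<in> obj K \<Longrightarrow> is_iso K (x \<otimes> \<one>) x (run K x)"
  using monoidal_conjuncts[THEN conjunct1] monoidal_conjuncts[THEN conjunct2, THEN conjunct1]
    monoidal_conjuncts[THEN conjunct2, THEN conjunct2, THEN conjunct1] by simp_all

lemma invs_Asc: "x \<in> obj K \<Longrightarrow> y \<in> obj K \<Longrightarrow> z \<in> obj K \<Longrightarrow> invs K (Asc x y z) (Asi x y z)"
  unfolding Asc_def Asi_def asci_def by (rule is_iso_invs) (simp_all add: iso_facts)

lemma invs_Lu: "x \<in> obj K \<Longrightarrow> invs K (Lu x) (Lui x)"
  unfolding Lu_def Lui_def luni_def by (rule is_iso_invs) (simp_all add: iso_facts)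

lemma invs_Ru: "x \<in> obj K \<Longrightarrow> invs K (Ru x) (Rui x)"
  unfolding Ru_def Rui_def runi_def by (rule is_iso_invs) (simp_all add: iso_facts)

lemma src_Asc [simp]: "src (Asc x y z) = (x \<otimes> y) \<otimes> z" and tgt_Asc [simp]: "tgt (Asc x y z) = x \<otimes> (y \<otimes> z)"
  and raw_Asc [simp]: "raw (Asc x y z) = asc K x y z"
  and src_Asi [simp]: "src (Asi x y z) = x \<otimes> (y \<otimes> z)" and tgt_Asi [simp]: "tgt (Asi x y z) = (x \<otimes> y) \<otimes> z"
  and raw_Asi [simp]: "raw (Asi x y z) = asci K x y z"
  by (simp_all add: Asc_def Asi_def)

lemma src_Lu [simp]: "src (Lu x) = \<one> \<otimes> x" and tgt_Lu [simp]: "tgt (Lu x) = x" and raw_Lu [simp]: "raw (Lu x) = lun K x"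
  and src_Lui [simp]: "src (Lui x) = x" and tgt_Lui [simp]: "tgt (Lui x) = \<one> \<otimes> x" and raw_Lui [simp]: "raw (Lui x) = luni K x"
  and src_Ru [simp]: "src (Ru x) = x \<otimes> \<one>" and tgt_Ru [simp]: "tgt (Ru x) = x" and raw_Ru [simp]: "raw (Ru x) = run K x"
  and src_Rui [simp]: "src (Rui x) = x" and tgt_Rui [simp]: "tgt (Rui x) = x \<otimes> \<one>" and raw_Rui [simp]: "raw (Rui x) = runi K x"
  by (simp_all add: Lu_def Lui_def Ru_def Rui_def)

lemma Asc_arr [simp]: "x \<in> obj K \<Longrightarrow> y \<in> obj K \<Longrightarrow> z \<in> obj K \<Longrightarrow> arr K (Asc x y z)"
  and Asi_arr [simp]: "x \<in> obj K \<Longrightarrow> y \<in> obj K \<Longrightarrow> z \<in> obj K \<Longrightarrow> arr K (Asi x y z)"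
  and Asi_Asc [simp]: "x \<in> obj K \<Longrightarrow> y \<in> obj K \<Longrightarrow> z \<in> obj K \<Longrightarrow> Asi x y z \<bullet> Asc x y z = Id ((x \<otimes> y) \<otimes> z)"
  and Asc_Asi [simp]: "x \<in> obj K \<Longrightarrow> y \<in> obj K \<Longrightarrow> z \<in> obj K \<Longrightarrow> Asc x y z \<bullet> Asi x y z = Id (x \<otimes> (y \<otimes> z))"
  using invsD[OF invs_Asc] by simp_all

lemma Lu_arr [simp]: "x \<in> obj K \<Longrightarrow> arr K (Lu x)" and Lui_arr [simp]: "x \<in> obj K \<Longrightarrow> arr K (Lui x)"
  and Lui_Lu [simp]: "x \<in> obj K \<Longrightarrow> Lui x \<bullet> Lu x = Id (\<one> \<otimes> x)" and Lu_Lui [simp]: "x \<in> obj K \<Longrightarrow> Lu x \<bullet> Lui x = Id x"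
  using invsD[OF invs_Lu] by simp_all

lemma Ru_arr [simp]: "x \<in> obj K \<Longrightarrow> arr K (Ru x)" and Rui_arr [simp]: "x \<in> obj K \<Longrightarrow> arr K (Rui x)"
  and Rui_Ru [simp]: "x \<in> obj K \<Longrightarrow> Rui x \<bullet> Ru x = Id (x \<otimes> \<one>)" and Ru_Rui [simp]: "x \<in> obj K \<Longrightarrow> Ru x \<bullet> Rui x = Id x"
  using invsD[OF invs_Ru] by simp_all

lemma iso_tails [simp]:
  "x \<in> obj K \<Longrightarrow> y \<in> obj K \<Longrightarrow> z \<in> obj K \<Longrightarrow> Asi x y z \<bullet> (Asc x y z \<bullet> t) = Id ((x \<otimes> y) \<otimes> z) \<bullet> t"
  "x \<in> obj K \<Longrightarrow> y \<in> obj K \<Longrightarrow> z \<in> obj K \<Longrightarrow> Asc x y z \<bullet> (Asi x y z \<bullet> t) = Id (x \<otimes> (y \<otimes> z)) \<bullet> t"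
  "x \<in> obj K \<Longrightarrow> Lui x \<bullet> (Lu x \<bullet> t) = Id (\<one> \<otimes> x) \<bullet> t" "x \<in> obj K \<Longrightarrow> Lu x \<bullet> (Lui x \<bullet> t) = Id x \<bullet> t"
  "x \<in> obj K \<Longrightarrow> Rui x \<bullet> (Ru x \<bullet> t) = Id (x \<otimes> \<one>) \<bullet> t" "x \<in> obj K \<Longrightarrow> Ru x \<bullet> (Rui x \<bullet> t) = Id x \<bullet> t"
  by (simp_all add: cmp_assoc[symmetric])

lemma raw_naturality:
  shows "x \<in> obj K \<Longrightarrow> x' \<in> obj K \<Longrightarrow> y \<in> obj K \<Longrightarrow> y' \<in> obj K \<Longrightarrow> z \<in> obj K \<Longrightarrow> z' \<in> obj K \<Longrightarrow>
      f \<in> hom K x x' \<Longrightarrow> g \<in> hom K y y' \<Longrightarrow> h \<in> hom K z z' \<Longrightarrow>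
      asc K x' y' z' \<cdot> ((f \<boxtimes> g) \<boxtimes> h) = (f \<boxtimes> (g \<boxtimes> h)) \<cdot> asc K x y z"
    and "x \<in> obj K \<Longrightarrow> x' \<in> obj K \<Longrightarrow> f \<in> hom K x x' \<Longrightarrow> lun K x' \<cdot> (ident K \<one> \<boxtimes> f) = f \<cdot> lun K x"
    and "x \<in> obj K \<Longrightarrow> x' \<in> obj K \<Longrightarrow> f \<in> hom K x x' \<Longrightarrow> run K x' \<cdot> (f \<boxtimes> ident K \<one>) = f \<cdot> run K x"
    and "w \<in> obj K \<Longrightarrow> x \<in> obj K \<Longrightarrow> y \<in> obj K \<Longrightarrow> z \<in> obj K \<Longrightarrow>
      asc K w x (y \<otimes> z) \<cdot> asc K (w \<otimes> x) y z =
        (ident K w \<boxtimes> asc K x y z) \<cdot> asc K w (x \<otimes> y) z \<cdot> (asc K w x y \<boxtimes> ident K z)"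
    and "x \<in> obj K \<Longrightarrow> y \<in> obj K \<Longrightarrow> (ident K x \<boxtimes> lun K y) \<cdot> asc K x \<one> y = run K x \<boxtimes> ident K y"
proof -
  note m = monoidal_conjuncts[THEN conjunct2, THEN conjunct2, THEN conjunct2]
  show "x \<in> obj K \<Longrightarrow> x' \<in> obj K \<Longrightarrow> y \<in> obj K \<Longrightarrow> y' \<in> obj K \<Longrightarrow> z \<in> obj K \<Longrightarrow> z' \<in> obj K \<Longrightarrow>
      f \<in> hom K x x' \<Longrightarrow> g \<in> hom K y y' \<Longrightarrow> h \<in> hom K z z' \<Longrightarrow>
      asc K x' y' z' \<cdot> ((f \<boxtimes> g) \<boxtimes> h) = (f \<boxtimes> (g \<boxtimes> h)) \<cdot> asc K x y z"
    using m[THEN conjunct1] by blast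
  show "x \<in> obj K \<Longrightarrow> x' \<in> obj K \<Longrightarrow> f \<in> hom K x x' \<Longrightarrow> lun K x' \<cdot> (ident K \<one> \<boxtimes> f) = f \<cdot> lun K x"
    "x \<in> obj K \<Longrightarrow> x' \<in> obj K \<Longrightarrow> f \<in> hom K x x' \<Longrightarrow> run K x' \<cdot> (f \<boxtimes> ident K \<one>) = f \<cdot> run K x"
    using m[THEN conjunct2, THEN conjunct1] by blast+
  show "w \<in> obj K \<Longrightarrow> x \<in> obj K \<Longrightarrow> y \<in> obj K \<Longrightarrow> z \<in> obj K \<Longrightarrow>
      asc K w x (y \<otimes> z) \<cdot> asc K (w \<otimes> x) y z =
        (ident K w \<boxtimes> asc K x y z) \<cdot> asc K w (x \<otimes> y) z \<cdot> (asc K w x y \<boxtimes> ident K z)"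
    using m[THEN conjunct2, THEN conjunct2, THEN conjunct1] by blast
  show "x \<in> obj K \<Longrightarrow> y \<in> obj K \<Longrightarrow> (ident K x \<boxtimes> lun K y) \<cdot> asc K x \<one> y = run K x \<boxtimes> ident K y"
    using m[THEN conjunct2, THEN conjunct2, THEN conjunct2] by blast
qed

lemma Asc_natural:
  assumes "arr K f" "arr K g" "arr K h"
  shows "Asc (tgt f) (tgt g) (tgt h) \<bullet> ((f \<odot> g) \<odot> h) = (f \<odot> (g \<odot> h)) \<bullet> Asc (src f) (src g) (src h)"
  using assms raw_naturality(1)[of "src f" "tgt f" "src g" "tgt g" "src h" "tgt h" "raw f" "raw g" "raw h"]
    arr_raw[of K f] arr_raw[of K g] arr_raw[of K h]
  by (intro tarr_eqI[of K]) simp_all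

lemma Asi_natural:
  assumes "arr K f" "arr K g" "arr K h"
  shows "Asi (tgt f) (tgt g) (tgt h) \<bullet> (f \<odot> (g \<odot> h)) = ((f \<odot> g) \<odot> h) \<bullet> Asi (src f) (src g) (src h)"
proof -
  have "Asi (tgt f) (tgt g) (tgt h) \<bullet> ((f \<odot> (g \<odot> h)) \<bullet> Asc (src f) (src g) (src h)) \<bullet> Asi (src f) (src g) (src h)
      = Asi (tgt f) (tgt g) (tgt h) \<bullet> (Asc (tgt f) (tgt g) (tgt h) \<bullet> ((f \<odot> g) \<odot> h)) \<bullet> Asi (src f) (src g) (src h)"
    by (simp only: Asc_natural[OF assms])
  then show ?thesis
    using assms by (simp add: cmp_assoc)
qed

lemma Lu_natural: "arr K f \<Longrightarrow> Lu (tgt f) \<bullet> (Id \<one> \<odot> f) = f \<bullet> Lu (src f)"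
  using raw_naturality(2)[of "src f" "tgt f" "raw f"] arr_raw[of K f]
  by (intro tarr_eqI[of K]) simp_all

lemma Ru_natural: "arr K f \<Longrightarrow> Ru (tgt f) \<bullet> (f \<odot> Id \<one>) = f \<bullet> Ru (src f)"
  using raw_naturality(3)[of "src f" "tgt f" "raw f"] arr_raw[of K f]
  by (intro tarr_eqI[of K]) simp_all

lemma Lui_natural:
  assumes "arr K f"
  shows "Lui (tgt f) \<bullet> f = (Id \<one> \<odot> f) \<bullet> Lui (src f)"
proof -
  have "Lui (tgt f) \<bullet> (f \<bullet> Lu (src f)) \<bullet> Lui (src f) = Lui (tgt f) \<bullet> (Lu (tgt f) \<bullet> (Id \<one> \<odot> f)) \<bullet> Lui (src f)"
    by (simp only: Lu_natural[OF assms])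
  then show ?thesis
    using assms by (simp add: cmp_assoc)
qed

lemma Rui_natural:
  assumes "arr K f"
  shows "Rui (tgt f) \<bullet> f = (f \<odot> Id \<one>) \<bullet> Rui (src f)"
proof -
  have "Rui (tgt f) \<bullet> (f \<bullet> Ru (src f)) \<bullet> Rui (src f) = Rui (tgt f) \<bullet> (Ru (tgt f) \<bullet> (f \<odot> Id \<one>)) \<bullet> Rui (src f)"
    by (simp only: Ru_natural[OF assms])
  then show ?thesis
    using assms by (simp add: cmp_assoc)
qed

lemma pentagon:
  assumes "w \<in> obj K" "x \<in> obj K" "y \<in> obj K" "z \<in> obj K"
  shows "Asc w x (y \<otimes> z) \<bullet> Asc (w \<otimes> x) y z = (Id w \<odot> Asc x y z) \<bullet> Asc w (x \<otimes> y) z \<bullet> (Asc w x y \<odot> Id z)"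
  using assms raw_naturality(4)[OF assms] by (intro tarr_eqI[of K]) simp_all

lemma triangle:
  assumes "x \<in> obj K" "y \<in> obj K"
  shows "(Id x \<odot> Lu y) \<bullet> Asc x \<one> y = Ru x \<odot> Id y"
  using assms raw_naturality(5)[OF assms] by (intro tarr_eqI[of K]) simp_all

text \<open>Tensoring with the unit object on either side is faithful, since it is isomorphic to the identity.\<close>

lemma Id_one_ten_cancel:
  assumes "Id \<one> \<odot> f = Id \<one> \<odot> g" "arr K f" "arr K g" "src f = src g" "tgt f = tgt g"
  shows "f = g"
proof -
  have "f \<bullet> Lu (src f) = g \<bullet> Lu (src f)"
    using Lu_natural[OF assms(2)] Lu_natural[OF assms(3)] assms by simp
  then show ?thesis
    using assms invs_epic[OF invs_Lu[of "src f"]] by (intro epicD[of "Lu (src f)" f g]) simp_all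
qed

lemma ten_Id_one_cancel:
  assumes "f \<odot> Id \<one> = g \<odot> Id \<one>" "arr K f" "arr K g" "src f = src g" "tgt f = tgt g"
  shows "f = g"
proof -
  have "f \<bullet> Ru (src f) = g \<bullet> Ru (src f)"
    using Ru_natural[OF assms(2)] Ru_natural[OF assms(3)] assms by simp
  then show ?thesis
    using assms invs_epic[OF invs_Ru[of "src f"]] by (intro epicD[of "Ru (src f)" f g]) simp_all
qed

lemma invs_ten: "invs K f f' \<Longrightarrow> invs K g g' \<Longrightarrow> invs K (f \<odot> g) (f' \<odot> g')"
  unfolding invs_def by (simp add: interchange)

text \<open>The unit maps of a product are determined by those of one factor.  These equations, due to Kelly, follow
from the pentagon and the triangle after tensoring with the unit object, which is faithful.\<close>

lemma Lu_ten:
  assumes x: "x \<in> obj K" and y: "y \<in> obj K"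
  shows "Lu (x \<otimes> y) \<bullet> Asc \<one> x y = Lu x \<odot> Id y"
proof (rule Id_one_ten_cancel)
  let ?p = "Asc \<one> (\<one> \<otimes> x) y \<bullet> (Asc \<one> \<one> x \<odot> Id y)"
  have "(Id \<one> \<odot> Lu (x \<otimes> y)) \<bullet> (Id \<one> \<odot> Asc \<one> x y) \<bullet> ?p
      = (Id \<one> \<odot> Lu (x \<otimes> y)) \<bullet> Asc \<one> \<one> (x \<otimes> y) \<bullet> Asc (\<one> \<otimes> \<one>) x y"
    using pentagon[of \<one> \<one> x y] x y by simp
  also have "\<dots> = (Ru \<one> \<odot> Id (x \<otimes> y)) \<bullet> Asc (\<one> \<otimes> \<one>) x y"
    using tail[OF triangle[of \<one> "x \<otimes> y"]] x y by simp
  also have "\<dots> = Asc \<one> x y \<bullet> ((Ru \<one> \<odot> Id x) \<odot> Id y)"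
    using Asc_natural[of "Ru \<one>" "Id x" "Id y"] x y by simp
  also have "\<dots> = Asc \<one> x y \<bullet> ((Id \<one> \<odot> Lu x) \<odot> Id y) \<bullet> (Asc \<one> \<one> x \<odot> Id y)"
    using x y by (simp add: interchange triangle)
  also have "\<dots> = (Id \<one> \<odot> (Lu x \<odot> Id y)) \<bullet> ?p"
    using tail[OF Asc_natural[of "Id \<one>" "Lu x" "Id y"]] x y by (simp add: cmp_assoc)
  finally have eq: "(Id \<one> \<odot> (Lu (x \<otimes> y) \<bullet> Asc \<one> x y)) \<bullet> ?p = (Id \<one> \<odot> (Lu x \<odot> Id y)) \<bullet> ?p"
    using x y by (simp add: interchange')
  have "epic K ?p"
    using x y invs_epic[OF invs_Asc[of \<one> "\<one> \<otimes> x" y]]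
      invs_epic[OF invs_ten[OF invs_Asc[of \<one> \<one> x], of "Id y" "Id y"]]
    by (intro epic_cmp) (simp_all add: invs_def)
  from epicD[OF this eq] show "Id \<one> \<odot> (Lu (x \<otimes> y) \<bullet> Asc \<one> x y) = Id \<one> \<odot> (Lu x \<odot> Id y)"
    using x y by simp
qed (use x y in simp_all)

lemma Ru_ten:
  assumes x: "x \<in> obj K" and y: "y \<in> obj K"
  shows "(Id x \<odot> Ru y) \<bullet> Asc x y \<one> = Ru (x \<otimes> y)"
proof (rule ten_Id_one_cancel)
  have "Asc x y \<one> \<bullet> ((Id x \<odot> Ru y) \<odot> Id \<one>) \<bullet> (Asc x y \<one> \<odot> Id \<one>)
      = (Id x \<odot> (Ru y \<odot> Id \<one>)) \<bullet> Asc x (y \<otimes> \<one>) \<one> \<bullet> (Asc x y \<one> \<odot> Id \<one>)"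
    using tail[OF Asc_natural[of "Id x" "Ru y" "Id \<one>"]] x y by (simp add: cmp_assoc)
  also have "\<dots> = (Id x \<odot> (Id y \<odot> Lu \<one>)) \<bullet> (Id x \<odot> Asc y \<one> \<one>) \<bullet> Asc x (y \<otimes> \<one>) \<one> \<bullet> (Asc x y \<one> \<odot> Id \<one>)"
    using x y by (simp add: merge triangle)
  also have "\<dots> = (Id x \<odot> (Id y \<odot> Lu \<one>)) \<bullet> Asc x y (\<one> \<otimes> \<one>) \<bullet> Asc (x \<otimes> y) \<one> \<one>"
    using pentagon[of x y \<one> \<one>] x y by simp
  also have "\<dots> = Asc x y \<one> \<bullet> (Id (x \<otimes> y) \<odot> Lu \<one>) \<bullet> Asc (x \<otimes> y) \<one> \<one>"
    using tail[OF Asc_natural[of "Id x" "Id y" "Lu \<one>"]] x y by (simp add: cmp_assoc)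
  also have "\<dots> = Asc x y \<one> \<bullet> (Ru (x \<otimes> y) \<odot> Id \<one>)"
    using triangle[of "x \<otimes> y" \<one>] x y by simp
  finally have eq: "Asc x y \<one> \<bullet> (((Id x \<odot> Ru y) \<bullet> Asc x y \<one>) \<odot> Id \<one>) = Asc x y \<one> \<bullet> (Ru (x \<otimes> y) \<odot> Id \<one>)"
    using x y by (simp add: interchange)
  from monicD[OF invs_monic[OF invs_Asc] eq] show "((Id x \<odot> Ru y) \<bullet> Asc x y \<one>) \<odot> Id \<one> = Ru (x \<otimes> y) \<odot> Id \<one>"
    using x y by simp
qed (use x y in simp_all)

lemma Lu_one_Ru_one: "Lu \<one> = Ru \<one>"
proof (rule ten_Id_one_cancel)
  have "Lu \<one> \<bullet> Lu (\<one> \<otimes> \<one>) = Lu \<one> \<bullet> (Id \<one> \<odot> Lu \<one>)"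
    using Lu_natural[of "Lu \<one>"] by simp
  from monicD[OF invs_monic[OF invs_Lu] this] have "Lu (\<one> \<otimes> \<one>) = Id \<one> \<odot> Lu \<one>"
    by simp
  then show "Lu \<one> \<odot> Id \<one> = Ru \<one> \<odot> Id \<one>"
    using Lu_ten[of \<one> \<one>] triangle[of \<one> \<one>] by simp
qed simp_all

end

section \<open>Monoids, comonoids and structure maps\<close>

text \<open>A mixed bimodule together with its left and right base, as a \<open>1\<close>-cell between its bases.\<close>

datatype ('o, 'a) cell = Cell (lb: "('o, 'a) comon") (md: "('o, 'a) bi") (rb: "('o, 'a) comon")

context monoidal_cat
begin

lemma eq_iff_raw: "arr K f \<Longrightarrow> arr K g \<Longrightarrow> src f = src g \<Longrightarrow> tgt f = tgt g \<Longrightarrow> f = g \<longleftrightarrow> raw f = raw g"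
  using tarr_eqI[of K f g] by blast

abbreviation isM :: "('o, 'a) comon \<Rightarrow> bool" where "isM X \<equiv> is_Monoid X"

definition bases :: "('o, 'a) comon set" where
  "bases = obj (Mon K) \<union> obj (Comon K)"

definition mu :: "('o, 'a) comon \<Rightarrow> ('o, 'a) tarr" where
  "mu X = (if isM X then Arr (und X \<otimes> und X) (mlt X) (und X) else Arr (und X) (mlt X) (und X \<otimes> und X))"

definition un :: "('o, 'a) comon \<Rightarrow> ('o, 'a) tarr" where
  "un X = (if isM X then Arr \<one> (unt X) (und X) else Arr (und X) (unt X) \<one>)"

lemma Mon_iff: "X \<in> obj (Mon K) \<longleftrightarrow> X \<in> bases \<and> isM X"
  and Comon_iff: "X \<in> obj (Comon K) \<longleftrightarrow> X \<in> bases \<and> \<not> isM X"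
  by (auto simp: bases_def Mon_def Comon_def)

lemma src_mu [simp]: "src (mu X) = (if isM X then und X \<otimes> und X else und X)"
  and tgt_mu [simp]: "tgt (mu X) = (if isM X then und X else und X \<otimes> und X)"
  and raw_mu [simp]: "raw (mu X) = mlt X"
  and src_un [simp]: "src (un X) = (if isM X then \<one> else und X)"
  and tgt_un [simp]: "tgt (un X) = (if isM X then und X else \<one>)"
  and raw_un [simp]: "raw (un X) = unt X"
  by (simp_all add: mu_def un_def)

lemma base_ob [simp]: "X \<in> bases \<Longrightarrow> und X \<in> obj K"
  and arr_mu [simp]: "X \<in> bases \<Longrightarrow> arr K (mu X)"
  and arr_un [simp]: "X \<in> bases \<Longrightarrow> arr K (un X)"
  by (auto simp: bases_def Mon_def Comon_def mu_def un_def)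

lemma monoid_laws:
  assumes "X \<in> bases" "isM X"
  shows "mu X \<bullet> (mu X \<odot> Id (und X)) = mu X \<bullet> (Id (und X) \<odot> mu X) \<bullet> Asc (und X) (und X) (und X)"
    "mu X \<bullet> (un X \<odot> Id (und X)) = Lu (und X)"
    "mu X \<bullet> (Id (und X) \<odot> un X) = Ru (und X)"
proof -
  note [simp] = base_ob[OF assms(1)] arr_mu[OF assms(1)] arr_un[OF assms(1)]
  have "X \<in> obj (Mon K)" using assms by (simp add: Mon_iff)
  then show "mu X \<bullet> (mu X \<odot> Id (und X)) = mu X \<bullet> (Id (und X) \<odot> mu X) \<bullet> Asc (und X) (und X) (und X)"
    "mu X \<bullet> (un X \<odot> Id (und X)) = Lu (und X)"
    "mu X \<bullet> (Id (und X) \<odot> un X) = Ru (und X)"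
    using assms(2) by (auto simp: eq_iff_raw Mon_def)
qed

lemma comonoid_laws:
  assumes "X \<in> bases" "\<not> isM X"
  shows "Asc (und X) (und X) (und X) \<bullet> (mu X \<odot> Id (und X)) \<bullet> mu X = (Id (und X) \<odot> mu X) \<bullet> mu X"
    "Lu (und X) \<bullet> (un X \<odot> Id (und X)) \<bullet> mu X = Id (und X)"
    "Ru (und X) \<bullet> (Id (und X) \<odot> un X) \<bullet> mu X = Id (und X)"
proof -
  note [simp] = base_ob[OF assms(1)] arr_mu[OF assms(1)] arr_un[OF assms(1)]
  have "X \<in> obj (Comon K)" using assms by (simp add: Comon_iff)
  then show "Asc (und X) (und X) (und X) \<bullet> (mu X \<odot> Id (und X)) \<bullet> mu X = (Id (und X) \<odot> mu X) \<bullet> mu X"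
    "Lu (und X) \<bullet> (un X \<odot> Id (und X)) \<bullet> mu X = Id (und X)"
    "Ru (und X) \<bullet> (Id (und X) \<odot> un X) \<bullet> mu X = Id (und X)"
    using assms(2) by (auto simp: eq_iff_raw Comon_def)
qed

text \<open>The following predicates treat actions and coactions uniformly.  \<open>lty\<close> and \<open>rty\<close> give the source and
target of a structure map, \<open>leq\<close> and \<open>req\<close> express that \<open>f\<close> is equivariant for structure maps on its
source and target.\<close>

definition lty :: "('o, 'a) comon \<Rightarrow> 'o \<Rightarrow> ('o, 'a) tarr \<Rightarrow> bool" where
  "lty X m l \<longleftrightarrow> arr K l \<and> und X \<in> obj K \<and> m \<in> obj K \<and>
    src l = (if isM X then und X \<otimes> m else m) \<and> tgt l = (if isM X then m else und X \<otimes> m)"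

definition rty :: "('o, 'a) comon \<Rightarrow> 'o \<Rightarrow> ('o, 'a) tarr \<Rightarrow> bool" where
  "rty Y m r \<longleftrightarrow> arr K r \<and> und Y \<in> obj K \<and> m \<in> obj K \<and>
    src r = (if isM Y then m \<otimes> und Y else m) \<and> tgt r = (if isM Y then m else m \<otimes> und Y)"

definition leq :: "('o, 'a) comon \<Rightarrow> ('o, 'a) tarr \<Rightarrow> ('o, 'a) tarr \<Rightarrow> ('o, 'a) tarr \<Rightarrow> bool" where
  "leq X l l' f \<longleftrightarrow> arr K f \<and> lty X (src f) l \<and> lty X (tgt f) l' \<and>
    (if isM X then f \<bullet> l = l' \<bullet> (Id (und X) \<odot> f) else l' \<bullet> f = (Id (und X) \<odot> f) \<bullet> l)"

definition req :: "('o, 'a) comon \<Rightarrow> ('o, 'a) tarr \<Rightarrow> ('o, 'a) tarr \<Rightarrow> ('o, 'a) tarr \<Rightarrow> bool" where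
  "req Y r r' f \<longleftrightarrow> arr K f \<and> rty Y (src f) r \<and> rty Y (tgt f) r' \<and>
    (if isM Y then f \<bullet> r = r' \<bullet> (f \<odot> Id (und Y)) else r' \<bullet> f = (f \<odot> Id (und Y)) \<bullet> r)"

lemma leq_cmp:
  assumes "leq X l l' f" "leq X l' l'' g" "src g = tgt f"
  shows "leq X l l'' (g \<bullet> f)"
proof (cases "isM X")
  case True
  have f: "f \<bullet> l = l' \<bullet> (Id (und X) \<odot> f)" and g: "g \<bullet> l' = l'' \<bullet> (Id (und X) \<odot> g)"
    using assms True by (simp_all add: leq_def)
  show ?thesis
    using assms True by (auto simp: leq_def lty_def cmp_assoc merge f tail[OF g])
next
  case False
  have f: "l' \<bullet> f = (Id (und X) \<odot> f) \<bullet> l" and g: "l'' \<bullet> g = (Id (und X) \<odot> g) \<bullet> l'"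
    using assms False by (simp_all add: leq_def)
  show ?thesis
    using assms False by (auto simp: leq_def lty_def cmp_assoc merge f tail[OF g])
qed

lemma req_cmp:
  assumes "req Y r r' f" "req Y r' r'' g" "src g = tgt f"
  shows "req Y r r'' (g \<bullet> f)"
proof (cases "isM Y")
  case True
  have f: "f \<bullet> r = r' \<bullet> (f \<odot> Id (und Y))" and g: "g \<bullet> r' = r'' \<bullet> (g \<odot> Id (und Y))"
    using assms True by (simp_all add: req_def)
  show ?thesis
    using assms True by (auto simp: req_def rty_def cmp_assoc merge f tail[OF g])
next
  case False
  have f: "r' \<bullet> f = (f \<odot> Id (und Y)) \<bullet> r" and g: "r'' \<bullet> g = (g \<odot> Id (und Y)) \<bullet> r'"
    using assms False by (simp_all add: req_def)
  show ?thesis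
    using assms False by (auto simp: req_def rty_def cmp_assoc merge f tail[OF g])
qed

text \<open>Equivariance can be tested after an equivariant monomorphism, or before an equivariant
  epimorphism, that stays one when tensored with the acting object.\<close>

lemma leq_cancel_monic:
  assumes mf: "leq X l l'' (m \<bullet> f)" and m: "leq X l' l'' m" and mono: "monic K m" "monic K (Id (und X) \<odot> m)"
  shows "leq X l l' f"
proof -
  have f: "arr K f" "tgt f = src m"
    using mf by (auto simp: leq_def)
  have ty: "lty X (src f) l" "lty X (tgt f) l'" "lty X (tgt m) l''"
    using mf m f by (auto simp: leq_def)
  show ?thesis
  proof (cases "isM X")
    case True
    have "m \<bullet> (f \<bullet> l) = m \<bullet> (l' \<bullet> (Id (und X) \<odot> f))"
    proof -
      have "m \<bullet> (f \<bullet> l) = l'' \<bullet> (Id (und X) \<odot> (m \<bullet> f))"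
        using mf True by (simp add: leq_def cmp_assoc)
      also have "\<dots> = (l'' \<bullet> (Id (und X) \<odot> m)) \<bullet> (Id (und X) \<odot> f)"
        using f ty m True by (simp add: cmp_assoc interchange leq_def lty_def)
      also have "\<dots> = m \<bullet> (l' \<bullet> (Id (und X) \<odot> f))"
        using m True by (simp add: leq_def cmp_assoc[symmetric])
      finally show ?thesis .
    qed
    from monicD[OF mono(1) this] show ?thesis
      using f ty True by (simp add: leq_def lty_def)
  next
    case False
    have "(Id (und X) \<odot> m) \<bullet> (l' \<bullet> f) = (Id (und X) \<odot> m) \<bullet> ((Id (und X) \<odot> f) \<bullet> l)"
    proof -
      have "(Id (und X) \<odot> m) \<bullet> (l' \<bullet> f) = (l'' \<bullet> m) \<bullet> f"
        using m False by (simp add: leq_def cmp_assoc[symmetric])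
      also have "\<dots> = (Id (und X) \<odot> (m \<bullet> f)) \<bullet> l"
        using mf False by (simp add: leq_def cmp_assoc)
      also have "\<dots> = (Id (und X) \<odot> m) \<bullet> ((Id (und X) \<odot> f) \<bullet> l)"
        using f ty m False by (simp add: interchange' leq_def lty_def)
      finally show ?thesis .
    qed
    from monicD[OF mono(2) this] show ?thesis
      using f ty m False by (simp add: leq_def lty_def)
  qed
qed

lemma req_cancel_monic:
  assumes mf: "req Y r r'' (m \<bullet> f)" and m: "req Y r' r'' m" and mono: "monic K m" "monic K (m \<odot> Id (und Y))"
  shows "req Y r r' f"
proof -
  have f: "arr K f" "tgt f = src m"
    using mf by (auto simp: req_def)
  have ty: "rty Y (src f) r" "rty Y (tgt f) r'" "rty Y (tgt m) r''"
    using mf m f by (auto simp: req_def)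
  show ?thesis
  proof (cases "isM Y")
    case True
    have "m \<bullet> (f \<bullet> r) = m \<bullet> (r' \<bullet> (f \<odot> Id (und Y)))"
    proof -
      have "m \<bullet> (f \<bullet> r) = r'' \<bullet> ((m \<bullet> f) \<odot> Id (und Y))"
        using mf True by (simp add: req_def cmp_assoc)
      also have "\<dots> = (r'' \<bullet> (m \<odot> Id (und Y))) \<bullet> (f \<odot> Id (und Y))"
        using f ty m True by (simp add: cmp_assoc interchange req_def rty_def)
      also have "\<dots> = m \<bullet> (r' \<bullet> (f \<odot> Id (und Y)))"
        using m True by (simp add: req_def cmp_assoc[symmetric])
      finally show ?thesis .
    qed
    from monicD[OF mono(1) this] show ?thesis
      using f ty True by (simp add: req_def rty_def)
  next
    case False
    have "(m \<odot> Id (und Y)) \<bullet> (r' \<bullet> f) = (m \<odot> Id (und Y)) \<bullet> ((f \<odot> Id (und Y)) \<bullet> r)"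
    proof -
      have "(m \<odot> Id (und Y)) \<bullet> (r' \<bullet> f) = (r'' \<bullet> m) \<bullet> f"
        using m False by (simp add: req_def cmp_assoc[symmetric])
      also have "\<dots> = ((m \<bullet> f) \<odot> Id (und Y)) \<bullet> r"
        using mf False by (simp add: req_def cmp_assoc)
      also have "\<dots> = (m \<odot> Id (und Y)) \<bullet> ((f \<odot> Id (und Y)) \<bullet> r)"
        using f ty m False by (simp add: interchange' req_def rty_def)
      finally show ?thesis .
    qed
    from monicD[OF mono(2) this] show ?thesis
      using f ty m False by (simp add: req_def rty_def)
  qed
qed

lemma leq_cancel_epic:
  assumes fe: "leq X l l'' (f \<bullet> e)" and e: "leq X l l' e" and ty'': "lty X (tgt f) l''"
    and epi: "epic K e" "epic K (Id (und X) \<odot> e)"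
  shows "leq X l' l'' f"
proof -
  have f: "arr K f" "src f = tgt e"
    using fe by (auto simp: leq_def)
  have ty: "lty X (src e) l" "lty X (src f) l'"
    using e f by (auto simp: leq_def)
  show ?thesis
  proof (cases "isM X")
    case True
    have "(f \<bullet> l') \<bullet> (Id (und X) \<odot> e) = (l'' \<bullet> (Id (und X) \<odot> f)) \<bullet> (Id (und X) \<odot> e)"
    proof -
      have "(f \<bullet> l') \<bullet> (Id (und X) \<odot> e) = (f \<bullet> e) \<bullet> l"
        using e True by (simp add: leq_def cmp_assoc)
      also have "\<dots> = (l'' \<bullet> (Id (und X) \<odot> f)) \<bullet> (Id (und X) \<odot> e)"
        using fe f e ty True by (simp add: leq_def cmp_assoc interchange lty_def)
      finally show ?thesis .
    qed
    from epicD[OF epi(2) this] show ?thesis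
      using f ty ty'' e True by (simp add: leq_def lty_def)
  next
    case False
    have "(l'' \<bullet> f) \<bullet> e = ((Id (und X) \<odot> f) \<bullet> l') \<bullet> e"
    proof -
      have "(l'' \<bullet> f) \<bullet> e = (Id (und X) \<odot> f) \<bullet> ((Id (und X) \<odot> e) \<bullet> l)"
        using fe f e ty False by (simp add: leq_def cmp_assoc interchange' lty_def)
      also have "\<dots> = ((Id (und X) \<odot> f) \<bullet> l') \<bullet> e"
        using e False by (simp add: leq_def cmp_assoc)
      finally show ?thesis .
    qed
    from epicD[OF epi(1) this] show ?thesis
      using f ty ty'' e False by (simp add: leq_def lty_def)
  qed
qed

lemma req_cancel_epic:
  assumes fe: "req Y r r'' (f \<bullet> e)" and e: "req Y r r' e" and ty'': "rty Y (tgt f) r''"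
    and epi: "epic K e" "epic K (e \<odot> Id (und Y))"
  shows "req Y r' r'' f"
proof -
  have f: "arr K f" "src f = tgt e"
    using fe by (auto simp: req_def)
  have ty: "rty Y (src e) r" "rty Y (src f) r'"
    using e f by (auto simp: req_def)
  show ?thesis
  proof (cases "isM Y")
    case True
    have "(f \<bullet> r') \<bullet> (e \<odot> Id (und Y)) = (r'' \<bullet> (f \<odot> Id (und Y))) \<bullet> (e \<odot> Id (und Y))"
    proof -
      have "(f \<bullet> r') \<bullet> (e \<odot> Id (und Y)) = (f \<bullet> e) \<bullet> r"
        using e True by (simp add: req_def cmp_assoc)
      also have "\<dots> = (r'' \<bullet> (f \<odot> Id (und Y))) \<bullet> (e \<odot> Id (und Y))"
        using fe f e ty True by (simp add: req_def cmp_assoc interchange rty_def)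
      finally show ?thesis .
    qed
    from epicD[OF epi(2) this] show ?thesis
      using f ty ty'' e True by (simp add: req_def rty_def)
  next
    case False
    have "(r'' \<bullet> f) \<bullet> e = ((f \<odot> Id (und Y)) \<bullet> r') \<bullet> e"
    proof -
      have "(r'' \<bullet> f) \<bullet> e = (f \<odot> Id (und Y)) \<bullet> ((e \<odot> Id (und Y)) \<bullet> r)"
        using fe f e ty False by (simp add: req_def cmp_assoc interchange' rty_def)
      also have "\<dots> = ((f \<odot> Id (und Y)) \<bullet> r') \<bullet> e"
        using e False by (simp add: req_def cmp_assoc)
      finally show ?thesis .
    qed
    from epicD[OF epi(1) this] show ?thesis
      using f ty ty'' e False by (simp add: req_def rty_def)
  qed
qed

text \<open>The structures that \<open>m \<otimes> n\<close> inherits from a left structure on \<open>m\<close> and a right structure on \<open>n\<close>.\<close>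

definition ltens :: "('o, 'a) comon \<Rightarrow> ('o, 'a) tarr \<Rightarrow> 'o \<Rightarrow> 'o \<Rightarrow> ('o, 'a) tarr" where
  "ltens X l m n = (if isM X then (l \<odot> Id n) \<bullet> Asi (und X) m n else Asc (und X) m n \<bullet> (l \<odot> Id n))"

definition rtens :: "('o, 'a) comon \<Rightarrow> ('o, 'a) tarr \<Rightarrow> 'o \<Rightarrow> 'o \<Rightarrow> ('o, 'a) tarr" where
  "rtens Y r m n = (if isM Y then (Id m \<odot> r) \<bullet> Asc m n (und Y) else Asi m n (und Y) \<bullet> (Id m \<odot> r))"

lemma lty_ltens [simp]: "lty X m l \<Longrightarrow> n \<in> obj K \<Longrightarrow> lty X (m \<otimes> n) (ltens X l m n)"
  by (auto simp: lty_def ltens_def)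

lemma rty_rtens [simp]: "rty Y n r \<Longrightarrow> m \<in> obj K \<Longrightarrow> rty Y (m \<otimes> n) (rtens Y r m n)"
  by (auto simp: rty_def rtens_def)

definition lstruct :: "('o, 'a) comon \<Rightarrow> 'o \<Rightarrow> ('o, 'a) tarr \<Rightarrow> bool" where
  "lstruct X m l \<longleftrightarrow> lty X m l \<and>
    (if isM X then l \<bullet> (mu X \<odot> Id m) = l \<bullet> (Id (und X) \<odot> l) \<bullet> Asc (und X) (und X) m \<and> l \<bullet> (un X \<odot> Id m) = Lu m
     else Asc (und X) (und X) m \<bullet> (mu X \<odot> Id m) \<bullet> l = (Id (und X) \<odot> l) \<bullet> l \<and> Lu m \<bullet> (un X \<odot> Id m) \<bullet> l = Id m)"

definition rstruct :: "('o, 'a) comon \<Rightarrow> 'o \<Rightarrow> ('o, 'a) tarr \<Rightarrow> bool" where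
  "rstruct Y m r \<longleftrightarrow> rty Y m r \<and>
    (if isM Y then r \<bullet> (r \<odot> Id (und Y)) = r \<bullet> (Id m \<odot> mu Y) \<bullet> Asc m (und Y) (und Y) \<and> r \<bullet> (Id m \<odot> un Y) = Ru m
     else Asc m (und Y) (und Y) \<bullet> (r \<odot> Id (und Y)) \<bullet> r = (Id m \<odot> mu Y) \<bullet> r \<and> Ru m \<bullet> (Id m \<odot> un Y) \<bullet> r = Id m)"

text \<open>Two structures commute when the left structure map is equivariant for the right structure.  By
\<open>commuting_left\<close> the right structure map is then equivariant for the left structure as well.\<close>

definition commuting :: "('o, 'a) comon \<Rightarrow> ('o, 'a) comon \<Rightarrow> 'o \<Rightarrow> ('o, 'a) tarr \<Rightarrow> ('o, 'a) tarr \<Rightarrow> bool" where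
  "commuting X Y m l r \<longleftrightarrow>
    (if isM X then req Y (rtens Y r (und X) m) r l else req Y r (rtens Y r (und X) m) l)"

lemma commuting_left:
  assumes "commuting X Y m l r" "lty X m l" "rty Y m r"
  shows "if isM Y then leq X (ltens X l m (und Y)) l r else leq X l (ltens X l m (und Y)) r"
proof -
  have ob: "m \<in> obj K" "und X \<in> obj K" "und Y \<in> obj K" "arr K l" "arr K r"
    using assms by (simp_all add: lty_def rty_def)
  have ty: "lty X (m \<otimes> und Y) (ltens X l m (und Y))" "lty X m l"
    using assms ob by simp_all
  show ?thesis
  proof (cases "isM X"; cases "isM Y")
    assume k: "isM X" "isM Y"
    have "l \<bullet> (Id (und X) \<odot> r) \<bullet> Asc (und X) m (und Y) = r \<bullet> (l \<odot> Id (und Y))"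
      using assms k by (simp add: commuting_def req_def rtens_def cmp_assoc)
    from tail3[OF this, of "Asi (und X) m (und Y)"]
    have "l \<bullet> (Id (und X) \<odot> r) = r \<bullet> (l \<odot> Id (und Y)) \<bullet> Asi (und X) m (und Y)"
      using assms ob k by (simp add: cmp_assoc lty_def rty_def)
    then show ?thesis
      using ty assms k ob by (simp add: leq_def rty_def ltens_def)
  next
    assume k: "isM X" "\<not> isM Y"
    have "r \<bullet> l = (l \<odot> Id (und Y)) \<bullet> Asi (und X) m (und Y) \<bullet> (Id (und X) \<odot> r)"
      using assms k by (simp add: commuting_def req_def rtens_def cmp_assoc)
    then show ?thesis
      using ty assms k ob by (simp add: leq_def rty_def ltens_def cmp_assoc)
  next
    assume k: "\<not> isM X" "isM Y"
    have "l \<bullet> r = (Id (und X) \<odot> r) \<bullet> Asc (und X) m (und Y) \<bullet> (l \<odot> Id (und Y))"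
      using assms k by (simp add: commuting_def req_def rtens_def cmp_assoc)
    then show ?thesis
      using ty assms k ob by (simp add: leq_def rty_def ltens_def cmp_assoc)
  next
    assume k: "\<not> isM X" "\<not> isM Y"
    have "Asc (und X) m (und Y) \<bullet> ((l \<odot> Id (und Y)) \<bullet> r)
        = Asc (und X) m (und Y) \<bullet> (Asi (und X) m (und Y) \<bullet> (Id (und X) \<odot> r)) \<bullet> l"
      using assms k by (simp add: commuting_def req_def rtens_def cmp_assoc)
    then have "Asc (und X) m (und Y) \<bullet> (l \<odot> Id (und Y)) \<bullet> r = (Id (und X) \<odot> r) \<bullet> l"
      using assms ob k by (simp add: cmp_assoc lty_def rty_def)
    then show ?thesis
      using ty assms k ob by (simp add: leq_def rty_def ltens_def cmp_assoc)
  qed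
qed

section \<open>The category of all mixed bimodules\<close>

text \<open>All categories \<open>Mix X Y\<close> at once.  Associativity and unit isomorphisms relate bimodules over many
different pairs of bases; inside one category, equations between them need no reference to the
individual \<open>Mix X Y\<close>.\<close>

definition V :: "(('o, 'a) cell, 'a) category" where
  "V = \<lparr> obj = {c. lb c \<in> bases \<and> rb c \<in> bases \<and> md c \<in> obj (Mix K (lb c) (rb c))},
     hom = (\<lambda>c d. if lb c = lb d \<and> rb c = rb d then hom (Mix K (lb c) (rb c)) (md c) (md d) else {}),
     ident = (\<lambda>c. ident K (carr (md c))),
     comp = comp K \<rparr>"

abbreviation car :: "('o, 'a) cell \<Rightarrow> 'o" where "car c \<equiv> carr (md c)"

definition la :: "('o, 'a) cell \<Rightarrow> ('o, 'a) tarr" where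
  "la c = (if isM (lb c) then Arr (und (lb c) \<otimes> car c) (lact (md c)) (car c)
     else Arr (car c) (lact (md c)) (und (lb c) \<otimes> car c))"

definition ra :: "('o, 'a) cell \<Rightarrow> ('o, 'a) tarr" where
  "ra c = (if isM (rb c) then Arr (car c \<otimes> und (rb c)) (ract (md c)) (car c)
     else Arr (car c) (ract (md c)) (car c \<otimes> und (rb c)))"

text \<open>The forgetful functor from bimodules to the ambient category, on arrows.\<close>

definition U :: "(('o, 'a) cell, 'a) tarr \<Rightarrow> ('o, 'a) tarr" where
  "U t = Arr (car (src t)) (raw t) (car (tgt t))"

lemma src_U [simp]: "src (U t) = car (src t)" and tgt_U [simp]: "tgt (U t) = car (tgt t)" and raw_U [simp]: "raw (U t) = raw t"
  by (simp_all add: U_def)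

lemma raw_la [simp]: "raw (la c) = lact (md c)" and raw_ra [simp]: "raw (ra c) = ract (md c)"
  by (simp_all add: la_def ra_def)

lemma src_la [simp]: "src (la c) = (if isM (lb c) then und (lb c) \<otimes> car c else car c)"
  and tgt_la [simp]: "tgt (la c) = (if isM (lb c) then car c else und (lb c) \<otimes> car c)"
  and src_ra [simp]: "src (ra c) = (if isM (rb c) then car c \<otimes> und (rb c) else car c)"
  and tgt_ra [simp]: "tgt (ra c) = (if isM (rb c) then car c else car c \<otimes> und (rb c))"
  by (simp_all add: la_def ra_def)

text \<open>The case distinctions on the constructor of a (co)monoid in the concepts of bimodule theory, as
conditionals on \<open>isM\<close>.\<close>

lemma kind_unfold:
  "left_structure K X m l \<longleftrightarrow> l \<in> lact_hom K X m \<and> (if isM X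
    then l \<cdot> (mlt X \<boxtimes> ident K m) = l \<cdot> (ident K (und X) \<boxtimes> l) \<cdot> asc K (und X) (und X) m \<and>
      l \<cdot> (unt X \<boxtimes> ident K m) = lun K m
    else asc K (und X) (und X) m \<cdot> (mlt X \<boxtimes> ident K m) \<cdot> l = (ident K (und X) \<boxtimes> l) \<cdot> l \<and>
      lun K m \<cdot> (unt X \<boxtimes> ident K m) \<cdot> l = ident K m)"
  "right_structure K Y m r \<longleftrightarrow> r \<in> ract_hom K Y m \<and> (if isM Y
    then r \<cdot> (r \<boxtimes> ident K (und Y)) = r \<cdot> (ident K m \<boxtimes> mlt Y) \<cdot> asc K m (und Y) (und Y) \<and>
      r \<cdot> (ident K m \<boxtimes> unt Y) = run K m
    else asc K m (und Y) (und Y) \<cdot> (r \<boxtimes> ident K (und Y)) \<cdot> r = (ident K m \<boxtimes> mlt Y) \<cdot> r \<and>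
      run K m \<cdot> (ident K m \<boxtimes> unt Y) \<cdot> r = ident K m)"
  "structures_commute K X Y m l r \<longleftrightarrow> (if isM X
    then if isM Y then r \<cdot> (l \<boxtimes> ident K (und Y)) = l \<cdot> (ident K (und X) \<boxtimes> r) \<cdot> asc K (und X) m (und Y)
      else r \<cdot> l = (l \<boxtimes> ident K (und Y)) \<cdot> asci K (und X) m (und Y) \<cdot> (ident K (und X) \<boxtimes> r)
    else if isM Y then l \<cdot> r = (ident K (und X) \<boxtimes> r) \<cdot> asc K (und X) m (und Y) \<cdot> (l \<boxtimes> ident K (und Y))
      else asc K (und X) m (und Y) \<cdot> (l \<boxtimes> ident K (und Y)) \<cdot> r = (ident K (und X) \<boxtimes> r) \<cdot> l)"
  "left_equivariant K X l l' f \<longleftrightarrow>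
    (if isM X then f \<cdot> l = l' \<cdot> (ident K (und X) \<boxtimes> f) else l' \<cdot> f = (ident K (und X) \<boxtimes> f) \<cdot> l)"
  "right_equivariant K Y r r' f \<longleftrightarrow>
    (if isM Y then f \<cdot> r = r' \<cdot> (f \<boxtimes> ident K (und Y)) else r' \<cdot> f = (f \<boxtimes> ident K (und Y)) \<cdot> r)"
  "l \<in> lact_hom K X m \<longleftrightarrow> (if isM X then l \<in> hom K (und X \<otimes> m) m else l \<in> hom K m (und X \<otimes> m))"
  "r \<in> ract_hom K Y m \<longleftrightarrow> (if isM Y then r \<in> hom K (m \<otimes> und Y) m else r \<in> hom K m (m \<otimes> und Y))"
  by (cases X; cases Y; simp add: left_structure_def right_structure_def structures_commute_def
      left_equivariant_def right_equivariant_def lact_hom_def ract_hom_def)+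

lemma left_structure_iff:
  assumes "X \<in> bases" "m \<in> obj K" "l = raw l'" "src l' = (if isM X then und X \<otimes> m else m)"
    "tgt l' = (if isM X then m else und X \<otimes> m)" "l' \<noteq> Null"
  shows "left_structure K X m l \<longleftrightarrow> lstruct X m l'"
proof -
  have a: "l \<in> lact_hom K X m \<longleftrightarrow> arr K l'"
    using assms(2-6) base_ob[OF assms(1)] by (cases X) (simp_all add: lact_hom_def arr_def)
  have b: "lty X m l' \<longleftrightarrow> arr K l'"
    using assms(2-6) base_ob[OF assms(1)] by (auto simp: lty_def)
  show ?thesis
  proof (cases "arr K l'")
    case True
    note [simp] = base_ob[OF assms(1)] arr_mu[OF assms(1)] arr_un[OF assms(1)] assms(2) True
    have a': "l \<in> lact_hom K X m" "lty X m l'"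
      using a b True by simp_all
    show ?thesis
      using assms(3-5) unfolding kind_unfold(1) lstruct_def
      by (cases "isM X") (use a' in \<open>simp_all add: eq_iff_raw\<close>)
  next
    case False
    then have "l \<notin> lact_hom K X m" "\<not> lty X m l'"
      using a b by simp_all
    then show ?thesis unfolding kind_unfold(1) lstruct_def by simp
  qed
qed

lemma right_structure_iff:
  assumes "X \<in> bases" "m \<in> obj K" "r = raw r'" "src r' = (if isM X then m \<otimes> und X else m)"
    "tgt r' = (if isM X then m else m \<otimes> und X)" "r' \<noteq> Null"
  shows "right_structure K X m r \<longleftrightarrow> rstruct X m r'"
proof -
  have a: "r \<in> ract_hom K X m \<longleftrightarrow> arr K r'"
    using assms(2-6) base_ob[OF assms(1)] by (cases X) (simp_all add: ract_hom_def arr_def)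
  have b: "rty X m r' \<longleftrightarrow> arr K r'"
    using assms(2-6) base_ob[OF assms(1)] by (auto simp: rty_def)
  show ?thesis
  proof (cases "arr K r'")
    case True
    note [simp] = base_ob[OF assms(1)] arr_mu[OF assms(1)] arr_un[OF assms(1)] assms(2) True
    have a': "r \<in> ract_hom K X m" "rty X m r'"
      using a b True by simp_all
    show ?thesis
      using assms(3-5) unfolding kind_unfold(2) rstruct_def
      by (cases "isM X") (use a' in \<open>simp_all add: eq_iff_raw\<close>)
  next
    case False
    then have "r \<notin> ract_hom K X m" "\<not> rty X m r'"
      using a b by simp_all
    then show ?thesis unfolding kind_unfold(2) rstruct_def by simp
  qed
qed

lemma structures_commute_iff:
  assumes "lty X m l" "rty Y m r"
  shows "structures_commute K X Y m (raw l) (raw r) \<longleftrightarrow> commuting X Y m l r"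
proof -
  have ob [simp]: "m \<in> obj K" "und X \<in> obj K" "und Y \<in> obj K" "arr K l" "arr K r"
    using assms by (simp_all add: lty_def rty_def)
  have ty: "rty Y (und X \<otimes> m) (rtens Y r (und X) m)"
    using assms by simp
  show ?thesis
  proof (cases "isM X"; cases "isM Y")
    assume k: "isM X" "isM Y"
    have s: "src l = und X \<otimes> m" "tgt l = m" "src r = m \<otimes> und Y" "tgt r = m"
      using assms k by (simp_all add: lty_def rty_def)
    have "commuting X Y m l r \<longleftrightarrow> r \<bullet> (l \<odot> Id (und Y)) = l \<bullet> (Id (und X) \<odot> r) \<bullet> Asc (und X) m (und Y)"
      using k assms ty s by (auto simp: commuting_def req_def rtens_def)
    then show ?thesis
      using k s by (simp add: kind_unfold(3) eq_iff_raw)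
  next
    assume k: "isM X" "\<not> isM Y"
    have s: "src l = und X \<otimes> m" "tgt l = m" "src r = m" "tgt r = m \<otimes> und Y"
      using assms k by (simp_all add: lty_def rty_def)
    have "commuting X Y m l r \<longleftrightarrow> r \<bullet> l = (l \<odot> Id (und Y)) \<bullet> Asi (und X) m (und Y) \<bullet> (Id (und X) \<odot> r)"
      using k assms ty s by (auto simp: commuting_def req_def rtens_def)
    then show ?thesis
      using k s by (simp add: kind_unfold(3) eq_iff_raw)
  next
    assume k: "\<not> isM X" "isM Y"
    have s: "src l = m" "tgt l = und X \<otimes> m" "src r = m \<otimes> und Y" "tgt r = m"
      using assms k by (simp_all add: lty_def rty_def)
    have "commuting X Y m l r \<longleftrightarrow> l \<bullet> r = (Id (und X) \<odot> r) \<bullet> Asc (und X) m (und Y) \<bullet> (l \<odot> Id (und Y))"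
      using k assms ty s by (auto simp: commuting_def req_def rtens_def cmp_assoc)
    then show ?thesis
      using k s by (simp add: kind_unfold(3) eq_iff_raw)
  next
    assume k: "\<not> isM X" "\<not> isM Y"
    have s: "src l = m" "tgt l = und X \<otimes> m" "src r = m" "tgt r = m \<otimes> und Y"
      using assms k by (simp_all add: lty_def rty_def)
    have "commuting X Y m l r \<longleftrightarrow> Asi (und X) m (und Y) \<bullet> (Id (und X) \<odot> r) \<bullet> l = (l \<odot> Id (und Y)) \<bullet> r"
      using k assms ty s by (auto simp: commuting_def req_def rtens_def cmp_assoc)
    also have "\<dots> \<longleftrightarrow> (Id (und X) \<odot> r) \<bullet> l = Asc (und X) m (und Y) \<bullet> (l \<odot> Id (und Y)) \<bullet> r"
    proof
      assume *: "Asi (und X) m (und Y) \<bullet> (Id (und X) \<odot> r) \<bullet> l = (l \<odot> Id (und Y)) \<bullet> r"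
      show "(Id (und X) \<odot> r) \<bullet> l = Asc (und X) m (und Y) \<bullet> (l \<odot> Id (und Y)) \<bullet> r"
        unfolding *[symmetric] using s by simp
    next
      assume *: "(Id (und X) \<odot> r) \<bullet> l = Asc (und X) m (und Y) \<bullet> (l \<odot> Id (und Y)) \<bullet> r"
      show "Asi (und X) m (und Y) \<bullet> (Id (und X) \<odot> r) \<bullet> l = (l \<odot> Id (und Y)) \<bullet> r"
        unfolding * using s by simp
    qed
    finally show ?thesis
      using k s by (auto simp: kind_unfold(3) eq_iff_raw)
  qed
qed

text \<open>A mixed bimodule, expressed by equations between arrows that know their source and target, in place
of membership in hom-sets.\<close>

lemma cell_iff:
  "c \<in> obj V \<longleftrightarrow> lb c \<in> bases \<and> rb c \<in> bases \<and> car c \<in> obj K \<and>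
    lstruct (lb c) (car c) (la c) \<and> rstruct (rb c) (car c) (ra c) \<and> commuting (lb c) (rb c) (car c) (la c) (ra c)"
proof -
  have nn: "la c \<noteq> Null" "ra c \<noteq> Null"
    by (simp_all add: la_def ra_def)
  show ?thesis
    using left_structure_iff[of "lb c" "car c" "lact (md c)" "la c"]
      right_structure_iff[of "rb c" "car c" "ract (md c)" "ra c"] nn
      structures_commute_iff[of "lb c" "car c" "la c" "rb c" "ra c"]
    by (auto simp: V_def Mix_def lstruct_def rstruct_def)
qed

lemma cell_base [simp]: "c \<in> obj V \<Longrightarrow> lb c \<in> bases" "c \<in> obj V \<Longrightarrow> rb c \<in> bases" "c \<in> obj V \<Longrightarrow> car c \<in> obj K"
  and cell_lstruct: "c \<in> obj V \<Longrightarrow> lstruct (lb c) (car c) (la c)"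
  and cell_rstruct: "c \<in> obj V \<Longrightarrow> rstruct (rb c) (car c) (ra c)"
  and cell_commuting: "c \<in> obj V \<Longrightarrow> commuting (lb c) (rb c) (car c) (la c) (ra c)"
  by (simp_all add: cell_iff)

lemma lty_la [simp]: "c \<in> obj V \<Longrightarrow> lty (lb c) (car c) (la c)" and rty_ra [simp]: "c \<in> obj V \<Longrightarrow> rty (rb c) (car c) (ra c)"
  using cell_lstruct[of c] cell_rstruct[of c] by (simp_all add: lstruct_def rstruct_def)

lemma arr_la [simp]: "c \<in> obj V \<Longrightarrow> arr K (la c)" and arr_ra [simp]: "c \<in> obj V \<Longrightarrow> arr K (ra c)"
  using lty_la[of c] rty_ra[of c] by (simp_all only: lty_def rty_def)

lemma la_req:
  "c \<in> obj V \<Longrightarrow> isM (lb c) \<Longrightarrow> req (rb c) (rtens (rb c) (ra c) (und (lb c)) (car c)) (ra c) (la c)"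
  "c \<in> obj V \<Longrightarrow> \<not> isM (lb c) \<Longrightarrow> req (rb c) (ra c) (rtens (rb c) (ra c) (und (lb c)) (car c)) (la c)"
  using cell_commuting[of c] by (simp_all add: commuting_def)

lemma ra_leq:
  "c \<in> obj V \<Longrightarrow> isM (rb c) \<Longrightarrow> leq (lb c) (ltens (lb c) (la c) (car c) (und (rb c))) (la c) (ra c)"
  "c \<in> obj V \<Longrightarrow> \<not> isM (rb c) \<Longrightarrow> leq (lb c) (la c) (ltens (lb c) (la c) (car c) (und (rb c))) (ra c)"
  using commuting_left[OF cell_commuting[of c]] by simp_all

lemma arr_V_iff:
  "arr V t \<longleftrightarrow> t \<noteq> Null \<and> src t \<in> obj V \<and> tgt t \<in> obj V \<and> lb (src t) = lb (tgt t) \<and> rb (src t) = rb (tgt t) \<and>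
    leq (lb (src t)) (la (src t)) (la (tgt t)) (U t) \<and> req (rb (src t)) (ra (src t)) (ra (tgt t)) (U t)"
proof -
  have hV: "raw t \<in> hom V (src t) (tgt t) \<longleftrightarrow> lb (src t) = lb (tgt t) \<and> rb (src t) = rb (tgt t) \<and>
      raw t \<in> hom K (car (src t)) (car (tgt t)) \<and>
      left_equivariant K (lb (src t)) (lact (md (src t))) (lact (md (tgt t))) (raw t) \<and>
      right_equivariant K (rb (src t)) (ract (md (src t))) (ract (md (tgt t))) (raw t)"
    unfolding V_def Mix_def by (simp only: category.simps mem_Collect_eq empty_iff if_split conj_assoc split: if_split) blast
  have hU: "arr K (U t) \<longleftrightarrow> car (src t) \<in> obj K \<and> car (tgt t) \<in> obj K \<and> raw t \<in> hom K (car (src t)) (car (tgt t))"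
    by (simp add: U_def)
  show ?thesis
  proof (cases "t \<noteq> Null \<and> src t \<in> obj V \<and> tgt t \<in> obj V \<and> lb (src t) = lb (tgt t) \<and> rb (src t) = rb (tgt t) \<and> arr K (U t)")
  case True
  then have t: "src t \<in> obj V" "tgt t \<in> obj V" "arr K (U t)" and e: "lb (tgt t) = lb (src t)" "rb (tgt t) = rb (src t)" by simp_all
  note ty = lty_la[OF t(1)] lty_la[OF t(2)] rty_ra[OF t(1)] rty_ra[OF t(2)]
  have l: "left_equivariant K (lb (src t)) (lact (md (src t))) (lact (md (tgt t))) (raw t)
      \<longleftrightarrow> leq (lb (src t)) (la (src t)) (la (tgt t)) (U t)"
    using t e ty by (auto simp: kind_unfold leq_def eq_iff_raw)
  have r: "right_equivariant K (rb (src t)) (ract (md (src t))) (ract (md (tgt t))) (raw t)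
      \<longleftrightarrow> req (rb (src t)) (ra (src t)) (ra (tgt t)) (U t)"
    using t e ty by (auto simp: kind_unfold req_def eq_iff_raw)
  show ?thesis
    using True hU l r unfolding arr_def[of V] hV by blast
next
  case False
  have "\<not> arr V t"
    using False hU cell_base(3)[of "src t"] cell_base(3)[of "tgt t"] unfolding arr_def[of V] hV by blast
  moreover have "leq (lb (src t)) (la (src t)) (la (tgt t)) (U t) \<Longrightarrow> arr K (U t)"
    by (simp add: leq_def)
  ultimately show ?thesis
    using False by blast
qed
qed

lemma arr_U [simp]: "arr V t \<Longrightarrow> arr K (U t)"
  unfolding arr_V_iff leq_def by blast

lemma arr_V_bases: "arr V t \<Longrightarrow> lb (tgt t) = lb (src t)" "arr V t \<Longrightarrow> rb (tgt t) = rb (src t)"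
  unfolding arr_V_iff by simp_all

lemma U_leq: "arr V t \<Longrightarrow> leq (lb (src t)) (la (src t)) (la (tgt t)) (U t)"
  and U_req: "arr V t \<Longrightarrow> req (rb (src t)) (ra (src t)) (ra (tgt t)) (U t)"
  unfolding arr_V_iff by blast+

lemma arr_VI:
  assumes "c \<in> obj V" "d \<in> obj V" "lb c = lb d" "rb c = rb d" "leq (lb c) (la c) (la d) f" "req (rb c) (ra c) (ra d) f"
    "src f = car c" "tgt f = car d"
  shows "arr V (Arr c (raw f) d)" "U (Arr c (raw f) d) = f"
proof -
  have f: "f \<noteq> Null"
    using assms(5) by (auto simp: leq_def)
  show "U (Arr c (raw f) d) = f"
    using assms(7,8) f by (cases f) (auto simp: U_def)
  then show "arr V (Arr c (raw f) d)"
    using assms(1-6) unfolding arr_V_iff by simp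
qed

lemma V_eqI:
  assumes "arr V s" "arr V t" "src s = src t" "tgt s = tgt t" "U s = U t"
  shows "s = t"
  using assms by (intro tarr_eqI[of V]) (auto simp: U_def)

end

locale twistable_cat = monoidal_cat +
  assumes equalizers: "has_equalizers K"
    and coequalizers: "has_coequalizers K"
    and twist: "twistable K"
begin

section \<open>Tensor and cotensor products of mixed bimodules\<close>

lemma induced_unique:
  assumes "X \<in> bases" "P \<in> bases" "Y \<in> bases" "M \<in> obj (Mix K X P)" "N \<in> obj (Mix K P Y)"
  shows "\<exists>!l. induced_lact K X P M N l" "\<exists>!r. induced_ract K Y P M N r"
proof -
  have "{X, P, Y} \<subseteq> obj (Mon K) \<union> obj (Comon K)"
    using assms(1-3) by (simp add: bases_def)
  from twist[unfolded twistable_def, THEN conjunct1, THEN spec, THEN spec, THEN spec, THEN mp, OF this]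
  show "\<exists>!l. induced_lact K X P M N l" "\<exists>!r. induced_ract K Y P M N r"
    using assms(4,5) by simp_all
qed

lemma mten_is_functor:
  assumes "X \<in> bases" "P \<in> bases" "Y \<in> bases"
  shows "is_functor (prod_cat (Mix K X P) (Mix K P Y)) (Mix K X Y) (mten_functor K X P Y)"
proof -
  have "{X, P, Y} \<subseteq> obj (Mon K) \<union> obj (Comon K)"
    using assms(1-3) by (simp add: bases_def)
  from twist[unfolded twistable_def, THEN conjunct1, THEN spec, THEN spec, THEN spec, THEN mp, OF this]
  show ?thesis by simp
qed

lemma associativity_exists:
  assumes "X \<in> bases" "P \<in> bases" "Q \<in> bases" "Y \<in> bases"
    "M \<in> obj (Mix K X P)" "N \<in> obj (Mix K P Q)" "R \<in> obj (Mix K Q Y)"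
  shows "\<exists>a. is_associativity K X P Q Y M N R a"
proof -
  have "{X, P, Q, Y} \<subseteq> obj (Mon K) \<union> obj (Comon K)"
    using assms(1-4) by (simp add: bases_def)
  from twist[unfolded twistable_def, THEN conjunct2, THEN spec, THEN spec, THEN spec, THEN spec, THEN mp, OF this]
  show ?thesis using assms(5-7) by simp
qed

lemma category_Mix: "X \<in> bases \<Longrightarrow> Y \<in> bases \<Longrightarrow> category (Mix K X Y)"
  using mten_is_functor[of X Y Y] by (simp add: is_functor_def)

lemma obj_V: "c \<in> obj V \<longleftrightarrow> lb c \<in> bases \<and> rb c \<in> bases \<and> md c \<in> obj (Mix K (lb c) (rb c))"
  and hom_V: "hom V c d = (if lb c = lb d \<and> rb c = rb d then hom (Mix K (lb c) (rb c)) (md c) (md d) else {})"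
  and comp_V [simp]: "comp V = comp K" and ident_V [simp]: "ident V c = ident K (car c)"
  and comp_Mix [simp]: "comp (Mix K X Y) = comp K" and ident_Mix [simp]: "ident (Mix K X Y) M = ident K (carr M)"
  unfolding V_def Mix_def by simp_all

lemma hom_Mix_K: "f \<in> hom (Mix K X Y) M N \<Longrightarrow> f \<in> hom K (carr M) (carr N)"
  by (simp add: Mix_def)

sublocale V: cat V
proof
  show "category V"
    unfolding category_def
  proof (intro conjI ballI)
    fix x assume x: "x \<in> obj V"
    then interpret M: cat "Mix K (lb x) (rb x)"
      using category_Mix by (simp add: cat_def)
    have "arr (Mix K (lb x) (rb x)) (idt (Mix K (lb x) (rb x)) (md x))"
      using x unfolding obj_V by simp
    then show "ident V x \<in> hom V x x"
      unfolding hom_V idt_def by simp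
  next
    fix x y z f g assume *: "x \<in> obj V" "y \<in> obj V" "z \<in> obj V" "f \<in> hom V x y" "g \<in> hom V y z"
    interpret M: cat "Mix K (lb x) (rb x)"
      using * category_Mix by (simp add: cat_def)
    show "g \<cdot>\<^bsub>V\<^esub> f \<in> hom V x z"
      using M.comp_hom[of "md x" "md y" "md z" f g] * unfolding obj_V hom_V by (simp split: if_splits)
  next
    fix x y f assume *: "x \<in> obj V" "y \<in> obj V" "f \<in> hom V x y"
    then have f: "f \<in> hom K (car x) (car y)"
      unfolding hom_V by (auto dest: hom_Mix_K split: if_splits)
    show "f \<cdot>\<^bsub>V\<^esub> ident V x = f" "ident V y \<cdot>\<^bsub>V\<^esub> f = f"
      using comp_ident[OF _ _ f] * by simp_all
  next
    fix w x y z f g h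
    assume *: "w \<in> obj V" "x \<in> obj V" "y \<in> obj V" "z \<in> obj V" "f \<in> hom V w x" "g \<in> hom V x y" "h \<in> hom V y z"
    then have "f \<in> hom K (car w) (car x)" "g \<in> hom K (car x) (car y)" "h \<in> hom K (car y) (car z)"
      unfolding hom_V by (auto dest: hom_Mix_K split: if_splits)
    from comp_assoc[OF _ _ _ _ this] show "(h \<cdot>\<^bsub>V\<^esub> g) \<cdot>\<^bsub>V\<^esub> f = h \<cdot>\<^bsub>V\<^esub> (g \<cdot>\<^bsub>V\<^esub> f)"
      using * by simp
  qed
qed

abbreviation cmp_V  (infixr "\<diamondop>" 70) where "g \<diamondop> f \<equiv> cmp V g f"

lemma U_cmp [simp]: "arr V g \<Longrightarrow> arr V f \<Longrightarrow> src g = tgt f \<Longrightarrow> U (g \<diamondop> f) = U g \<bullet> U f"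
  by (rule tarr_eqI[of K]) simp_all

lemma U_idt [simp]: "c \<in> obj V \<Longrightarrow> U (idt V c) = Id (car c)"
  by (rule tarr_eqI[of K]) simp_all

definition composable :: "('a, 'b) cell \<Rightarrow> ('a, 'b) cell \<Rightarrow> bool"  (infix "\<rhd>" 50) where
  "c \<rhd> d \<longleftrightarrow> c \<in> obj V \<and> d \<in> obj V \<and> rb c = lb d"

text \<open>The structure map of a (co)tensor product: the projection from \<open>car c \<otimes> car d\<close> over a monoid, the
inclusion into \<open>car c \<otimes> car d\<close> over a comonoid.\<close>

definition Q :: "('a, 'b) cell \<Rightarrow> ('a, 'b) cell \<Rightarrow> ('a, 'b) tarr" where
  "Q c d = (if isM (rb c)
     then Arr (car c \<otimes> car d) (bal_arr K (rb c) (md c) (md d)) (bal_obj K (rb c) (md c) (md d))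
     else Arr (bal_obj K (rb c) (md c) (md d)) (bal_arr K (rb c) (md c) (md d)) (car c \<otimes> car d))"

text \<open>Horizontal composition of \<open>1\<close>-cells, which is the (co)tensor product over the common base.\<close>

definition hob :: "('a, 'b) cell \<Rightarrow> ('a, 'b) cell \<Rightarrow> ('a, 'b) cell" where
  "hob c d = Cell (lb c) (mten K (lb c) (rb c) (rb d) (md c) (md d)) (rb d)"

lemma lb_hob [simp]: "lb (hob c d) = lb c" and rb_hob [simp]: "rb (hob c d) = rb d"
  and md_hob: "md (hob c d) = mten K (lb c) (rb c) (rb d) (md c) (md d)"
  and car_hob: "car (hob c d) = bal_obj K (rb c) (md c) (md d)"
  by (simp_all add: hob_def mten_def)

lemma composableD: "c \<rhd> d \<Longrightarrow> c \<in> obj V" "c \<rhd> d \<Longrightarrow> d \<in> obj V" "c \<rhd> d \<Longrightarrow> rb c = lb d"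
  by (simp_all add: composable_def)

lemma hob_V [simp]: "c \<rhd> d \<Longrightarrow> hob c d \<in> obj V"
  using is_functorD(3)[OF mten_is_functor[of "lb c" "rb c" "rb d"], of "(md c, md d)"]
  unfolding composable_def obj_V hob_def mten_functor_def prod_cat_def by auto

lemma raw_Q [simp]: "raw (Q c d) = bal_arr K (rb c) (md c) (md d)"
  by (simp add: Q_def)

lemma src_Q [simp]: "src (Q c d) = (if isM (rb c) then car c \<otimes> car d else car (hob c d))"
  and tgt_Q [simp]: "tgt (Q c d) = (if isM (rb c) then car (hob c d) else car c \<otimes> car d)"
  by (simp_all add: Q_def car_hob)

lemma bal_kind: "bal K P M N = (if isM P
    then coeq K ((carr M \<otimes> und P) \<otimes> carr N) (carr M \<otimes> carr N)
      (ract M \<boxtimes> ident K (carr N)) ((ident K (carr M) \<boxtimes> lact N) \<cdot> asc K (carr M) (und P) (carr N))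
    else equ K (carr M \<otimes> carr N) (carr M \<otimes> (und P \<otimes> carr N))
      (asc K (carr M) (und P) (carr N) \<cdot> (ract M \<boxtimes> ident K (carr N))) (ident K (carr M) \<boxtimes> lact N))"
  by (cases P) (simp_all add: bal_def Let_def)

lemma tens_kind:
  "tens_lact K X M N = (if isM X then (lact M \<boxtimes> ident K (carr N)) \<cdot> asci K (und X) (carr M) (carr N)
    else asc K (und X) (carr M) (carr N) \<cdot> (lact M \<boxtimes> ident K (carr N)))"
  "tens_ract K Y M N = (if isM Y then (ident K (carr M) \<boxtimes> ract N) \<cdot> asc K (carr M) (carr N) (und Y)
    else asci K (carr M) (carr N) (und Y) \<cdot> (ident K (carr M) \<boxtimes> ract N))"
  by (cases X; cases Y; simp add: tens_lact_def tens_ract_def)+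

lemma induced_kind:
  "induced_lact K X P M N l \<longleftrightarrow> l \<in> lact_hom K X (bal_obj K P M N) \<and> (if isM P
    then left_equivariant K X (tens_lact K X M N) l (bal_arr K P M N)
    else left_equivariant K X l (tens_lact K X M N) (bal_arr K P M N))"
  "induced_ract K Y P M N r \<longleftrightarrow> r \<in> ract_hom K Y (bal_obj K P M N) \<and> (if isM P
    then right_equivariant K Y (tens_ract K Y M N) r (bal_arr K P M N)
    else right_equivariant K Y r (tens_ract K Y M N) (bal_arr K P M N))"
  by (cases P; simp add: induced_lact_def induced_ract_def)+

lemma Q_coequalizer:
  assumes cd: "c \<rhd> d" and k: "isM (rb c)"
  shows "is_coequalizer K ((car c \<otimes> und (rb c)) \<otimes> car d) (car c \<otimes> car d)
    (raw (ra c \<odot> Id (car d))) (raw ((Id (car c) \<odot> la d) \<bullet> Asc (car c) (und (rb c)) (car d)))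
    (car (hob c d)) (raw (Q c d))"
proof -
  note cd' [simp] = composableD[OF cd]
  let ?a = "ra c \<odot> Id (car d)" and ?b = "(Id (car c) \<odot> la d) \<bullet> Asc (car c) (und (rb c)) (car d)"
  have ab: "arr K ?a" "arr K ?b" "src ?a = (car c \<otimes> und (rb c)) \<otimes> car d" "tgt ?a = car c \<otimes> car d"
    "src ?b = (car c \<otimes> und (rb c)) \<otimes> car d" "tgt ?b = car c \<otimes> car d"
    using k arr_la[of d] cell_base[of d] cell_base[of c] by simp_all
  have "\<exists>q z. is_coequalizer K ((car c \<otimes> und (rb c)) \<otimes> car d) (car c \<otimes> car d) (raw ?a) (raw ?b) q z"
    using coequalizers ab arr_raw[OF ab(1)] arr_raw[OF ab(2)] arr_src[OF ab(1)] arr_tgt[OF ab(1)]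
    unfolding has_coequalizers_def by metis
  then have "\<exists>p. is_coequalizer K ((car c \<otimes> und (rb c)) \<otimes> car d) (car c \<otimes> car d) (raw ?a) (raw ?b) (fst p) (snd p)"
    by simp
  note someI_ex[OF this, folded coeq_def]
  moreover have "bal K (rb c) (md c) (md d) = coeq K ((car c \<otimes> und (rb c)) \<otimes> car d) (car c \<otimes> car d) (raw ?a) (raw ?b)"
    using k ab arr_la[of d] cell_base[of d] cell_base[of c] by (simp add: bal_kind)
  ultimately show ?thesis
    by (simp add: car_hob bal_obj_def bal_arr_def)
qed

lemma Q_equalizer:
  assumes cd: "c \<rhd> d" and k: "\<not> isM (rb c)"
  shows "is_equalizer K (car c \<otimes> car d) (car c \<otimes> (und (rb c) \<otimes> car d))
    (raw (Asc (car c) (und (rb c)) (car d) \<bullet> (ra c \<odot> Id (car d)))) (raw (Id (car c) \<odot> la d))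
    (car (hob c d)) (raw (Q c d))"
proof -
  note cd' [simp] = composableD[OF cd]
  let ?a = "Asc (car c) (und (rb c)) (car d) \<bullet> (ra c \<odot> Id (car d))" and ?b = "Id (car c) \<odot> la d"
  have ab: "arr K ?a" "arr K ?b" "src ?a = car c \<otimes> car d" "tgt ?a = car c \<otimes> (und (rb c) \<otimes> car d)"
    "src ?b = car c \<otimes> car d" "tgt ?b = car c \<otimes> (und (rb c) \<otimes> car d)"
    using k arr_la[of d] cell_base[of d] cell_base[of c] by simp_all
  have "\<exists>q z. is_equalizer K (car c \<otimes> car d) (car c \<otimes> (und (rb c) \<otimes> car d)) (raw ?a) (raw ?b) q z"
    using equalizers ab arr_raw[OF ab(1)] arr_raw[OF ab(2)] arr_src[OF ab(1)] arr_tgt[OF ab(1)]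
    unfolding has_equalizers_def by metis
  then have "\<exists>p. is_equalizer K (car c \<otimes> car d) (car c \<otimes> (und (rb c) \<otimes> car d)) (raw ?a) (raw ?b) (fst p) (snd p)"
    by simp
  note someI_ex[OF this, folded equ_def]
  moreover have "bal K (rb c) (md c) (md d) = equ K (car c \<otimes> car d) (car c \<otimes> (und (rb c) \<otimes> car d)) (raw ?a) (raw ?b)"
    using k ab arr_la[of d] cell_base[of d] cell_base[of c] by (simp add: bal_kind)
  ultimately show ?thesis
    by (simp add: car_hob bal_obj_def bal_arr_def)
qed

lemma arr_Q [simp]: "c \<rhd> d \<Longrightarrow> arr K (Q c d)"
  using Q_coequalizer[of c d] Q_equalizer[of c d] composableD[of c d]
  by (cases "isM (rb c)") (simp_all add: Q_def car_hob is_coequalizer_def is_equalizer_def)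

lemma car_hob_ob [simp]: "c \<rhd> d \<Longrightarrow> car (hob c d) \<in> obj K"
  using cell_base(3)[OF hob_V] .

context
  fixes c d
  assumes cd: "c \<rhd> d"
begin

lemma composable_cells [simp]: "c \<in> obj V" "d \<in> obj V" "rb c = lb d" "car (hob c d) \<in> obj K"
  using composableD[OF cd] car_hob_ob[OF cd] by simp_all

lemma Q_fork:
  assumes "isM (rb c)"
  shows "Q c d \<bullet> (ra c \<odot> Id (car d)) = Q c d \<bullet> (Id (car c) \<odot> la d) \<bullet> Asc (car c) (und (rb c)) (car d)"
  using Q_coequalizer[OF cd assms] assms cd unfolding is_coequalizer_def
  by (intro tarr_eqI[of K]) simp_all

lemma Q_cofork:
  assumes "\<not> isM (rb c)"
  shows "Asc (car c) (und (rb c)) (car d) \<bullet> (ra c \<odot> Id (car d)) \<bullet> Q c d = (Id (car c) \<odot> la d) \<bullet> Q c d"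
proof -
  have "(Asc (car c) (und (rb c)) (car d) \<bullet> (ra c \<odot> Id (car d))) \<bullet> Q c d = (Id (car c) \<odot> la d) \<bullet> Q c d"
    using Q_equalizer[OF cd assms] assms cd unfolding is_equalizer_def
    by (intro tarr_eqI[of K]) simp_all
  then show ?thesis by (simp add: cmp_assoc)
qed

lemma Q_factor:
  assumes k: "isM (rb c)" and h: "arr K h" "src h = car c \<otimes> car d"
    and eq: "h \<bullet> (ra c \<odot> Id (car d)) = h \<bullet> (Id (car c) \<odot> la d) \<bullet> Asc (car c) (und (rb c)) (car d)"
  obtains k where "arr K k" "src k = car (hob c d)" "tgt k = tgt h" "k \<bullet> Q c d = h"
    "\<And>k'. arr K k' \<Longrightarrow> src k' = car (hob c d) \<Longrightarrow> k' \<bullet> Q c d = h \<Longrightarrow> k' = k"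
proof -
  have "raw h \<cdot> raw (ra c \<odot> Id (car d)) = raw h \<cdot> raw ((Id (car c) \<odot> la d) \<bullet> Asc (car c) (und (rb c)) (car d))"
    using arg_cong[OF eq, of raw] h k by simp
  moreover have "raw h \<in> hom K (car c \<otimes> car d) (tgt h)" "tgt h \<in> obj K"
    using arr_raw[OF h(1)] h by simp_all
  ultimately obtain k0 where k0: "k0 \<in> hom K (car (hob c d)) (tgt h)" "k0 \<cdot> raw (Q c d) = raw h"
    and un: "\<And>k'. k' \<in> hom K (car (hob c d)) (tgt h) \<Longrightarrow> k' \<cdot> raw (Q c d) = raw h \<Longrightarrow> k' = k0"
    using Q_coequalizer[OF cd k] unfolding is_coequalizer_def by metis
  let ?k = "Arr (car (hob c d)) k0 (tgt h)"
  have a: "arr K ?k" using k0 h cd by simp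
  show thesis
  proof (rule that[of ?k])
    show "?k \<bullet> Q c d = h"
      using a k0 h k cd by (intro tarr_eqI[of K]) simp_all
  next
    fix k' assume k': "arr K k'" "src k' = car (hob c d)" "k' \<bullet> Q c d = h"
    have t: "tgt k' = tgt h" "raw k' \<cdot> raw (Q c d) = raw h"
      unfolding k'(3)[symmetric] using k'(1,2) k cd by simp_all
    then have "raw k' = k0"
      using un[of "raw k'"] arr_raw[OF k'(1)] k' by simp
    then show "k' = ?k"
      using a k' t by (intro tarr_eqI[of K]) simp_all
  qed (use a in simp_all)
qed

lemma Q_cofactor:
  assumes k: "\<not> isM (rb c)" and h: "arr K h" "tgt h = car c \<otimes> car d"
    and eq: "Asc (car c) (und (rb c)) (car d) \<bullet> (ra c \<odot> Id (car d)) \<bullet> h = (Id (car c) \<odot> la d) \<bullet> h"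
  obtains k where "arr K k" "tgt k = car (hob c d)" "src k = src h" "Q c d \<bullet> k = h"
    "\<And>k'. arr K k' \<Longrightarrow> tgt k' = car (hob c d) \<Longrightarrow> Q c d \<bullet> k' = h \<Longrightarrow> k' = k"
proof -
  have "(Asc (car c) (und (rb c)) (car d) \<bullet> (ra c \<odot> Id (car d))) \<bullet> h = (Id (car c) \<odot> la d) \<bullet> h"
    using eq by (simp add: cmp_assoc)
  from arg_cong[OF this, of raw]
  have "raw (Asc (car c) (und (rb c)) (car d) \<bullet> (ra c \<odot> Id (car d))) \<cdot> raw h = raw (Id (car c) \<odot> la d) \<cdot> raw h"
    using h k by simp
  moreover have "raw h \<in> hom K (src h) (car c \<otimes> car d)" "src h \<in> obj K"
    using arr_raw[OF h(1)] h by simp_all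
  ultimately obtain k0 where k0: "k0 \<in> hom K (src h) (car (hob c d))" "raw (Q c d) \<cdot> k0 = raw h"
    and un: "\<And>k'. k' \<in> hom K (src h) (car (hob c d)) \<Longrightarrow> raw (Q c d) \<cdot> k' = raw h \<Longrightarrow> k' = k0"
    using Q_equalizer[OF cd k] unfolding is_equalizer_def by metis
  let ?k = "Arr (src h) k0 (car (hob c d))"
  have a: "arr K ?k" using k0 h cd by simp
  show thesis
  proof (rule that[of ?k])
    show "Q c d \<bullet> ?k = h"
      using a k0 h k cd by (intro tarr_eqI[of K]) simp_all
  next
    fix k' assume k': "arr K k'" "tgt k' = car (hob c d)" "Q c d \<bullet> k' = h"
    have t: "src k' = src h" "raw (Q c d) \<cdot> raw k' = raw h"
      unfolding k'(3)[symmetric] using k'(1,2) k cd by simp_all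
    then have "raw k' = k0"
      using un[of "raw k'"] arr_raw[OF k'(1)] k' by simp
    then show "k' = ?k"
      using a k' t by (intro tarr_eqI[of K]) simp_all
  qed (use a in simp_all)
qed

lemma Q_epic: "isM (rb c) \<Longrightarrow> epic K (Q c d)"
proof (rule epicI)
  fix f g assume k: "isM (rb c)" and f: "arr K f" "src f = tgt (Q c d)" and g: "arr K g" "src g = tgt (Q c d)"
    and eq: "f \<bullet> Q c d = g \<bullet> Q c d"
  have "(f \<bullet> Q c d) \<bullet> (ra c \<odot> Id (car d)) = (f \<bullet> Q c d) \<bullet> (Id (car c) \<odot> la d) \<bullet> Asc (car c) (und (rb c)) (car d)"
    using Q_fork[OF k] by (simp add: cmp_assoc)
  moreover have "arr K (f \<bullet> Q c d)" "src (f \<bullet> Q c d) = car c \<otimes> car d"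
    using f k cd by simp_all
  ultimately obtain k0 where "arr K k0" "src k0 = car (hob c d)" "tgt k0 = tgt (f \<bullet> Q c d)" "k0 \<bullet> Q c d = f \<bullet> Q c d"
    and u: "\<And>k'. arr K k' \<Longrightarrow> src k' = car (hob c d) \<Longrightarrow> k' \<bullet> Q c d = f \<bullet> Q c d \<Longrightarrow> k' = k0"
    using Q_factor[OF k] by blast
  from u[of f] u[of g] show "f = g"
    using f g eq k by simp
qed (use cd in simp)

lemma Q_monic: "\<not> isM (rb c) \<Longrightarrow> monic K (Q c d)"
proof (rule monicI)
  fix f g assume k: "\<not> isM (rb c)" and f: "arr K f" "tgt f = src (Q c d)" and g: "arr K g" "tgt g = src (Q c d)"
    and eq: "Q c d \<bullet> f = Q c d \<bullet> g"
  have "Asc (car c) (und (rb c)) (car d) \<bullet> (ra c \<odot> Id (car d)) \<bullet> (Q c d \<bullet> f) = (Id (car c) \<odot> la d) \<bullet> (Q c d \<bullet> f)"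
    using tail3[OF Q_cofork[OF k], of f] by (simp add: cmp_assoc)
  moreover have "arr K (Q c d \<bullet> f)" "tgt (Q c d \<bullet> f) = car c \<otimes> car d"
    using f k cd by simp_all
  ultimately obtain k0 where "arr K k0" "tgt k0 = car (hob c d)" "src k0 = src (Q c d \<bullet> f)" "Q c d \<bullet> k0 = Q c d \<bullet> f"
    and u: "\<And>k'. arr K k' \<Longrightarrow> tgt k' = car (hob c d) \<Longrightarrow> Q c d \<bullet> k' = Q c d \<bullet> f \<Longrightarrow> k' = k0"
    using Q_cofactor[OF k] by blast
  from u[of f] u[of g] show "f = g"
    using f g eq k by simp
qed (use cd in simp)

text \<open>The actions on the (co)tensor product are defined as the unique ones that make its structure map
equivariant, and they exist by twistability.\<close>

lemma Q_leq: "isM (rb c) \<Longrightarrow> leq (lb c) (ltens (lb c) (la c) (car c) (car d)) (la (hob c d)) (Q c d)"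
  "\<not> isM (rb c) \<Longrightarrow> leq (lb c) (la (hob c d)) (ltens (lb c) (la c) (car c) (car d)) (Q c d)"
proof -
  let ?t = "ltens (lb c) (la c) (car c) (car d)" and ?h = "la (hob c d)"
  have ind: "induced_lact K (lb c) (rb c) (md c) (md d) (lact (md (hob c d)))"
    unfolding md_hob mten_def bi.sel
    by (rule theI'[OF induced_unique(1)[of _ _ "rb d"]]) (use cd in \<open>auto simp only: composable_def obj_V\<close>)
  have t: "raw ?t = tens_lact K (lb c) (md c) (md d)"
    by (cases "isM (lb c)") (simp_all add: ltens_def tens_kind)
  have ty: "lty (lb c) (car c \<otimes> car d) ?t" "lty (lb c) (car (hob c d)) ?h"
    using lty_la[OF hob_V[OF cd]] by simp_all
  note simps = leq_def eq_iff_raw[of "Q c d \<bullet> ?t"] eq_iff_raw[of "?h \<bullet> Q c d"] eq_iff_raw[of "Q c d \<bullet> ?h"] eq_iff_raw[of "?t \<bullet> Q c d"]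
  show "leq (lb c) ?t ?h (Q c d)" if k: "isM (rb c)"
    using ind ty k cd unfolding induced_kind kind_unfold(4) t[symmetric] simps
    by (cases "isM (lb c)") (simp_all add: lty_def simps)
  show "leq (lb c) ?h ?t (Q c d)" if k: "\<not> isM (rb c)"
    using ind ty k cd unfolding induced_kind kind_unfold(4) t[symmetric] simps
    by (cases "isM (lb c)") (simp_all add: lty_def simps)
qed

lemma Q_req: "isM (rb c) \<Longrightarrow> req (rb d) (rtens (rb d) (ra d) (car c) (car d)) (ra (hob c d)) (Q c d)"
  "\<not> isM (rb c) \<Longrightarrow> req (rb d) (ra (hob c d)) (rtens (rb d) (ra d) (car c) (car d)) (Q c d)"
proof -
  let ?t = "rtens (rb d) (ra d) (car c) (car d)" and ?h = "ra (hob c d)"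
  have ind: "induced_ract K (rb d) (rb c) (md c) (md d) (ract (md (hob c d)))"
    unfolding md_hob mten_def bi.sel
    by (rule theI'[OF induced_unique(2)[of "lb c"]]) (use cd in \<open>auto simp only: composable_def obj_V\<close>)
  have t: "raw ?t = tens_ract K (rb d) (md c) (md d)"
    by (cases "isM (rb d)") (simp_all add: rtens_def tens_kind)
  have ty: "rty (rb d) (car c \<otimes> car d) ?t" "rty (rb d) (car (hob c d)) ?h"
    using rty_ra[OF hob_V[OF cd]] by simp_all
  note simps = req_def eq_iff_raw[of "Q c d \<bullet> ?t"] eq_iff_raw[of "?h \<bullet> Q c d"] eq_iff_raw[of "Q c d \<bullet> ?h"] eq_iff_raw[of "?t \<bullet> Q c d"]
  show "req (rb d) ?t ?h (Q c d)" if k: "isM (rb c)"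
    using ind ty k cd unfolding induced_kind kind_unfold(5) t[symmetric] simps
    by (cases "isM (rb d)") (simp_all add: rty_def simps)
  show "req (rb d) ?h ?t (Q c d)" if k: "\<not> isM (rb c)"
    using ind ty k cd unfolding induced_kind kind_unfold(5) t[symmetric] simps
    by (cases "isM (rb d)") (simp_all add: rty_def simps)
qed

end

declare composable_cells [simp del]

section \<open>Horizontal composition of maps\<close>

lemma composable_src_tgt [simp]:
  assumes "arr V s" "arr V t" "rb (src s) = lb (src t)"
  shows "src s \<rhd> src t" "tgt s \<rhd> tgt t" "src s \<rhd> tgt t" "tgt s \<rhd> src t"
  using assms(3) arr_src[OF assms(1)] arr_src[OF assms(2)] arr_tgt[OF assms(1)] arr_tgt[OF assms(2)]
    arr_V_bases[OF assms(1)] arr_V_bases[OF assms(2)] unfolding composable_def by metis+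

lemma composable_hob [simp]: "c \<rhd> d \<Longrightarrow> d \<rhd> e \<Longrightarrow> hob c d \<rhd> e" "c \<rhd> d \<Longrightarrow> d \<rhd> e \<Longrightarrow> c \<rhd> hob d e"
proof -
  assume cd: "c \<rhd> d" and de: "d \<rhd> e"
  then show "hob c d \<rhd> e" "c \<rhd> hob d e"
    using hob_V[OF cd] hob_V[OF de] unfolding composable_def by simp_all
qed

definition hc :: "(('a, 'b) cell, 'b) tarr \<Rightarrow> (('a, 'b) cell, 'b) tarr \<Rightarrow> (('a, 'b) cell, 'b) tarr"  (infixl "\<star>" 76) where
  "s \<star> t = (if arr V s \<and> arr V t \<and> rb (src s) = lb (src t)
     then Arr (hob (src s) (src t))
       (bal_map K (rb (src s)) (md (src s)) (md (src t)) (rb (src s)) (md (tgt s)) (md (tgt t)) (raw s) (raw t))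
       (hob (tgt s) (tgt t))
     else Null)"

lemma arr_V_raw: "arr V t \<Longrightarrow> raw t \<in> hom (Mix K (lb (src t)) (rb (src t))) (md (src t)) (md (tgt t))"
  using arr_raw[of V t] arr_V_bases[of t] unfolding hom_V by simp

lemma cell_md: "c \<in> obj V \<Longrightarrow> md c \<in> obj (Mix K (lb c) (rb c))"
  unfolding obj_V by blast

lemma mten_map:
  assumes "X \<in> bases" "P \<in> bases" "Y \<in> bases" "M \<in> obj (Mix K X P)" "M' \<in> obj (Mix K X P)"
    "N \<in> obj (Mix K P Y)" "N' \<in> obj (Mix K P Y)" "f \<in> hom (Mix K X P) M M'" "h \<in> hom (Mix K P Y) N N'"
  shows "bal_map K P M N P M' N' f h \<in> hom (Mix K X Y) (mten K X P Y M N) (mten K X P Y M' N')"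
    "bal_map K P M N P M N (ident K (carr M)) (ident K (carr N)) = ident K (carr (mten K X P Y M N))"
    "M'' \<in> obj (Mix K X P) \<Longrightarrow> N'' \<in> obj (Mix K P Y) \<Longrightarrow> f' \<in> hom (Mix K X P) M' M'' \<Longrightarrow> h' \<in> hom (Mix K P Y) N' N'' \<Longrightarrow>
      bal_map K P M N P M'' N'' (f' \<cdot> f) (h' \<cdot> h) = bal_map K P M' N' P M'' N'' f' h' \<cdot> bal_map K P M N P M' N' f h"
  using is_functorD(4)[OF mten_is_functor[OF assms(1-3)], of "(M, N)" "(M', N')" "(f, h)"]
    is_functorD(5)[OF mten_is_functor[OF assms(1-3)], of "(M, N)"]
    is_functorD(6)[OF mten_is_functor[OF assms(1-3)], of "(M, N)" "(M', N')" "(M'', N'')" "(f, h)" "(f', h')"] assms(4-9)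
  by (simp_all add: mten_functor_def prod_cat_def)

lemma arr_hc [simp]: "arr V (s \<star> t) \<longleftrightarrow> arr V s \<and> arr V t \<and> rb (src s) = lb (src t)"
proof (cases "arr V s \<and> arr V t \<and> rb (src s) = lb (src t)")
  case True
  then have s: "arr V s" and t: "arr V t" and st: "rb (src s) = lb (src t)" by simp_all
  note m = cell_md[OF arr_src[OF s]] cell_md[OF arr_tgt[OF s]] cell_md[OF arr_src[OF t]] cell_md[OF arr_tgt[OF t]]
  note b = arr_V_bases[OF s] arr_V_bases[OF t]
  note m' = m(1)[unfolded st] m(2)[unfolded b st] m(3) m(4)[unfolded b] arr_V_raw[OF s, unfolded st] arr_V_raw[OF t]
  have lb_src_base: "lb (src s) \<in> bases" "lb (src t) \<in> bases" "rb (src t) \<in> bases"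
    using cell_base[OF arr_src[OF s]] cell_base[OF arr_src[OF t]] by simp_all
  have "bal_map K (rb (src s)) (md (src s)) (md (src t)) (rb (src s)) (md (tgt s)) (md (tgt t)) (raw s) (raw t)
      \<in> hom (Mix K (lb (src s)) (rb (src t))) (md (hob (src s) (src t))) (md (hob (tgt s) (tgt t)))"
    using mten_map(1)[OF _ _ _ m'] m'(5,6) b s t st unfolding md_hob
    by (simp only: b st lb_src_base)
  then have "bal_map K (rb (src s)) (md (src s)) (md (src t)) (rb (src s)) (md (tgt s)) (md (tgt t)) (raw s) (raw t)
      \<in> hom V (hob (src s) (src t)) (hob (tgt s) (tgt t))"
    unfolding hom_V by (simp only: lb_hob rb_hob b simp_thms if_True)
  then show ?thesis
    using hob_V[OF composable_src_tgt(1)[OF s t st]] hob_V[OF composable_src_tgt(2)[OF s t st]] True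
    unfolding hc_def by (simp only: arr_Arr simp_thms if_True)
next
  case False
  then have "s \<star> t = Null"
    unfolding hc_def by (rule if_not_P)
  then show ?thesis
    using False by (metis not_arr_Null)
qed

lemma src_hc [simp]: "arr V s \<Longrightarrow> arr V t \<Longrightarrow> rb (src s) = lb (src t) \<Longrightarrow> src (s \<star> t) = hob (src s) (src t)"
  and tgt_hc [simp]: "arr V s \<Longrightarrow> arr V t \<Longrightarrow> rb (src s) = lb (src t) \<Longrightarrow> tgt (s \<star> t) = hob (tgt s) (tgt t)"
  by (simp_all add: hc_def)

lemma hc_idt [simp]:
  assumes "c \<rhd> d"
  shows "idt V c \<star> idt V d = idt V (hob c d)"
proof -
  note cd = composableD[OF assms]
  note m = cell_md[OF cd(1), unfolded cd(3)] cell_md[OF cd(2)]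
  have "raw (idt V c \<star> idt V d) = ident K (car (hob c d))"
    using mten_map(2)[of "lb c" "lb d" "rb d" "md c" "md c" "md d" "md d" "ident K (car c)" "ident K (car d)"]
      cd m arr_V_raw[of "idt V c"] arr_V_raw[of "idt V d"]
    by (simp add: md_hob hc_def)
  then show ?thesis
    using cd assms by (intro tarr_eqI[of V]) simp_all
qed

lemma hc_cmp:
  assumes "arr V s'" "arr V s" "src s' = tgt s" "arr V t'" "arr V t" "src t' = tgt t" "rb (src s) = lb (src t)"
  shows "(s' \<star> t') \<diamondop> (s \<star> t) = (s' \<diamondop> s) \<star> (t' \<diamondop> t)"
proof -
  note b = arr_V_bases[OF assms(1)] arr_V_bases[OF assms(2)] arr_V_bases[OF assms(4)] arr_V_bases[OF assms(5)]
  have tg: "lb (src s') = lb (src s)" "rb (src s') = rb (src s)" "lb (src t') = lb (src t)" "rb (src t') = rb (src t)"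
    unfolding assms(3,6) by (rule b)+
  note m = cell_md[OF arr_src[OF assms(2)], unfolded assms(7)] cell_md[OF arr_tgt[OF assms(2)], unfolded b assms(7)]
    cell_md[OF arr_tgt[OF assms(1)], unfolded b tg assms(7)]
    cell_md[OF arr_src[OF assms(5)]] cell_md[OF arr_tgt[OF assms(5)], unfolded b] cell_md[OF arr_tgt[OF assms(4)], unfolded b tg]
  note r = arr_V_raw[OF assms(2), unfolded assms(7)] arr_V_raw[OF assms(5)]
    arr_V_raw[OF assms(1), unfolded assms(3), unfolded b assms(7)] arr_V_raw[OF assms(4), unfolded assms(6), unfolded b]
  have base: "lb (src s) \<in> bases" "lb (src t) \<in> bases" "rb (src t) \<in> bases"
    using cell_base[OF arr_src[OF assms(2)]] cell_base[OF arr_src[OF assms(5)]] by simp_all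
  have "raw ((s' \<diamondop> s) \<star> (t' \<diamondop> t)) = raw (s' \<star> t') \<cdot> raw (s \<star> t)"
    using mten_map(3)[OF base m(1,2,4,5) r(1,2) m(3,6) r(3,4)] assms b by (simp add: hc_def)
  then show ?thesis
    using assms b by (intro tarr_eqI[of V]) simp_all
qed

lemma hc_cmp':
  assumes "arr V s'" "arr V s" "src s' = tgt s" "arr V t'" "arr V t" "src t' = tgt t" "rb (src s) = lb (src t)"
  shows "(s' \<star> t') \<diamondop> ((s \<star> t) \<diamondop> k) = ((s' \<diamondop> s) \<star> (t' \<diamondop> t)) \<diamondop> k"
  using hc_cmp[OF assms] by (rule V.tail)

lemmas hmerge = hc_cmp hc_cmp'

lemma bal_map_kind: "bal_map K P M N P' M' N' f h = (THE k. k \<in> hom K (bal_obj K P M N) (bal_obj K P' M' N') \<and> (if isM P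
    then k \<cdot> bal_arr K P M N = bal_arr K P' M' N' \<cdot> (f \<boxtimes> h)
    else bal_arr K P' M' N' \<cdot> k = (f \<boxtimes> h) \<cdot> bal_arr K P M N))"
  by (cases P) (simp_all add: bal_map_def)

lemma la_natural: "arr V t \<Longrightarrow> isM (lb (src t)) \<Longrightarrow> U t \<bullet> la (src t) = la (tgt t) \<bullet> (Id (und (lb (src t))) \<odot> U t)"
  "arr V t \<Longrightarrow> \<not> isM (lb (src t)) \<Longrightarrow> la (tgt t) \<bullet> U t = (Id (und (lb (src t))) \<odot> U t) \<bullet> la (src t)"
  using U_leq[of t] by (simp_all add: leq_def)

lemma ra_natural: "arr V t \<Longrightarrow> isM (rb (src t)) \<Longrightarrow> U t \<bullet> ra (src t) = ra (tgt t) \<bullet> (U t \<odot> Id (und (rb (src t))))"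
  "arr V t \<Longrightarrow> \<not> isM (rb (src t)) \<Longrightarrow> ra (tgt t) \<bullet> U t = (U t \<odot> Id (und (rb (src t)))) \<bullet> ra (src t)"
  using U_req[of t] by (simp_all add: req_def)

text \<open>The defining property of \<open>s \<star> t\<close> is stated by a definite description, so existence and uniqueness have
to be derived: \<open>U s \<odot> U t\<close> followed by the projection coequalizes the two actions of the middle base.\<close>

lemma U_hc_tensor:
  assumes s: "arr V s" and t: "arr V t" and st: "rb (src s) = lb (src t)" and k: "isM (rb (src s))"
  shows "U (s \<star> t) \<bullet> Q (src s) (src t) = Q (tgt s) (tgt t) \<bullet> (U s \<odot> U t)"
proof -
  let ?c = "src s" and ?d = "src t" and ?c' = "tgt s" and ?d' = "tgt t" and ?p = "und (rb (src s))"
  note b [simp] = arr_V_bases[OF s] arr_V_bases[OF t]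
  note [simp] = s t st
  have p [simp]: "und (lb (src t)) \<in> obj K" using cell_base(1)[OF arr_src[OF t]] by simp
  have k' [simp]: "isM (lb (src t))" using k by simp
  let ?h = "Q ?c' ?d' \<bullet> (U s \<odot> U t)"
  have h: "arr K ?h" "src ?h = car ?c \<otimes> car ?d" "tgt ?h = car (hob ?c' ?d')"
    by simp_all
  have "?h \<bullet> (ra ?c \<odot> Id (car ?d)) = Q ?c' ?d' \<bullet> (ra ?c' \<odot> Id (car ?d')) \<bullet> ((U s \<odot> Id ?p) \<odot> U t)"
    using ra_natural(1)[OF s k] by (simp add: cmp_assoc merge)
  also have "\<dots> = Q ?c' ?d' \<bullet> (Id (car ?c') \<odot> la ?d') \<bullet> Asc (car ?c') ?p (car ?d') \<bullet> ((U s \<odot> Id ?p) \<odot> U t)"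
    using tail[OF Q_fork[of ?c' ?d']] by (simp add: cmp_assoc)
  also have "\<dots> = Q ?c' ?d' \<bullet> (Id (car ?c') \<odot> la ?d') \<bullet> (U s \<odot> (Id ?p \<odot> U t)) \<bullet> Asc (car ?c) ?p (car ?d)"
    using Asc_natural[of "U s" "Id ?p" "U t"] by simp
  also have "\<dots> = ?h \<bullet> (Id (car ?c) \<odot> la ?d) \<bullet> Asc (car ?c) ?p (car ?d)"
    using la_natural(1)[OF t] by (simp add: cmp_assoc merge)
  finally have eq: "?h \<bullet> (ra ?c \<odot> Id (car ?d)) = ?h \<bullet> (Id (car ?c) \<odot> la ?d) \<bullet> Asc (car ?c) ?p (car ?d)" .
  obtain q where q: "arr K q" "src q = car (hob ?c ?d)" "tgt q = tgt ?h" "q \<bullet> Q ?c ?d = ?h"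
    and u: "\<And>q'. arr K q' \<Longrightarrow> src q' = car (hob ?c ?d) \<Longrightarrow> q' \<bullet> Q ?c ?d = ?h \<Longrightarrow> q' = q"
    using Q_factor[OF _ k h(1,2) eq] by (metis composable_src_tgt(1) s t st)
  have rq: "raw q \<in> hom K (car (hob ?c ?d)) (car (hob ?c' ?d'))"
    using arr_raw[OF q(1)] q(2,3) h(3) by simp
  have raw_h: "raw ?h = raw (Q ?c' ?d') \<cdot> (raw s \<boxtimes> raw t)"
    by simp
  have "raw (s \<star> t) = raw q"
    unfolding hc_def bal_map_kind using k'
  proof (simp only: s t st simp_thms if_True tarr.sel, intro the_equality conjI)
    show "raw q \<in> hom K (bal_obj K (lb ?d) (md ?c) (md ?d)) (bal_obj K (lb ?d) (md ?c') (md ?d'))"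
      using rq by (simp add: car_hob)
    have "raw (q \<bullet> Q ?c ?d) = raw ?h" using q(4) by simp
    then show "raw q \<cdot> bal_arr K (lb ?d) (md ?c) (md ?d) = bal_arr K (lb ?d) (md ?c') (md ?d') \<cdot> (raw s \<boxtimes> raw t)"
      unfolding raw_h using q(1,2) by simp
  next
    fix r assume r: "r \<in> hom K (bal_obj K (lb ?d) (md ?c) (md ?d)) (bal_obj K (lb ?d) (md ?c') (md ?d')) \<and>
      r \<cdot> bal_arr K (lb ?d) (md ?c) (md ?d) = bal_arr K (lb ?d) (md ?c') (md ?d') \<cdot> (raw s \<boxtimes> raw t)"
    let ?r = "Arr (car (hob ?c ?d)) r (car (hob ?c' ?d'))"
    have "bal_obj K (lb ?d) (md ?c) (md ?d) = car (hob ?c ?d)" "bal_obj K (lb ?d) (md ?c') (md ?d') = car (hob ?c' ?d')"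
      by (simp_all add: car_hob)
    then have ar: "arr K ?r" using r by simp
    have "?r \<bullet> Q ?c ?d = ?h"
      using ar r by (intro tarr_eqI[of K]) simp_all
    from u[OF ar _ this] show "r = raw q"
      by auto
  qed
  then have "U (s \<star> t) = q"
    using q(1-3) h(3) by (intro tarr_eqI[of K]) simp_all
  then show ?thesis
    using q(4) by simp
qed

lemma U_hc_cotensor:
  assumes s: "arr V s" and t: "arr V t" and st: "rb (src s) = lb (src t)" and k: "\<not> isM (rb (src s))"
  shows "Q (tgt s) (tgt t) \<bullet> U (s \<star> t) = (U s \<odot> U t) \<bullet> Q (src s) (src t)"
proof -
  let ?c = "src s" and ?d = "src t" and ?c' = "tgt s" and ?d' = "tgt t" and ?p = "und (rb (src s))"
  note b [simp] = arr_V_bases[OF s] arr_V_bases[OF t]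
  note [simp] = s t st
  have p [simp]: "und (lb (src t)) \<in> obj K" using cell_base(1)[OF arr_src[OF t]] by simp
  have k' [simp]: "\<not> isM (lb (src t))" using k by simp
  have k2: "\<not> isM (rb (tgt s))" by simp
  let ?h = "(U s \<odot> U t) \<bullet> Q ?c ?d"
  have h: "arr K ?h" "tgt ?h = car ?c' \<otimes> car ?d'" "src ?h = car (hob ?c ?d)"
    by simp_all
  have "Asc (car ?c') ?p (car ?d') \<bullet> (ra ?c' \<odot> Id (car ?d')) \<bullet> ?h
      = Asc (car ?c') ?p (car ?d') \<bullet> ((U s \<odot> Id ?p) \<odot> U t) \<bullet> (ra ?c \<odot> Id (car ?d)) \<bullet> Q ?c ?d"
    using ra_natural(2)[OF s k] by (simp add: cmp_assoc merge)
  also have "\<dots> = (U s \<odot> (Id ?p \<odot> U t)) \<bullet> Asc (car ?c) ?p (car ?d) \<bullet> (ra ?c \<odot> Id (car ?d)) \<bullet> Q ?c ?d"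
    using tail[OF Asc_natural[of "U s" "Id ?p" "U t"]] by (simp add: cmp_assoc)
  also have "\<dots> = (U s \<odot> (Id ?p \<odot> U t)) \<bullet> (Id (car ?c) \<odot> la ?d) \<bullet> Q ?c ?d"
    using Q_cofork[of ?c ?d] by simp
  also have "\<dots> = (Id (car ?c') \<odot> la ?d') \<bullet> ?h"
    using la_natural(2)[OF t] by (simp add: cmp_assoc merge)
  finally have eq: "Asc (car ?c') ?p (car ?d') \<bullet> (ra ?c' \<odot> Id (car ?d')) \<bullet> ?h = (Id (car ?c') \<odot> la ?d') \<bullet> ?h" .
  obtain q where q: "arr K q" "tgt q = car (hob ?c' ?d')" "src q = src ?h" "Q ?c' ?d' \<bullet> q = ?h"
    and u: "\<And>q'. arr K q' \<Longrightarrow> tgt q' = car (hob ?c' ?d') \<Longrightarrow> Q ?c' ?d' \<bullet> q' = ?h \<Longrightarrow> q' = q"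
    using Q_cofactor[OF _ k2 h(1,2)] eq composable_src_tgt(2)[OF s t st] b(2) by metis
  have rq: "raw q \<in> hom K (car (hob ?c ?d)) (car (hob ?c' ?d'))"
    using arr_raw[OF q(1)] q(2,3) h(3) by simp
  have raw_h: "raw ?h = (raw s \<boxtimes> raw t) \<cdot> raw (Q ?c ?d)"
    by simp
  have "raw (s \<star> t) = raw q"
    unfolding hc_def bal_map_kind using k'
  proof (simp only: s t st simp_thms if_True if_False tarr.sel, intro the_equality conjI)
    show "raw q \<in> hom K (bal_obj K (lb ?d) (md ?c) (md ?d)) (bal_obj K (lb ?d) (md ?c') (md ?d'))"
      using rq by (simp add: car_hob)
    have "raw (Q ?c' ?d' \<bullet> q) = raw ?h" using q(4) by simp
    then show "bal_arr K (lb ?d) (md ?c') (md ?d') \<cdot> raw q = (raw s \<boxtimes> raw t) \<cdot> bal_arr K (lb ?d) (md ?c) (md ?d)"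
      unfolding raw_h using q(1,2) by simp
  next
    fix r assume r: "r \<in> hom K (bal_obj K (lb ?d) (md ?c) (md ?d)) (bal_obj K (lb ?d) (md ?c') (md ?d')) \<and>
      bal_arr K (lb ?d) (md ?c') (md ?d') \<cdot> r = (raw s \<boxtimes> raw t) \<cdot> bal_arr K (lb ?d) (md ?c) (md ?d)"
    let ?r = "Arr (car (hob ?c ?d)) r (car (hob ?c' ?d'))"
    have "bal_obj K (lb ?d) (md ?c) (md ?d) = car (hob ?c ?d)" "bal_obj K (lb ?d) (md ?c') (md ?d') = car (hob ?c' ?d')"
      by (simp_all add: car_hob)
    then have ar: "arr K ?r" using r by simp
    have "Q ?c' ?d' \<bullet> ?r = ?h"
      using ar r by (intro tarr_eqI[of K]) simp_all
    from u[OF ar _ this] show "r = raw q"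
      by auto
  qed
  then have "U (s \<star> t) = q"
    using q(1-3) h(3) by (intro tarr_eqI[of K]) simp_all
  then show ?thesis
    using q(4) by simp
qed

section \<open>Associators\<close>

text \<open>For three bimodules, \<open>al\<close> is a chosen associativity isomorphism and \<open>ali\<close> its inverse.  Compatibility
with the structure maps is first derived for an arbitrary associativity isomorphism \<open>a\<close>, because
\<open>associativity_eq\<close> compares two of them.\<close>

definition assoc_arr :: "('a, 'b) cell \<Rightarrow> ('a, 'b) cell \<Rightarrow> ('a, 'b) cell \<Rightarrow> 'b \<Rightarrow> (('a, 'b) cell, 'b) tarr" where
  "assoc_arr c d e a = Arr (hob (hob c d) e) a (hob c (hob d e))"

definition assoc_inv :: "('a, 'b) cell \<Rightarrow> ('a, 'b) cell \<Rightarrow> ('a, 'b) cell \<Rightarrow> 'b \<Rightarrow> (('a, 'b) cell, 'b) tarr" where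
  "assoc_inv c d e a = Arr (hob c (hob d e))
     (inv_arr K (car (hob (hob c d) e)) (car (hob c (hob d e))) a) (hob (hob c d) e)"

definition al_raw :: "('a, 'b) cell \<Rightarrow> ('a, 'b) cell \<Rightarrow> ('a, 'b) cell \<Rightarrow> 'b" where
  "al_raw c d e = (SOME a. is_associativity K (lb c) (rb c) (rb d) (rb e) (md c) (md d) (md e) a)"

abbreviation "al c d e \<equiv> assoc_arr c d e (al_raw c d e)"
abbreviation "ali c d e \<equiv> assoc_inv c d e (al_raw c d e)"

lemma src_assoc_arr [simp]: "src (assoc_arr c d e a) = hob (hob c d) e" and tgt_assoc_arr [simp]: "tgt (assoc_arr c d e a) = hob c (hob d e)"
  and raw_assoc_arr [simp]: "raw (assoc_arr c d e a) = a"
  and src_assoc_inv [simp]: "src (assoc_inv c d e a) = hob c (hob d e)" and tgt_assoc_inv [simp]: "tgt (assoc_inv c d e a) = hob (hob c d) e"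
  by (simp_all add: assoc_arr_def assoc_inv_def)

lemma assoc_kind: "assoc_compatible K X P R Y M N L a \<longleftrightarrow>
    (let m = carr M; n = carr N; l = carr L; MN = mten K X P R M N; NL = mten K P R Y N L;
         mn = bal_arr K P M N; nl = bal_arr K R N L; mn_l = bal_arr K R MN L; m_nl = bal_arr K P M NL
     in if isM P
       then if isM R then a \<cdot> mn_l \<cdot> (mn \<boxtimes> ident K l) = m_nl \<cdot> (ident K m \<boxtimes> nl) \<cdot> asc K m n l
         else mn_l \<cdot> inv_arr K (bal_obj K R MN L) (bal_obj K P M NL) a \<cdot> m_nl
           = (mn \<boxtimes> ident K l) \<cdot> asci K m n l \<cdot> (ident K m \<boxtimes> nl)
       else if isM R then m_nl \<cdot> a \<cdot> mn_l = (ident K m \<boxtimes> nl) \<cdot> asc K m n l \<cdot> (mn \<boxtimes> ident K l)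
         else (ident K m \<boxtimes> nl) \<cdot> m_nl \<cdot> a = asc K m n l \<cdot> (mn \<boxtimes> ident K l) \<cdot> mn_l)"
  by (cases P; cases R; simp add: assoc_compatible_def Let_def)

context
  fixes c d e
  assumes cd: "c \<rhd> d" and de: "d \<rhd> e"
begin

lemma composable3_cells [simp]: "c \<rhd> d" "d \<rhd> e" "c \<in> obj V" "d \<in> obj V" "e \<in> obj V" "rb c = lb d" "rb d = lb e"
  using cd de composableD[OF cd] composableD[OF de] by simp_all

context
  fixes a
  assumes a: "is_associativity K (lb c) (rb c) (rb d) (rb e) (md c) (md d) (md e) a"
begin

lemma invs_assoc: "invs V (assoc_arr c d e a) (assoc_inv c d e a)"
proof -
  obtain b where i: "inverse_arrows (Mix K (lb c) (rb e)) (md (hob (hob c d) e)) (md (hob c (hob d e))) a b"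
    using a by (auto simp: is_associativity_def is_iso_def md_hob)
  then have "inverse_arrows K (car (hob (hob c d) e)) (car (hob c (hob d e))) a b"
    by (auto simp: inverse_arrows_def dest: hom_Mix_K)
  from inv_arr_eq[OF this] have "raw (assoc_inv c d e a) = b"
    by (simp add: assoc_inv_def)
  with i have "inverse_arrows V (hob (hob c d) e) (hob c (hob d e)) a (raw (assoc_inv c d e a))"
    by (simp add: inverse_arrows_def hom_V)
  from V.inverse_arrows_invs[OF this] show ?thesis
    by (simp add: assoc_arr_def assoc_inv_def)
qed

lemma assoc_arr_V [simp]: "arr V (assoc_arr c d e a)" "arr V (assoc_inv c d e a)"
  "assoc_inv c d e a \<diamondop> assoc_arr c d e a = idt V (hob (hob c d) e)" "assoc_arr c d e a \<diamondop> assoc_inv c d e a = idt V (hob c (hob d e))"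
  using V.invsD[OF invs_assoc] by simp_all

lemma raw_assoc_inv: "raw (assoc_inv c d e a) = inv_arr K (car (hob (hob c d) e)) (car (hob c (hob d e))) a"
  by (simp add: assoc_inv_def)

lemma assoc_compat: "assoc_compatible K (lb c) (rb c) (rb d) (rb e) (md c) (md d) (md e) a"
  using a by (simp add: is_associativity_def)

lemma assoc_mm:
  assumes "isM (rb c)" "isM (rb d)"
  shows "U (assoc_arr c d e a) \<bullet> Q (hob c d) e \<bullet> (Q c d \<odot> Id (car e)) = Q c (hob d e) \<bullet> (Id (car c) \<odot> Q d e) \<bullet> Asc (car c) (car d) (car e)"
  using assms assoc_compat unfolding assoc_kind
  by (intro tarr_eqI[of K]) (simp_all add: Let_def md_hob)

lemma assoc_mc:
  assumes "isM (rb c)" "\<not> isM (rb d)"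
  shows "Q (hob c d) e \<bullet> U (assoc_inv c d e a) \<bullet> Q c (hob d e) = (Q c d \<odot> Id (car e)) \<bullet> Asi (car c) (car d) (car e) \<bullet> (Id (car c) \<odot> Q d e)"
  using assms assoc_compat unfolding assoc_kind
  by (intro tarr_eqI[of K]) (simp_all add: Let_def md_hob raw_assoc_inv mten_def)

lemma assoc_cm:
  assumes "\<not> isM (rb c)" "isM (rb d)"
  shows "Q c (hob d e) \<bullet> U (assoc_arr c d e a) \<bullet> Q (hob c d) e = (Id (car c) \<odot> Q d e) \<bullet> Asc (car c) (car d) (car e) \<bullet> (Q c d \<odot> Id (car e))"
  using assms assoc_compat unfolding assoc_kind
  by (intro tarr_eqI[of K]) (simp_all add: Let_def md_hob)

lemma assoc_cc:
  assumes "\<not> isM (rb c)" "\<not> isM (rb d)"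
  shows "(Id (car c) \<odot> Q d e) \<bullet> Q c (hob d e) \<bullet> U (assoc_arr c d e a) = Asc (car c) (car d) (car e) \<bullet> (Q c d \<odot> Id (car e)) \<bullet> Q (hob c d) e"
  using assms assoc_compat unfolding assoc_kind
  by (intro tarr_eqI[of K]) (simp_all add: Let_def md_hob)

end

lemma al_is_associativity:
  "is_associativity K (lb c) (rb c) (rb d) (rb e) (md c) (md d) (md e) (al_raw c d e)"
  unfolding al_raw_def
  by (rule someI_ex[OF associativity_exists]) (use cell_md[of c] cell_md[of d] cell_md[of e] in simp_all)

lemmas invs_al = invs_assoc[OF al_is_associativity]
lemmas al_arr [simp] = assoc_arr_V[OF al_is_associativity]
lemmas al_mm = assoc_mm[OF al_is_associativity]
lemmas al_mc = assoc_mc[OF al_is_associativity]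
lemmas al_cm = assoc_cm[OF al_is_associativity]
lemmas al_cc = assoc_cc[OF al_is_associativity]

end

declare composable3_cells [simp del]

text \<open>If exactly one of the two bases is a monoid, then compatibility determines the isomorphism, resp. its
inverse, after composing with one projection and one inclusion.  So in these cases, which are those of
the zigzag identities, the definite description \<open>associativity\<close> denotes the chosen isomorphism.\<close>

lemma associativity_eq:
  assumes cd: "c \<rhd> d" and de: "d \<rhd> e" and k: "isM (rb c) \<longleftrightarrow> \<not> isM (rb d)"
  shows "associativity K (lb c) (rb c) (rb d) (rb e) (md c) (md d) (md e) = al_raw c d e"
  unfolding associativity_def
proof (rule the_equality)
  show "is_associativity K (lb c) (rb c) (rb d) (rb e) (md c) (md d) (md e) (al_raw c d e)"
    by (rule al_is_associativity[OF cd de])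
  fix a assume a: "is_associativity K (lb c) (rb c) (rb d) (rb e) (md c) (md d) (md e) a"
  note [simp] = composable3_cells[OF cd de]
  note i = V.invsD[OF invs_assoc[OF cd de a]] and j = V.invsD[OF invs_al[OF cd de]]
  show "a = al_raw c d e"
  proof (cases "isM (rb c)")
    case False
    then have kd: "isM (rb d)" using k by simp
    have "Q c (hob d e) \<bullet> U (assoc_arr c d e a) \<bullet> Q (hob c d) e = Q c (hob d e) \<bullet> U (al c d e) \<bullet> Q (hob c d) e"
      unfolding assoc_cm[OF cd de a False kd] al_cm[OF cd de False kd] ..
    then have "U (assoc_arr c d e a) \<bullet> Q (hob c d) e = U (al c d e) \<bullet> Q (hob c d) e"
      by (rule monicD[OF Q_monic, rotated 2]) (use False kd i(1) j(1) in simp_all)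
    then have "U (assoc_arr c d e a) = U (al c d e)"
      by (rule epicD[OF Q_epic, rotated 2]) (use kd i(1) in simp_all)
    from arg_cong[OF this, of raw] show ?thesis by simp
  next
    case True
    then have kd: "\<not> isM (rb d)" using k by simp
    have "Q (hob c d) e \<bullet> U (assoc_inv c d e a) \<bullet> Q c (hob d e) = Q (hob c d) e \<bullet> U (ali c d e) \<bullet> Q c (hob d e)"
      unfolding assoc_mc[OF cd de a True kd] al_mc[OF cd de True kd] ..
    then have "U (assoc_inv c d e a) \<bullet> Q c (hob d e) = U (ali c d e) \<bullet> Q c (hob d e)"
      by (rule monicD[OF Q_monic, rotated 2]) (use True kd i(2) j(2) in simp_all)
    then have "U (assoc_inv c d e a) = U (ali c d e)"
      by (rule epicD[OF Q_epic, rotated 2]) (use True i(2) in simp_all)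
    then have e: "assoc_inv c d e a = ali c d e"
      using i(2) j(2) by (intro V_eqI) simp_all
    have "assoc_arr c d e a = assoc_arr c d e a \<diamondop> (ali c d e \<diamondop> al c d e)"
      using i(1) j by simp
    also have "\<dots> = al c d e"
      unfolding e[symmetric] V.tail[OF i(6)] using j by simp
    finally show ?thesis by (metis raw_assoc_arr)
  qed
qed

section \<open>Tensoring the structure maps with an object\<close>

text \<open>The unit object as a monoid.  Every object is a bimodule over it, and tensor products over it are
tensor products in the ambient category.\<close>

definition one_mon :: "('a, 'b) comon" where
  "one_mon = Monoid \<one> (lun K \<one>) (ident K \<one>)"

lemma one_mon_sel [simp]: "isM one_mon" "und one_mon = \<one>"
  by (simp_all add: one_mon_def)

lemma mu_one [simp]: "mu one_mon = Lu \<one>" and un_one [simp]: "un one_mon = Id \<one>"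
  by (simp_all add: mu_def un_def Lu_def idt_def one_mon_def)

lemma one_mon_base [simp]: "one_mon \<in> bases"
proof -
  have "Lu \<one> \<bullet> (Lu \<one> \<odot> Id \<one>) = Lu \<one> \<bullet> (Id \<one> \<odot> Lu \<one>) \<bullet> Asc \<one> \<one> \<one>"
    by (simp add: triangle) (simp add: Lu_one_Ru_one)
  from arg_cong[OF this, of raw]
  have "lun K \<one> \<cdot> (lun K \<one> \<boxtimes> ident K \<one>) = lun K \<one> \<cdot> (ident K \<one> \<boxtimes> lun K \<one>) \<cdot> asc K \<one> \<one> \<one>"
    by simp
  moreover have "Lu \<one> \<bullet> (Id \<one> \<odot> Id \<one>) = Lu \<one>"
    by simp
  from arg_cong[OF this, of raw] have "lun K \<one> \<cdot> (ident K \<one> \<boxtimes> ident K \<one>) = lun K \<one>"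
    by (simp del: Id_ten)
  moreover have "lun K \<one> = run K \<one>"
    using arg_cong[OF Lu_one_Ru_one, of raw] by simp
  moreover have "lun K \<one> \<in> hom K (\<one> \<otimes> \<one>) \<one>" "ident K \<one> \<in> hom K \<one> \<one>"
    using arr_raw[of K "Lu \<one>"] arr_raw[of K "Id \<one>"] by simp_all
  ultimately have "one_mon \<in> obj (Mon K)"
    by (simp add: Mon_def one_mon_def)
  then show ?thesis by (simp add: Mon_iff)
qed

lemma lstruct_one: "m \<in> obj K \<Longrightarrow> lstruct one_mon m (Lu m)"
  by (simp add: lstruct_def lty_def triangle) (simp add: Lu_one_Ru_one)

lemma rstruct_one: "m \<in> obj K \<Longrightarrow> rstruct one_mon m (Ru m)"
  by (simp add: rstruct_def rty_def triangle)

lemma commuting_one_right: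
  assumes "lty X m l" "m \<in> obj K"
  shows "commuting X one_mon m l (Ru m)"
proof -
  have x: "und X \<in> obj K" "arr K l" using assms by (simp_all add: lty_def)
  have "rty one_mon (und X \<otimes> m) (rtens one_mon (Ru m) (und X) m)"
    using x assms(2) by (intro rty_rtens) (simp_all add: rty_def)
  then show ?thesis
    using assms x Ru_natural[of l] by (cases "isM X") (simp_all add: commuting_def req_def rtens_def rty_def lty_def Ru_ten)
qed

lemma commuting_one_left:
  assumes "rty Y m r" "m \<in> obj K"
  shows "commuting one_mon Y m (Lu m) r"
proof -
  have x: "und Y \<in> obj K" "arr K r" using assms by (simp_all add: rty_def)
  have ty: "rty Y (\<one> \<otimes> m) (rtens Y r \<one> m)"
    using x assms by (intro rty_rtens) simp_all
  have l: "Lu (m \<otimes> und Y) = (Lu m \<odot> Id (und Y)) \<bullet> Asi \<one> m (und Y)"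
    unfolding Lu_ten[OF assms(2) x(1), symmetric] using assms x by (simp add: cmp_assoc)
  show ?thesis
  proof (cases "isM Y")
    case True
    have "Lu m \<bullet> (Id \<one> \<odot> r) = r \<bullet> Lu (m \<otimes> und Y)"
      using Lu_natural[of r] assms x True by (simp add: rty_def)
    from tail[OF this] show ?thesis
      using assms x ty True by (simp add: commuting_def req_def rtens_def cmp_assoc Lu_ten)
  next
    case False
    have "Lu (m \<otimes> und Y) \<bullet> (Id \<one> \<odot> r) = r \<bullet> Lu m"
      using Lu_natural[of r] assms x False by (simp add: rty_def)
    then show ?thesis
      using assms x ty False by (simp add: commuting_def req_def rtens_def cmp_assoc l)
  qed
qed

text \<open>An object as a bimodule over the unit object, and a bimodule with one of its two structures replaced by
that of the unit object.\<close>

definition triv :: "'a \<Rightarrow> ('a, 'b) cell" where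
  "triv x = Cell one_mon (Bi x (lun K x) (run K x)) one_mon"

definition rtriv :: "('a, 'b) cell \<Rightarrow> ('a, 'b) cell" where
  "rtriv d = Cell (lb d) (Bi (car d) (lact (md d)) (run K (car d))) one_mon"

definition ltriv :: "('a, 'b) cell \<Rightarrow> ('a, 'b) cell" where
  "ltriv c = Cell one_mon (Bi (car c) (lun K (car c)) (ract (md c))) (rb c)"

lemma triv_sel [simp]: "lb (triv x) = one_mon" "rb (triv x) = one_mon" "car (triv x) = x"
  "lb (rtriv d) = lb d" "rb (rtriv d) = one_mon" "car (rtriv d) = car d"
  "lb (ltriv c) = one_mon" "rb (ltriv c) = rb c" "car (ltriv c) = car c"
  by (simp_all add: triv_def rtriv_def ltriv_def)

lemma triv_structures [simp]: "la (triv x) = Lu x" "ra (triv x) = Ru x" "la (rtriv d) = la d" "ra (rtriv d) = Ru (car d)"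
  "la (ltriv c) = Lu (car c)" "ra (ltriv c) = ra c"
  by (simp_all add: la_def ra_def triv_def rtriv_def ltriv_def Lu_def Ru_def)

lemma triv_V [simp]: "x \<in> obj K \<Longrightarrow> triv x \<in> obj V" "d \<in> obj V \<Longrightarrow> rtriv d \<in> obj V" "c \<in> obj V \<Longrightarrow> ltriv c \<in> obj V"
  unfolding cell_iff[of "triv x"] cell_iff[of "rtriv d"] cell_iff[of "ltriv c"]
  by (simp_all add: lstruct_one rstruct_one cell_lstruct cell_rstruct commuting_one_right commuting_one_left lty_def rty_def)

lemma Q_triv: "Q c (rtriv d) = Q c d" "Q (ltriv c) d = Q c d"
  by (simp_all add: Q_def bal_arr_def bal_obj_def bal_kind rtriv_def ltriv_def)

text \<open>The two arrows whose coequalizer is taken over the unit object agree by the triangle, so the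
projection is invertible.\<close>

lemma Q_unit_base:
  assumes cd: "c \<rhd> d" and one: "rb c = one_mon"
  obtains j where "invs K (Q c d) j"
proof -
  note cd' [simp] = composableD(1,2)[OF cd]
  have rb: "lb d = one_mon" using composableD(3)[OF cd] one by simp
  have r: "ra c = Ru (car c)"
    using cell_rstruct[OF cd'(1)] one by (simp add: rstruct_def rty_def)
  have l: "la d = Lu (car d)"
    using cell_lstruct[OF cd'(2)] rb by (simp add: lstruct_def lty_def)
  have k: "isM (rb c)" using one by simp
  have ob [simp]: "car c \<in> obj K" "car d \<in> obj K" "car (hob c d) \<in> obj K"
    using cd by simp_all
  have "Id (car c \<otimes> car d) \<bullet> (ra c \<odot> Id (car d)) = Id (car c \<otimes> car d) \<bullet> (Id (car c) \<odot> la d) \<bullet> Asc (car c) (und (rb c)) (car d)"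
    using one by (simp add: r l triangle)
  moreover have "arr K (Id (car c \<otimes> car d))" "src (Id (car c \<otimes> car d)) = car c \<otimes> car d"
    by simp_all
  ultimately obtain j where j0: "arr K j" "src j = car (hob c d)" "tgt j = tgt (Id (car c \<otimes> car d))"
    "j \<bullet> Q c d = Id (car c \<otimes> car d)"
    using Q_factor[OF cd k] by blast
  note j = j0[simplified]
  have "(Q c d \<bullet> j) \<bullet> Q c d = Id (car (hob c d)) \<bullet> Q c d"
    using cd k j by (simp add: cmp_assoc)
  from epicD[OF Q_epic[OF cd k] this] have "Q c d \<bullet> j = Id (car (hob c d))"
    using cd k j by simp
  then have "invs K (Q c d) j"
    using cd k j by (simp add: invs_def)
  then show thesis by (rule that)
qed

lemma invs_Id: "x \<in> obj K \<Longrightarrow> invs K (Id x) (Id x)"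
  by (simp add: invs_def)

lemma invs_U:
  assumes "invs V s t"
  shows "invs K (U s) (U t)"
proof -
  note i = V.invsD[OF assms]
  have "U t \<bullet> U s = U (t \<diamondop> s)" "U s \<bullet> U t = U (s \<diamondop> t)"
    using i(1-4) by simp_all
  then show ?thesis
    unfolding i(5,6) using i(1-4) by (simp add: invs_def)
qed

text \<open>Tensoring with an object of an arbitrary monoidal category need not keep coequalizers epic or
equalizers monic.  Here it does: tensoring with \<open>x\<close> is tensoring over the unit object with \<open>x\<close>,
and compatibility of the associativity isomorphism for the bases \<open>rb c\<close> and \<open>\<one>\<close> writes a composite
that involves \<open>Q c d \<odot> Id x\<close> as a composite of epic, resp. monic, arrows.\<close>

lemma Q_ten_epic:
  assumes cd: "c \<rhd> d" and k: "isM (rb c)" and x: "x \<in> obj K"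
  shows "epic K (Q c d \<odot> Id x)"
proof -
  let ?d = "rtriv d" and ?e = "triv x"
  note cd' [simp] = composableD(1,2)[OF cd]
  have cd2 [simp]: "c \<rhd> ?d" "?d \<rhd> ?e"
    using composableD[OF cd] x by (simp_all add: composable_def)
  obtain i where i: "invs K (Q ?d ?e) i"
    by (rule Q_unit_base[of ?d ?e]) simp_all
  obtain j where j: "invs K (Q (hob c ?d) ?e) j"
    by (rule Q_unit_base[of "hob c ?d" ?e]) simp_all
  have ob [simp]: "car c \<in> obj K" "car d \<in> obj K" using cd' by simp_all
  have kd: "isM (rb ?d)" by simp
  have "epic K (Q c (hob ?d ?e) \<bullet> (Id (car c) \<odot> Q ?d ?e) \<bullet> Asc (car c) (car ?d) (car ?e))"
    using k x
    by (intro epic_cmp Q_epic invs_epic[OF invs_Asc] invs_epic[OF invs_ten[OF invs_Id i]]) simp_all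
  then have "epic K ((U (al c ?d ?e) \<bullet> Q (hob c ?d) ?e) \<bullet> (Q c ?d \<odot> Id (car ?e)))"
    unfolding al_mm[OF cd2 k kd, symmetric] by (simp add: cmp_assoc)
  moreover have "invs K (U (al c ?d ?e) \<bullet> Q (hob c ?d) ?e) (j \<bullet> U (ali c ?d ?e))"
    by (rule invs_cmp[OF invs_U[OF invs_al] j]) simp_all
  ultimately have "epic K (Q c ?d \<odot> Id (car ?e))"
    by (rule epic_iso_cancel)
  then show ?thesis by (simp add: Q_triv)
qed

lemma Q_ten_monic:
  assumes cd: "c \<rhd> d" and k: "\<not> isM (rb c)" and x: "x \<in> obj K"
  shows "monic K (Q c d \<odot> Id x)"
proof -
  let ?d = "rtriv d" and ?e = "triv x"
  note cd' [simp] = composableD(1,2)[OF cd]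
  have cd2 [simp]: "c \<rhd> ?d" "?d \<rhd> ?e"
    using composableD[OF cd] x by (simp_all add: composable_def)
  obtain j where j: "invs K (Q (hob c ?d) ?e) j"
    by (rule Q_unit_base[of "hob c ?d" ?e]) simp_all
  have kd: "isM (rb ?d)" by simp
  have "monic K (Q c (hob ?d ?e) \<bullet> U (al c ?d ?e) \<bullet> Q (hob c ?d) ?e)"
    using k
    by (intro monic_cmp Q_monic invs_monic[OF j] invs_monic[OF invs_U[OF invs_al]]) simp_all
  then have "monic K (((Id (car c) \<odot> Q ?d ?e) \<bullet> Asc (car c) (car ?d) (car ?e)) \<bullet> (Q c ?d \<odot> Id (car ?e)))"
    unfolding al_cm[OF cd2 k kd] by (simp add: cmp_assoc)
  from monic_second[OF this] show ?thesis by (simp add: Q_triv)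
qed

lemma ten_Q_epic:
  assumes cd: "c \<rhd> d" and k: "isM (rb c)" and x: "x \<in> obj K"
  shows "epic K (Id x \<odot> Q c d)"
proof -
  let ?c = "ltriv c" and ?t = "triv x"
  note cd' [simp] = composableD(1,2)[OF cd]
  have cd2 [simp]: "?t \<rhd> ?c" "?c \<rhd> d"
    using composableD[OF cd] x by (simp_all add: composable_def)
  obtain i where i: "invs K (Q ?t ?c) i"
    by (rule Q_unit_base[of ?t ?c]) simp_all
  obtain j where j: "invs K (Q ?t (hob ?c d)) j"
    by (rule Q_unit_base[of ?t "hob ?c d"]) simp_all
  have ob [simp]: "car c \<in> obj K" "car d \<in> obj K" using cd' by simp_all
  have kd: "isM (rb ?t)" "isM (rb ?c)" using k by simp_all
  have "epic K (U (al ?t ?c d) \<bullet> Q (hob ?t ?c) d \<bullet> (Q ?t ?c \<odot> Id (car d)))"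
    using k x
    by (intro epic_cmp Q_epic invs_epic[OF invs_U[OF invs_al]] invs_epic[OF invs_ten[OF i invs_Id]]) simp_all
  then have "epic K (Q ?t (hob ?c d) \<bullet> ((Id (car ?t) \<odot> Q ?c d) \<bullet> Asc (car ?t) (car ?c) (car d)))"
    unfolding al_mm[OF cd2 kd] .
  from epic_first[OF epic_iso_cancel[OF this j]] show ?thesis by (simp add: Q_triv)
qed

lemma ten_Q_monic:
  assumes cd: "c \<rhd> d" and k: "\<not> isM (rb c)" and x: "x \<in> obj K"
  shows "monic K (Id x \<odot> Q c d)"
proof -
  let ?c = "ltriv c" and ?t = "triv x"
  note cd' [simp] = composableD(1,2)[OF cd]
  have cd2 [simp]: "?t \<rhd> ?c" "?c \<rhd> d"
    using composableD[OF cd] x by (simp_all add: composable_def)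
  obtain j where j: "invs K (Q ?t (hob ?c d)) j"
    by (rule Q_unit_base[of ?t "hob ?c d"]) simp_all
  have kd: "isM (rb ?t)" "\<not> isM (rb ?c)" using k by simp_all
  have "monic K (Q (hob ?t ?c) d \<bullet> U (ali ?t ?c d) \<bullet> Q ?t (hob ?c d))"
    using k
    by (intro monic_cmp Q_monic invs_monic[OF j] invs_monic[OF invs_U[OF V.invs_sym[OF invs_al]]]) simp_all
  then have "monic K (((Q ?t ?c \<odot> Id (car d)) \<bullet> Asi (car ?t) (car ?c) (car d)) \<bullet> (Id (car ?t) \<odot> Q ?c d))"
    unfolding al_mc[OF cd2 kd] by (simp add: cmp_assoc)
  from monic_second[OF this] show ?thesis by (simp add: Q_triv)
qed

text \<open>The tests to which all coherence equations below are reduced.  The composite with \<open>m\<close> and \<open>e\<close> serves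
for maps out of a tensor product into a cotensor product.\<close>

lemma V_eq_epic:
  assumes "arr V s" "arr V t" "src s = src t" "tgt s = tgt t" "epic K e" "tgt e = car (src s)" "U s \<bullet> e = U t \<bullet> e"
  shows "s = t"
proof (rule V_eqI[OF assms(1-4)])
  show "U s = U t"
    by (rule epicD[OF assms(5,7)]) (use assms(1,6) in simp_all)
qed

lemma V_eq_monic:
  assumes "arr V s" "arr V t" "src s = src t" "tgt s = tgt t" "monic K m" "src m = car (tgt s)" "m \<bullet> U s = m \<bullet> U t"
  shows "s = t"
proof (rule V_eqI[OF assms(1-4)])
  show "U s = U t"
    by (rule monicD[OF assms(5,7)]) (use assms(1,6) in simp_all)
qed

lemma V_eq_both:
  assumes "arr V s" "arr V t" "src s = src t" "tgt s = tgt t" "monic K m" "src m = car (tgt s)"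
    "epic K e" "tgt e = car (src s)" "m \<bullet> U s \<bullet> e = m \<bullet> U t \<bullet> e"
  shows "s = t"
proof (rule V_eq_epic[OF assms(1-4,7,8)])
  show "U s \<bullet> e = U t \<bullet> e"
    by (rule monicD[OF assms(5,9)]) (use assms epic_arr[OF assms(7)] in simp_all)
qed

section \<open>Coherence\<close>

lemma ali_natural_of_al:
  assumes s: "arr V s" and t: "arr V t" and u: "arr V u" and st: "rb (src s) = lb (src t)" and tu: "rb (src t) = lb (src u)"
    and nat: "al (tgt s) (tgt t) (tgt u) \<diamondop> (s \<star> t \<star> u) = (s \<star> (t \<star> u)) \<diamondop> al (src s) (src t) (src u)"
  shows "ali (tgt s) (tgt t) (tgt u) \<diamondop> (s \<star> (t \<star> u)) = (s \<star> t \<star> u) \<diamondop> ali (src s) (src t) (src u)"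
proof -
  have "ali (tgt s) (tgt t) (tgt u) \<diamondop> ((s \<star> (t \<star> u)) \<diamondop> al (src s) (src t) (src u)) \<diamondop> ali (src s) (src t) (src u)
      = ali (tgt s) (tgt t) (tgt u) \<diamondop> (al (tgt s) (tgt t) (tgt u) \<diamondop> (s \<star> t \<star> u)) \<diamondop> ali (src s) (src t) (src u)"
    by (simp only: nat)
  then show ?thesis
    using s t u st tu V.tail[OF al_arr(3)[of "tgt s" "tgt t" "tgt u"]] by (simp add: V.cmp_assoc)
qed

text \<open>In each of the four cases, compatibility rewrites the associativity isomorphism of bimodules, between
suitable structure maps, into that of the ambient category, which is natural.\<close>

lemma al_natural:
  assumes s: "arr V s" and t: "arr V t" and u: "arr V u" and st: "rb (src s) = lb (src t)" and tu: "rb (src t) = lb (src u)"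
  shows "al (tgt s) (tgt t) (tgt u) \<diamondop> (s \<star> t \<star> u) = (s \<star> (t \<star> u)) \<diamondop> al (src s) (src t) (src u)"
proof -
  let ?c = "src s" and ?d = "src t" and ?e = "src u" and ?c' = "tgt s" and ?d' = "tgt t" and ?e' = "tgt u"
  note [simp] = s t u st tu
  note b [simp] = arr_V_bases[OF s] arr_V_bases[OF t] arr_V_bases[OF u]
  have cd [simp]: "?c \<rhd> ?d" "?d \<rhd> ?e" "?c' \<rhd> ?d'" "?d' \<rhd> ?e'" by simp_all
  have A: "arr K (U s)" "arr K (U t)" "arr K (U u)" by simp_all
  note An = Asc_natural[OF A, simplified] and Ain = Asi_natural[OF A, simplified]
  have stu: "arr V (s \<star> t)" "arr V (t \<star> u)" by simp_all
  show ?thesis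
  proof (cases "isM (rb ?c)"; cases "isM (rb ?d)")
    assume k: "isM (rb ?c)" "isM (rb ?d)"
    have k': "isM (rb ?c')" "isM (rb ?d')" using k by simp_all
    note q = U_hc_tensor[OF s t st k(1)] U_hc_tensor[OF t u tu k(2)]
      U_hc_tensor[OF stu(1) u, simplified, OF k(2)[simplified]] U_hc_tensor[OF s stu(2), simplified, OF k(1)[simplified]]
    note m = al_mm[OF cd(1,2) k] al_mm[OF cd(3,4) k']
    let ?E = "Q (hob ?c ?d) ?e \<bullet> (Q ?c ?d \<odot> Id (car ?e))"
    show ?thesis
    proof (rule V_eq_epic[of _ _ ?E])
      show "epic K ?E"
        using k by (intro epic_cmp Q_epic Q_ten_epic) simp_all
      have "U (al ?c' ?d' ?e' \<diamondop> (s \<star> t \<star> u)) \<bullet> ?E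
          = U (al ?c' ?d' ?e') \<bullet> Q (hob ?c' ?d') ?e' \<bullet> (U (s \<star> t) \<odot> U u) \<bullet> (Q ?c ?d \<odot> Id (car ?e))"
        using tail[OF q(3)] by (simp add: cmp_assoc)
      also have "\<dots> = U (al ?c' ?d' ?e') \<bullet> Q (hob ?c' ?d') ?e' \<bullet> (Q ?c' ?d' \<odot> Id (car ?e')) \<bullet> ((U s \<odot> U t) \<odot> U u)"
        using k by (simp add: merge q(1))
      also have "\<dots> = Q ?c' (hob ?d' ?e') \<bullet> (Id (car ?c') \<odot> Q ?d' ?e') \<bullet> (U s \<odot> (U t \<odot> U u)) \<bullet> Asc (car ?c) (car ?d) (car ?e)"
        using tail3[OF m(2)] An by (simp add: cmp_assoc)
      also have "\<dots> = Q ?c' (hob ?d' ?e') \<bullet> (U s \<odot> U (t \<star> u)) \<bullet> (Id (car ?c) \<odot> Q ?d ?e) \<bullet> Asc (car ?c) (car ?d) (car ?e)"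
        using k by (simp add: merge q(2))
      also have "\<dots> = U (s \<star> (t \<star> u)) \<bullet> Q ?c (hob ?d ?e) \<bullet> (Id (car ?c) \<odot> Q ?d ?e) \<bullet> Asc (car ?c) (car ?d) (car ?e)"
        using tail[OF q(4)] by (simp add: cmp_assoc)
      also have "\<dots> = U ((s \<star> (t \<star> u)) \<diamondop> al ?c ?d ?e) \<bullet> ?E"
        using m(1) by (simp add: cmp_assoc)
      finally show "U (al ?c' ?d' ?e' \<diamondop> (s \<star> t \<star> u)) \<bullet> ?E = U ((s \<star> (t \<star> u)) \<diamondop> al ?c ?d ?e) \<bullet> ?E" .
    qed (use k in simp_all)
  next
    assume k: "\<not> isM (rb ?c)" "isM (rb ?d)"
    have k': "\<not> isM (rb ?c')" "isM (rb ?d')" using k by simp_all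
    note q = U_hc_cotensor[OF s t st k(1)] U_hc_tensor[OF t u tu k(2)]
      U_hc_tensor[OF stu(1) u, simplified, OF k(2)[simplified]] U_hc_cotensor[OF s stu(2), simplified, OF k(1)[simplified]]
    note m = al_cm[OF cd(1,2) k] al_cm[OF cd(3,4) k']
    show ?thesis
    proof (rule V_eq_both[of _ _ "Q ?c' (hob ?d' ?e')" "Q (hob ?c ?d) ?e"])
      show "monic K (Q ?c' (hob ?d' ?e'))" "epic K (Q (hob ?c ?d) ?e)"
        using k by (simp_all add: Q_monic Q_epic)
      have "Q ?c' (hob ?d' ?e') \<bullet> U (al ?c' ?d' ?e' \<diamondop> (s \<star> t \<star> u)) \<bullet> Q (hob ?c ?d) ?e
          = Q ?c' (hob ?d' ?e') \<bullet> U (al ?c' ?d' ?e') \<bullet> Q (hob ?c' ?d') ?e' \<bullet> (U (s \<star> t) \<odot> U u)"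
        using q(3) by (simp add: cmp_assoc)
      also have "\<dots> = (Id (car ?c') \<odot> Q ?d' ?e') \<bullet> Asc (car ?c') (car ?d') (car ?e') \<bullet> ((U s \<odot> U t) \<odot> U u) \<bullet> (Q ?c ?d \<odot> Id (car ?e))"
        using tail3[OF m(2)] k by (simp add: cmp_assoc merge q(1))
      also have "\<dots> = (Id (car ?c') \<odot> Q ?d' ?e') \<bullet> (U s \<odot> (U t \<odot> U u)) \<bullet> Asc (car ?c) (car ?d) (car ?e) \<bullet> (Q ?c ?d \<odot> Id (car ?e))"
        by (simp only: tail[OF An] cmp_assoc)
      also have "\<dots> = (U s \<odot> U (t \<star> u)) \<bullet> (Id (car ?c) \<odot> Q ?d ?e) \<bullet> Asc (car ?c) (car ?d) (car ?e) \<bullet> (Q ?c ?d \<odot> Id (car ?e))"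
        using k by (simp add: merge q(2))
      also have "\<dots> = Q ?c' (hob ?d' ?e') \<bullet> U ((s \<star> (t \<star> u)) \<diamondop> al ?c ?d ?e) \<bullet> Q (hob ?c ?d) ?e"
        using m(1)[symmetric] tail[OF q(4)] by (simp add: cmp_assoc)
      finally show "Q ?c' (hob ?d' ?e') \<bullet> U (al ?c' ?d' ?e' \<diamondop> (s \<star> t \<star> u)) \<bullet> Q (hob ?c ?d) ?e
          = Q ?c' (hob ?d' ?e') \<bullet> U ((s \<star> (t \<star> u)) \<diamondop> al ?c ?d ?e) \<bullet> Q (hob ?c ?d) ?e" .
    qed (use k in simp_all)
  next
    assume k: "\<not> isM (rb ?c)" "\<not> isM (rb ?d)"
    have k': "\<not> isM (rb ?c')" "\<not> isM (rb ?d')" using k by simp_all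
    note q = U_hc_cotensor[OF s t st k(1)] U_hc_cotensor[OF t u tu k(2)]
      U_hc_cotensor[OF stu(1) u, simplified, OF k(2)[simplified]] U_hc_cotensor[OF s stu(2), simplified, OF k(1)[simplified]]
    note m = al_cc[OF cd(1,2) k] al_cc[OF cd(3,4) k']
    let ?E = "(Id (car ?c') \<odot> Q ?d' ?e') \<bullet> Q ?c' (hob ?d' ?e')"
    show ?thesis
    proof (rule V_eq_monic[of _ _ ?E])
      show "monic K ?E"
        using k by (intro monic_cmp Q_monic ten_Q_monic) simp_all
      have "?E \<bullet> U (al ?c' ?d' ?e' \<diamondop> (s \<star> t \<star> u))
          = Asc (car ?c') (car ?d') (car ?e') \<bullet> (Q ?c' ?d' \<odot> Id (car ?e')) \<bullet> Q (hob ?c' ?d') ?e' \<bullet> U (s \<star> t \<star> u)"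
        using tail3[OF m(2)] by (simp add: cmp_assoc)
      also have "\<dots> = Asc (car ?c') (car ?d') (car ?e') \<bullet> ((U s \<odot> U t) \<odot> U u) \<bullet> (Q ?c ?d \<odot> Id (car ?e)) \<bullet> Q (hob ?c ?d) ?e"
        using k by (simp add: merge q(1,3))
      also have "\<dots> = (U s \<odot> (U t \<odot> U u)) \<bullet> (Id (car ?c) \<odot> Q ?d ?e) \<bullet> Q ?c (hob ?d ?e) \<bullet> U (al ?c ?d ?e)"
        using tail[OF An] m(1) by (simp add: cmp_assoc)
      also have "\<dots> = ?E \<bullet> U ((s \<star> (t \<star> u)) \<diamondop> al ?c ?d ?e)"
        using k tail[OF q(4)] by (simp add: cmp_assoc merge q(2))
      finally show "?E \<bullet> U (al ?c' ?d' ?e' \<diamondop> (s \<star> t \<star> u)) = ?E \<bullet> U ((s \<star> (t \<star> u)) \<diamondop> al ?c ?d ?e)" .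
    qed (use k in simp_all)
  next
    assume k: "isM (rb ?c)" "\<not> isM (rb ?d)"
    have k': "isM (rb ?c')" "\<not> isM (rb ?d')" using k by simp_all
    note q = U_hc_tensor[OF s t st k(1)] U_hc_cotensor[OF t u tu k(2)]
      U_hc_cotensor[OF stu(1) u, simplified, OF k(2)[simplified]] U_hc_tensor[OF s stu(2), simplified, OF k(1)[simplified]]
    note m = al_mc[OF cd(1,2) k] al_mc[OF cd(3,4) k']
    \<comment> \<open>Here compatibility speaks of the inverse, so naturality of the inverse comes first.\<close>
    have "ali ?c' ?d' ?e' \<diamondop> (s \<star> (t \<star> u)) = (s \<star> t \<star> u) \<diamondop> ali ?c ?d ?e"
    proof (rule V_eq_both[of _ _ "Q (hob ?c' ?d') ?e'" "Q ?c (hob ?d ?e)"])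
      show "monic K (Q (hob ?c' ?d') ?e')" "epic K (Q ?c (hob ?d ?e))"
        using k by (simp_all add: Q_monic Q_epic)
      have "Q (hob ?c' ?d') ?e' \<bullet> U (ali ?c' ?d' ?e' \<diamondop> (s \<star> (t \<star> u))) \<bullet> Q ?c (hob ?d ?e)
          = Q (hob ?c' ?d') ?e' \<bullet> U (ali ?c' ?d' ?e') \<bullet> Q ?c' (hob ?d' ?e') \<bullet> (U s \<odot> U (t \<star> u))"
        using q(4) by (simp add: cmp_assoc)
      also have "\<dots> = (Q ?c' ?d' \<odot> Id (car ?e')) \<bullet> Asi (car ?c') (car ?d') (car ?e') \<bullet> (U s \<odot> (U t \<odot> U u)) \<bullet> (Id (car ?c) \<odot> Q ?d ?e)"
        using tail3[OF m(2)] k by (simp add: cmp_assoc merge q(2))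
      also have "\<dots> = (Q ?c' ?d' \<odot> Id (car ?e')) \<bullet> ((U s \<odot> U t) \<odot> U u) \<bullet> Asi (car ?c) (car ?d) (car ?e) \<bullet> (Id (car ?c) \<odot> Q ?d ?e)"
        by (simp only: tail[OF Ain] cmp_assoc)
      also have "\<dots> = (U (s \<star> t) \<odot> U u) \<bullet> (Q ?c ?d \<odot> Id (car ?e)) \<bullet> Asi (car ?c) (car ?d) (car ?e) \<bullet> (Id (car ?c) \<odot> Q ?d ?e)"
        using k by (simp add: merge q(1))
      also have "\<dots> = Q (hob ?c' ?d') ?e' \<bullet> U ((s \<star> t \<star> u) \<diamondop> ali ?c ?d ?e) \<bullet> Q ?c (hob ?d ?e)"
        using m(1)[symmetric] tail[OF q(3)] by (simp add: cmp_assoc)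
      finally show "Q (hob ?c' ?d') ?e' \<bullet> U (ali ?c' ?d' ?e' \<diamondop> (s \<star> (t \<star> u))) \<bullet> Q ?c (hob ?d ?e)
          = Q (hob ?c' ?d') ?e' \<bullet> U ((s \<star> t \<star> u) \<diamondop> ali ?c ?d ?e) \<bullet> Q ?c (hob ?d ?e)" .
    qed (use k in simp_all)
    then have "al ?c' ?d' ?e' \<diamondop> (ali ?c' ?d' ?e' \<diamondop> (s \<star> (t \<star> u))) \<diamondop> al ?c ?d ?e
        = al ?c' ?d' ?e' \<diamondop> ((s \<star> t \<star> u) \<diamondop> ali ?c ?d ?e) \<diamondop> al ?c ?d ?e"
      by simp
    then show ?thesis
      using V.tail[OF al_arr(4)[OF cd(3,4)]] by (simp add: V.cmp_assoc)
  qed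
qed

lemmas ali_natural = ali_natural_of_al[OF _ _ _ _ _ al_natural]

text \<open>The pentagon of the ambient category with two of its sides inverted, as the pentagons for alternating
bases contain them.\<close>

lemma pentagon_left:
  assumes "w \<in> obj K" "x \<in> obj K" "y \<in> obj K" "z \<in> obj K"
  shows "Asi w x (y \<otimes> z) \<bullet> (Id w \<odot> Asc x y z) \<bullet> Asc w (x \<otimes> y) z = Asc (w \<otimes> x) y z \<bullet> (Asi w x y \<odot> Id z)"
proof -
  have "Asi w x (y \<otimes> z) \<bullet> (Asc w x (y \<otimes> z) \<bullet> Asc (w \<otimes> x) y z) \<bullet> (Asi w x y \<odot> Id z)
      = Asi w x (y \<otimes> z) \<bullet> ((Id w \<odot> Asc x y z) \<bullet> Asc w (x \<otimes> y) z \<bullet> (Asc w x y \<odot> Id z)) \<bullet> (Asi w x y \<odot> Id z)"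
    by (simp only: pentagon[OF assms])
  then show ?thesis
    using assms by (simp add: cmp_assoc interchange)
qed

lemma pentagon_right:
  assumes "w \<in> obj K" "x \<in> obj K" "y \<in> obj K" "z \<in> obj K"
  shows "Asc w (x \<otimes> y) z \<bullet> (Asc w x y \<odot> Id z) \<bullet> Asi (w \<otimes> x) y z = (Id w \<odot> Asi x y z) \<bullet> Asc w x (y \<otimes> z)"
proof -
  have "(Id w \<odot> Asi x y z) \<bullet> (Asc w x (y \<otimes> z) \<bullet> Asc (w \<otimes> x) y z) \<bullet> Asi (w \<otimes> x) y z
      = (Id w \<odot> Asi x y z) \<bullet> ((Id w \<odot> Asc x y z) \<bullet> Asc w (x \<otimes> y) z \<bullet> (Asc w x y \<odot> Id z)) \<bullet> Asi (w \<otimes> x) y z"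
    by (simp only: pentagon[OF assms])
  then show ?thesis
    using assms by (simp add: cmp_assoc interchange')
qed

text \<open>The pentagon for four bimodules over bases that alternate between monoids and comonoids.  It is written
with the inverses of those associativity isomorphisms for which compatibility speaks of the inverse, so
that both sides go from a tensor product over \<open>rb c\<close> and \<open>rb e\<close> to a cotensor product over \<open>rb d\<close>.\<close>

lemma pentagon_mcm:
  assumes cd: "c \<rhd> d" and de: "d \<rhd> e" and ef: "e \<rhd> f"
    and k: "isM (rb c)" "\<not> isM (rb d)" "isM (rb e)"
  shows "ali c d (hob e f) \<diamondop> (idt V c \<star> al d e f) \<diamondop> al c (hob d e) f = al (hob c d) e f \<diamondop> (ali c d e \<star> idt V f)"
proof -
  note cells = composableD[OF cd] composableD[OF de] composableD[OF ef]
  note [simp] = cd de ef cells(1,2,4,5,7,8)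
  let ?c = "car c" and ?d = "car d" and ?e = "car e" and ?f = "car f"
  have ob: "?c \<in> obj K" "?d \<in> obj K" "?e \<in> obj K" "?f \<in> obj K" by simp_all
  have bs [simp]: "rb c = lb d" "rb d = lb e" "rb e = lb f" by (rule cells)+
  have k' [simp]: "isM (lb d)" "\<not> isM (lb e)" "isM (lb f)" using k by simp_all
  have ci: "arr V (idt V c)" "arr V (idt V f)" "arr V (al d e f)" "arr V (ali c d e)" by simp_all
  have q1: "U (idt V c \<star> al d e f) \<bullet> Q c (hob (hob d e) f) = Q c (hob d (hob e f)) \<bullet> (Id ?c \<odot> U (al d e f))"
    using U_hc_tensor[of "idt V c" "al d e f"] by simp
  have q2: "U (ali c d e \<star> idt V f) \<bullet> Q (hob c (hob d e)) f = Q (hob (hob c d) e) f \<bullet> (U (ali c d e) \<odot> Id ?f)"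
    using U_hc_tensor[of "ali c d e" "idt V f"] by simp
  have m1: "U (al c (hob d e) f) \<bullet> Q (hob c (hob d e)) f \<bullet> (Q c (hob d e) \<odot> Id ?f)
      = Q c (hob (hob d e) f) \<bullet> (Id ?c \<odot> Q (hob d e) f) \<bullet> Asc ?c (car (hob d e)) ?f"
    by (rule al_mm) simp_all
  have m2: "Q (hob c d) (hob e f) \<bullet> U (ali c d (hob e f)) \<bullet> Q c (hob d (hob e f))
      = (Q c d \<odot> Id (car (hob e f))) \<bullet> Asi ?c ?d (car (hob e f)) \<bullet> (Id ?c \<odot> Q d (hob e f))"
    by (rule al_mc) simp_all
  have m3: "Q d (hob e f) \<bullet> U (al d e f) \<bullet> Q (hob d e) f = (Id ?d \<odot> Q e f) \<bullet> Asc ?d ?e ?f \<bullet> (Q d e \<odot> Id ?f)"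
    by (rule al_cm) simp_all
  have m4: "Q (hob c d) (hob e f) \<bullet> U (al (hob c d) e f) \<bullet> Q (hob (hob c d) e) f
      = (Id (car (hob c d)) \<odot> Q e f) \<bullet> Asc (car (hob c d)) ?e ?f \<bullet> (Q (hob c d) e \<odot> Id ?f)"
    by (rule al_cm) simp_all
  have m5: "Q (hob c d) e \<bullet> U (ali c d e) \<bullet> Q c (hob d e) = (Q c d \<odot> Id ?e) \<bullet> Asi ?c ?d ?e \<bullet> (Id ?c \<odot> Q d e)"
    by (rule al_mc) simp_all
  have n1: "Asi ?c ?d (car (hob e f)) \<bullet> (Id ?c \<odot> (Id ?d \<odot> Q e f)) = ((Id ?c \<odot> Id ?d) \<odot> Q e f) \<bullet> Asi ?c ?d (?e \<otimes> ?f)"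
    using Asi_natural[of "Id ?c" "Id ?d" "Q e f"] by simp
  have n2: "(Id ?c \<odot> (Q d e \<odot> Id ?f)) \<bullet> Asc ?c (car (hob d e)) ?f = Asc ?c (?d \<otimes> ?e) ?f \<bullet> ((Id ?c \<odot> Q d e) \<odot> Id ?f)"
    using Asc_natural[of "Id ?c" "Q d e" "Id ?f"] by simp
  have n3: "Asc (car (hob c d)) ?e ?f \<bullet> ((Q c d \<odot> Id ?e) \<odot> Id ?f) = (Q c d \<odot> (Id ?e \<odot> Id ?f)) \<bullet> Asc (?c \<otimes> ?d) ?e ?f"
    using Asc_natural[of "Q c d" "Id ?e" "Id ?f"] by simp
  let ?m = "Q (hob c d) (hob e f)" and ?E = "Q (hob c (hob d e)) f \<bullet> (Q c (hob d e) \<odot> Id ?f)"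
  show ?thesis
  proof (rule V_eq_both[of _ _ ?m ?E])
    show "monic K ?m" "epic K ?E"
      by (simp add: Q_monic) (intro epic_cmp Q_epic Q_ten_epic; simp)
    have "?m \<bullet> U (ali c d (hob e f) \<diamondop> (idt V c \<star> al d e f) \<diamondop> al c (hob d e) f) \<bullet> ?E
        = ?m \<bullet> U (ali c d (hob e f)) \<bullet> U (idt V c \<star> al d e f) \<bullet> Q c (hob (hob d e) f) \<bullet> (Id ?c \<odot> Q (hob d e) f) \<bullet> Asc ?c (car (hob d e)) ?f"
      using m1 by (simp add: cmp_assoc)
    also have "\<dots> = ?m \<bullet> U (ali c d (hob e f)) \<bullet> Q c (hob d (hob e f)) \<bullet> (Id ?c \<odot> (U (al d e f) \<bullet> Q (hob d e) f)) \<bullet> Asc ?c (car (hob d e)) ?f"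
      using tail[OF q1] by (simp add: cmp_assoc merge)
    also have "\<dots> = (Q c d \<odot> Id (car (hob e f))) \<bullet> Asi ?c ?d (car (hob e f)) \<bullet> (Id ?c \<odot> (Q d (hob e f) \<bullet> U (al d e f) \<bullet> Q (hob d e) f)) \<bullet> Asc ?c (car (hob d e)) ?f"
      using tail3[OF m2] by (simp add: cmp_assoc merge)
    also have "\<dots> = (Q c d \<odot> Id (car (hob e f))) \<bullet> Asi ?c ?d (car (hob e f)) \<bullet> (Id ?c \<odot> (Id ?d \<odot> Q e f)) \<bullet>
        (Id ?c \<odot> Asc ?d ?e ?f) \<bullet> (Id ?c \<odot> (Q d e \<odot> Id ?f)) \<bullet> Asc ?c (car (hob d e)) ?f"
      by (simp add: m3 merge)
    also have "\<dots> = (Q c d \<odot> Id (car (hob e f))) \<bullet> ((Id ?c \<odot> Id ?d) \<odot> Q e f) \<bullet> Asi ?c ?d (?e \<otimes> ?f) \<bullet> (Id ?c \<odot> Asc ?d ?e ?f) \<bullet>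
        Asc ?c (?d \<otimes> ?e) ?f \<bullet> ((Id ?c \<odot> Q d e) \<odot> Id ?f)"
      by (simp only: tail[OF n1] n2 cmp_assoc)
    also have "\<dots> = (Q c d \<odot> Q e f) \<bullet> Asi ?c ?d (?e \<otimes> ?f) \<bullet> (Id ?c \<odot> Asc ?d ?e ?f) \<bullet> Asc ?c (?d \<otimes> ?e) ?f \<bullet> ((Id ?c \<odot> Q d e) \<odot> Id ?f)"
      by (simp add: merge)
    also have "\<dots> = (Q c d \<odot> Q e f) \<bullet> Asc (?c \<otimes> ?d) ?e ?f \<bullet> (Asi ?c ?d ?e \<odot> Id ?f) \<bullet> ((Id ?c \<odot> Q d e) \<odot> Id ?f)"
      using tail3[OF pentagon_left[OF ob]] by (simp add: cmp_assoc)
    also have "\<dots> = (Id (car (hob c d)) \<odot> Q e f) \<bullet> (Q c d \<odot> (Id ?e \<odot> Id ?f)) \<bullet> Asc (?c \<otimes> ?d) ?e ?f \<bullet> (Asi ?c ?d ?e \<odot> Id ?f) \<bullet> ((Id ?c \<odot> Q d e) \<odot> Id ?f)"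
      by (simp add: merge)
    also have "\<dots> = (Id (car (hob c d)) \<odot> Q e f) \<bullet> Asc (car (hob c d)) ?e ?f \<bullet> ((Q c d \<odot> Id ?e) \<odot> Id ?f) \<bullet> (Asi ?c ?d ?e \<odot> Id ?f) \<bullet> ((Id ?c \<odot> Q d e) \<odot> Id ?f)"
      by (simp only: tail[OF n3] cmp_assoc)
    also have "\<dots> = (Id (car (hob c d)) \<odot> Q e f) \<bullet> Asc (car (hob c d)) ?e ?f \<bullet> ((Q (hob c d) e \<bullet> U (ali c d e) \<bullet> Q c (hob d e)) \<odot> Id ?f)"
      by (simp add: m5 merge)
    also have "\<dots> = ?m \<bullet> U (al (hob c d) e f) \<bullet> Q (hob (hob c d) e) f \<bullet> ((U (ali c d e) \<bullet> Q c (hob d e)) \<odot> Id ?f)"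
      using tail3[OF m4] by (simp add: cmp_assoc merge)
    also have "\<dots> = ?m \<bullet> U (al (hob c d) e f \<diamondop> (ali c d e \<star> idt V f)) \<bullet> ?E"
      using tail[OF q2] by (simp add: cmp_assoc merge)
    finally show "?m \<bullet> U (ali c d (hob e f) \<diamondop> (idt V c \<star> al d e f) \<diamondop> al c (hob d e) f) \<bullet> ?E
        = ?m \<bullet> U (al (hob c d) e f \<diamondop> (ali c d e \<star> idt V f)) \<bullet> ?E" .
  qed simp_all
qed

lemma pentagon_cmc:
  assumes cd: "c \<rhd> d" and de: "d \<rhd> e" and ef: "e \<rhd> f"
    and k: "\<not> isM (rb c)" "isM (rb d)" "\<not> isM (rb e)"
  shows "(idt V c \<star> ali d e f) \<diamondop> al c d (hob e f) = al c (hob d e) f \<diamondop> (al c d e \<star> idt V f) \<diamondop> ali (hob c d) e f"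
proof -
  note cells = composableD[OF cd] composableD[OF de] composableD[OF ef]
  note [simp] = cd de ef cells(1,2,4,5,7,8)
  let ?c = "car c" and ?d = "car d" and ?e = "car e" and ?f = "car f"
  have ob: "?c \<in> obj K" "?d \<in> obj K" "?e \<in> obj K" "?f \<in> obj K" by simp_all
  have bs [simp]: "rb c = lb d" "rb d = lb e" "rb e = lb f" by (rule cells)+
  have k' [simp]: "\<not> isM (lb d)" "isM (lb e)" "\<not> isM (lb f)" using k by simp_all
  have q1: "Q c (hob (hob d e) f) \<bullet> U (idt V c \<star> ali d e f) = (Id ?c \<odot> U (ali d e f)) \<bullet> Q c (hob d (hob e f))"
    using U_hc_cotensor[of "idt V c" "ali d e f"] by simp
  have q2: "Q (hob c (hob d e)) f \<bullet> U (al c d e \<star> idt V f) = (U (al c d e) \<odot> Id ?f) \<bullet> Q (hob (hob c d) e) f"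
    using U_hc_cotensor[of "al c d e" "idt V f"] by simp
  have m1: "(Id ?c \<odot> Q (hob d e) f) \<bullet> Q c (hob (hob d e) f) \<bullet> U (al c (hob d e) f)
      = Asc ?c (car (hob d e)) ?f \<bullet> (Q c (hob d e) \<odot> Id ?f) \<bullet> Q (hob c (hob d e)) f"
    by (rule al_cc) simp_all
  have m2: "Q c (hob d (hob e f)) \<bullet> U (al c d (hob e f)) \<bullet> Q (hob c d) (hob e f)
      = (Id ?c \<odot> Q d (hob e f)) \<bullet> Asc ?c ?d (car (hob e f)) \<bullet> (Q c d \<odot> Id (car (hob e f)))"
    by (rule al_cm) simp_all
  have m3: "Q (hob d e) f \<bullet> U (ali d e f) \<bullet> Q d (hob e f) = (Q d e \<odot> Id ?f) \<bullet> Asi ?d ?e ?f \<bullet> (Id ?d \<odot> Q e f)"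
    by (rule al_mc) simp_all
  have m4: "Q (hob (hob c d) e) f \<bullet> U (ali (hob c d) e f) \<bullet> Q (hob c d) (hob e f)
      = (Q (hob c d) e \<odot> Id ?f) \<bullet> Asi (car (hob c d)) ?e ?f \<bullet> (Id (car (hob c d)) \<odot> Q e f)"
    by (rule al_mc) simp_all
  have m5: "Q c (hob d e) \<bullet> U (al c d e) \<bullet> Q (hob c d) e = (Id ?c \<odot> Q d e) \<bullet> Asc ?c ?d ?e \<bullet> (Q c d \<odot> Id ?e)"
    by (rule al_cm) simp_all
  have n1: "(Id ?c \<odot> (Id ?d \<odot> Q e f)) \<bullet> Asc ?c ?d (car (hob e f)) = Asc ?c ?d (?e \<otimes> ?f) \<bullet> ((Id ?c \<odot> Id ?d) \<odot> Q e f)"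
    using Asc_natural[of "Id ?c" "Id ?d" "Q e f"] by simp
  have n2: "Asc ?c (car (hob d e)) ?f \<bullet> ((Id ?c \<odot> Q d e) \<odot> Id ?f) = (Id ?c \<odot> (Q d e \<odot> Id ?f)) \<bullet> Asc ?c (?d \<otimes> ?e) ?f"
    using Asc_natural[of "Id ?c" "Q d e" "Id ?f"] by simp
  have n3: "Asi (?c \<otimes> ?d) ?e ?f \<bullet> (Q c d \<odot> (Id ?e \<odot> Id ?f)) = ((Q c d \<odot> Id ?e) \<odot> Id ?f) \<bullet> Asi (car (hob c d)) ?e ?f"
    using Asi_natural[of "Q c d" "Id ?e" "Id ?f"] by simp
  let ?e' = "Q (hob c d) (hob e f)" and ?M = "(Id ?c \<odot> Q (hob d e) f) \<bullet> Q c (hob (hob d e) f)"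
  show ?thesis
  proof (rule V_eq_both[of _ _ ?M ?e'])
    show "monic K ?M" "epic K ?e'"
      by (intro monic_cmp Q_monic ten_Q_monic; simp) (simp add: Q_epic)
    have "?M \<bullet> U ((idt V c \<star> ali d e f) \<diamondop> al c d (hob e f)) \<bullet> ?e'
        = (Id ?c \<odot> (Q (hob d e) f \<bullet> U (ali d e f))) \<bullet> Q c (hob d (hob e f)) \<bullet> U (al c d (hob e f)) \<bullet> ?e'"
      using tail[OF q1] by (simp add: cmp_assoc merge)
    also have "\<dots> = (Id ?c \<odot> (Q (hob d e) f \<bullet> U (ali d e f) \<bullet> Q d (hob e f))) \<bullet> Asc ?c ?d (car (hob e f)) \<bullet> (Q c d \<odot> Id (car (hob e f)))"
      by (simp add: m2 cmp_assoc merge)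
    also have "\<dots> = (Id ?c \<odot> (Q d e \<odot> Id ?f)) \<bullet> (Id ?c \<odot> Asi ?d ?e ?f) \<bullet> (Id ?c \<odot> (Id ?d \<odot> Q e f)) \<bullet> Asc ?c ?d (car (hob e f)) \<bullet> (Q c d \<odot> Id (car (hob e f)))"
      by (simp add: m3 merge)
    also have "\<dots> = (Id ?c \<odot> (Q d e \<odot> Id ?f)) \<bullet> (Id ?c \<odot> Asi ?d ?e ?f) \<bullet> Asc ?c ?d (?e \<otimes> ?f) \<bullet> ((Id ?c \<odot> Id ?d) \<odot> Q e f) \<bullet> (Q c d \<odot> Id (car (hob e f)))"
      by (simp only: tail[OF n1] cmp_assoc)
    also have "\<dots> = (Id ?c \<odot> (Q d e \<odot> Id ?f)) \<bullet> (Id ?c \<odot> Asi ?d ?e ?f) \<bullet> Asc ?c ?d (?e \<otimes> ?f) \<bullet> (Q c d \<odot> Q e f)"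
      by (simp add: merge)
    also have "\<dots> = (Id ?c \<odot> (Q d e \<odot> Id ?f)) \<bullet> Asc ?c (?d \<otimes> ?e) ?f \<bullet> (Asc ?c ?d ?e \<odot> Id ?f) \<bullet> Asi (?c \<otimes> ?d) ?e ?f \<bullet> (Q c d \<odot> Q e f)"
      using tail3[OF pentagon_right[OF ob]] tail[OF pentagon_right[OF ob, symmetric]] by (simp add: cmp_assoc)
    also have "\<dots> = (Id ?c \<odot> (Q d e \<odot> Id ?f)) \<bullet> Asc ?c (?d \<otimes> ?e) ?f \<bullet> (Asc ?c ?d ?e \<odot> Id ?f) \<bullet> Asi (?c \<otimes> ?d) ?e ?f \<bullet>
        (Q c d \<odot> (Id ?e \<odot> Id ?f)) \<bullet> (Id (car (hob c d)) \<odot> Q e f)"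
      by (simp add: merge)
    also have "\<dots> = Asc ?c (car (hob d e)) ?f \<bullet> ((Id ?c \<odot> Q d e) \<odot> Id ?f) \<bullet> (Asc ?c ?d ?e \<odot> Id ?f) \<bullet> ((Q c d \<odot> Id ?e) \<odot> Id ?f) \<bullet>
        Asi (car (hob c d)) ?e ?f \<bullet> (Id (car (hob c d)) \<odot> Q e f)"
      by (simp only: tail[OF n3] tail[OF n2] cmp_assoc)
    also have "\<dots> = Asc ?c (car (hob d e)) ?f \<bullet> ((Q c (hob d e) \<bullet> U (al c d e) \<bullet> Q (hob c d) e) \<odot> Id ?f) \<bullet>
        Asi (car (hob c d)) ?e ?f \<bullet> (Id (car (hob c d)) \<odot> Q e f)"
      by (simp add: m5 merge)
    also have "\<dots> = Asc ?c (car (hob d e)) ?f \<bullet> ((Q c (hob d e) \<bullet> U (al c d e)) \<odot> Id ?f) \<bullet> Q (hob (hob c d) e) f \<bullet> U (ali (hob c d) e f) \<bullet> ?e'"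
      by (simp add: m4 cmp_assoc merge)
    also have "\<dots> = ?M \<bullet> U (al c (hob d e) f \<diamondop> (al c d e \<star> idt V f) \<diamondop> ali (hob c d) e f) \<bullet> ?e'"
      using tail[OF q2] tail3[OF m1] by (simp add: cmp_assoc merge)
    finally show "?M \<bullet> U ((idt V c \<star> ali d e f) \<diamondop> al c d (hob e f)) \<bullet> ?e'
        = ?M \<bullet> U (al c (hob d e) f \<diamondop> (al c d e \<star> idt V f) \<diamondop> ali (hob c d) e f) \<bullet> ?e'" .
  qed simp_all
qed

section \<open>Unit bimodules\<close>

text \<open>The unit \<open>1\<close>-cell: a (co)monoid as a bi(co)module over itself.\<close>

definition reg :: "('a, 'b) comon \<Rightarrow> ('a, 'b) cell" where
  "reg X = Cell X (regular X) X"

lemma reg_sel [simp]: "lb (reg X) = X" "rb (reg X) = X" "md (reg X) = regular X" "carr (regular X) = und X"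
  "la (reg X) = mu X" "ra (reg X) = mu X"
  by (simp_all add: reg_def regular_def la_def ra_def mu_def)

lemma mu_ty [simp]: "X \<in> bases \<Longrightarrow> lty X (und X) (mu X)" "X \<in> bases \<Longrightarrow> rty X (und X) (mu X)"
  by (simp_all add: lty_def rty_def)

lemma reg_V [simp]: "X \<in> bases \<Longrightarrow> reg X \<in> obj V"
proof -
  assume X: "X \<in> bases"
  note m = monoid_laws[OF X] and c = comonoid_laws[OF X]
  have ty: "rty X (und X \<otimes> und X) (rtens X (mu X) (und X) (und X))"
    using X by simp
  have "lstruct X (und X) (mu X)" "rstruct X (und X) (mu X)"
    using X m c by (cases "isM X"; simp add: lstruct_def rstruct_def)+
  moreover have "commuting X X (und X) (mu X) (mu X)"
  proof (cases "isM X")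
    case True
    then show ?thesis
      using X m ty by (simp add: commuting_def req_def rtens_def cmp_assoc)
  next
    case False
    have "Asi (und X) (und X) (und X) \<bullet> (Id (und X) \<odot> mu X) \<bullet> mu X = (mu X \<odot> Id (und X)) \<bullet> mu X"
      unfolding c(1)[OF False, symmetric] using X False by simp
    then show ?thesis
      using X False ty by (simp add: commuting_def req_def rtens_def cmp_assoc)
  qed
  ultimately show ?thesis
    unfolding cell_iff using X by simp
qed

lemma reg_composable [simp]: "d \<in> obj V \<Longrightarrow> reg (lb d) \<rhd> d" "c \<in> obj V \<Longrightarrow> c \<rhd> reg (rb c)"
  by (simp_all add: composable_def)

lemma la_leq:
  "d \<in> obj V \<Longrightarrow> isM (lb d) \<Longrightarrow> leq (lb d) (ltens (lb d) (mu (lb d)) (und (lb d)) (car d)) (la d) (la d)"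
  "d \<in> obj V \<Longrightarrow> \<not> isM (lb d) \<Longrightarrow> leq (lb d) (la d) (ltens (lb d) (mu (lb d)) (und (lb d)) (car d)) (la d)"
proof -
  assume d [simp]: "d \<in> obj V"
  let ?X = "lb d"
  have ty: "lty ?X (und ?X \<otimes> car d) (ltens ?X (mu ?X) (und ?X) (car d))" "lty ?X (car d) (la d)" by simp_all
  show "leq ?X (ltens ?X (mu ?X) (und ?X) (car d)) (la d) (la d)" if k: "isM ?X"
  proof -
    have "la d \<bullet> (mu ?X \<odot> Id (car d)) = la d \<bullet> (Id (und ?X) \<odot> la d) \<bullet> Asc (und ?X) (und ?X) (car d)"
      using cell_lstruct[OF d] k by (simp add: lstruct_def)
    from tail[OF this] show ?thesis
      using ty k by (simp add: leq_def ltens_def cmp_assoc)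
  qed
  show "leq ?X (la d) (ltens ?X (mu ?X) (und ?X) (car d)) (la d)" if k: "\<not> isM ?X"
    using ty k cell_lstruct[OF d] by (simp add: leq_def ltens_def lstruct_def cmp_assoc)
qed

lemma ra_req:
  "c \<in> obj V \<Longrightarrow> isM (rb c) \<Longrightarrow> req (rb c) (rtens (rb c) (mu (rb c)) (car c) (und (rb c))) (ra c) (ra c)"
  "c \<in> obj V \<Longrightarrow> \<not> isM (rb c) \<Longrightarrow> req (rb c) (ra c) (rtens (rb c) (mu (rb c)) (car c) (und (rb c))) (ra c)"
proof -
  assume c [simp]: "c \<in> obj V"
  let ?Y = "rb c"
  have ty: "rty ?Y (car c \<otimes> und ?Y) (rtens ?Y (mu ?Y) (car c) (und ?Y))" "rty ?Y (car c) (ra c)" by simp_all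
  show "req ?Y (rtens ?Y (mu ?Y) (car c) (und ?Y)) (ra c) (ra c)" if k: "isM ?Y"
    using ty k cell_rstruct[OF c] by (simp add: req_def rtens_def rstruct_def cmp_assoc)
  show "req ?Y (ra c) (rtens ?Y (mu ?Y) (car c) (und ?Y)) (ra c)" if k: "\<not> isM ?Y"
  proof -
    have "Asc (car c) (und ?Y) (und ?Y) \<bullet> (ra c \<odot> Id (und ?Y)) \<bullet> ra c = (Id (car c) \<odot> mu ?Y) \<bullet> ra c"
      using cell_rstruct[OF c] k by (simp add: rstruct_def)
    then have "Asi (car c) (und ?Y) (und ?Y) \<bullet> Asc (car c) (und ?Y) (und ?Y) \<bullet> (ra c \<odot> Id (und ?Y)) \<bullet> ra c
        = Asi (car c) (und ?Y) (und ?Y) \<bullet> (Id (car c) \<odot> mu ?Y) \<bullet> ra c"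
      by simp
    then show ?thesis
      using ty k by (simp add: req_def rtens_def cmp_assoc)
  qed
qed

text \<open>The unit maps go out of the tensor product over a monoid, but into the cotensor product over a
  comonoid.\<close>

definition lu :: "('a, 'b) cell \<Rightarrow> (('a, 'b) cell, 'b) tarr" where
  "lu d = (if isM (lb d) then Arr (hob (reg (lb d)) d) (tensor_unit_left K (lb d) (md d)) d
     else Arr d (cotensor_unit_left K (lb d) (md d)) (hob (reg (lb d)) d))"

definition ru :: "('a, 'b) cell \<Rightarrow> (('a, 'b) cell, 'b) tarr" where
  "ru c = (if isM (rb c) then Arr (hob c (reg (rb c))) (tensor_unit_right K (rb c) (md c)) c
     else Arr c (cotensor_unit_right K (rb c) (md c)) (hob c (reg (rb c))))"

lemma src_lu [simp]: "src (lu d) = (if isM (lb d) then hob (reg (lb d)) d else d)"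
  and tgt_lu [simp]: "tgt (lu d) = (if isM (lb d) then d else hob (reg (lb d)) d)"
  and src_ru [simp]: "src (ru c) = (if isM (rb c) then hob c (reg (rb c)) else c)"
  and tgt_ru [simp]: "tgt (ru c) = (if isM (rb c) then c else hob c (reg (rb c)))"
  by (simp_all add: lu_def ru_def)

text \<open>The unit isomorphisms are defined by definite descriptions; this identifies them with arrows obtained
from the universal property.\<close>

lemma tensor_unit_raw:
  assumes cd: "c \<rhd> d" and k: "isM (rb c)" and q: "arr K q" "src q = car (hob c d)" "q \<bullet> Q c d = h"
  shows "(THE f. f \<in> hom K (bal_obj K (rb c) (md c) (md d)) (tgt h) \<and> f \<cdot> bal_arr K (rb c) (md c) (md d) = raw h) = raw q"
proof (rule the_equality)
  have t: "tgt q = tgt h" "raw q \<cdot> bal_arr K (rb c) (md c) (md d) = raw h"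
    unfolding q(3)[symmetric] using cd k q(1,2) by simp_all
  show "raw q \<in> hom K (bal_obj K (rb c) (md c) (md d)) (tgt h) \<and> raw q \<cdot> bal_arr K (rb c) (md c) (md d) = raw h"
    using t arr_raw[OF q(1)] q(2) by (simp add: car_hob)
  fix f assume f: "f \<in> hom K (bal_obj K (rb c) (md c) (md d)) (tgt h) \<and> f \<cdot> bal_arr K (rb c) (md c) (md d) = raw h"
  let ?f = "Arr (car (hob c d)) f (tgt h)"
  have a: "arr K ?f"
    using f cd arr_tgt[OF q(1)] t by (simp add: car_hob[symmetric])
  have "?f \<bullet> Q c d = q \<bullet> Q c d"
    using a f q(1,2) t k cd by (intro tarr_eqI[of K]) simp_all
  from epicD[OF Q_epic[OF cd k] this a] have "?f = q"
    using k by simp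
  then show "f = raw q" by auto
qed

lemma cotensor_unit_raw:
  assumes cd: "c \<rhd> d" and k: "\<not> isM (rb c)" and q: "arr K q" "tgt q = car (hob c d)" "Q c d \<bullet> q = h"
  shows "(THE f. f \<in> hom K (src h) (bal_obj K (rb c) (md c) (md d)) \<and> bal_arr K (rb c) (md c) (md d) \<cdot> f = raw h) = raw q"
proof (rule the_equality)
  have t: "src q = src h" "bal_arr K (rb c) (md c) (md d) \<cdot> raw q = raw h"
    unfolding q(3)[symmetric] using cd k q(1,2) by simp_all
  show "raw q \<in> hom K (src h) (bal_obj K (rb c) (md c) (md d)) \<and> bal_arr K (rb c) (md c) (md d) \<cdot> raw q = raw h"
    using t arr_raw[OF q(1)] q(2) by (simp add: car_hob)
  fix f assume f: "f \<in> hom K (src h) (bal_obj K (rb c) (md c) (md d)) \<and> bal_arr K (rb c) (md c) (md d) \<cdot> f = raw h"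
  let ?f = "Arr (src h) f (car (hob c d))"
  have a: "arr K ?f"
    using f cd arr_src[OF q(1)] t by (simp add: car_hob[symmetric])
  have "Q c d \<bullet> ?f = Q c d \<bullet> q"
    using a f q(1,2) t k cd by (intro tarr_eqI[of K]) simp_all
  from monicD[OF Q_monic[OF cd k] this a] have "?f = q"
    using k by simp
  then show "f = raw q" by auto
qed

lemma lu_monoid:
  assumes d: "d \<in> obj V" and k: "isM (lb d)"
  shows "arr V (lu d)" "U (lu d) \<bullet> Q (reg (lb d)) d = la d"
proof -
  let ?X = "lb d" and ?r = "reg (lb d)"
  note [simp] = d k
  have rd [simp]: "?r \<rhd> d" by simp
  have kr: "isM (rb ?r)" by simp
  have ob [simp]: "und ?X \<in> obj K" by simp
  have "la d \<bullet> (ra ?r \<odot> Id (car d)) = la d \<bullet> (Id (car ?r) \<odot> la d) \<bullet> Asc (car ?r) (und (rb ?r)) (car d)"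
    using cell_lstruct[OF d] by (simp add: lstruct_def)
  moreover have "arr K (la d)" "src (la d) = car ?r \<otimes> car d" by simp_all
  ultimately obtain q where q: "arr K q" "src q = car (hob ?r d)" "tgt q = tgt (la d)" "q \<bullet> Q ?r d = la d"
    using Q_factor[OF rd kr] by blast
  have "leq ?X (la (hob ?r d)) (la d) q"
    by (rule leq_cancel_epic[of _ "ltens ?X (mu ?X) (und ?X) (car d)" _ _ "Q ?r d"])
      (use q la_leq(1)[OF d k] Q_leq(1)[OF rd kr] Q_epic[OF rd kr] ten_Q_epic[OF rd kr ob] in simp_all)
  moreover have "req (rb d) (ra (hob ?r d)) (ra d) q"
    by (rule req_cancel_epic[of _ "rtens (rb d) (ra d) (und ?X) (car d)" _ _ "Q ?r d"])
      (use q la_req(1)[OF d k] Q_req(1)[OF rd kr] Q_epic[OF rd kr] Q_ten_epic[OF rd kr, of "und (rb d)"] in simp_all)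
  ultimately have v: "arr V (Arr (hob ?r d) (raw q) d)" "U (Arr (hob ?r d) (raw q) d) = q"
    using q(2,3) by (intro arr_VI; simp)+
  have "lu d = Arr (hob ?r d) (raw q) d"
    using tensor_unit_raw[OF rd kr q(1,2,4)] by (simp add: lu_def tensor_unit_left_def)
  with v q(4) show "arr V (lu d)" "U (lu d) \<bullet> Q ?r d = la d"
    by simp_all
qed

lemma lu_comonoid:
  assumes d: "d \<in> obj V" and k: "\<not> isM (lb d)"
  shows "arr V (lu d)" "Q (reg (lb d)) d \<bullet> U (lu d) = la d"
proof -
  let ?X = "lb d" and ?r = "reg (lb d)"
  note [simp] = d k
  have rd [simp]: "?r \<rhd> d" by simp
  have kr: "\<not> isM (rb ?r)" by simp
  have ob [simp]: "und ?X \<in> obj K" by simp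
  have "Asc (car ?r) (und (rb ?r)) (car d) \<bullet> (ra ?r \<odot> Id (car d)) \<bullet> la d = (Id (car ?r) \<odot> la d) \<bullet> la d"
    using cell_lstruct[OF d] by (simp add: lstruct_def)
  moreover have "arr K (la d)" "tgt (la d) = car ?r \<otimes> car d" by simp_all
  ultimately obtain q where q: "arr K q" "tgt q = car (hob ?r d)" "src q = src (la d)" "Q ?r d \<bullet> q = la d"
    using Q_cofactor[OF rd kr] by blast
  have "leq ?X (la d) (la (hob ?r d)) q"
    by (rule leq_cancel_monic[of _ _ "ltens ?X (mu ?X) (und ?X) (car d)" "Q ?r d"])
      (use q la_leq(2)[OF d k] Q_leq(2)[OF rd kr] Q_monic[OF rd kr] ten_Q_monic[OF rd kr ob] in simp_all)
  moreover have "req (rb d) (ra d) (ra (hob ?r d)) q"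
    by (rule req_cancel_monic[of _ _ "rtens (rb d) (ra d) (und ?X) (car d)" "Q ?r d"])
      (use q la_req(2)[OF d k] Q_req(2)[OF rd kr] Q_monic[OF rd kr] Q_ten_monic[OF rd kr, of "und (rb d)"] in simp_all)
  ultimately have v: "arr V (Arr d (raw q) (hob ?r d))" "U (Arr d (raw q) (hob ?r d)) = q"
    using q(2,3) by (intro arr_VI; simp)+
  have "lu d = Arr d (raw q) (hob ?r d)"
    using cotensor_unit_raw[OF rd kr q(1,2,4)] by (simp add: lu_def cotensor_unit_left_def)
  with v q(4) show "arr V (lu d)" "Q ?r d \<bullet> U (lu d) = la d"
    by simp_all
qed

lemma ru_monoid:
  assumes c: "c \<in> obj V" and k: "isM (rb c)"
  shows "arr V (ru c)" "U (ru c) \<bullet> Q c (reg (rb c)) = ra c"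
proof -
  let ?Y = "rb c" and ?r = "reg (rb c)"
  note [simp] = c k
  have cr [simp]: "c \<rhd> ?r" by simp
  have ob [simp]: "und ?Y \<in> obj K" by simp
  have "ra c \<bullet> (ra c \<odot> Id (car ?r)) = ra c \<bullet> (Id (car c) \<odot> la ?r) \<bullet> Asc (car c) (und (rb c)) (car ?r)"
    using cell_rstruct[OF c] by (simp add: rstruct_def)
  moreover have "arr K (ra c)" "src (ra c) = car c \<otimes> car ?r" by simp_all
  ultimately obtain q where q: "arr K q" "src q = car (hob c ?r)" "tgt q = tgt (ra c)" "q \<bullet> Q c ?r = ra c"
    using Q_factor[OF cr k] by blast
  have "req ?Y (ra (hob c ?r)) (ra c) q"
    by (rule req_cancel_epic[of _ "rtens ?Y (mu ?Y) (car c) (und ?Y)" _ _ "Q c ?r"])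
      (use q ra_req(1)[OF c k] Q_req(1)[OF cr k] Q_epic[OF cr k] Q_ten_epic[OF cr k ob] in simp_all)
  moreover have "leq (lb c) (la (hob c ?r)) (la c) q"
    by (rule leq_cancel_epic[of _ "ltens (lb c) (la c) (car c) (und ?Y)" _ _ "Q c ?r"])
      (use q ra_leq(1)[OF c k] Q_leq(1)[OF cr k] Q_epic[OF cr k] ten_Q_epic[OF cr k, of "und (lb c)"] in simp_all)
  ultimately have v: "arr V (Arr (hob c ?r) (raw q) c)" "U (Arr (hob c ?r) (raw q) c) = q"
    using q(2,3) by (intro arr_VI; simp)+
  have "ru c = Arr (hob c ?r) (raw q) c"
    using tensor_unit_raw[OF cr k q(1,2,4)] by (simp add: ru_def tensor_unit_right_def)
  with v q(4) show "arr V (ru c)" "U (ru c) \<bullet> Q c ?r = ra c"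
    by simp_all
qed

lemma ru_comonoid:
  assumes c: "c \<in> obj V" and k: "\<not> isM (rb c)"
  shows "arr V (ru c)" "Q c (reg (rb c)) \<bullet> U (ru c) = ra c"
proof -
  let ?Y = "rb c" and ?r = "reg (rb c)"
  note [simp] = c k
  have cr [simp]: "c \<rhd> ?r" by simp
  have ob [simp]: "und ?Y \<in> obj K" by simp
  have "Asc (car c) (und (rb c)) (car ?r) \<bullet> (ra c \<odot> Id (car ?r)) \<bullet> ra c = (Id (car c) \<odot> la ?r) \<bullet> ra c"
    using cell_rstruct[OF c] by (simp add: rstruct_def)
  moreover have "arr K (ra c)" "tgt (ra c) = car c \<otimes> car ?r" by simp_all
  ultimately obtain q where q: "arr K q" "tgt q = car (hob c ?r)" "src q = src (ra c)" "Q c ?r \<bullet> q = ra c"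
    using Q_cofactor[OF cr k] by blast
  have "req ?Y (ra c) (ra (hob c ?r)) q"
    by (rule req_cancel_monic[of _ _ "rtens ?Y (mu ?Y) (car c) (und ?Y)" "Q c ?r"])
      (use q ra_req(2)[OF c k] Q_req(2)[OF cr k] Q_monic[OF cr k] Q_ten_monic[OF cr k ob] in simp_all)
  moreover have "leq (lb c) (la c) (la (hob c ?r)) q"
    by (rule leq_cancel_monic[of _ _ "ltens (lb c) (la c) (car c) (und ?Y)" "Q c ?r"])
      (use q ra_leq(2)[OF c k] Q_leq(2)[OF cr k] Q_monic[OF cr k] ten_Q_monic[OF cr k, of "und (lb c)"] in simp_all)
  ultimately have v: "arr V (Arr c (raw q) (hob c ?r))" "U (Arr c (raw q) (hob c ?r)) = q"
    using q(2,3) by (intro arr_VI; simp)+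
  have "ru c = Arr c (raw q) (hob c ?r)"
    using cotensor_unit_raw[OF cr k q(1,2,4)] by (simp add: ru_def cotensor_unit_right_def)
  with v q(4) show "arr V (ru c)" "Q c ?r \<bullet> U (ru c) = ra c"
    by simp_all
qed

lemma arr_lu [simp]: "d \<in> obj V \<Longrightarrow> arr V (lu d)" and arr_ru [simp]: "c \<in> obj V \<Longrightarrow> arr V (ru c)"
  using lu_monoid(1) lu_comonoid(1) ru_monoid(1) ru_comonoid(1) by blast+

text \<open>The inverse of an equivariant isomorphism is equivariant.\<close>

lemma invs_of_invs_U:
  assumes t: "arr V t" and i: "invs K (U t) j"
  shows "invs V t (Arr (tgt t) (raw j) (src t))"
proof -
  note j = invsD[OF i, simplified]
  note b = arr_V_bases[OF t]
  have c: "src t \<in> obj V" "tgt t \<in> obj V" using t by simp_all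
  have X: "und (lb (src t)) \<in> obj K" "und (rb (src t)) \<in> obj K" using c by simp_all
  have m: "monic K (U t)" "monic K (Id (und (lb (src t))) \<odot> U t)" "monic K (U t \<odot> Id (und (rb (src t))))"
    using invs_monic[OF i] invs_monic[OF invs_ten[OF invs_Id[OF X(1)] i]] invs_monic[OF invs_ten[OF i invs_Id[OF X(2)]]] .
  have "leq (lb (src t)) (la (tgt t)) (la (src t)) j"
    by (rule leq_cancel_monic[OF _ U_leq[OF t] m(1,2)])
      (use U_leq[of "idt V (tgt t)"] c j b in simp)
  moreover have "req (rb (src t)) (ra (tgt t)) (ra (src t)) j"
    by (rule req_cancel_monic[OF _ U_req[OF t] m(1,3)])
      (use U_req[of "idt V (tgt t)"] c j b in simp)
  ultimately have v: "arr V (Arr (tgt t) (raw j) (src t))" "U (Arr (tgt t) (raw j) (src t)) = j"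
    using c j b by (intro arr_VI; simp)+
  let ?j = "Arr (tgt t) (raw j) (src t)"
  have "?j \<diamondop> t = idt V (src t)"
    using v j t by (intro V_eqI) (simp_all del: arr_Arr)
  moreover have "t \<diamondop> ?j = idt V (tgt t)"
    using v j t by (intro V_eqI) (simp_all del: arr_Arr)
  ultimately show ?thesis
    using v(1) t unfolding invs_def by simp
qed

text \<open>Over a monoid, \<open>n \<mapsto> 1 \<otimes> n\<close> is inverse to \<open>a \<otimes> n \<mapsto> a n\<close>.\<close>

lemma lu_iso:
  assumes d: "d \<in> obj V" and k: "isM (lb d)"
  obtains j where "invs V (lu d) j"
proof -
  let ?X = "lb d" and ?r = "reg (lb d)"
  let ?x = "und ?X" and ?n = "car d"
  note [simp] = d k
  have rd [simp]: "?r \<rhd> d" by simp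
  have kr: "isM (rb ?r)" by simp
  have ob [simp]: "?x \<in> obj K" by simp
  note lu = lu_monoid[OF d k]
  \<comment> \<open>The candidate inverse inserts the unit of the monoid.\<close>
  let ?s = "Q ?r d \<bullet> (un ?X \<odot> Id ?n) \<bullet> Lui ?n"
  have 1: "U (lu d) \<bullet> ?s = Id ?n"
    using cell_lstruct[OF d] tail[OF lu(2)] by (simp add: lstruct_def cmp_assoc[symmetric])
  have act: "(Id ?x \<odot> la d) \<bullet> Asc ?x ?x ?n \<bullet> ((un ?X \<odot> Id ?x) \<odot> Id ?n) = (un ?X \<odot> Id ?n) \<bullet> (Id \<one> \<odot> la d) \<bullet> Asc \<one> ?x ?n"
    using Asc_natural[of "un ?X" "Id ?x" "Id ?n"] by (simp add: merge)
  have unit: "mu ?X \<bullet> (un ?X \<odot> Id ?x) = Lu ?x"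
    by (rule monoid_laws(2)) simp_all
  have "Q ?r d \<bullet> (un ?X \<odot> Id ?n) \<bullet> (Id \<one> \<odot> la d) \<bullet> Asc \<one> ?x ?n
      = Q ?r d \<bullet> ((Id ?x \<odot> la d) \<bullet> Asc ?x ?x ?n \<bullet> ((un ?X \<odot> Id ?x) \<odot> Id ?n))"
    by (simp only: act)
  also have "\<dots> = Q ?r d \<bullet> (mu ?X \<odot> Id ?n) \<bullet> ((un ?X \<odot> Id ?x) \<odot> Id ?n)"
    using tail[OF Q_fork[OF rd kr]] by (simp add: cmp_assoc)
  also have "\<dots> = Q ?r d \<bullet> Lu (?x \<otimes> ?n) \<bullet> Asc \<one> ?x ?n"
    by (simp add: merge unit Lu_ten)
  finally have e: "Q ?r d \<bullet> (un ?X \<odot> Id ?n) \<bullet> (Id \<one> \<odot> la d) \<bullet> Asc \<one> ?x ?n = Q ?r d \<bullet> Lu (?x \<otimes> ?n) \<bullet> Asc \<one> ?x ?n" .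
  have "(Q ?r d \<bullet> (un ?X \<odot> Id ?n) \<bullet> (Id \<one> \<odot> la d)) \<bullet> Asc \<one> ?x ?n = (Q ?r d \<bullet> Lu (?x \<otimes> ?n)) \<bullet> Asc \<one> ?x ?n"
    using e by (simp add: cmp_assoc)
  from epicD[OF invs_epic[OF invs_Asc] this]
  have e': "Q ?r d \<bullet> (un ?X \<odot> Id ?n) \<bullet> (Id \<one> \<odot> la d) = Q ?r d \<bullet> Lu (?x \<otimes> ?n)"
    by simp
  have "(?s \<bullet> U (lu d)) \<bullet> Q ?r d = Q ?r d \<bullet> (un ?X \<odot> Id ?n) \<bullet> Lui ?n \<bullet> la d"
    using lu(2) by (simp add: cmp_assoc)
  also have "\<dots> = (Q ?r d \<bullet> (un ?X \<odot> Id ?n) \<bullet> (Id \<one> \<odot> la d)) \<bullet> Lui (?x \<otimes> ?n)"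
    using Lui_natural[of "la d"] by (simp add: cmp_assoc)
  also have "\<dots> = Id (car (hob ?r d)) \<bullet> Q ?r d"
    unfolding e' by (simp add: cmp_assoc)
  finally have "?s \<bullet> U (lu d) = Id (car (hob ?r d))"
    by (rule epicD[OF Q_epic[OF rd kr]]) (use lu(1) in simp_all)
  with 1 have "invs K (U (lu d)) ?s"
    using lu(1) unfolding invs_def by simp
  from that[OF invs_of_invs_U[OF lu(1) this]] show thesis .
qed

lemma ru_iso:
  assumes c: "c \<in> obj V" and k: "isM (rb c)"
  obtains j where "invs V (ru c) j"
proof -
  let ?Y = "rb c" and ?r = "reg (rb c)"
  let ?y = "und ?Y" and ?m = "car c"
  note [simp] = c k
  have cr [simp]: "c \<rhd> ?r" by simp
  have ob [simp]: "?y \<in> obj K" by simp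
  note ru = ru_monoid[OF c k]
  let ?s = "Q c ?r \<bullet> (Id ?m \<odot> un ?Y) \<bullet> Rui ?m"
  have 1: "U (ru c) \<bullet> ?s = Id ?m"
    using cell_rstruct[OF c] tail[OF ru(2)] by (simp add: rstruct_def cmp_assoc[symmetric])
  have unit: "mu ?Y \<bullet> (Id ?y \<odot> un ?Y) = Ru ?y"
    by (rule monoid_laws(3)) simp_all
  have "Q c ?r \<bullet> (Id ?m \<odot> un ?Y) \<bullet> (ra c \<odot> Id \<one>) = Q c ?r \<bullet> (ra c \<odot> Id ?y) \<bullet> (Id (?m \<otimes> ?y) \<odot> un ?Y)"
    by (simp add: merge)
  also have "\<dots> = Q c ?r \<bullet> (Id ?m \<odot> mu ?Y) \<bullet> Asc ?m ?y ?y \<bullet> ((Id ?m \<odot> Id ?y) \<odot> un ?Y)"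
    using tail[OF Q_fork[OF cr k]] by (simp add: cmp_assoc)
  also have "\<dots> = Q c ?r \<bullet> (Id ?m \<odot> mu ?Y) \<bullet> (Id ?m \<odot> (Id ?y \<odot> un ?Y)) \<bullet> Asc ?m ?y \<one>"
    using Asc_natural[of "Id ?m" "Id ?y" "un ?Y"] by (simp del: Id_ten)
  also have "\<dots> = Q c ?r \<bullet> Ru (?m \<otimes> ?y)"
    by (simp add: merge unit Ru_ten)
  finally have e': "Q c ?r \<bullet> (Id ?m \<odot> un ?Y) \<bullet> (ra c \<odot> Id \<one>) = Q c ?r \<bullet> Ru (?m \<otimes> ?y)" .
  have "(?s \<bullet> U (ru c)) \<bullet> Q c ?r = Q c ?r \<bullet> (Id ?m \<odot> un ?Y) \<bullet> Rui ?m \<bullet> ra c"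
    using ru(2) by (simp add: cmp_assoc)
  also have "\<dots> = (Q c ?r \<bullet> (Id ?m \<odot> un ?Y) \<bullet> (ra c \<odot> Id \<one>)) \<bullet> Rui (?m \<otimes> ?y)"
    using Rui_natural[of "ra c"] by (simp add: cmp_assoc)
  also have "\<dots> = Id (car (hob c ?r)) \<bullet> Q c ?r"
    unfolding e' by (simp add: cmp_assoc)
  finally have "?s \<bullet> U (ru c) = Id (car (hob c ?r))"
    by (rule epicD[OF Q_epic[OF cr k]]) (use ru(1) in simp_all)
  with 1 have "invs K (U (ru c)) ?s"
    using ru(1) unfolding invs_def by simp
  from that[OF invs_of_invs_U[OF ru(1) this]] show thesis .
qed

lemma lu_natural_monoid:
  assumes t [simp]: "arr V t" and k [simp]: "isM (lb (src t))"
  shows "lu (tgt t) \<diamondop> (idt V (reg (lb (src t))) \<star> t) = t \<diamondop> lu (src t)"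
proof -
  let ?r = "reg (lb (src t))"
  note b [simp] = arr_V_bases[OF t]
  have q: "U (idt V ?r \<star> t) \<bullet> Q ?r (src t) = Q ?r (tgt t) \<bullet> (Id (und (lb (src t))) \<odot> U t)"
    using U_hc_tensor[of "idt V ?r" t] by simp
  have l: "U (lu (src t)) \<bullet> Q ?r (src t) = la (src t)" "U (lu (tgt t)) \<bullet> Q ?r (tgt t) = la (tgt t)"
    using lu_monoid(2)[of "src t"] lu_monoid(2)[of "tgt t"] by simp_all
  have c: "?r \<rhd> src t" "?r \<rhd> tgt t" using reg_composable(1)[of "src t"] reg_composable(1)[of "tgt t"] by simp_all
  show ?thesis
    by (rule V_eq_epic[of _ _ "Q ?r (src t)"])
      (use c in \<open>simp_all add: cmp_assoc q l tail[OF l(2)] la_natural(1) Q_epic\<close>)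
qed

lemma lu_natural_comonoid:
  assumes t [simp]: "arr V t" and k [simp]: "\<not> isM (lb (src t))"
  shows "(idt V (reg (lb (src t))) \<star> t) \<diamondop> lu (src t) = lu (tgt t) \<diamondop> t"
proof -
  let ?r = "reg (lb (src t))"
  note b [simp] = arr_V_bases[OF t]
  have q: "Q ?r (tgt t) \<bullet> U (idt V ?r \<star> t) = (Id (und (lb (src t))) \<odot> U t) \<bullet> Q ?r (src t)"
    using U_hc_cotensor[of "idt V ?r" t] by simp
  have l: "Q ?r (src t) \<bullet> U (lu (src t)) = la (src t)" "Q ?r (tgt t) \<bullet> U (lu (tgt t)) = la (tgt t)"
    using lu_comonoid(2)[of "src t"] lu_comonoid(2)[of "tgt t"] by simp_all
  have c: "?r \<rhd> src t" "?r \<rhd> tgt t" using reg_composable(1)[of "src t"] reg_composable(1)[of "tgt t"] by simp_all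
  show ?thesis
    by (rule V_eq_monic[of _ _ "Q ?r (tgt t)"])
      (use c in \<open>simp_all add: cmp_assoc tail[OF q] l tail[OF l(2)] la_natural(2) Q_monic\<close>)
qed

lemma ru_natural_monoid:
  assumes t [simp]: "arr V t" and k [simp]: "isM (rb (src t))"
  shows "ru (tgt t) \<diamondop> (t \<star> idt V (reg (rb (src t)))) = t \<diamondop> ru (src t)"
proof -
  let ?r = "reg (rb (src t))"
  note b [simp] = arr_V_bases[OF t]
  have q: "U (t \<star> idt V ?r) \<bullet> Q (src t) ?r = Q (tgt t) ?r \<bullet> (U t \<odot> Id (und (rb (src t))))"
    using U_hc_tensor[of t "idt V ?r"] by simp
  have l: "U (ru (src t)) \<bullet> Q (src t) ?r = ra (src t)" "U (ru (tgt t)) \<bullet> Q (tgt t) ?r = ra (tgt t)"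
    using ru_monoid(2)[of "src t"] ru_monoid(2)[of "tgt t"] by simp_all
  have c: "src t \<rhd> ?r" "tgt t \<rhd> ?r" using reg_composable(2)[of "src t"] reg_composable(2)[of "tgt t"] by simp_all
  show ?thesis
    by (rule V_eq_epic[of _ _ "Q (src t) ?r"])
      (use c in \<open>simp_all add: cmp_assoc q l tail[OF l(2)] ra_natural(1) Q_epic\<close>)
qed

lemma ru_natural_comonoid:
  assumes t [simp]: "arr V t" and k [simp]: "\<not> isM (rb (src t))"
  shows "(t \<star> idt V (reg (rb (src t)))) \<diamondop> ru (src t) = ru (tgt t) \<diamondop> t"
proof -
  let ?r = "reg (rb (src t))"
  note b [simp] = arr_V_bases[OF t]
  have q: "Q (tgt t) ?r \<bullet> U (t \<star> idt V ?r) = (U t \<odot> Id (und (rb (src t)))) \<bullet> Q (src t) ?r"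
    using U_hc_cotensor[of t "idt V ?r"] by simp
  have l: "Q (src t) ?r \<bullet> U (ru (src t)) = ra (src t)" "Q (tgt t) ?r \<bullet> U (ru (tgt t)) = ra (tgt t)"
    using ru_comonoid(2)[of "src t"] ru_comonoid(2)[of "tgt t"] by simp_all
  have c: "src t \<rhd> ?r" "tgt t \<rhd> ?r" using reg_composable(2)[of "src t"] reg_composable(2)[of "tgt t"] by simp_all
  show ?thesis
    by (rule V_eq_monic[of _ _ "Q (tgt t) ?r"])
      (use c in \<open>simp_all add: cmp_assoc tail[OF q] l tail[OF l(2)] ra_natural(2) Q_monic\<close>)
qed

context
  fixes c d
  assumes cd: "c \<rhd> d"
begin

text \<open>The two sides are induced by the (co)actions of the middle base on \<open>c\<close> and on \<open>d\<close>, which agree after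
composing with the structure map of the product.\<close>

lemma triangle_comonoid:
  assumes k: "\<not> isM (rb c)"
  shows "al c (reg (rb c)) d \<diamondop> (ru c \<star> idt V d) = idt V c \<star> lu d"
proof -
  note cells = composableD[OF cd]
  note [simp] = cd cells(1,2) k
  let ?r = "reg (lb d)"
  have rd [simp]: "rb c = lb d" by (rule cells)
  have [simp]: "\<not> isM (lb d)" using k rd by simp
  have cr [simp]: "c \<rhd> ?r" "?r \<rhd> d" using reg_composable(1)[of d] reg_composable(2)[of c] rd by simp_all
  have q1: "Q (hob c ?r) d \<bullet> U (ru c \<star> idt V d) = (U (ru c) \<odot> Id (car d)) \<bullet> Q c d"
    using U_hc_cotensor[of "ru c" "idt V d"] rd by simp
  have q2: "Q c (hob ?r d) \<bullet> U (idt V c \<star> lu d) = (Id (car c) \<odot> U (lu d)) \<bullet> Q c d"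
    using U_hc_cotensor[of "idt V c" "lu d"] rd by simp
  have m: "(Id (car c) \<odot> Q ?r d) \<bullet> Q c (hob ?r d) \<bullet> U (al c ?r d) = Asc (car c) (und (lb d)) (car d) \<bullet> (Q c ?r \<odot> Id (car d)) \<bullet> Q (hob c ?r) d"
    using al_cc[of c ?r d] by simp
  have l: "Q ?r d \<bullet> U (lu d) = la d" "Q c ?r \<bullet> U (ru c) = ra c"
    using lu_comonoid(2)[of d] ru_comonoid(2)[of c] rd by simp_all
  let ?E = "(Id (car c) \<odot> Q ?r d) \<bullet> Q c (hob ?r d)"
  have "al c ?r d \<diamondop> (ru c \<star> idt V d) = idt V c \<star> lu d"
  proof (rule V_eq_monic[of _ _ ?E])
    show "monic K ?E" by (intro monic_cmp Q_monic ten_Q_monic) simp_all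
    have "?E \<bullet> U (al c ?r d \<diamondop> (ru c \<star> idt V d)) = Asc (car c) (und (lb d)) (car d) \<bullet> (Q c ?r \<odot> Id (car d)) \<bullet> Q (hob c ?r) d \<bullet> U (ru c \<star> idt V d)"
      using tail3[OF m] rd by (simp add: cmp_assoc)
    also have "\<dots> = Asc (car c) (und (lb d)) (car d) \<bullet> (ra c \<odot> Id (car d)) \<bullet> Q c d"
      by (simp add: q1 merge l)
    also have "\<dots> = (Id (car c) \<odot> la d) \<bullet> Q c d"
      using Q_cofork[OF cd k] by simp
    also have "\<dots> = ?E \<bullet> U (idt V c \<star> lu d)"
      using rd by (simp add: cmp_assoc q2 merge l)
    finally show "?E \<bullet> U (al c ?r d \<diamondop> (ru c \<star> idt V d)) = ?E \<bullet> U (idt V c \<star> lu d)" .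
  qed simp_all
  then show ?thesis by simp
qed

lemma triangle_monoid:
  assumes k: "isM (rb c)"
  shows "(idt V c \<star> lu d) \<diamondop> al c (reg (rb c)) d = ru c \<star> idt V d"
proof -
  note cells = composableD[OF cd]
  note [simp] = cd cells(1,2) k
  let ?r = "reg (lb d)"
  have rd [simp]: "rb c = lb d" by (rule cells)
  have [simp]: "isM (lb d)" using k rd by simp
  have cr [simp]: "c \<rhd> ?r" "?r \<rhd> d" using reg_composable(1)[of d] reg_composable(2)[of c] rd by simp_all
  have q1: "U (ru c \<star> idt V d) \<bullet> Q (hob c ?r) d = Q c d \<bullet> (U (ru c) \<odot> Id (car d))"
    using U_hc_tensor[of "ru c" "idt V d"] rd by simp
  have q2: "U (idt V c \<star> lu d) \<bullet> Q c (hob ?r d) = Q c d \<bullet> (Id (car c) \<odot> U (lu d))"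
    using U_hc_tensor[of "idt V c" "lu d"] rd by simp
  have m: "U (al c ?r d) \<bullet> Q (hob c ?r) d \<bullet> (Q c ?r \<odot> Id (car d)) = Q c (hob ?r d) \<bullet> (Id (car c) \<odot> Q ?r d) \<bullet> Asc (car c) (und (lb d)) (car d)"
    using al_mm[of c ?r d] by simp
  have l: "U (lu d) \<bullet> Q ?r d = la d" "U (ru c) \<bullet> Q c ?r = ra c"
    using lu_monoid(2)[of d] ru_monoid(2)[of c] rd by simp_all
  let ?E = "Q (hob c ?r) d \<bullet> (Q c ?r \<odot> Id (car d))"
  have "(idt V c \<star> lu d) \<diamondop> al c ?r d = ru c \<star> idt V d"
  proof (rule V_eq_epic[of _ _ ?E])
    show "epic K ?E" by (intro epic_cmp Q_epic Q_ten_epic) simp_all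
    have "U ((idt V c \<star> lu d) \<diamondop> al c ?r d) \<bullet> ?E = U (idt V c \<star> lu d) \<bullet> Q c (hob ?r d) \<bullet> (Id (car c) \<odot> Q ?r d) \<bullet> Asc (car c) (und (lb d)) (car d)"
      using m rd by (simp add: cmp_assoc)
    also have "\<dots> = Q c d \<bullet> (Id (car c) \<odot> la d) \<bullet> Asc (car c) (und (lb d)) (car d)"
      by (simp add: tail[OF q2] cmp_assoc merge l)
    also have "\<dots> = Q c d \<bullet> (ra c \<odot> Id (car d))"
      using Q_fork[OF cd k] by simp
    also have "\<dots> = U (ru c \<star> idt V d) \<bullet> ?E"
      using rd by (simp add: tail[OF q1] cmp_assoc merge l)
    finally show "U ((idt V c \<star> lu d) \<diamondop> al c ?r d) \<bullet> ?E = U (ru c \<star> idt V d) \<bullet> ?E" .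
  qed simp_all
  then show ?thesis by simp
qed

text \<open>The unit map of a product comes from that of its outer factor, because the action on the product is
induced by the action on this factor.\<close>

lemma lu_hob_monoid:
  assumes k: "isM (lb c)" "\<not> isM (rb c)"
  shows "lu (hob c d) = (lu c \<star> idt V d) \<diamondop> ali (reg (lb c)) c d"
proof -
  note cells = composableD[OF cd]
  note [simp] = cd cells(1,2) k
  let ?r = "reg (lb c)"
  have rd: "rb c = lb d" by (rule cells)
  have [simp]: "\<not> isM (lb d)" using k rd by simp
  have ob [simp]: "hob c d \<in> obj V" by simp
  have rr [simp]: "?r \<rhd> c" "?r \<rhd> hob c d" using reg_composable(1)[OF ob] by simp_all
  have q1: "Q c d \<bullet> U (lu c \<star> idt V d) = (U (lu c) \<odot> Id (car d)) \<bullet> Q (hob ?r c) d"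
    using U_hc_cotensor[of "lu c" "idt V d"] rd by simp
  have m: "Q (hob ?r c) d \<bullet> U (ali ?r c d) \<bullet> Q ?r (hob c d) = (Q ?r c \<odot> Id (car d)) \<bullet> Asi (und (lb c)) (car c) (car d) \<bullet> (Id (und (lb c)) \<odot> Q c d)"
    using al_mc[of ?r c d] by simp
  have l: "U (lu (hob c d)) \<bullet> Q ?r (hob c d) = la (hob c d)" "U (lu c) \<bullet> Q ?r c = la c"
    using lu_monoid(2)[OF ob] lu_monoid(2)[of c] by simp_all
  have lq: "Q c d \<bullet> la (hob c d) = (la c \<odot> Id (car d)) \<bullet> Asi (und (lb c)) (car c) (car d) \<bullet> (Id (und (lb c)) \<odot> Q c d)"
    using Q_leq(2)[OF cd k(2)] by (simp add: leq_def ltens_def cmp_assoc)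
  show ?thesis
  proof (rule V_eq_both[of _ _ "Q c d" "Q ?r (hob c d)"])
    show "monic K (Q c d)" "epic K (Q ?r (hob c d))" by (simp_all add: Q_monic Q_epic)
    have "Q c d \<bullet> U ((lu c \<star> idt V d) \<diamondop> ali ?r c d) \<bullet> Q ?r (hob c d)
        = (U (lu c) \<odot> Id (car d)) \<bullet> Q (hob ?r c) d \<bullet> U (ali ?r c d) \<bullet> Q ?r (hob c d)"
      using rd by (simp add: cmp_assoc tail[OF q1])
    also have "\<dots> = Q c d \<bullet> U (lu (hob c d)) \<bullet> Q ?r (hob c d)"
      by (simp add: m l lq merge)
    finally show "Q c d \<bullet> U (lu (hob c d)) \<bullet> Q ?r (hob c d) = Q c d \<bullet> U ((lu c \<star> idt V d) \<diamondop> ali ?r c d) \<bullet> Q ?r (hob c d)" ..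
  qed (use rd in simp_all)
qed

lemma lu_hob_comonoid:
  assumes k: "\<not> isM (lb c)" "isM (rb c)"
  shows "al (reg (lb c)) c d \<diamondop> (lu c \<star> idt V d) = lu (hob c d)"
proof -
  note cells = composableD[OF cd]
  note [simp] = cd cells(1,2) k
  let ?r = "reg (lb c)"
  have rd: "rb c = lb d" by (rule cells)
  have [simp]: "isM (lb d)" using k rd by simp
  have ob [simp]: "hob c d \<in> obj V" by simp
  have rr [simp]: "?r \<rhd> c" "?r \<rhd> hob c d" using reg_composable(1)[OF ob] by simp_all
  have q1: "U (lu c \<star> idt V d) \<bullet> Q c d = Q (hob ?r c) d \<bullet> (U (lu c) \<odot> Id (car d))"
    using U_hc_tensor[of "lu c" "idt V d"] rd by simp
  have m: "Q ?r (hob c d) \<bullet> U (al ?r c d) \<bullet> Q (hob ?r c) d = (Id (und (lb c)) \<odot> Q c d) \<bullet> Asc (und (lb c)) (car c) (car d) \<bullet> (Q ?r c \<odot> Id (car d))"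
    using al_cm[of ?r c d] by simp
  have l: "Q ?r (hob c d) \<bullet> U (lu (hob c d)) = la (hob c d)" "Q ?r c \<bullet> U (lu c) = la c"
    using lu_comonoid(2)[OF ob] lu_comonoid(2)[of c] by simp_all
  have lq: "la (hob c d) \<bullet> Q c d = (Id (und (lb c)) \<odot> Q c d) \<bullet> Asc (und (lb c)) (car c) (car d) \<bullet> (la c \<odot> Id (car d))"
    using Q_leq(1)[OF cd k(2)] by (simp add: leq_def ltens_def cmp_assoc)
  show ?thesis
  proof (rule V_eq_both[of _ _ "Q ?r (hob c d)" "Q c d"])
    show "monic K (Q ?r (hob c d))" "epic K (Q c d)" by (simp_all add: Q_monic Q_epic)
    have "Q ?r (hob c d) \<bullet> U (al ?r c d \<diamondop> (lu c \<star> idt V d)) \<bullet> Q c d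
        = Q ?r (hob c d) \<bullet> U (al ?r c d) \<bullet> Q (hob ?r c) d \<bullet> (U (lu c) \<odot> Id (car d))"
      using rd by (simp add: cmp_assoc q1)
    also have "\<dots> = Q ?r (hob c d) \<bullet> U (lu (hob c d)) \<bullet> Q c d"
      by (simp add: tail3[OF m] cmp_assoc l tail[OF l(1)] lq merge)
    finally show "Q ?r (hob c d) \<bullet> U (al ?r c d \<diamondop> (lu c \<star> idt V d)) \<bullet> Q c d = Q ?r (hob c d) \<bullet> U (lu (hob c d)) \<bullet> Q c d" .
  qed (use rd in simp_all)
qed

lemma ru_hob_monoid:
  assumes k: "\<not> isM (rb c)" "isM (rb d)"
  shows "ru (hob c d) = (idt V c \<star> ru d) \<diamondop> al c d (reg (rb d))"
proof -
  note cells = composableD[OF cd]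
  note [simp] = cd cells(1,2) k
  let ?r = "reg (rb d)"
  have rd: "rb c = lb d" by (rule cells)
  have [simp]: "\<not> isM (lb d)" using k rd by simp
  have ob [simp]: "hob c d \<in> obj V" by simp
  have rr [simp]: "d \<rhd> ?r" "hob c d \<rhd> ?r" using reg_composable(2)[OF ob] by simp_all
  have q1: "Q c d \<bullet> U (idt V c \<star> ru d) = (Id (car c) \<odot> U (ru d)) \<bullet> Q c (hob d ?r)"
    using U_hc_cotensor[of "idt V c" "ru d"] rd by simp
  have m: "Q c (hob d ?r) \<bullet> U (al c d ?r) \<bullet> Q (hob c d) ?r = (Id (car c) \<odot> Q d ?r) \<bullet> Asc (car c) (car d) (und (rb d)) \<bullet> (Q c d \<odot> Id (und (rb d)))"
    using al_cm[of c d ?r] by simp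
  have l: "U (ru (hob c d)) \<bullet> Q (hob c d) ?r = ra (hob c d)" "U (ru d) \<bullet> Q d ?r = ra d"
    using ru_monoid(2)[OF ob] ru_monoid(2)[of d] by simp_all
  have lq: "Q c d \<bullet> ra (hob c d) = (Id (car c) \<odot> ra d) \<bullet> Asc (car c) (car d) (und (rb d)) \<bullet> (Q c d \<odot> Id (und (rb d)))"
    using Q_req(2)[OF cd k(1)] by (simp add: req_def rtens_def cmp_assoc)
  show ?thesis
  proof (rule V_eq_both[of _ _ "Q c d" "Q (hob c d) ?r"])
    show "monic K (Q c d)" "epic K (Q (hob c d) ?r)" by (simp_all add: Q_monic Q_epic)
    have "Q c d \<bullet> U ((idt V c \<star> ru d) \<diamondop> al c d ?r) \<bullet> Q (hob c d) ?r
        = (Id (car c) \<odot> U (ru d)) \<bullet> Q c (hob d ?r) \<bullet> U (al c d ?r) \<bullet> Q (hob c d) ?r"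
      using rd by (simp add: cmp_assoc tail[OF q1])
    also have "\<dots> = Q c d \<bullet> U (ru (hob c d)) \<bullet> Q (hob c d) ?r"
      by (simp add: m l lq merge)
    finally show "Q c d \<bullet> U (ru (hob c d)) \<bullet> Q (hob c d) ?r = Q c d \<bullet> U ((idt V c \<star> ru d) \<diamondop> al c d ?r) \<bullet> Q (hob c d) ?r" ..
  qed (use rd in simp_all)
qed

lemma ru_hob_comonoid:
  assumes k: "isM (rb c)" "\<not> isM (rb d)"
  shows "ali c d (reg (rb d)) \<diamondop> (idt V c \<star> ru d) = ru (hob c d)"
proof -
  note cells = composableD[OF cd]
  note [simp] = cd cells(1,2) k
  let ?r = "reg (rb d)"
  have rd: "rb c = lb d" by (rule cells)
  have [simp]: "isM (lb d)" using k rd by simp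
  have ob [simp]: "hob c d \<in> obj V" by simp
  have rr [simp]: "d \<rhd> ?r" "hob c d \<rhd> ?r" using reg_composable(2)[OF ob] by simp_all
  have q1: "U (idt V c \<star> ru d) \<bullet> Q c d = Q c (hob d ?r) \<bullet> (Id (car c) \<odot> U (ru d))"
    using U_hc_tensor[of "idt V c" "ru d"] rd by simp
  have m: "Q (hob c d) ?r \<bullet> U (ali c d ?r) \<bullet> Q c (hob d ?r) = (Q c d \<odot> Id (und (rb d))) \<bullet> Asi (car c) (car d) (und (rb d)) \<bullet> (Id (car c) \<odot> Q d ?r)"
    using al_mc[of c d ?r] by simp
  have l: "Q (hob c d) ?r \<bullet> U (ru (hob c d)) = ra (hob c d)" "Q d ?r \<bullet> U (ru d) = ra d"
    using ru_comonoid(2)[OF ob] ru_comonoid(2)[of d] by simp_all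
  have lq: "ra (hob c d) \<bullet> Q c d = (Q c d \<odot> Id (und (rb d))) \<bullet> Asi (car c) (car d) (und (rb d)) \<bullet> (Id (car c) \<odot> ra d)"
    using Q_req(1)[OF cd k(1)] by (simp add: req_def rtens_def cmp_assoc)
  show ?thesis
  proof (rule V_eq_both[of _ _ "Q (hob c d) ?r" "Q c d"])
    show "monic K (Q (hob c d) ?r)" "epic K (Q c d)" by (simp_all add: Q_monic Q_epic)
    have "Q (hob c d) ?r \<bullet> U (ali c d ?r \<diamondop> (idt V c \<star> ru d)) \<bullet> Q c d
        = Q (hob c d) ?r \<bullet> U (ali c d ?r) \<bullet> Q c (hob d ?r) \<bullet> (Id (car c) \<odot> U (ru d))"
      using rd by (simp add: cmp_assoc q1)
    also have "\<dots> = Q (hob c d) ?r \<bullet> U (ru (hob c d)) \<bullet> Q c d"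
      by (simp add: tail3[OF m] cmp_assoc l tail[OF l(1)] lq merge)
    finally show "Q (hob c d) ?r \<bullet> U (ali c d ?r \<diamondop> (idt V c \<star> ru d)) \<bullet> Q c d = Q (hob c d) ?r \<bullet> U (ru (hob c d)) \<bullet> Q c d" .
  qed (use rd in simp_all)
qed

end

section \<open>Functors between categories of mixed bimodules\<close>

lemma Arr_collapse: "arr C t \<Longrightarrow> Arr (src t) (raw t) (tgt t) = t"
  by (cases t) simp_all

text \<open>The action on maps of bimodules of a functor from \<open>Mix (lb (src t)) (rb (src t))\<close> to \<open>Mix X Y\<close>.  Through
it, functors and adjunctions between categories of mixed bimodules are established by equations in \<open>V\<close>.\<close>

definition cell_map :: "('a, 'b) comon \<Rightarrow> ('a, 'b) comon \<Rightarrow> (('a, 'b) bi, 'b, ('a, 'b) bi, 'b) ftor \<Rightarrow>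
    (('a, 'b) cell, 'b) tarr \<Rightarrow> (('a, 'b) cell, 'b) tarr" where
  "cell_map X Y F t = Arr (Cell X (fob F (md (src t))) Y)
     (far F (md (src t)) (md (tgt t)) (raw t)) (Cell X (fob F (md (tgt t))) Y)"

lemma src_cell_map [simp]: "src (cell_map X Y F t) = Cell X (fob F (md (src t))) Y"
  and tgt_cell_map [simp]: "tgt (cell_map X Y F t) = Cell X (fob F (md (tgt t))) Y"
  and raw_cell_map [simp]: "raw (cell_map X Y F t) = far F (md (src t)) (md (tgt t)) (raw t)"
  by (simp_all add: cell_map_def)

lemma Cell_V: "X \<in> bases \<Longrightarrow> Y \<in> bases \<Longrightarrow> Cell X M Y \<in> obj V \<longleftrightarrow> M \<in> obj (Mix K X Y)"
  unfolding obj_V by simp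

lemma arr_Cell:
  assumes "X \<in> bases" "Y \<in> bases"
  shows "arr V (Arr (Cell X M Y) f (Cell X N Y)) \<longleftrightarrow> M \<in> obj (Mix K X Y) \<and> N \<in> obj (Mix K X Y) \<and> f \<in> hom (Mix K X Y) M N"
  using assms by (simp add: Cell_V hom_V)

lemma functor_from_V:
  assumes b: "X \<in> bases" "Y \<in> bases" "X' \<in> bases" "Y' \<in> bases"
    and ob: "\<And>c. c \<in> obj V \<Longrightarrow> lb c = X \<Longrightarrow> rb c = Y \<Longrightarrow> Cell X' (fob F (md c)) Y' \<in> obj V"
    and ar: "\<And>t. arr V t \<Longrightarrow> lb (src t) = X \<Longrightarrow> rb (src t) = Y \<Longrightarrow> arr V (cell_map X' Y' F t)"
    and id: "\<And>c. c \<in> obj V \<Longrightarrow> lb c = X \<Longrightarrow> rb c = Y \<Longrightarrow> cell_map X' Y' F (idt V c) = idt V (Cell X' (fob F (md c)) Y')"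
    and cp: "\<And>s t. arr V s \<Longrightarrow> arr V t \<Longrightarrow> src s = tgt t \<Longrightarrow> lb (src t) = X \<Longrightarrow> rb (src t) = Y \<Longrightarrow>
      cell_map X' Y' F (s \<diamondop> t) = cell_map X' Y' F s \<diamondop> cell_map X' Y' F t"
  shows "is_functor (Mix K X Y) (Mix K X' Y') F"
  unfolding is_functor_def
proof (intro conjI ballI category_Mix b)
  fix M assume M: "M \<in> obj (Mix K X Y)"
  show "fob F M \<in> obj (Mix K X' Y')"
    using ob[of "Cell X M Y"] M b by (simp add: Cell_V)
  have "raw (cell_map X' Y' F (idt V (Cell X M Y))) = raw (idt V (Cell X' (fob F M) Y'))"
    using id[of "Cell X M Y"] M b by (simp add: Cell_V)
  then show "far F M M (ident (Mix K X Y) M) = ident (Mix K X' Y') (fob F M)"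
    by simp
next
  fix M N f assume M: "M \<in> obj (Mix K X Y)" "N \<in> obj (Mix K X Y)" "f \<in> hom (Mix K X Y) M N"
  have "arr V (Arr (Cell X M Y) f (Cell X N Y))"
    using M b by (simp only: arr_Cell)
  from ar[OF this] show "far F M N f \<in> hom (Mix K X' Y') (fob F M) (fob F N)"
    unfolding cell_map_def using b by (simp add: arr_Cell del: arr_Arr)
next
  fix M N L f g assume M: "M \<in> obj (Mix K X Y)" "N \<in> obj (Mix K X Y)" "L \<in> obj (Mix K X Y)"
    "f \<in> hom (Mix K X Y) M N" "g \<in> hom (Mix K X Y) N L"
  let ?f = "Arr (Cell X M Y) f (Cell X N Y)" and ?g = "Arr (Cell X N Y) g (Cell X L Y)"
  have a: "arr V ?f" "arr V ?g"
    using M b by (simp_all only: arr_Cell)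
  have "raw (cell_map X' Y' F (?g \<diamondop> ?f)) = raw (cell_map X' Y' F ?g \<diamondop> cell_map X' Y' F ?f)"
    using cp[OF a(2,1)] by simp
  also have "\<dots> = raw (cell_map X' Y' F ?g) \<cdot> raw (cell_map X' Y' F ?f)"
    using ar[OF a(1)] ar[OF a(2)] by (simp del: raw_cell_map)
  finally show "far F M L (g \<cdot>\<^bsub>Mix K X Y\<^esub> f) = far F N L g \<cdot>\<^bsub>Mix K X' Y'\<^esub> far F M N f"
    using a by (simp del: arr_Arr)
qed

lemma adjunction_from_V:
  assumes b: "X \<in> bases" "Y \<in> bases" "X' \<in> bases" "Y' \<in> bases"
    and F: "is_functor (Mix K X Y) (Mix K X' Y') F" and G: "is_functor (Mix K X' Y') (Mix K X Y) G"
    and \<eta>: "\<And>c. c \<in> obj V \<Longrightarrow> lb c = X \<Longrightarrow> rb c = Y \<Longrightarrow> arr V (\<eta> c)"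
      "\<And>c. c \<in> obj V \<Longrightarrow> lb c = X \<Longrightarrow> rb c = Y \<Longrightarrow> src (\<eta> c) = c"
      "\<And>c. c \<in> obj V \<Longrightarrow> lb c = X \<Longrightarrow> rb c = Y \<Longrightarrow> tgt (\<eta> c) = Cell X (fob G (fob F (md c))) Y"
    and \<epsilon>: "\<And>d. d \<in> obj V \<Longrightarrow> lb d = X' \<Longrightarrow> rb d = Y' \<Longrightarrow> arr V (\<epsilon> d)"
      "\<And>d. d \<in> obj V \<Longrightarrow> lb d = X' \<Longrightarrow> rb d = Y' \<Longrightarrow> src (\<epsilon> d) = Cell X' (fob F (fob G (md d))) Y'"
      "\<And>d. d \<in> obj V \<Longrightarrow> lb d = X' \<Longrightarrow> rb d = Y' \<Longrightarrow> tgt (\<epsilon> d) = d"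
    and \<eta>_nat: "\<And>t. arr V t \<Longrightarrow> lb (src t) = X \<Longrightarrow> rb (src t) = Y \<Longrightarrow>
      \<eta> (tgt t) \<diamondop> t = cell_map X Y G (cell_map X' Y' F t) \<diamondop> \<eta> (src t)"
    and \<epsilon>_nat: "\<And>t. arr V t \<Longrightarrow> lb (src t) = X' \<Longrightarrow> rb (src t) = Y' \<Longrightarrow>
      \<epsilon> (tgt t) \<diamondop> cell_map X' Y' F (cell_map X Y G t) = t \<diamondop> \<epsilon> (src t)"
    and zigF: "\<And>c. c \<in> obj V \<Longrightarrow> lb c = X \<Longrightarrow> rb c = Y \<Longrightarrow>
      \<epsilon> (Cell X' (fob F (md c)) Y') \<diamondop> cell_map X' Y' F (\<eta> c) = idt V (Cell X' (fob F (md c)) Y')"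
    and zigG: "\<And>d. d \<in> obj V \<Longrightarrow> lb d = X' \<Longrightarrow> rb d = Y' \<Longrightarrow>
      cell_map X Y G (\<epsilon> d) \<diamondop> \<eta> (Cell X (fob G (md d)) Y) = idt V (Cell X (fob G (md d)) Y)"
  shows "adjunction (Mix K X Y) (Mix K X' Y') F G"
proof -
  have oF: "fob F M \<in> obj (Mix K X' Y')" if "M \<in> obj (Mix K X Y)" for M
    using is_functorD(3)[OF F that] .
  have oG: "fob G N \<in> obj (Mix K X Y)" if "N \<in> obj (Mix K X' Y')" for N
    using is_functorD(3)[OF G that] .
  have vF: "arr V (cell_map X' Y' F t)" if "arr V t" "lb (src t) = X" "rb (src t) = Y" for t
    using is_functorD(4)[OF F, of "md (src t)" "md (tgt t)" "raw t"] that arr_V_raw[of t] arr_V_bases[of t]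
      cell_md[of "src t"] cell_md[of "tgt t"] b oF
    unfolding cell_map_def arr_Cell[OF b(3,4)] by simp
  have vG: "arr V (cell_map X Y G t)" if "arr V t" "lb (src t) = X'" "rb (src t) = Y'" for t
    using is_functorD(4)[OF G, of "md (src t)" "md (tgt t)" "raw t"] that arr_V_raw[of t] arr_V_bases[of t]
      cell_md[of "src t"] cell_md[of "tgt t"] b oG
    unfolding cell_map_def arr_Cell[OF b(1,2)] by simp
  have C: "Cell X M Y \<in> obj V" if "M \<in> obj (Mix K X Y)" for M
    using that b by (simp add: Cell_V)
  have C': "Cell X' N Y' \<in> obj V" if "N \<in> obj (Mix K X' Y')" for N
    using that b by (simp add: Cell_V)
  note e = \<eta>[OF C, simplified]
  note d = \<epsilon>[OF C', simplified]
  show ?thesis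
  proof (rule adjunction_unit_counit[OF F G, of "\<lambda>M. raw (\<eta> (Cell X M Y))" "\<lambda>N. raw (\<epsilon> (Cell X' N Y'))"])
    fix M assume M: "M \<in> obj (Mix K X Y)"
    show "raw (\<eta> (Cell X M Y)) \<in> hom (Mix K X Y) M (fob G (fob F M))"
      using arr_V_raw[OF e(1)[OF M]] e(2,3)[OF M] by simp
    have a: "arr V (\<epsilon> (Cell X' (fob F M) Y'))" "arr V (cell_map X' Y' F (\<eta> (Cell X M Y)))"
      using d(1)[OF oF[OF M]] vF[OF e(1)[OF M]] e(2)[OF M] by simp_all
    have "raw (\<epsilon> (Cell X' (fob F M) Y') \<diamondop> cell_map X' Y' F (\<eta> (Cell X M Y))) = raw (idt V (Cell X' (fob F M) Y'))"
      using zigF[OF C[OF M]] by simp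
    then show "raw (\<epsilon> (Cell X' (fob F M) Y')) \<cdot>\<^bsub>Mix K X' Y'\<^esub> far F M (fob G (fob F M)) (raw (\<eta> (Cell X M Y)))
        = ident (Mix K X' Y') (fob F M)"
      using a d(2)[OF oF[OF M]] e(2,3)[OF M] by simp
  next
    fix N assume N: "N \<in> obj (Mix K X' Y')"
    show "raw (\<epsilon> (Cell X' N Y')) \<in> hom (Mix K X' Y') (fob F (fob G N)) N"
      using arr_V_raw[OF d(1)[OF N]] d(2,3)[OF N] by simp
    have a: "arr V (\<eta> (Cell X (fob G N) Y))" "arr V (cell_map X Y G (\<epsilon> (Cell X' N Y')))"
      using e(1)[OF oG[OF N]] vG[OF d(1)[OF N]] d(2)[OF N] by simp_all
    have "raw (cell_map X Y G (\<epsilon> (Cell X' N Y')) \<diamondop> \<eta> (Cell X (fob G N) Y)) = raw (idt V (Cell X (fob G N) Y))"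
      using zigG[OF C'[OF N]] by simp
    then show "far G (fob F (fob G N)) N (raw (\<epsilon> (Cell X' N Y'))) \<cdot>\<^bsub>Mix K X Y\<^esub> raw (\<eta> (Cell X (fob G N) Y))
        = ident (Mix K X Y) (fob G N)"
      using a e(3)[OF oG[OF N]] d(2,3)[OF N] by simp
  next
    fix M M' u assume M: "M \<in> obj (Mix K X Y)" "M' \<in> obj (Mix K X Y)" and u: "u \<in> hom (Mix K X Y) M M'"
    let ?t = "Arr (Cell X M Y) u (Cell X M' Y)"
    have t: "arr V ?t" using M u b by (simp only: arr_Cell)
    have a: "arr V (cell_map X' Y' F ?t)" "arr V (cell_map X Y G (cell_map X' Y' F ?t))"
      using vF[OF t] vG[OF vF[OF t]] by simp_all
    have "raw (\<eta> (tgt ?t) \<diamondop> ?t) = raw (cell_map X Y G (cell_map X' Y' F ?t) \<diamondop> \<eta> (src ?t))"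
      using \<eta>_nat[OF t] by simp
    then show "raw (\<eta> (Cell X M' Y)) \<cdot>\<^bsub>Mix K X Y\<^esub> u
        = far G (fob F M) (fob F M') (far F M M' u) \<cdot>\<^bsub>Mix K X Y\<^esub> raw (\<eta> (Cell X M Y))"
      using a t e(1-3)[OF M(1)] e(1-3)[OF M(2)] by (simp del: arr_Arr)
  next
    fix N N' v assume N: "N \<in> obj (Mix K X' Y')" "N' \<in> obj (Mix K X' Y')" and v: "v \<in> hom (Mix K X' Y') N N'"
    let ?t = "Arr (Cell X' N Y') v (Cell X' N' Y')"
    have t: "arr V ?t" using N v b by (simp only: arr_Cell)
    have a: "arr V (cell_map X Y G ?t)" "arr V (cell_map X' Y' F (cell_map X Y G ?t))"
      using vG[OF t] vF[OF vG[OF t]] by simp_all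
    have "raw (\<epsilon> (tgt ?t) \<diamondop> cell_map X' Y' F (cell_map X Y G ?t)) = raw (?t \<diamondop> \<epsilon> (src ?t))"
      using \<epsilon>_nat[OF t] by simp
    then show "raw (\<epsilon> (Cell X' N' Y')) \<cdot>\<^bsub>Mix K X' Y'\<^esub> far F (fob G N) (fob G N') (far G N N' v)
        = v \<cdot>\<^bsub>Mix K X' Y'\<^esub> raw (\<epsilon> (Cell X' N Y'))"
      using a t d(1-3)[OF N(1)] d(1-3)[OF N(2)] by (simp del: arr_Arr)
  qed
qed

text \<open>The functors \<open>c \<otimes> _\<close> and \<open>_ \<otimes> d\<close>, over a base of either kind.\<close>

definition tensor_left :: "('a, 'b) cell \<Rightarrow> ('a, 'b) comon \<Rightarrow> (('a, 'b) bi, 'b, ('a, 'b) bi, 'b) ftor" where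
  "tensor_left c Y = \<lparr> fob = (\<lambda>N. mten K (lb c) (rb c) Y (md c) N),
     far = (\<lambda>N N' f. bal_map K (rb c) (md c) N (rb c) (md c) N' (ident K (car c)) f) \<rparr>"

definition tensor_right :: "('a, 'b) comon \<Rightarrow> ('a, 'b) cell \<Rightarrow> (('a, 'b) bi, 'b, ('a, 'b) bi, 'b) ftor" where
  "tensor_right X d = \<lparr> fob = (\<lambda>M. mten K X (lb d) (rb d) M (md d)),
     far = (\<lambda>M M' f. bal_map K (lb d) M (md d) (lb d) M' (md d) f (ident K (car d))) \<rparr>"

lemma tensor_left_cell: "lb d = rb c \<Longrightarrow> rb d = Y \<Longrightarrow> Cell (lb c) (fob (tensor_left c Y) (md d)) Y = hob c d"
  by (simp add: tensor_left_def hob_def)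

lemma tensor_right_cell: "lb c = X \<Longrightarrow> rb c = lb d \<Longrightarrow> Cell X (fob (tensor_right X d) (md c)) (rb d) = hob c d"
  by (simp add: tensor_right_def hob_def)

lemma tensor_left_cell_map:
  assumes "c \<in> obj V" "arr V t" "lb (src t) = rb c" "rb (src t) = Y"
  shows "cell_map (lb c) Y (tensor_left c Y) t = idt V c \<star> t"
proof -
  have "rb (tgt t) = Y" "lb (tgt t) = rb c" using arr_V_bases[OF assms(2)] assms by simp_all
  then show ?thesis
    unfolding cell_map_def hc_def using assms by (simp add: tensor_left_cell) (simp add: tensor_left_def)
qed

lemma tensor_right_cell_map:
  assumes "d \<in> obj V" "arr V t" "rb (src t) = lb d" "lb (src t) = X"
  shows "cell_map X (rb d) (tensor_right X d) t = t \<star> idt V d"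
proof -
  have "lb (tgt t) = X" "rb (tgt t) = lb d" using arr_V_bases[OF assms(2)] assms by simp_all
  then show ?thesis
    unfolding cell_map_def hc_def using assms by (simp add: tensor_right_cell) (simp add: tensor_right_def)
qed

lemma tensor_left_functor:
  assumes c: "c \<in> obj V" and Y: "Y \<in> bases"
  shows "is_functor (Mix K (rb c) Y) (Mix K (lb c) Y) (tensor_left c Y)"
proof (rule functor_from_V)
  fix d assume d: "d \<in> obj V" "lb d = rb c" "rb d = Y"
  then have cd: "c \<rhd> d" using c by (simp add: composable_def)
  show "Cell (lb c) (fob (tensor_left c Y) (md d)) Y \<in> obj V"
    using cd d by (simp add: tensor_left_cell)
  show "cell_map (lb c) Y (tensor_left c Y) (idt V d) = idt V (Cell (lb c) (fob (tensor_left c Y) (md d)) Y)"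
    using cd c d by (simp add: tensor_left_cell_map tensor_left_cell)
next
  fix t assume "arr V t" "lb (src t) = rb c" "rb (src t) = Y"
  then show "arr V (cell_map (lb c) Y (tensor_left c Y) t)"
    using c by (simp add: tensor_left_cell_map)
next
  fix s t assume s: "arr V s" "arr V t" "src s = tgt t" "lb (src t) = rb c" "rb (src t) = Y"
  then show "cell_map (lb c) Y (tensor_left c Y) (s \<diamondop> t) = cell_map (lb c) Y (tensor_left c Y) s \<diamondop> cell_map (lb c) Y (tensor_left c Y) t"
    using c arr_V_bases[OF s(2)] by (simp add: tensor_left_cell_map hc_cmp)
qed (use c Y in simp_all)

lemma tensor_right_functor:
  assumes d: "d \<in> obj V" and X: "X \<in> bases"
  shows "is_functor (Mix K X (lb d)) (Mix K X (rb d)) (tensor_right X d)"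
proof (rule functor_from_V)
  fix c assume c: "c \<in> obj V" "lb c = X" "rb c = lb d"
  then have cd: "c \<rhd> d" using d by (simp add: composable_def)
  show "Cell X (fob (tensor_right X d) (md c)) (rb d) \<in> obj V"
    using cd c by (simp add: tensor_right_cell)
  show "cell_map X (rb d) (tensor_right X d) (idt V c) = idt V (Cell X (fob (tensor_right X d) (md c)) (rb d))"
    using cd c d by (simp add: tensor_right_cell_map tensor_right_cell)
next
  fix t assume "arr V t" "lb (src t) = X" "rb (src t) = lb d"
  then show "arr V (cell_map X (rb d) (tensor_right X d) t)"
    using d by (simp add: tensor_right_cell_map)
next
  fix s t assume s: "arr V s" "arr V t" "src s = tgt t" "lb (src t) = X" "rb (src t) = lb d"
  then show "cell_map X (rb d) (tensor_right X d) (s \<diamondop> t) = cell_map X (rb d) (tensor_right X d) s \<diamondop> cell_map X (rb d) (tensor_right X d) t"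
    using d arr_V_bases[OF s(2)] by (simp add: tensor_right_cell_map hc_cmp)
qed (use d X in simp_all)

section \<open>Change of comonoid\<close>

text \<open>The comodules \<open>\<^sub>gN\<close> and \<open>N\<^sub>g\<close> over \<open>D\<close>, for a comonoid morphism \<open>g\<close> into \<open>D\<close>.\<close>

definition push_left :: "'b \<Rightarrow> ('a, 'b) comon \<Rightarrow> ('a, 'b) cell \<Rightarrow> ('a, 'b) cell" where
  "push_left g D c = Cell D (comod_left_via K g (md c)) (rb c)"

definition push_right :: "'b \<Rightarrow> ('a, 'b) comon \<Rightarrow> ('a, 'b) cell \<Rightarrow> ('a, 'b) cell" where
  "push_right g D c = Cell (lb c) (comod_right_via K g (md c)) D"

lemma req_ten:
  assumes "arr K f" "rty Y n r"
  shows "req Y (rtens Y r (src f) n) (rtens Y r (tgt f) n) (f \<odot> Id n)"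
proof -
  have y: "und Y \<in> obj K" "n \<in> obj K" "arr K r" using assms by (simp_all add: rty_def)
  have ty: "rty Y (src f \<otimes> n) (rtens Y r (src f) n)" "rty Y (tgt f \<otimes> n) (rtens Y r (tgt f) n)" using assms by simp_all
  show ?thesis
  proof (cases "isM Y")
    case True
    then have r: "src r = n \<otimes> und Y" "tgt r = n" using assms by (simp_all add: rty_def)
    have e: "Asc (tgt f) n (und Y) \<bullet> ((f \<odot> Id n) \<odot> Id (und Y)) = (f \<odot> (Id n \<odot> Id (und Y))) \<bullet> Asc (src f) n (und Y)"
      using Asc_natural[of f "Id n" "Id (und Y)"] assms y by simp
    show ?thesis
      using assms y ty True r e by (simp add: req_def rtens_def merge cmp_assoc)
  next
    case False
    then have r: "src r = n" "tgt r = n \<otimes> und Y" using assms by (simp_all add: rty_def)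
    have e: "Asi (tgt f) n (und Y) \<bullet> (f \<odot> (Id n \<odot> Id (und Y))) = ((f \<odot> Id n) \<odot> Id (und Y)) \<bullet> Asi (src f) n (und Y)"
      using Asi_natural[of f "Id n" "Id (und Y)"] assms y by simp
    have "Asi (tgt f) n (und Y) \<bullet> (Id (tgt f) \<odot> r) \<bullet> (f \<odot> Id n) = Asi (tgt f) n (und Y) \<bullet> (f \<odot> (Id n \<odot> Id (und Y))) \<bullet> (Id (src f) \<odot> r)"
      using assms y r by (simp add: merge)
    then show ?thesis
      using assms y ty False r tail[OF e] by (simp add: req_def rtens_def cmp_assoc)
  qed
qed

lemma leq_ten:
  assumes "arr K f" "lty X m l"
  shows "leq X (ltens X l m (src f)) (ltens X l m (tgt f)) (Id m \<odot> f)"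
proof -
  have x: "und X \<in> obj K" "m \<in> obj K" "arr K l" using assms by (simp_all add: lty_def)
  have ty: "lty X (m \<otimes> src f) (ltens X l m (src f))" "lty X (m \<otimes> tgt f) (ltens X l m (tgt f))" using assms by simp_all
  show ?thesis
  proof (cases "isM X")
    case True
    then have l: "src l = und X \<otimes> m" "tgt l = m" using assms by (simp_all add: lty_def)
    have e: "Asi (und X) m (tgt f) \<bullet> (Id (und X) \<odot> (Id m \<odot> f)) = ((Id (und X) \<odot> Id m) \<odot> f) \<bullet> Asi (und X) m (src f)"
      using Asi_natural[of "Id (und X)" "Id m" f] assms x by simp
    show ?thesis
      using assms x ty True l e by (simp add: leq_def ltens_def merge cmp_assoc)
  next
    case False
    then have l: "src l = m" "tgt l = und X \<otimes> m" using assms by (simp_all add: lty_def)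
    have e: "Asc (und X) m (tgt f) \<bullet> ((Id (und X) \<odot> Id m) \<odot> f) = (Id (und X) \<odot> (Id m \<odot> f)) \<bullet> Asc (und X) m (src f)"
      using Asc_natural[of "Id (und X)" "Id m" f] assms x by simp
    have "Asc (und X) m (tgt f) \<bullet> (l \<odot> Id (tgt f)) \<bullet> (Id m \<odot> f) = Asc (und X) m (tgt f) \<bullet> ((Id (und X) \<odot> Id m) \<odot> f) \<bullet> (l \<odot> Id (src f))"
      using assms x l by (simp add: merge)
    then show ?thesis
      using assms x ty False l tail[OF e] by (simp add: leq_def ltens_def cmp_assoc)
  qed
qed

lemma req_Lu: "rty Y n r \<Longrightarrow> req Y (rtens Y r \<one> n) r (Lu n)"
  using commuting_one_left[of Y n r] by (simp add: commuting_def rty_def)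

lemma leq_Ru:
  assumes "lty X m l"
  shows "leq X (ltens X l m \<one>) l (Ru m)"
  using commuting_left[OF commuting_one_right[OF assms] assms] assms by (simp add: lty_def rty_def)

end

text \<open>A morphism \<open>g : C \<rightarrow> D\<close> of comonoids, also given as the arrow \<open>h\<close> that knows its source and target.\<close>

locale comonoid_change = twistable_cat +
  fixes g :: 'b and C D :: "('a, 'b) comon" and h :: "('a, 'b) tarr"
  assumes C: "C \<in> bases" "\<not> isM C" and D: "D \<in> bases" "\<not> isM D"
    and h: "arr K h" "src h = und C" "tgt h = und D" "raw h = g"
    and h_mu: "(h \<odot> h) \<bullet> mu C = mu D \<bullet> h" and h_un: "un D \<bullet> h = un C"
begin

lemma uC: "und C \<in> obj K" "und D \<in> obj K"
  using C D by simp_all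

lemma push_left_sel:
  assumes c: "c \<in> obj V" and l: "lb c = C"
  shows "lb (push_left g D c) = D" "rb (push_left g D c) = rb c" "car (push_left g D c) = car c" "ra (push_left g D c) = ra c"
    "la (push_left g D c) = (h \<odot> Id (car c)) \<bullet> la c"
proof -
  show s: "lb (push_left g D c) = D" "rb (push_left g D c) = rb c" "car (push_left g D c) = car c" "ra (push_left g D c) = ra c"
    by (simp_all add: push_left_def comod_left_via_def ra_def)
  have a: "arr K ((h \<odot> Id (car c)) \<bullet> la c)" "src ((h \<odot> Id (car c)) \<bullet> la c) = car c"
    "tgt ((h \<odot> Id (car c)) \<bullet> la c) = und D \<otimes> car c" "raw ((h \<odot> Id (car c)) \<bullet> la c) = (g \<boxtimes> ident K (car c)) \<cdot> lact (md c)"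
    using c l C D h by simp_all
  have "la (push_left g D c) = Arr (car c) ((g \<boxtimes> ident K (car c)) \<cdot> lact (md c)) (und D \<otimes> car c)"
    using s D by (simp add: la_def) (simp add: push_left_def comod_left_via_def)
  also have "\<dots> = (h \<odot> Id (car c)) \<bullet> la c"
    using Arr_collapse[OF a(1)] unfolding a(2-4) .
  finally show "la (push_left g D c) = (h \<odot> Id (car c)) \<bullet> la c" .
qed

lemma push_left_V:
  assumes c: "c \<in> obj V" and l: "lb c = C"
  shows "push_left g D c \<in> obj V"
proof -
  note sel = push_left_sel[OF c l]
  note [simp] = c l C D h(1-3) uC
  let ?n = "car c" and ?c = "und C" and ?d = "und D"
  have lc: "Asc ?c ?c ?n \<bullet> (mu C \<odot> Id ?n) \<bullet> la c = (Id ?c \<odot> la c) \<bullet> la c" "Lu ?n \<bullet> (un C \<odot> Id ?n) \<bullet> la c = Id ?n"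
    using cell_lstruct[OF c] by (simp_all add: lstruct_def)
  let ?l = "(h \<odot> Id ?n) \<bullet> la c"
  have "Asc ?d ?d ?n \<bullet> (mu D \<odot> Id ?n) \<bullet> ?l = Asc ?d ?d ?n \<bullet> ((h \<odot> h) \<odot> Id ?n) \<bullet> (mu C \<odot> Id ?n) \<bullet> la c"
    by (simp add: merge h_mu)
  also have "\<dots> = (h \<odot> (h \<odot> Id ?n)) \<bullet> (Id ?c \<odot> la c) \<bullet> la c"
    using tail[OF Asc_natural[of h h "Id ?n"]] lc(1) by (simp add: cmp_assoc)
  also have "\<dots> = (Id ?d \<odot> ?l) \<bullet> ?l"
    by (simp add: merge)
  finally have 1: "Asc ?d ?d ?n \<bullet> (mu D \<odot> Id ?n) \<bullet> ?l = (Id ?d \<odot> ?l) \<bullet> ?l" .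
  have 2: "Lu ?n \<bullet> (un D \<odot> Id ?n) \<bullet> ?l = Id ?n"
    using lc(2) by (simp add: merge h_un)
  have ls: "lstruct D ?n ?l"
    using 1 2 by (simp add: lstruct_def lty_def)
  have "req (rb c) (ra c) (rtens (rb c) (ra c) ?c ?n) (la c)"
    using la_req(2)[OF c] by simp
  moreover have "req (rb c) (rtens (rb c) (ra c) ?c ?n) (rtens (rb c) (ra c) ?d ?n) (h \<odot> Id ?n)"
    using req_ten[OF h(1) rty_ra[OF c]] by simp
  ultimately have "commuting D (rb c) ?n ?l (ra c)"
    unfolding commuting_def using req_cmp by simp
  then show ?thesis
    unfolding cell_iff sel using ls cell_rstruct[OF c] by simp
qed

definition push_left_map :: "(('a, 'b) cell, 'b) tarr \<Rightarrow> (('a, 'b) cell, 'b) tarr" where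
  "push_left_map t = Arr (push_left g D (src t)) (raw t) (push_left g D (tgt t))"

lemma push_left_map_arr:
  assumes t: "arr V t" and l: "lb (src t) = C"
  shows "arr V (push_left_map t)" "U (push_left_map t) = U t"
proof -
  note b = arr_V_bases[OF t]
  have o: "src t \<in> obj V" "tgt t \<in> obj V" "lb (tgt t) = C" using t l b by simp_all
  note s = push_left_sel[OF o(1) l] and s' = push_left_sel[OF o(2,3)]
  note [simp] = C D h(1-3) uC t l b s s' push_left_V[OF o(1) l] push_left_V[OF o(2,3)] o
  have "la (tgt t) \<bullet> U t = (Id (und C) \<odot> U t) \<bullet> la (src t)"
    using la_natural(2)[OF t] by simp
  then have "((h \<odot> Id (car (tgt t))) \<bullet> la (tgt t)) \<bullet> U t = (Id (und D) \<odot> U t) \<bullet> (h \<odot> Id (car (src t))) \<bullet> la (src t)"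
    by (simp add: cmp_assoc merge)
  then have "leq D (la (push_left g D (src t))) (la (push_left g D (tgt t))) (U t)"
    by (simp add: leq_def lty_def)
  then have "arr V (Arr (push_left g D (src t)) (raw (U t)) (push_left g D (tgt t)))" "U (Arr (push_left g D (src t)) (raw (U t)) (push_left g D (tgt t))) = U t"
    using U_req[OF t] by (intro arr_VI; simp)+
  then show "arr V (push_left_map t)" "U (push_left_map t) = U t"
    by (simp_all add: push_left_map_def)
qed

lemma src_push_left_map [simp]: "src (push_left_map t) = push_left g D (src t)" and tgt_push_left_map [simp]: "tgt (push_left_map t) = push_left g D (tgt t)"
  by (simp_all add: push_left_map_def)

lemma push_right_sel:
  assumes c: "c \<in> obj V" and l: "rb c = C"
  shows "rb (push_right g D c) = D" "lb (push_right g D c) = lb c" "car (push_right g D c) = car c" "la (push_right g D c) = la c"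
    "ra (push_right g D c) = (Id (car c) \<odot> h) \<bullet> ra c"
proof -
  show s: "rb (push_right g D c) = D" "lb (push_right g D c) = lb c" "car (push_right g D c) = car c" "la (push_right g D c) = la c"
    by (simp_all add: push_right_def comod_right_via_def la_def)
  have a: "arr K ((Id (car c) \<odot> h) \<bullet> ra c)" "src ((Id (car c) \<odot> h) \<bullet> ra c) = car c"
    "tgt ((Id (car c) \<odot> h) \<bullet> ra c) = car c \<otimes> und D" "raw ((Id (car c) \<odot> h) \<bullet> ra c) = (ident K (car c) \<boxtimes> g) \<cdot> ract (md c)"
    using c l C D h by simp_all
  have "ra (push_right g D c) = Arr (car c) ((ident K (car c) \<boxtimes> g) \<cdot> ract (md c)) (car c \<otimes> und D)"
    using s D by (simp add: ra_def) (simp add: push_right_def comod_right_via_def)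
  also have "\<dots> = (Id (car c) \<odot> h) \<bullet> ra c"
    using Arr_collapse[OF a(1)] unfolding a(2-4) .
  finally show "ra (push_right g D c) = (Id (car c) \<odot> h) \<bullet> ra c" .
qed

lemma push_right_V:
  assumes c: "c \<in> obj V" and l: "rb c = C"
  shows "push_right g D c \<in> obj V"
proof -
  note sel = push_right_sel[OF c l]
  note [simp] = c l C D h(1-3) uC
  let ?m = "car c" and ?c = "und C" and ?d = "und D"
  have rc: "Asc ?m ?c ?c \<bullet> (ra c \<odot> Id ?c) \<bullet> ra c = (Id ?m \<odot> mu C) \<bullet> ra c" "Ru ?m \<bullet> (Id ?m \<odot> un C) \<bullet> ra c = Id ?m"
    using cell_rstruct[OF c] by (simp_all add: rstruct_def)
  let ?r = "(Id ?m \<odot> h) \<bullet> ra c"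
  have "Asc ?m ?d ?d \<bullet> (?r \<odot> Id ?d) \<bullet> ?r = Asc ?m ?d ?d \<bullet> ((Id ?m \<odot> h) \<odot> h) \<bullet> (ra c \<odot> Id ?c) \<bullet> ra c"
    by (simp add: merge)
  also have "\<dots> = (Id ?m \<odot> (h \<odot> h)) \<bullet> (Id ?m \<odot> mu C) \<bullet> ra c"
    using tail[OF Asc_natural[of "Id ?m" h h]] rc(1) by (simp add: cmp_assoc)
  also have "\<dots> = (Id ?m \<odot> mu D) \<bullet> ?r"
    by (simp add: merge h_mu)
  finally have 1: "Asc ?m ?d ?d \<bullet> (?r \<odot> Id ?d) \<bullet> ?r = (Id ?m \<odot> mu D) \<bullet> ?r" .
  have 2: "Ru ?m \<bullet> (Id ?m \<odot> un D) \<bullet> ?r = Id ?m"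
    using rc(2) by (simp add: merge h_un)
  have rs: "rstruct D ?m ?r"
    using 1 2 by (simp add: rstruct_def rty_def)
  have "commuting (lb c) D ?m (la c) ?r"
  proof (cases "isM (lb c)")
    case True
    have e: "req C (rtens C (ra c) (und (lb c)) ?m) (ra c) (la c)"
      using la_req(1)[OF c True] by simp
    have x: "und (lb c) \<in> obj K" by simp
    have n: "Asi (und (lb c)) ?m ?d \<bullet> (Id (und (lb c)) \<odot> (Id ?m \<odot> h)) = ((Id (und (lb c)) \<odot> Id ?m) \<odot> h) \<bullet> Asi (und (lb c)) ?m ?c"
      using Asi_natural[of "Id (und (lb c))" "Id ?m" h] by simp
    have "ra c \<bullet> la c = (la c \<odot> Id ?c) \<bullet> Asi (und (lb c)) ?m ?c \<bullet> (Id (und (lb c)) \<odot> ra c)"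
      using e by (simp add: req_def rtens_def)
    then have "?r \<bullet> la c = (Id ?m \<odot> h) \<bullet> (la c \<odot> Id ?c) \<bullet> Asi (und (lb c)) ?m ?c \<bullet> (Id (und (lb c)) \<odot> ra c)"
      by (simp add: cmp_assoc)
    also have "\<dots> = (la c \<odot> Id ?d) \<bullet> ((Id (und (lb c)) \<odot> Id ?m) \<odot> h) \<bullet> Asi (und (lb c)) ?m ?c \<bullet> (Id (und (lb c)) \<odot> ra c)"
      using True by (simp add: merge)
    also have "\<dots> = (la c \<odot> Id ?d) \<bullet> Asi (und (lb c)) ?m ?d \<bullet> (Id (und (lb c)) \<odot> (Id ?m \<odot> h)) \<bullet> (Id (und (lb c)) \<odot> ra c)"
      by (simp only: tail[OF n] cmp_assoc)
    also have "\<dots> = (la c \<odot> Id ?d) \<bullet> rtens D ?r (und (lb c)) ?m"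
      by (simp add: rtens_def merge)
    finally show ?thesis
      using True rty_rtens[of D ?m ?r "und (lb c)"] by (simp add: commuting_def req_def rty_def)
  next
    case False
    have e: "req C (ra c) (rtens C (ra c) (und (lb c)) ?m) (la c)"
      using la_req(2)[OF c False] by simp
    have n: "Asi (und (lb c)) ?m ?d \<bullet> (Id (und (lb c)) \<odot> (Id ?m \<odot> h)) = ((Id (und (lb c)) \<odot> Id ?m) \<odot> h) \<bullet> Asi (und (lb c)) ?m ?c"
      using Asi_natural[of "Id (und (lb c))" "Id ?m" h] by simp
    have "Asi (und (lb c)) ?m ?c \<bullet> (Id (und (lb c)) \<odot> ra c) \<bullet> la c = (la c \<odot> Id ?c) \<bullet> ra c"
      using e by (simp add: req_def rtens_def cmp_assoc)
    then have "((Id (und (lb c)) \<odot> Id ?m) \<odot> h) \<bullet> Asi (und (lb c)) ?m ?c \<bullet> (Id (und (lb c)) \<odot> ra c) \<bullet> la c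
        = ((Id (und (lb c)) \<odot> Id ?m) \<odot> h) \<bullet> (la c \<odot> Id ?c) \<bullet> ra c"
      by simp
    then have "Asi (und (lb c)) ?m ?d \<bullet> (Id (und (lb c)) \<odot> (Id ?m \<odot> h)) \<bullet> (Id (und (lb c)) \<odot> ra c) \<bullet> la c
        = ((Id (und (lb c)) \<odot> Id ?m) \<odot> h) \<bullet> (la c \<odot> Id ?c) \<bullet> ra c"
      by (simp only: tail[OF n] cmp_assoc)
    then have "rtens D ?r (und (lb c)) ?m \<bullet> la c = (la c \<odot> Id ?d) \<bullet> ?r"
      using False by (simp add: rtens_def merge cmp_assoc)
    then show ?thesis
      using False rty_rtens[of D ?m ?r "und (lb c)"] by (simp add: commuting_def req_def rty_def)
  qed
  then show ?thesis
    unfolding cell_iff sel using rs cell_lstruct[OF c] by simp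
qed

definition push_right_map :: "(('a, 'b) cell, 'b) tarr \<Rightarrow> (('a, 'b) cell, 'b) tarr" where
  "push_right_map t = Arr (push_right g D (src t)) (raw t) (push_right g D (tgt t))"

lemma push_right_map_arr:
  assumes t: "arr V t" and l: "rb (src t) = C"
  shows "arr V (push_right_map t)" "U (push_right_map t) = U t"
proof -
  note b = arr_V_bases[OF t]
  have o: "src t \<in> obj V" "tgt t \<in> obj V" "rb (tgt t) = C" using t l b by simp_all
  note s = push_right_sel[OF o(1) l] and s' = push_right_sel[OF o(2,3)]
  note [simp] = C D h(1-3) uC t l b s s' push_right_V[OF o(1) l] push_right_V[OF o(2,3)] o
  have "ra (tgt t) \<bullet> U t = (U t \<odot> Id (und C)) \<bullet> ra (src t)"
    using ra_natural(2)[OF t] by simp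
  then have "((Id (car (tgt t)) \<odot> h) \<bullet> ra (tgt t)) \<bullet> U t = (U t \<odot> Id (und D)) \<bullet> (Id (car (src t)) \<odot> h) \<bullet> ra (src t)"
    by (simp add: cmp_assoc merge)
  then have "req D (ra (push_right g D (src t))) (ra (push_right g D (tgt t))) (U t)"
    by (simp add: req_def rty_def)
  then have "arr V (Arr (push_right g D (src t)) (raw (U t)) (push_right g D (tgt t)))" "U (Arr (push_right g D (src t)) (raw (U t)) (push_right g D (tgt t))) = U t"
    using U_leq[OF t] by (intro arr_VI; simp)+
  then show "arr V (push_right_map t)" "U (push_right_map t) = U t"
    by (simp_all add: push_right_map_def)
qed

lemma src_push_right_map [simp]: "src (push_right_map t) = push_right g D (src t)" and tgt_push_right_map [simp]: "tgt (push_right_map t) = push_right g D (tgt t)"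
  by (simp_all add: push_right_map_def)

text \<open>\<open>cg\<close> is \<open>C\<^sub>g\<close> and \<open>gc\<close> is \<open>\<^sub>gC\<close>, each with the regular coaction of \<open>C\<close> on the other side.\<close>

definition "cg = push_right g D (reg C)"
definition "gc = push_left g D (reg C)"

lemma regC: "reg C \<in> obj V" "lb (reg C) = C" "rb (reg C) = C"
  using C by simp_all

lemma cg_V [simp]: "cg \<in> obj V" and cg_sel [simp]: "lb cg = C" "rb cg = D" "car cg = und C" "la cg = mu C"
    "ra cg = (Id (und C) \<odot> h) \<bullet> mu C"
  unfolding cg_def using push_right_sel[OF regC(1,3)] push_right_V[OF regC(1,3)] by simp_all

lemma gc_V [simp]: "gc \<in> obj V" and gc_sel [simp]: "lb gc = D" "rb gc = C" "car gc = und C" "ra gc = mu C"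
    "la gc = (h \<odot> Id (und C)) \<bullet> mu C"
  unfolding gc_def using push_left_sel[OF regC(1,2)] push_left_V[OF regC(1,2)] by simp_all

lemmas base_simps [simp] = C D h(1-3) uC

definition push_left_ftor :: "(('a, 'b) bi, 'b, ('a, 'b) bi, 'b) ftor" where
  "push_left_ftor = \<lparr> fob = comod_left_via K g, far = (\<lambda>_ _ f. f) \<rparr>"

definition push_right_ftor :: "(('a, 'b) bi, 'b, ('a, 'b) bi, 'b) ftor" where
  "push_right_ftor = \<lparr> fob = comod_right_via K g, far = (\<lambda>_ _ f. f) \<rparr>"

lemma push_left_ftor_cell: "rb c = Y \<Longrightarrow> Cell D (fob push_left_ftor (md c)) Y = push_left g D c"
  by (simp add: push_left_ftor_def push_left_def)

lemma push_right_ftor_cell: "lb c = X \<Longrightarrow> Cell X (fob push_right_ftor (md c)) D = push_right g D c"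
  by (simp add: push_right_ftor_def push_right_def)

lemma push_left_ftor_cell_map: "arr V t \<Longrightarrow> rb (src t) = Y \<Longrightarrow> cell_map D Y push_left_ftor t = push_left_map t"
  using arr_V_bases[of t] unfolding cell_map_def push_left_map_def by (simp add: push_left_ftor_cell) (simp add: push_left_ftor_def)

lemma push_right_ftor_cell_map: "arr V t \<Longrightarrow> lb (src t) = X \<Longrightarrow> cell_map X D push_right_ftor t = push_right_map t"
  using arr_V_bases[of t] unfolding cell_map_def push_right_map_def by (simp add: push_right_ftor_cell) (simp add: push_right_ftor_def)

lemma push_left_map_idt: "c \<in> obj V \<Longrightarrow> lb c = C \<Longrightarrow> push_left_map (idt V c) = idt V (push_left g D c)"
  using push_left_map_arr[of "idt V c"] push_left_V[of c] push_left_sel[of c] by (intro V_eqI) simp_all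

lemma push_right_map_idt: "c \<in> obj V \<Longrightarrow> rb c = C \<Longrightarrow> push_right_map (idt V c) = idt V (push_right g D c)"
  using push_right_map_arr[of "idt V c"] push_right_V[of c] push_right_sel[of c] by (intro V_eqI) simp_all

lemma push_left_map_cmp:
  assumes s: "arr V s" "arr V t" "src s = tgt t" "lb (src t) = C"
  shows "push_left_map (s \<diamondop> t) = push_left_map s \<diamondop> push_left_map t"
proof -
  note b = arr_V_bases[OF s(2)]
  have a: "arr V (push_left_map s)" "U (push_left_map s) = U s" "arr V (push_left_map t)" "U (push_left_map t) = U t"
    "arr V (push_left_map (s \<diamondop> t))" "U (push_left_map (s \<diamondop> t)) = U (s \<diamondop> t)"
    using push_left_map_arr[of s] push_left_map_arr[of t] push_left_map_arr[of "s \<diamondop> t"] s b by simp_all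
  show ?thesis
    by (rule V_eqI) (use a s in simp_all)
qed

lemma push_right_map_cmp:
  assumes s: "arr V s" "arr V t" "src s = tgt t" "rb (src t) = C"
  shows "push_right_map (s \<diamondop> t) = push_right_map s \<diamondop> push_right_map t"
proof -
  note b = arr_V_bases[OF s(2)]
  have a: "arr V (push_right_map s)" "U (push_right_map s) = U s" "arr V (push_right_map t)" "U (push_right_map t) = U t"
    "arr V (push_right_map (s \<diamondop> t))" "U (push_right_map (s \<diamondop> t)) = U (s \<diamondop> t)"
    using push_right_map_arr[of s] push_right_map_arr[of t] push_right_map_arr[of "s \<diamondop> t"] s b by simp_all
  show ?thesis
    by (rule V_eqI) (use a s in simp_all)
qed

lemma push_left_ftor_functor:
  assumes Y: "Y \<in> bases"
  shows "is_functor (Mix K C Y) (Mix K D Y) push_left_ftor"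
proof (rule functor_from_V)
  fix c assume c: "c \<in> obj V" "lb c = C" "rb c = Y"
  show "Cell D (fob push_left_ftor (md c)) Y \<in> obj V"
    using push_left_V[OF c(1,2)] c by (simp add: push_left_ftor_cell)
  show "cell_map D Y push_left_ftor (idt V c) = idt V (Cell D (fob push_left_ftor (md c)) Y)"
    using c by (simp add: push_left_ftor_cell_map push_left_ftor_cell push_left_map_idt)
next
  fix t assume "arr V t" "lb (src t) = C" "rb (src t) = Y"
  then show "arr V (cell_map D Y push_left_ftor t)"
    by (simp add: push_left_ftor_cell_map push_left_map_arr)
next
  fix s t assume s: "arr V s" "arr V t" "src s = tgt t" "lb (src t) = C" "rb (src t) = Y"
  then show "cell_map D Y push_left_ftor (s \<diamondop> t) = cell_map D Y push_left_ftor s \<diamondop> cell_map D Y push_left_ftor t"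
    using arr_V_bases[OF s(2)] by (simp add: push_left_ftor_cell_map push_left_map_cmp)
qed (use Y in simp_all)

lemma push_right_ftor_functor:
  assumes X: "X \<in> bases"
  shows "is_functor (Mix K X C) (Mix K X D) push_right_ftor"
proof (rule functor_from_V)
  fix c assume c: "c \<in> obj V" "lb c = X" "rb c = C"
  show "Cell X (fob push_right_ftor (md c)) D \<in> obj V"
    using push_right_V[OF c(1,3)] c by (simp add: push_right_ftor_cell)
  show "cell_map X D push_right_ftor (idt V c) = idt V (Cell X (fob push_right_ftor (md c)) D)"
    using c by (simp add: push_right_ftor_cell_map push_right_ftor_cell push_right_map_idt)
next
  fix t assume "arr V t" "lb (src t) = X" "rb (src t) = C"
  then show "arr V (cell_map X D push_right_ftor t)"
    by (simp add: push_right_ftor_cell_map push_right_map_arr)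
next
  fix s t assume s: "arr V s" "arr V t" "src s = tgt t" "lb (src t) = X" "rb (src t) = C"
  then show "cell_map X D push_right_ftor (s \<diamondop> t) = cell_map X D push_right_ftor s \<diamondop> cell_map X D push_right_ftor t"
    using arr_V_bases[OF s(2)] by (simp add: push_right_ftor_cell_map push_right_map_cmp)
qed (use X in simp_all)

text \<open>The coaction, corestricted to the cotensor product.\<close>

definition eta_l :: "('a, 'b) cell \<Rightarrow> (('a, 'b) cell, 'b) tarr" where
  "eta_l c = (SOME t. arr V t \<and> src t = c \<and> tgt t = hob cg (push_left g D c) \<and> Q cg (push_left g D c) \<bullet> U t = la c)"

lemma eta_l:
  assumes c: "c \<in> obj V" "lb c = C"
  shows "arr V (eta_l c)" "src (eta_l c) = c" "tgt (eta_l c) = hob cg (push_left g D c)" "Q cg (push_left g D c) \<bullet> U (eta_l c) = la c"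
proof -
  let ?d = "push_left g D c"
  note sel [simp] = push_left_sel[OF c] and V [simp] = push_left_V[OF c]
  note [simp] = c
  have cd [simp]: "cg \<rhd> ?d" by (simp add: composable_def)
  have k: "\<not> isM (rb cg)" by simp
  let ?c = "und C" and ?n = "car c"
  have lc: "Asc ?c ?c ?n \<bullet> (mu C \<odot> Id ?n) \<bullet> la c = (Id ?c \<odot> la c) \<bullet> la c"
    using cell_lstruct[OF c(1)] by (simp add: lstruct_def)
  have "Asc (car cg) (und (rb cg)) (car ?d) \<bullet> (ra cg \<odot> Id (car ?d)) \<bullet> la c
      = Asc ?c (und D) ?n \<bullet> ((Id ?c \<odot> h) \<odot> Id ?n) \<bullet> (mu C \<odot> Id ?n) \<bullet> la c"
    by (simp add: merge)
  also have "\<dots> = (Id ?c \<odot> (h \<odot> Id ?n)) \<bullet> (Id ?c \<odot> la c) \<bullet> la c"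
    using tail[OF Asc_natural[of "Id ?c" h "Id ?n"]] lc by (simp add: cmp_assoc)
  also have "\<dots> = (Id (car cg) \<odot> la ?d) \<bullet> la c"
    by (simp add: merge)
  finally have eq: "Asc (car cg) (und (rb cg)) (car ?d) \<bullet> (ra cg \<odot> Id (car ?d)) \<bullet> la c = (Id (car cg) \<odot> la ?d) \<bullet> la c" .
  have "arr K (la c)" "tgt (la c) = car cg \<otimes> car ?d" by simp_all
  from Q_cofactor[OF cd k this eq] obtain q
    where q: "arr K q" "tgt q = car (hob cg ?d)" "src q = src (la c)" "Q cg ?d \<bullet> q = la c" by blast
  have "leq C (la c) (la (hob cg ?d)) q"
    by (rule leq_cancel_monic[of _ _ "ltens C (mu C) ?c ?n" "Q cg ?d"])
      (use q la_leq(2)[OF c(1)] Q_leq(2)[OF cd k] Q_monic[OF cd k] ten_Q_monic[OF cd k, of ?c] in simp_all)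
  moreover have "req (rb c) (ra c) (ra (hob cg ?d)) q"
    by (rule req_cancel_monic[of _ _ "rtens (rb c) (ra c) ?c ?n" "Q cg ?d"])
      (use q la_req(2)[OF c(1)] Q_req(2)[OF cd k] Q_monic[OF cd k] Q_ten_monic[OF cd k, of "und (rb c)"] in simp_all)
  ultimately have v: "arr V (Arr c (raw q) (hob cg ?d))" "U (Arr c (raw q) (hob cg ?d)) = q"
    using q by (intro arr_VI; simp)+
  have "\<exists>t. arr V t \<and> src t = c \<and> tgt t = hob cg ?d \<and> Q cg ?d \<bullet> U t = la c"
    using v q(4) by (intro exI[of _ "Arr c (raw q) (hob cg ?d)"]) (simp del: arr_Arr)
  from someI_ex[OF this, folded eta_l_def]
  show "arr V (eta_l c)" "src (eta_l c) = c" "tgt (eta_l c) = hob cg ?d" "Q cg ?d \<bullet> U (eta_l c) = la c"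
    by blast+
qed

text \<open>The counit of \<open>C\<close> applied to the first factor of \<open>C\<^sub>g \<box> d\<close>.\<close>

definition eps_l :: "('a, 'b) cell \<Rightarrow> (('a, 'b) cell, 'b) tarr" where
  "eps_l d = Arr (push_left g D (hob cg d)) (raw (Lu (car d) \<bullet> (un C \<odot> Id (car d)) \<bullet> Q cg d)) d"

lemma eps_l:
  assumes d: "d \<in> obj V" "lb d = D"
  shows "arr V (eps_l d)" "src (eps_l d) = push_left g D (hob cg d)" "tgt (eps_l d) = d"
    "U (eps_l d) = Lu (car d) \<bullet> (un C \<odot> Id (car d)) \<bullet> Q cg d"
    "(Id (und C) \<odot> U (eps_l d)) \<bullet> la (hob cg d) = Q cg d"
proof -
  note [simp] = d
  have cd [simp]: "cg \<rhd> d" by (simp add: composable_def)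
  have k: "\<not> isM (rb cg)" by simp
  let ?h = "hob cg d"
  have hV [simp]: "?h \<in> obj V" and hl: "lb ?h = C" by simp_all
  note sel [simp] = push_left_sel[OF hV hl] and V [simp] = push_left_V[OF hV hl]
  let ?c = "und C" and ?d = "und D" and ?n = "car d"
  let ?e = "Lu ?n \<bullet> (un C \<odot> Id ?n) \<bullet> Q cg d"
  have lQ: "(Id ?c \<odot> Q cg d) \<bullet> la ?h = Asc ?c ?c ?n \<bullet> (mu C \<odot> Id ?n) \<bullet> Q cg d"
    using Q_leq(2)[OF cd k] by (simp add: leq_def ltens_def cmp_assoc)
  have cof: "(Id ?c \<odot> la d) \<bullet> Q cg d = Asc ?c ?d ?n \<bullet> ((Id ?c \<odot> h) \<odot> Id ?n) \<bullet> (mu C \<odot> Id ?n) \<bullet> Q cg d"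
    using Q_cofork[OF cd k] by (simp add: merge)
  have co1: "Lu ?c \<bullet> (un C \<odot> Id ?c) \<bullet> mu C = Id ?c" and co2: "Ru ?c \<bullet> (Id ?c \<odot> un C) \<bullet> mu C = Id ?c"
    using comonoid_laws(2,3)[of C] by simp_all
  have nat: "Asc \<one> ?d ?n \<bullet> ((un C \<odot> Id ?d) \<odot> Id ?n) = (un C \<odot> (Id ?d \<odot> Id ?n)) \<bullet> Asc ?c ?d ?n"
    using Asc_natural[of "un C" "Id ?d" "Id ?n"] by simp
  have lun: "Lu (?d \<otimes> ?n) \<bullet> Asc \<one> ?d ?n = Lu ?d \<odot> Id ?n"
    by (rule Lu_ten) simp_all
  have luh: "Lu ?d \<bullet> (Id \<one> \<odot> h) = h \<bullet> Lu ?c"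
    using Lu_natural[of h] by simp
  have "la d \<bullet> ?e = Lu (?d \<otimes> ?n) \<bullet> (Id \<one> \<odot> la d) \<bullet> (un C \<odot> Id ?n) \<bullet> Q cg d"
    using tail[OF Lu_natural[of "la d"]] by (simp add: cmp_assoc)
  also have "\<dots> = Lu (?d \<otimes> ?n) \<bullet> (un C \<odot> (Id ?d \<odot> Id ?n)) \<bullet> (Id ?c \<odot> la d) \<bullet> Q cg d"
    by (simp add: merge)
  also have "\<dots> = Lu (?d \<otimes> ?n) \<bullet> Asc \<one> ?d ?n \<bullet> ((un C \<odot> Id ?d) \<odot> Id ?n) \<bullet> ((Id ?c \<odot> h) \<odot> Id ?n) \<bullet> (mu C \<odot> Id ?n) \<bullet> Q cg d"
    by (simp only: cof tail[OF nat] cmp_assoc)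
  also have "\<dots> = ((Lu ?d \<bullet> (Id \<one> \<odot> h) \<bullet> (un C \<odot> Id ?c) \<bullet> mu C) \<odot> Id ?n) \<bullet> Q cg d"
    by (simp add: tail[OF lun] merge)
  also have "Lu ?d \<bullet> (Id \<one> \<odot> h) \<bullet> (un C \<odot> Id ?c) \<bullet> mu C = h"
    by (simp add: tail[OF luh] cmp_assoc co1)
  finally have 1: "la d \<bullet> ?e = (h \<odot> Id ?n) \<bullet> Q cg d" .
  have nat2: "Asc ?c \<one> ?n \<bullet> ((Id ?c \<odot> un C) \<odot> Id ?n) = (Id ?c \<odot> (un C \<odot> Id ?n)) \<bullet> Asc ?c ?c ?n"
    using Asc_natural[of "Id ?c" "un C" "Id ?n"] by simp
  have "(Id ?c \<odot> ?e) \<bullet> la ?h = (Id ?c \<odot> Lu ?n) \<bullet> (Id ?c \<odot> (un C \<odot> Id ?n)) \<bullet> (Id ?c \<odot> Q cg d) \<bullet> la ?h"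
    by (simp add: merge)
  also have "\<dots> = (Id ?c \<odot> Lu ?n) \<bullet> Asc ?c \<one> ?n \<bullet> ((Id ?c \<odot> un C) \<odot> Id ?n) \<bullet> (mu C \<odot> Id ?n) \<bullet> Q cg d"
    by (simp only: lQ tail[OF nat2] cmp_assoc)
  also have "\<dots> = ((Ru ?c \<bullet> (Id ?c \<odot> un C) \<bullet> mu C) \<odot> Id ?n) \<bullet> Q cg d"
    using tail[OF triangle[of ?c ?n]] by (simp add: merge)
  also have "\<dots> = Q cg d"
    by (simp add: co2)
  finally have 2: "(Id ?c \<odot> ?e) \<bullet> la ?h = Q cg d" .
  have "(Id ?d \<odot> ?e) \<bullet> (h \<odot> Id (car ?h)) \<bullet> la ?h = (h \<odot> Id ?n) \<bullet> (Id ?c \<odot> ?e) \<bullet> la ?h"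
    by (simp add: merge)
  also have "\<dots> = la d \<bullet> ?e"
    by (simp only: 2 1)
  finally have l: "leq D (la (push_left g D ?h)) (la d) ?e"
    by (simp add: leq_def lty_def)
  have "req (rb d) (ra ?h) (rtens (rb d) (ra d) ?c ?n) (Q cg d)"
    using Q_req(2)[OF cd k] by simp
  moreover have "req (rb d) (rtens (rb d) (ra d) ?c ?n) (rtens (rb d) (ra d) \<one> ?n) (un C \<odot> Id ?n)"
    using req_ten[of "un C" "rb d" ?n "ra d"] by simp
  moreover have "req (rb d) (rtens (rb d) (ra d) \<one> ?n) (ra d) (Lu ?n)"
    by (rule req_Lu) simp
  ultimately have r: "req (rb d) (ra ?h) (ra d) ?e"
    using req_cmp[OF req_cmp] by (simp add: cmp_assoc)
  have e: "eps_l d = Arr (push_left g D ?h) (raw ?e) d" by (simp add: eps_l_def)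
  have "arr V (Arr (push_left g D ?h) (raw ?e) d)" "U (Arr (push_left g D ?h) (raw ?e) d) = ?e"
    by (rule arr_VI; use l r in simp)+
  then show "arr V (eps_l d)" and U: "U (eps_l d) = ?e" unfolding e by simp_all
  show "(Id (und C) \<odot> U (eps_l d)) \<bullet> la ?h = Q cg d" unfolding U by (rule 2)
  show "src (eps_l d) = push_left g D (hob cg d)" "tgt (eps_l d) = d" by (simp_all add: e)
qed

text \<open>The triangle identities are the counit laws: for \<open>\<^sub>gN\<close> that of the \<open>C\<close>-comodule \<open>N\<close>, and for \<open>C\<^sub>g \<box> N\<close>
that of \<open>C\<close> itself, since the coaction on \<open>C\<^sub>g \<box> N\<close> is given by the comultiplication.\<close>

lemma change_adjunction_left:
  assumes Y: "Y \<in> bases"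
  shows "adjunction (Mix K C Y) (Mix K D Y) push_left_ftor (tensor_left cg Y)"
proof (rule adjunction_from_V[where \<eta> = eta_l and \<epsilon> = eps_l])
  show "is_functor (Mix K C Y) (Mix K D Y) push_left_ftor"
    by (rule push_left_ftor_functor[OF Y])
  show "is_functor (Mix K D Y) (Mix K C Y) (tensor_left cg Y)"
    using tensor_left_functor[of cg Y] Y by simp
next
  fix c assume c: "c \<in> obj V" "lb c = C" "rb c = Y"
  note e = eta_l[OF c(1,2)]
  note sel [simp] = push_left_sel[OF c(1,2)] and V [simp] = push_left_V[OF c(1,2)]
  show "arr V (eta_l c)" "src (eta_l c) = c" by (rule e)+
  have gl: "Cell D (fob push_left_ftor (md c)) Y = push_left g D c"
    using c by (simp add: push_left_ftor_cell)
  then have "fob push_left_ftor (md c) = md (push_left g D c)" by (metis cell.sel(2))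
  then show "tgt (eta_l c) = Cell C (fob (tensor_left cg Y) (fob push_left_ftor (md c))) Y"
    using e(3) tensor_left_cell[of "push_left g D c" cg Y] c by simp
  have cd [simp]: "cg \<rhd> push_left g D c" by (simp add: composable_def)
  note ep = eps_l[OF V sel(1)]
  have lc: "Lu (car c) \<bullet> (un C \<odot> Id (car c)) \<bullet> la c = Id (car c)"
    using cell_lstruct[OF c(1)] c by (simp add: lstruct_def)
  have ca: "arr V (push_left_map (eta_l c))" "U (push_left_map (eta_l c)) = U (eta_l c)"
    using push_left_map_arr[OF e(1)] e(2) c(2) by simp_all
  have "eps_l (push_left g D c) \<diamondop> push_left_map (eta_l c) = idt V (push_left g D c)"
    by (rule V_eqI) (use ep ca e lc c in \<open>simp_all add: cmp_assoc\<close>)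
  then show "eps_l (Cell D (fob push_left_ftor (md c)) Y) \<diamondop> cell_map D Y push_left_ftor (eta_l c) = idt V (Cell D (fob push_left_ftor (md c)) Y)"
    using gl push_left_ftor_cell_map[OF e(1)] e(2) c by simp
next
  fix d assume d: "d \<in> obj V" "lb d = D" "rb d = Y"
  have cd [simp]: "cg \<rhd> d" using d by (simp add: composable_def)
  have hV [simp]: "hob cg d \<in> obj V" and hl: "lb (hob cg d) = C" by simp_all
  note sel [simp] = push_left_sel[OF hV hl] and V [simp] = push_left_V[OF hV hl]
  note ep = eps_l[OF d(1,2)] and e = eta_l[OF hV hl]
  show "arr V (eps_l d)" "tgt (eps_l d) = d" by (rule ep)+
  have lw: "Cell C (fob (tensor_left cg Y) (md d)) Y = hob cg d"
    using tensor_left_cell[of d cg Y] d by simp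
  then have m: "fob (tensor_left cg Y) (md d) = md (hob cg d)" by (metis cell.sel(2))
  show "src (eps_l d) = Cell D (fob push_left_ftor (fob (tensor_left cg Y) (md d))) Y"
    using ep(2) push_left_ftor_cell[of "hob cg d" Y] d m by simp
  have [simp]: "lb (push_left g D (hob cg d)) = D" by simp
  have cd2 [simp]: "cg \<rhd> push_left g D (hob cg d)" by (simp add: composable_def)
  have q: "Q cg d \<bullet> U (idt V cg \<star> eps_l d) = (Id (und C) \<odot> U (eps_l d)) \<bullet> Q cg (push_left g D (hob cg d))"
    using U_hc_cotensor[of "idt V cg" "eps_l d"] ep(1-3) by simp
  have "Q cg d \<bullet> U ((idt V cg \<star> eps_l d) \<diamondop> eta_l (hob cg d)) = (Id (und C) \<odot> U (eps_l d)) \<bullet> la (hob cg d)"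
    using ep e q tail[OF q] by (simp add: cmp_assoc)
  also have "\<dots> = Q cg d \<bullet> U (idt V (hob cg d))"
    by (simp add: ep(5))
  finally have "(idt V cg \<star> eps_l d) \<diamondop> eta_l (hob cg d) = idt V (hob cg d)"
    by (intro V_eq_monic[of _ _ "Q cg d"]) (use ep e in \<open>simp_all add: Q_monic\<close>)
  then show "cell_map C Y (tensor_left cg Y) (eps_l d) \<diamondop> eta_l (Cell C (fob (tensor_left cg Y) (md d)) Y) = idt V (Cell C (fob (tensor_left cg Y) (md d)) Y)"
    using lw tensor_left_cell_map[of cg "eps_l d" Y] ep(1-3) d by simp
next
  fix t assume t: "arr V t" "lb (src t) = C" "rb (src t) = Y"
  note b = arr_V_bases[OF t(1)]
  have o: "src t \<in> obj V" "tgt t \<in> obj V" "lb (tgt t) = C" using t b by simp_all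
  note s [simp] = push_left_sel[OF o(1) t(2)] and s' [simp] = push_left_sel[OF o(2,3)]
  note v [simp] = push_left_V[OF o(1) t(2)] push_left_V[OF o(2,3)]
  have cd [simp]: "cg \<rhd> push_left g D (src t)" "cg \<rhd> push_left g D (tgt t)" by (simp_all add: composable_def)
  note e = eta_l[OF o(1) t(2)] and e' = eta_l[OF o(2,3)] and ca = push_left_map_arr[OF t(1,2)]
  have q: "Q cg (push_left g D (tgt t)) \<bullet> U (idt V cg \<star> push_left_map t) = (Id (und C) \<odot> U t) \<bullet> Q cg (push_left g D (src t))"
    using U_hc_cotensor[of "idt V cg" "push_left_map t"] ca by simp
  have "eta_l (tgt t) \<diamondop> t = (idt V cg \<star> push_left_map t) \<diamondop> eta_l (src t)"
    by (rule V_eq_monic[of _ _ "Q cg (push_left g D (tgt t))"])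
      (use t b e e' ca q la_natural(2)[OF t(1)] in \<open>simp_all add: cmp_assoc Q_monic tail[OF q] tail[OF e'(4)]\<close>)
  then show "eta_l (tgt t) \<diamondop> t = cell_map C Y (tensor_left cg Y) (cell_map D Y push_left_ftor t) \<diamondop> eta_l (src t)"
    using push_left_ftor_cell_map[OF t(1,3)] tensor_left_cell_map[of cg "push_left_map t" Y] ca t by simp
next
  fix t assume t: "arr V t" "lb (src t) = D" "rb (src t) = Y"
  note b = arr_V_bases[OF t(1)]
  have o: "src t \<in> obj V" "tgt t \<in> obj V" "lb (tgt t) = D" using t b by simp_all
  have cd [simp]: "cg \<rhd> src t" "cg \<rhd> tgt t" using o t by (simp_all add: composable_def)
  have at: "arr V (idt V cg \<star> t)" "lb (src (idt V cg \<star> t)) = C" "rb (src (idt V cg \<star> t)) = Y" using t by simp_all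
  note ca = push_left_map_arr[OF at(1,2)] and e = eps_l[OF o(1) t(2)] and e' = eps_l[OF o(2,3)]
  have q: "Q cg (tgt t) \<bullet> U (idt V cg \<star> t) = (Id (und C) \<odot> U t) \<bullet> Q cg (src t)"
    using U_hc_cotensor[of "idt V cg" t] t by simp
  have "Lu (car (tgt t)) \<bullet> (un C \<odot> Id (car (tgt t))) \<bullet> (Id (und C) \<odot> U t) = Lu (car (tgt t)) \<bullet> (Id \<one> \<odot> U t) \<bullet> (un C \<odot> Id (car (src t)))"
    using o t by (simp add: merge)
  also have "\<dots> = U t \<bullet> Lu (car (src t)) \<bullet> (un C \<odot> Id (car (src t)))"
    using tail[OF Lu_natural[of "U t"]] t by (simp add: cmp_assoc)
  finally have n: "Lu (car (tgt t)) \<bullet> (un C \<odot> Id (car (tgt t))) \<bullet> (Id (und C) \<odot> U t) = U t \<bullet> Lu (car (src t)) \<bullet> (un C \<odot> Id (car (src t)))" .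
  have "eps_l (tgt t) \<diamondop> push_left_map (idt V cg \<star> t) = t \<diamondop> eps_l (src t)"
    by (rule V_eqI) (use t e e' ca q tail3[OF n] in \<open>simp_all add: cmp_assoc\<close>)
  then show "eps_l (tgt t) \<diamondop> cell_map D Y push_left_ftor (cell_map C Y (tensor_left cg Y) t) = t \<diamondop> eps_l (src t)"
    using push_left_ftor_cell_map[OF at(1,3)] tensor_left_cell_map[of cg t Y] t by simp
qed (use Y in simp_all)

definition eta_r :: "('a, 'b) cell \<Rightarrow> (('a, 'b) cell, 'b) tarr" where
  "eta_r c = (SOME t. arr V t \<and> src t = c \<and> tgt t = hob (push_right g D c) gc \<and> Q (push_right g D c) gc \<bullet> U t = ra c)"

lemma eta_r:
  assumes c: "c \<in> obj V" "rb c = C"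
  shows "arr V (eta_r c)" "src (eta_r c) = c" "tgt (eta_r c) = hob (push_right g D c) gc" "Q (push_right g D c) gc \<bullet> U (eta_r c) = ra c"
proof -
  let ?d = "push_right g D c"
  note sel [simp] = push_right_sel[OF c] and V [simp] = push_right_V[OF c]
  note [simp] = c
  have cd [simp]: "?d \<rhd> gc" by (simp add: composable_def)
  have k: "\<not> isM (rb ?d)" by simp
  let ?c = "und C" and ?m = "car c"
  have rc: "Asc ?m ?c ?c \<bullet> (ra c \<odot> Id ?c) \<bullet> ra c = (Id ?m \<odot> mu C) \<bullet> ra c"
    using cell_rstruct[OF c(1)] by (simp add: rstruct_def)
  have "Asc (car ?d) (und (rb ?d)) (car gc) \<bullet> (ra ?d \<odot> Id (car gc)) \<bullet> ra c
      = Asc ?m (und D) ?c \<bullet> ((Id ?m \<odot> h) \<odot> Id ?c) \<bullet> (ra c \<odot> Id ?c) \<bullet> ra c"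
    by (simp add: merge)
  also have "\<dots> = (Id ?m \<odot> (h \<odot> Id ?c)) \<bullet> (Id ?m \<odot> mu C) \<bullet> ra c"
    using tail[OF Asc_natural[of "Id ?m" h "Id ?c"]] rc by (simp add: cmp_assoc)
  also have "\<dots> = (Id (car ?d) \<odot> la gc) \<bullet> ra c"
    by (simp add: merge)
  finally have eq: "Asc (car ?d) (und (rb ?d)) (car gc) \<bullet> (ra ?d \<odot> Id (car gc)) \<bullet> ra c = (Id (car ?d) \<odot> la gc) \<bullet> ra c" .
  have "arr K (ra c)" "tgt (ra c) = car ?d \<otimes> car gc" by simp_all
  from Q_cofactor[OF cd k this eq] obtain q
    where q: "arr K q" "tgt q = car (hob ?d gc)" "src q = src (ra c)" "Q ?d gc \<bullet> q = ra c" by blast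
  have "req C (ra c) (ra (hob ?d gc)) q"
    by (rule req_cancel_monic[of _ _ "rtens C (mu C) ?m ?c" "Q ?d gc"])
      (use q ra_req(2)[OF c(1)] Q_req(2)[OF cd k] Q_monic[OF cd k] Q_ten_monic[OF cd k, of ?c] in simp_all)
  moreover have "leq (lb c) (la c) (la (hob ?d gc)) q"
    by (rule leq_cancel_monic[of _ _ "ltens (lb c) (la c) ?m ?c" "Q ?d gc"])
      (use q ra_leq(2)[OF c(1)] Q_leq(2)[OF cd k] Q_monic[OF cd k] ten_Q_monic[OF cd k, of "und (lb c)"] in simp_all)
  ultimately have v: "arr V (Arr c (raw q) (hob ?d gc))" "U (Arr c (raw q) (hob ?d gc)) = q"
    using q by (intro arr_VI; simp)+
  have "\<exists>t. arr V t \<and> src t = c \<and> tgt t = hob ?d gc \<and> Q ?d gc \<bullet> U t = ra c"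
    using v q(4) by (intro exI[of _ "Arr c (raw q) (hob ?d gc)"]) (simp del: arr_Arr)
  from someI_ex[OF this, folded eta_r_def]
  show "arr V (eta_r c)" "src (eta_r c) = c" "tgt (eta_r c) = hob ?d gc" "Q ?d gc \<bullet> U (eta_r c) = ra c"
    by blast+
qed

definition eps_r :: "('a, 'b) cell \<Rightarrow> (('a, 'b) cell, 'b) tarr" where
  "eps_r d = Arr (push_right g D (hob d gc)) (raw (Ru (car d) \<bullet> (Id (car d) \<odot> un C) \<bullet> Q d gc)) d"

lemma eps_r:
  assumes d: "d \<in> obj V" "rb d = D"
  shows "arr V (eps_r d)" "src (eps_r d) = push_right g D (hob d gc)" "tgt (eps_r d) = d"
    "U (eps_r d) = Ru (car d) \<bullet> (Id (car d) \<odot> un C) \<bullet> Q d gc"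
    "(U (eps_r d) \<odot> Id (und C)) \<bullet> ra (hob d gc) = Q d gc"
proof -
  note [simp] = d
  have cd [simp]: "d \<rhd> gc" by (simp add: composable_def)
  have k: "\<not> isM (rb d)" by simp
  let ?h = "hob d gc"
  have hV [simp]: "?h \<in> obj V" and hl: "rb ?h = C" by simp_all
  note sel [simp] = push_right_sel[OF hV hl] and V [simp] = push_right_V[OF hV hl]
  let ?c = "und C" and ?d = "und D" and ?m = "car d"
  let ?e = "Ru ?m \<bullet> (Id ?m \<odot> un C) \<bullet> Q d gc"
  have rQ: "(Q d gc \<odot> Id ?c) \<bullet> ra ?h = Asi ?m ?c ?c \<bullet> (Id ?m \<odot> mu C) \<bullet> Q d gc"
    using Q_req(2)[OF cd k] by (simp add: req_def rtens_def cmp_assoc)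
  have "Asi ?m ?d ?c \<bullet> Asc ?m ?d ?c \<bullet> (ra d \<odot> Id ?c) \<bullet> Q d gc = Asi ?m ?d ?c \<bullet> (Id ?m \<odot> la gc) \<bullet> Q d gc"
    using Q_cofork[OF cd k] by simp
  then have cof: "(ra d \<odot> Id ?c) \<bullet> Q d gc = Asi ?m ?d ?c \<bullet> (Id ?m \<odot> (h \<odot> Id ?c)) \<bullet> (Id ?m \<odot> mu C) \<bullet> Q d gc"
    by (simp add: merge)
  have co1: "Lu ?c \<bullet> (un C \<odot> Id ?c) \<bullet> mu C = Id ?c" and co2: "Ru ?c \<bullet> (Id ?c \<odot> un C) \<bullet> mu C = Id ?c"
    using comonoid_laws(2,3)[of C] by simp_all
  have nat: "Asi ?m ?d \<one> \<bullet> (Id ?m \<odot> (Id ?d \<odot> un C)) = ((Id ?m \<odot> Id ?d) \<odot> un C) \<bullet> Asi ?m ?d ?c"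
    using Asi_natural[of "Id ?m" "Id ?d" "un C"] by simp
  have ruh: "Ru ?d \<bullet> (h \<odot> Id \<one>) = h \<bullet> Ru ?c"
    using Ru_natural[of h] by simp
  have run: "Ru (?m \<otimes> ?d) \<bullet> Asi ?m ?d \<one> = Id ?m \<odot> Ru ?d"
    unfolding Ru_ten[of ?m ?d, simplified, symmetric] by (simp add: cmp_assoc)
  have "ra d \<bullet> ?e = Ru (?m \<otimes> ?d) \<bullet> (ra d \<odot> Id \<one>) \<bullet> (Id ?m \<odot> un C) \<bullet> Q d gc"
    using tail[OF Ru_natural[of "ra d"]] by (simp add: cmp_assoc)
  also have "\<dots> = Ru (?m \<otimes> ?d) \<bullet> ((Id ?m \<odot> Id ?d) \<odot> un C) \<bullet> (ra d \<odot> Id ?c) \<bullet> Q d gc"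
    by (simp add: merge)
  also have "\<dots> = Ru (?m \<otimes> ?d) \<bullet> Asi ?m ?d \<one> \<bullet> (Id ?m \<odot> (Id ?d \<odot> un C)) \<bullet> (Id ?m \<odot> (h \<odot> Id ?c)) \<bullet> (Id ?m \<odot> mu C) \<bullet> Q d gc"
    by (simp only: cof tail[OF nat] cmp_assoc)
  also have "\<dots> = (Id ?m \<odot> (Ru ?d \<bullet> (h \<odot> Id \<one>) \<bullet> (Id ?c \<odot> un C) \<bullet> mu C)) \<bullet> Q d gc"
    by (simp add: tail[OF run] merge)
  also have "Ru ?d \<bullet> (h \<odot> Id \<one>) \<bullet> (Id ?c \<odot> un C) \<bullet> mu C = h"
    by (simp add: tail[OF ruh] cmp_assoc co2)
  finally have 1: "ra d \<bullet> ?e = (Id ?m \<odot> h) \<bullet> Q d gc" .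
  have nat2: "Asi ?m \<one> ?c \<bullet> (Id ?m \<odot> (un C \<odot> Id ?c)) = ((Id ?m \<odot> un C) \<odot> Id ?c) \<bullet> Asi ?m ?c ?c"
    using Asi_natural[of "Id ?m" "un C" "Id ?c"] by simp
  have tri: "(Ru ?m \<odot> Id ?c) \<bullet> Asi ?m \<one> ?c = Id ?m \<odot> Lu ?c"
    unfolding triangle[of ?m ?c, simplified, symmetric] by (simp add: cmp_assoc)
  have "(?e \<odot> Id ?c) \<bullet> ra ?h = (Ru ?m \<odot> Id ?c) \<bullet> ((Id ?m \<odot> un C) \<odot> Id ?c) \<bullet> (Q d gc \<odot> Id ?c) \<bullet> ra ?h"
    by (simp add: merge)
  also have "\<dots> = (Ru ?m \<odot> Id ?c) \<bullet> Asi ?m \<one> ?c \<bullet> (Id ?m \<odot> (un C \<odot> Id ?c)) \<bullet> (Id ?m \<odot> mu C) \<bullet> Q d gc"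
    by (simp only: rQ tail[OF nat2] cmp_assoc)
  also have "\<dots> = (Id ?m \<odot> (Lu ?c \<bullet> (un C \<odot> Id ?c) \<bullet> mu C)) \<bullet> Q d gc"
    by (simp add: tail[OF tri] merge)
  also have "\<dots> = Q d gc"
    by (simp add: co1)
  finally have 2: "(?e \<odot> Id ?c) \<bullet> ra ?h = Q d gc" .
  have "(?e \<odot> Id ?d) \<bullet> (Id (car ?h) \<odot> h) \<bullet> ra ?h = (Id ?m \<odot> h) \<bullet> (?e \<odot> Id ?c) \<bullet> ra ?h"
    by (simp add: merge)
  also have "\<dots> = ra d \<bullet> ?e"
    by (simp only: 2 1)
  finally have r: "req D (ra (push_right g D ?h)) (ra d) ?e"
    by (simp add: req_def rty_def)
  have "leq (lb d) (la ?h) (ltens (lb d) (la d) ?m ?c) (Q d gc)"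
    using Q_leq(2)[OF cd k] by simp
  moreover have "leq (lb d) (ltens (lb d) (la d) ?m ?c) (ltens (lb d) (la d) ?m \<one>) (Id ?m \<odot> un C)"
    using leq_ten[of "un C" "lb d" ?m "la d"] by simp
  moreover have "leq (lb d) (ltens (lb d) (la d) ?m \<one>) (la d) (Ru ?m)"
    by (rule leq_Ru) simp
  ultimately have l: "leq (lb d) (la ?h) (la d) ?e"
    using leq_cmp[OF leq_cmp] by (simp add: cmp_assoc)
  have e: "eps_r d = Arr (push_right g D ?h) (raw ?e) d" by (simp add: eps_r_def)
  have "arr V (Arr (push_right g D ?h) (raw ?e) d)" "U (Arr (push_right g D ?h) (raw ?e) d) = ?e"
    by (rule arr_VI; use l r in simp)+
  then show "arr V (eps_r d)" and U: "U (eps_r d) = ?e" unfolding e by simp_all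
  show "(U (eps_r d) \<odot> Id (und C)) \<bullet> ra ?h = Q d gc" unfolding U by (rule 2)
  show "src (eps_r d) = push_right g D (hob d gc)" "tgt (eps_r d) = d" by (simp_all add: e)
qed

lemma change_adjunction_right:
  assumes X: "X \<in> bases"
  shows "adjunction (Mix K X C) (Mix K X D) push_right_ftor (tensor_right X gc)"
proof (rule adjunction_from_V[where \<eta> = eta_r and \<epsilon> = eps_r])
  show "is_functor (Mix K X C) (Mix K X D) push_right_ftor"
    by (rule push_right_ftor_functor[OF X])
  show "is_functor (Mix K X D) (Mix K X C) (tensor_right X gc)"
    using tensor_right_functor[of gc X] X by simp
next
  fix c assume c: "c \<in> obj V" "lb c = X" "rb c = C"
  note e = eta_r[OF c(1,3)]
  note sel [simp] = push_right_sel[OF c(1,3)] and V [simp] = push_right_V[OF c(1,3)]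
  show "arr V (eta_r c)" "src (eta_r c) = c" by (rule e)+
  have gl: "Cell X (fob push_right_ftor (md c)) D = push_right g D c"
    using c by (simp add: push_right_ftor_cell)
  then have "fob push_right_ftor (md c) = md (push_right g D c)" by (metis cell.sel(2))
  then show "tgt (eta_r c) = Cell X (fob (tensor_right X gc) (fob push_right_ftor (md c))) C"
    using e(3) tensor_right_cell[of "push_right g D c" X gc] c by simp
  have cd [simp]: "push_right g D c \<rhd> gc" by (simp add: composable_def)
  note ep = eps_r[OF V sel(1)]
  have rc: "Ru (car c) \<bullet> (Id (car c) \<odot> un C) \<bullet> ra c = Id (car c)"
    using cell_rstruct[OF c(1)] c by (simp add: rstruct_def)
  have ca: "arr V (push_right_map (eta_r c))" "U (push_right_map (eta_r c)) = U (eta_r c)"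
    using push_right_map_arr[OF e(1)] e(2) c(3) by simp_all
  have "eps_r (push_right g D c) \<diamondop> push_right_map (eta_r c) = idt V (push_right g D c)"
    by (rule V_eqI) (use ep ca e rc c in \<open>simp_all add: cmp_assoc\<close>)
  then show "eps_r (Cell X (fob push_right_ftor (md c)) D) \<diamondop> cell_map X D push_right_ftor (eta_r c) = idt V (Cell X (fob push_right_ftor (md c)) D)"
    using gl push_right_ftor_cell_map[OF e(1)] e(2) c by simp
next
  fix d assume d: "d \<in> obj V" "lb d = X" "rb d = D"
  have cd [simp]: "d \<rhd> gc" using d by (simp add: composable_def)
  have hV [simp]: "hob d gc \<in> obj V" and hl: "rb (hob d gc) = C" by simp_all
  note sel [simp] = push_right_sel[OF hV hl] and V [simp] = push_right_V[OF hV hl]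
  note ep = eps_r[OF d(1,3)] and e = eta_r[OF hV hl]
  show "arr V (eps_r d)" "tgt (eps_r d) = d" by (rule ep)+
  have rw: "Cell X (fob (tensor_right X gc) (md d)) C = hob d gc"
    using tensor_right_cell[of d X gc] d by simp
  then have m: "fob (tensor_right X gc) (md d) = md (hob d gc)" by (metis cell.sel(2))
  show "src (eps_r d) = Cell X (fob push_right_ftor (fob (tensor_right X gc) (md d))) D"
    using ep(2) push_right_ftor_cell[of "hob d gc" X] d m by simp
  have [simp]: "rb (push_right g D (hob d gc)) = D" by simp
  have cd2 [simp]: "push_right g D (hob d gc) \<rhd> gc" by (simp add: composable_def)
  have q: "Q d gc \<bullet> U (eps_r d \<star> idt V gc) = (U (eps_r d) \<odot> Id (und C)) \<bullet> Q (push_right g D (hob d gc)) gc"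
    using U_hc_cotensor[of "eps_r d" "idt V gc"] ep(1-3) by simp
  have dc [simp]: "car d \<in> obj K" using d by simp
  have "Q d gc \<bullet> U ((eps_r d \<star> idt V gc) \<diamondop> eta_r (hob d gc)) = (U (eps_r d) \<odot> Id (und C)) \<bullet> ra (hob d gc)"
    using ep e q tail[OF q] by (simp add: cmp_assoc)
  also have "\<dots> = Q d gc \<bullet> U (idt V (hob d gc))"
    using d by (simp add: ep(5))
  finally have "(eps_r d \<star> idt V gc) \<diamondop> eta_r (hob d gc) = idt V (hob d gc)"
    by (intro V_eq_monic[of _ _ "Q d gc"]) (use ep e d in \<open>simp_all add: Q_monic\<close>)
  then show "cell_map X C (tensor_right X gc) (eps_r d) \<diamondop> eta_r (Cell X (fob (tensor_right X gc) (md d)) C) = idt V (Cell X (fob (tensor_right X gc) (md d)) C)"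
    using rw tensor_right_cell_map[of gc "eps_r d" X] ep(1-3) d by simp
next
  fix t assume t: "arr V t" "lb (src t) = X" "rb (src t) = C"
  note b = arr_V_bases[OF t(1)]
  have o: "src t \<in> obj V" "tgt t \<in> obj V" "rb (tgt t) = C" using t b by simp_all
  note s [simp] = push_right_sel[OF o(1) t(3)] and s' [simp] = push_right_sel[OF o(2,3)]
  note v [simp] = push_right_V[OF o(1) t(3)] push_right_V[OF o(2,3)]
  have cd [simp]: "push_right g D (src t) \<rhd> gc" "push_right g D (tgt t) \<rhd> gc" by (simp_all add: composable_def)
  note e = eta_r[OF o(1) t(3)] and e' = eta_r[OF o(2,3)] and ca = push_right_map_arr[OF t(1,3)]
  have q: "Q (push_right g D (tgt t)) gc \<bullet> U (push_right_map t \<star> idt V gc) = (U t \<odot> Id (und C)) \<bullet> Q (push_right g D (src t)) gc"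
    using U_hc_cotensor[of "push_right_map t" "idt V gc"] ca by simp
  have "eta_r (tgt t) \<diamondop> t = (push_right_map t \<star> idt V gc) \<diamondop> eta_r (src t)"
    by (rule V_eq_monic[of _ _ "Q (push_right g D (tgt t)) gc"])
      (use t b e e' ca q ra_natural(2)[OF t(1)] in \<open>simp_all add: cmp_assoc Q_monic tail[OF q] tail[OF e'(4)]\<close>)
  then show "eta_r (tgt t) \<diamondop> t = cell_map X C (tensor_right X gc) (cell_map X D push_right_ftor t) \<diamondop> eta_r (src t)"
    using push_right_ftor_cell_map[OF t(1,2)] tensor_right_cell_map[of gc "push_right_map t" X] ca t by simp
next
  fix t assume t: "arr V t" "lb (src t) = X" "rb (src t) = D"
  note b = arr_V_bases[OF t(1)]
  have o: "src t \<in> obj V" "tgt t \<in> obj V" "rb (tgt t) = D" using t b by simp_all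
  have cd [simp]: "src t \<rhd> gc" "tgt t \<rhd> gc" using o t by (simp_all add: composable_def)
  have at: "arr V (t \<star> idt V gc)" "lb (src (t \<star> idt V gc)) = X" "rb (src (t \<star> idt V gc)) = C" using t by simp_all
  note ca = push_right_map_arr[OF at(1,3)] and e = eps_r[OF o(1) t(3)] and e' = eps_r[OF o(2,3)]
  have q: "Q (tgt t) gc \<bullet> U (t \<star> idt V gc) = (U t \<odot> Id (und C)) \<bullet> Q (src t) gc"
    using U_hc_cotensor[of t "idt V gc"] t by simp
  have "Ru (car (tgt t)) \<bullet> (Id (car (tgt t)) \<odot> un C) \<bullet> (U t \<odot> Id (und C)) = Ru (car (tgt t)) \<bullet> (U t \<odot> Id \<one>) \<bullet> (Id (car (src t)) \<odot> un C)"
    using o t by (simp add: merge)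
  also have "\<dots> = U t \<bullet> Ru (car (src t)) \<bullet> (Id (car (src t)) \<odot> un C)"
    using tail[OF Ru_natural[of "U t"]] t by (simp add: cmp_assoc)
  finally have n: "Ru (car (tgt t)) \<bullet> (Id (car (tgt t)) \<odot> un C) \<bullet> (U t \<odot> Id (und C)) = U t \<bullet> Ru (car (src t)) \<bullet> (Id (car (src t)) \<odot> un C)" .
  have "eps_r (tgt t) \<diamondop> push_right_map (t \<star> idt V gc) = t \<diamondop> eps_r (src t)"
    by (rule V_eqI) (use t e e' ca q tail3[OF n] in \<open>simp_all add: cmp_assoc\<close>)
  then show "eps_r (tgt t) \<diamondop> cell_map X D push_right_ftor (cell_map X C (tensor_right X gc) t) = t \<diamondop> eps_r (src t)"
    using push_right_ftor_cell_map[OF at(1,2)] tensor_right_cell_map[of gc t X] t by simp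
qed (use X in simp_all)

end

context twistable_cat
begin

section \<open>Adjoint pairs of bimodules\<close>

lemma invs_hc:
  assumes s: "invs V s s'" and t: "invs V t t'" and st: "rb (src s) = lb (src t)"
  shows "invs V (s \<star> t) (s' \<star> t')"
proof -
  note i = V.invsD[OF s] V.invsD[OF t]
  have b: "rb (tgt s) = lb (tgt t)" "rb (src s) = lb (tgt t)" "rb (tgt s) = lb (src t)"
    using arr_V_bases[OF i(1)] arr_V_bases[OF i(7)] st by simp_all
  show ?thesis
    unfolding invs_def using i st b by (simp add: hc_cmp)
qed

lemma invs_idt: "c \<in> obj V \<Longrightarrow> invs V (idt V c) (idt V c)"
  by (simp add: invs_def)

lemma invs_unique:
  assumes "invs V s s'" "invs V s t'"
  shows "s' = t'"
proof -
  note i = V.invsD[OF assms(1)] and j = V.invsD[OF assms(2)]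
  have "s' = s' \<diamondop> (s \<diamondop> t')" unfolding j(6) using i j by simp
  also have "\<dots> = t'" unfolding V.tail[OF i(5)] using i j by simp
  finally show ?thesis .
qed

text \<open>The same pentagons in the form in which they enter the triangle identities of the next adjunctions.\<close>

lemma pentagon_mcm_inverse:
  assumes cd: "c \<rhd> d" and de: "d \<rhd> e" and ef: "e \<rhd> f"
    and k: "isM (rb c)" "\<not> isM (rb d)" "isM (rb e)"
  shows "ali c (hob d e) f \<diamondop> (idt V c \<star> ali d e f) \<diamondop> al c d (hob e f) = (al c d e \<star> idt V f) \<diamondop> ali (hob c d) e f"
proof -
  note cells = composableD[OF cd] composableD[OF de] composableD[OF ef]
  note [simp] = cd de ef cells
  have "invs V (ali c d (hob e f) \<diamondop> (idt V c \<star> al d e f) \<diamondop> al c (hob d e) f)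
      ((ali c (hob d e) f \<diamondop> (idt V c \<star> ali d e f)) \<diamondop> al c d (hob e f))"
    by (intro V.invs_cmp V.invs_sym[OF invs_al] invs_hc invs_idt invs_al) simp_all
  moreover have "invs V (al (hob c d) e f \<diamondop> (ali c d e \<star> idt V f)) ((al c d e \<star> idt V f) \<diamondop> ali (hob c d) e f)"
    by (intro V.invs_cmp V.invs_sym[OF invs_al] invs_hc invs_idt invs_al) simp_all
  ultimately show ?thesis
    unfolding pentagon_mcm[OF cd de ef k] using invs_unique by (simp add: V.cmp_assoc)
qed

lemma pentagon_cmc_inverse:
  assumes cd: "c \<rhd> d" and de: "d \<rhd> e" and ef: "e \<rhd> f"
    and k: "\<not> isM (rb c)" "isM (rb d)" "\<not> isM (rb e)"
  shows "ali c d (hob e f) \<diamondop> (idt V c \<star> al d e f) = al (hob c d) e f \<diamondop> (ali c d e \<star> idt V f) \<diamondop> ali c (hob d e) f"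
proof -
  note cells = composableD[OF cd] composableD[OF de] composableD[OF ef]
  note [simp] = cd de ef cells
  have "invs V ((idt V c \<star> ali d e f) \<diamondop> al c d (hob e f)) (ali c d (hob e f) \<diamondop> (idt V c \<star> al d e f))"
    by (intro V.invs_cmp V.invs_sym[OF invs_al] invs_hc invs_idt invs_al) simp_all
  moreover have "invs V (al c (hob d e) f \<diamondop> (al c d e \<star> idt V f) \<diamondop> ali (hob c d) e f)
      ((al (hob c d) e f \<diamondop> (ali c d e \<star> idt V f)) \<diamondop> ali c (hob d e) f)"
    by (intro V.invs_cmp V.invs_sym[OF invs_al] invs_hc invs_idt invs_al) simp_all
  ultimately show ?thesis
    unfolding pentagon_cmc[OF cd de ef k] using invs_unique by (simp add: V.cmp_assoc)
qed

end

text \<open>\<open>1\<close>-cells \<open>q\<close> from \<open>A\<close> to \<open>B\<close> and \<open>p\<close> from \<open>B\<close> to \<open>A\<close> that are adjoint, with unit \<open>De\<close> and counit \<open>Mu\<close>.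
The two zigzag identities are written with the chosen associativity isomorphisms.\<close>

locale adjoint_pair = twistable_cat +
  fixes A B :: "('a, 'b) comon" and p q :: "('a, 'b) cell" and De Mu :: "(('a, 'b) cell, 'b) tarr"
  assumes A: "A \<in> bases" "isM A" and B: "B \<in> bases" "\<not> isM B"
    and p: "p \<in> obj V" "lb p = B" "rb p = A" and q: "q \<in> obj V" "lb q = A" "rb q = B"
    and De: "arr V De" "src De = reg B" "tgt De = hob p q"
    and Mu: "arr V Mu" "src Mu = hob q p" "tgt Mu = reg A"
    and zig_q: "lu q \<diamondop> (Mu \<star> idt V q) \<diamondop> ali q p q \<diamondop> (idt V q \<star> De) \<diamondop> ru q = idt V q"
    and zig_p: "ru p \<diamondop> (idt V p \<star> Mu) \<diamondop> al p q p \<diamondop> (De \<star> idt V p) \<diamondop> lu p = idt V p"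
begin

lemmas pair_simps [simp] = A B p q De Mu

lemma pq [simp]: "p \<rhd> q" "q \<rhd> p" "reg A \<rhd> q" "reg B \<rhd> p" "q \<rhd> reg B" "p \<rhd> reg A"
  by (simp_all add: composable_def)

text \<open>The unit is \<open>c \<cong> B \<box> c \<rightarrow> (p \<otimes> q) \<box> c \<cong> p \<otimes> (q \<box> c)\<close>, and dually for the counit.  Each triangle identity
is a zigzag identity tensored with the argument: a pentagon and naturality move the associativity
isomorphisms aside, and the unit maps are rewritten by \<open>triangle_comonoid\<close> and \<open>lu_hob_monoid\<close>, resp.
their duals.\<close>

lemma tensor_left_adjunction:
  assumes Y [simp]: "Y \<in> bases"
  shows "adjunction (Mix K B Y) (Mix K A Y) (tensor_left q Y) (tensor_left p Y)"
proof (rule adjunction_from_V[where \<eta> = "\<lambda>c. al p q c \<diamondop> (De \<star> idt V c) \<diamondop> lu c"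
      and \<epsilon> = "\<lambda>d. lu d \<diamondop> (Mu \<star> idt V d) \<diamondop> ali q p d"])
  show "is_functor (Mix K B Y) (Mix K A Y) (tensor_left q Y)" "is_functor (Mix K A Y) (Mix K B Y) (tensor_left p Y)"
    using tensor_left_functor[of q Y] tensor_left_functor[of p Y] by simp_all
next
  fix c assume c: "c \<in> obj V" "lb c = B" "rb c = Y"
  note [simp] = c
  have qc [simp]: "q \<rhd> c" "reg B \<rhd> c" by (simp_all add: composable_def)
  have l: "Cell A (fob (tensor_left q Y) (md c)) Y = hob q c"
    using tensor_left_cell[of c q Y] by simp
  then have m: "fob (tensor_left q Y) (md c) = md (hob q c)" by (metis cell.sel(2))
  let ?h = "al p q c \<diamondop> (De \<star> idt V c) \<diamondop> lu c"
  show h: "arr V ?h" "src ?h = c" by simp_all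
  show "tgt ?h = Cell B (fob (tensor_left p Y) (fob (tensor_left q Y) (md c))) Y"
    using tensor_left_cell[of "hob q c" p Y] by (simp add: m)
  have r: "\<not> isM (rb q)" "isM (rb p)" by simp_all
  have pent: "ali q p (hob q c) \<diamondop> (idt V q \<star> al p q c) = al (hob q p) q c \<diamondop> (ali q p q \<star> idt V c) \<diamondop> ali q (hob p q) c"
    by (rule pentagon_cmc_inverse) simp_all
  have n1: "ali q (hob p q) c \<diamondop> (idt V q \<star> (De \<star> idt V c)) = (idt V q \<star> De \<star> idt V c) \<diamondop> ali q (reg B) c"
    using ali_natural[of "idt V q" De "idt V c"] by simp
  have n2: "(Mu \<star> idt V (hob q c)) \<diamondop> al (hob q p) q c = al (reg A) q c \<diamondop> (Mu \<star> idt V q \<star> idt V c)"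
    using al_natural[of Mu "idt V q" "idt V c"] by simp
  have u1: "lu (hob q c) \<diamondop> al (reg A) q c = lu q \<star> idt V c"
    using lu_hob_monoid[of q c] by (simp add: V.cmp_assoc)
  have u2: "ali q (reg B) c \<diamondop> (idt V q \<star> lu c) = ru q \<star> idt V c"
    unfolding triangle_comonoid[of q c, simplified, symmetric] using V.tail[OF al_arr(3)[of q "reg B" c]] by simp
  have "lu (hob q c) \<diamondop> (Mu \<star> idt V (hob q c)) \<diamondop> ali q p (hob q c) \<diamondop> (idt V q \<star> ?h)
      = lu (hob q c) \<diamondop> (Mu \<star> idt V (hob q c)) \<diamondop> ali q p (hob q c) \<diamondop> (idt V q \<star> al p q c) \<diamondop> (idt V q \<star> (De \<star> idt V c)) \<diamondop> (idt V q \<star> lu c)"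
    by (simp add: hmerge)
  also have "\<dots> = lu (hob q c) \<diamondop> (Mu \<star> idt V (hob q c)) \<diamondop> al (hob q p) q c \<diamondop> (ali q p q \<star> idt V c) \<diamondop> ali q (hob p q) c \<diamondop> (idt V q \<star> (De \<star> idt V c)) \<diamondop> (idt V q \<star> lu c)"
    by (simp only: V.tail[OF pent] V.cmp_assoc)
  also have "\<dots> = lu (hob q c) \<diamondop> al (reg A) q c \<diamondop> (Mu \<star> idt V q \<star> idt V c) \<diamondop> (ali q p q \<star> idt V c) \<diamondop> (idt V q \<star> De \<star> idt V c) \<diamondop> ali q (reg B) c \<diamondop> (idt V q \<star> lu c)"
    by (simp only: V.tail[OF n1] V.tail[OF n2] V.cmp_assoc)
  also have "\<dots> = (lu q \<star> idt V c) \<diamondop> (Mu \<star> idt V q \<star> idt V c) \<diamondop> (ali q p q \<star> idt V c) \<diamondop> (idt V q \<star> De \<star> idt V c) \<diamondop> (ru q \<star> idt V c)"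
    by (simp only: V.tail[OF u1] u2)
  also have "\<dots> = (lu q \<diamondop> (Mu \<star> idt V q) \<diamondop> ali q p q \<diamondop> (idt V q \<star> De) \<diamondop> ru q) \<star> idt V c"
    by (simp add: hmerge)
  also have "\<dots> = idt V (hob q c)"
    unfolding zig_q by simp
  finally show "(lu (Cell A (fob (tensor_left q Y) (md c)) Y) \<diamondop> (Mu \<star> idt V (Cell A (fob (tensor_left q Y) (md c)) Y)) \<diamondop> ali q p (Cell A (fob (tensor_left q Y) (md c)) Y)) \<diamondop>
      cell_map A Y (tensor_left q Y) ?h = idt V (Cell A (fob (tensor_left q Y) (md c)) Y)"
    using tensor_left_cell_map[of q ?h Y] h unfolding l by (simp add: V.cmp_assoc)
next
  fix d assume d: "d \<in> obj V" "lb d = A" "rb d = Y"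
  note [simp] = d
  have pd [simp]: "p \<rhd> d" "reg A \<rhd> d" by (simp_all add: composable_def)
  have l: "Cell B (fob (tensor_left p Y) (md d)) Y = hob p d"
    using tensor_left_cell[of d p Y] by simp
  then have m: "fob (tensor_left p Y) (md d) = md (hob p d)" by (metis cell.sel(2))
  let ?h = "lu d \<diamondop> (Mu \<star> idt V d) \<diamondop> ali q p d"
  show h: "arr V ?h" "tgt ?h = d" by simp_all
  show "src ?h = Cell A (fob (tensor_left q Y) (fob (tensor_left p Y) (md d))) Y"
    using tensor_left_cell[of "hob p d" q Y] by (simp add: m)
  have "al p (hob q p) d \<diamondop> (ali p (hob q p) d \<diamondop> (idt V p \<star> ali q p d) \<diamondop> al p q (hob p d)) = al p (hob q p) d \<diamondop> (al p q p \<star> idt V d) \<diamondop> ali (hob p q) p d"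
    using pentagon_mcm_inverse[of p q p d] by simp
  then have pent: "(idt V p \<star> ali q p d) \<diamondop> al p q (hob p d) = al p (hob q p) d \<diamondop> (al p q p \<star> idt V d) \<diamondop> ali (hob p q) p d"
    using V.tail[OF al_arr(4)[of p "hob q p" d]] by simp
  have n1: "ali (hob p q) p d \<diamondop> (De \<star> idt V (hob p d)) = (De \<star> idt V p \<star> idt V d) \<diamondop> ali (reg B) p d"
    using ali_natural[of De "idt V p" "idt V d"] by simp
  have n2: "(idt V p \<star> (Mu \<star> idt V d)) \<diamondop> al p (hob q p) d = al p (reg A) d \<diamondop> (idt V p \<star> Mu \<star> idt V d)"
    using al_natural[of "idt V p" Mu "idt V d"] by simp
  have u1: "ali (reg B) p d \<diamondop> lu (hob p d) = lu p \<star> idt V d"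
    unfolding lu_hob_comonoid[of p d, simplified, symmetric] using V.tail[OF al_arr(3)[of "reg B" p d]] by simp
  have u2: "(idt V p \<star> lu d) \<diamondop> al p (reg A) d = ru p \<star> idt V d"
    using triangle_monoid[of p d] by simp
  have "(idt V p \<star> ?h) \<diamondop> al p q (hob p d) \<diamondop> (De \<star> idt V (hob p d)) \<diamondop> lu (hob p d)
      = (idt V p \<star> lu d) \<diamondop> (idt V p \<star> (Mu \<star> idt V d)) \<diamondop> (idt V p \<star> ali q p d) \<diamondop> al p q (hob p d) \<diamondop> (De \<star> idt V (hob p d)) \<diamondop> lu (hob p d)"
    by (simp add: hmerge)
  also have "\<dots> = (idt V p \<star> lu d) \<diamondop> (idt V p \<star> (Mu \<star> idt V d)) \<diamondop> al p (hob q p) d \<diamondop> (al p q p \<star> idt V d) \<diamondop> ali (hob p q) p d \<diamondop> (De \<star> idt V (hob p d)) \<diamondop> lu (hob p d)"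
    by (simp only: V.tail[OF pent] V.cmp_assoc)
  also have "\<dots> = (idt V p \<star> lu d) \<diamondop> al p (reg A) d \<diamondop> (idt V p \<star> Mu \<star> idt V d) \<diamondop> (al p q p \<star> idt V d) \<diamondop> (De \<star> idt V p \<star> idt V d) \<diamondop> ali (reg B) p d \<diamondop> lu (hob p d)"
    by (simp only: V.tail[OF n1] V.tail[OF n2] V.cmp_assoc)
  also have "\<dots> = (ru p \<star> idt V d) \<diamondop> (idt V p \<star> Mu \<star> idt V d) \<diamondop> (al p q p \<star> idt V d) \<diamondop> (De \<star> idt V p \<star> idt V d) \<diamondop> (lu p \<star> idt V d)"
    by (simp only: V.tail[OF u2] u1)
  also have "\<dots> = (ru p \<diamondop> (idt V p \<star> Mu) \<diamondop> al p q p \<diamondop> (De \<star> idt V p) \<diamondop> lu p) \<star> idt V d"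
    by (simp add: hmerge)
  also have "\<dots> = idt V (hob p d)"
    unfolding zig_p by simp
  finally show "cell_map B Y (tensor_left p Y) ?h \<diamondop> (al p q (Cell B (fob (tensor_left p Y) (md d)) Y) \<diamondop> (De \<star> idt V (Cell B (fob (tensor_left p Y) (md d)) Y)) \<diamondop> lu (Cell B (fob (tensor_left p Y) (md d)) Y))
      = idt V (Cell B (fob (tensor_left p Y) (md d)) Y)"
    using tensor_left_cell_map[of p ?h Y] h unfolding l by simp
next
  fix t assume t: "arr V t" "lb (src t) = B" "rb (src t) = Y"
  note b = arr_V_bases[OF t(1)]
  note [simp] = t b
  have c [simp]: "q \<rhd> src t" "q \<rhd> tgt t" "reg B \<rhd> src t" "reg B \<rhd> tgt t" by (simp_all add: composable_def)
  have n1: "lu (tgt t) \<diamondop> t = (idt V (reg B) \<star> t) \<diamondop> lu (src t)"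
    using lu_natural_comonoid[of t] by simp
  have n2: "al p q (tgt t) \<diamondop> (idt V (hob p q) \<star> t) = (idt V p \<star> (idt V q \<star> t)) \<diamondop> al p q (src t)"
    using al_natural[of "idt V p" "idt V q" t] by simp
  have "(al p q (tgt t) \<diamondop> (De \<star> idt V (tgt t)) \<diamondop> lu (tgt t)) \<diamondop> t
      = al p q (tgt t) \<diamondop> (De \<star> idt V (tgt t)) \<diamondop> (idt V (reg B) \<star> t) \<diamondop> lu (src t)"
    by (simp only: V.cmp_assoc n1)
  also have "\<dots> = al p q (tgt t) \<diamondop> (idt V (hob p q) \<star> t) \<diamondop> (De \<star> idt V (src t)) \<diamondop> lu (src t)"
    by (simp add: hmerge)
  also have "\<dots> = (idt V p \<star> (idt V q \<star> t)) \<diamondop> al p q (src t) \<diamondop> (De \<star> idt V (src t)) \<diamondop> lu (src t)"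
    by (simp only: V.tail[OF n2] V.cmp_assoc)
  finally show "(al p q (tgt t) \<diamondop> (De \<star> idt V (tgt t)) \<diamondop> lu (tgt t)) \<diamondop> t
      = cell_map B Y (tensor_left p Y) (cell_map A Y (tensor_left q Y) t) \<diamondop> al p q (src t) \<diamondop> (De \<star> idt V (src t)) \<diamondop> lu (src t)"
    using tensor_left_cell_map[of q t Y] tensor_left_cell_map[of p "idt V q \<star> t" Y] by simp
next
  fix t assume t: "arr V t" "lb (src t) = A" "rb (src t) = Y"
  note b = arr_V_bases[OF t(1)]
  note [simp] = t b
  have c [simp]: "p \<rhd> src t" "p \<rhd> tgt t" "reg A \<rhd> src t" "reg A \<rhd> tgt t" by (simp_all add: composable_def)
  have n1: "lu (tgt t) \<diamondop> (idt V (reg A) \<star> t) = t \<diamondop> lu (src t)"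
    using lu_natural_monoid[of t] by simp
  have n2: "ali q p (tgt t) \<diamondop> (idt V q \<star> (idt V p \<star> t)) = (idt V (hob q p) \<star> t) \<diamondop> ali q p (src t)"
    using ali_natural[of "idt V q" "idt V p" t] by simp
  have "(lu (tgt t) \<diamondop> (Mu \<star> idt V (tgt t)) \<diamondop> ali q p (tgt t)) \<diamondop> (idt V q \<star> (idt V p \<star> t))
      = lu (tgt t) \<diamondop> (Mu \<star> idt V (tgt t)) \<diamondop> (idt V (hob q p) \<star> t) \<diamondop> ali q p (src t)"
    by (simp only: V.cmp_assoc n2)
  also have "\<dots> = lu (tgt t) \<diamondop> (idt V (reg A) \<star> t) \<diamondop> (Mu \<star> idt V (src t)) \<diamondop> ali q p (src t)"
    by (simp add: hmerge)
  also have "\<dots> = t \<diamondop> lu (src t) \<diamondop> (Mu \<star> idt V (src t)) \<diamondop> ali q p (src t)"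
    by (simp only: V.tail[OF n1] V.cmp_assoc)
  finally show "(lu (tgt t) \<diamondop> (Mu \<star> idt V (tgt t)) \<diamondop> ali q p (tgt t)) \<diamondop> cell_map A Y (tensor_left q Y) (cell_map B Y (tensor_left p Y) t)
      = t \<diamondop> lu (src t) \<diamondop> (Mu \<star> idt V (src t)) \<diamondop> ali q p (src t)"
    using tensor_left_cell_map[of p t Y] tensor_left_cell_map[of q "idt V p \<star> t" Y] by simp
qed simp_all

lemma tensor_right_adjunction:
  assumes X [simp]: "X \<in> bases"
  shows "adjunction (Mix K X B) (Mix K X A) (tensor_right X p) (tensor_right X q)"
proof (rule adjunction_from_V[where \<eta> = "\<lambda>c. ali c p q \<diamondop> (idt V c \<star> De) \<diamondop> ru c"
      and \<epsilon> = "\<lambda>d. ru d \<diamondop> (idt V d \<star> Mu) \<diamondop> al d q p"])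
  show "is_functor (Mix K X B) (Mix K X A) (tensor_right X p)" "is_functor (Mix K X A) (Mix K X B) (tensor_right X q)"
    using tensor_right_functor[of p X] tensor_right_functor[of q X] by simp_all
next
  fix c assume c: "c \<in> obj V" "lb c = X" "rb c = B"
  note [simp] = c
  have qc [simp]: "c \<rhd> p" "c \<rhd> reg B" by (simp_all add: composable_def)
  have l: "Cell X (fob (tensor_right X p) (md c)) A = hob c p"
    using tensor_right_cell[of c X p] by simp
  then have m: "fob (tensor_right X p) (md c) = md (hob c p)" by (metis cell.sel(2))
  let ?h = "ali c p q \<diamondop> (idt V c \<star> De) \<diamondop> ru c"
  show h: "arr V ?h" "src ?h = c" by simp_all
  show "tgt ?h = Cell X (fob (tensor_right X q) (fob (tensor_right X p) (md c))) B"
    using tensor_right_cell[of "hob c p" X q] by (simp add: m)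
  have "(ali c p (hob q p) \<diamondop> (idt V c \<star> al p q p)) \<diamondop> al c (hob p q) p = (al (hob c p) q p \<diamondop> (ali c p q \<star> idt V p) \<diamondop> ali c (hob p q) p) \<diamondop> al c (hob p q) p"
    using pentagon_cmc_inverse[of c p q p] by simp
  then have pent: "al (hob c p) q p \<diamondop> (ali c p q \<star> idt V p) = ali c p (hob q p) \<diamondop> (idt V c \<star> al p q p) \<diamondop> al c (hob p q) p"
    by (simp add: V.cmp_assoc)
  have n1: "al c (hob p q) p \<diamondop> (idt V c \<star> De \<star> idt V p) = (idt V c \<star> (De \<star> idt V p)) \<diamondop> al c (reg B) p"
    using al_natural[of "idt V c" De "idt V p"] by simp
  have n2: "(idt V (hob c p) \<star> Mu) \<diamondop> ali c p (hob q p) = ali c p (reg A) \<diamondop> (idt V c \<star> (idt V p \<star> Mu))"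
    using ali_natural[of "idt V c" "idt V p" Mu] by simp
  have u1: "ru (hob c p) \<diamondop> ali c p (reg A) = idt V c \<star> ru p"
    using ru_hob_monoid[of c p] by (simp add: V.cmp_assoc)
  have u2: "al c (reg B) p \<diamondop> (ru c \<star> idt V p) = idt V c \<star> lu p"
    using triangle_comonoid[of c p] by simp
  have "ru (hob c p) \<diamondop> (idt V (hob c p) \<star> Mu) \<diamondop> al (hob c p) q p \<diamondop> (?h \<star> idt V p)
      = ru (hob c p) \<diamondop> (idt V (hob c p) \<star> Mu) \<diamondop> al (hob c p) q p \<diamondop> (ali c p q \<star> idt V p) \<diamondop> (idt V c \<star> De \<star> idt V p) \<diamondop> (ru c \<star> idt V p)"
    by (simp add: hmerge)
  also have "\<dots> = ru (hob c p) \<diamondop> (idt V (hob c p) \<star> Mu) \<diamondop> ali c p (hob q p) \<diamondop> (idt V c \<star> al p q p) \<diamondop> al c (hob p q) p \<diamondop> (idt V c \<star> De \<star> idt V p) \<diamondop> (ru c \<star> idt V p)"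
    by (simp only: V.tail[OF pent] V.cmp_assoc)
  also have "\<dots> = ru (hob c p) \<diamondop> ali c p (reg A) \<diamondop> (idt V c \<star> (idt V p \<star> Mu)) \<diamondop> (idt V c \<star> al p q p) \<diamondop> (idt V c \<star> (De \<star> idt V p)) \<diamondop> al c (reg B) p \<diamondop> (ru c \<star> idt V p)"
    by (simp only: V.tail[OF n1] V.tail[OF n2] V.cmp_assoc)
  also have "\<dots> = (idt V c \<star> ru p) \<diamondop> (idt V c \<star> (idt V p \<star> Mu)) \<diamondop> (idt V c \<star> al p q p) \<diamondop> (idt V c \<star> (De \<star> idt V p)) \<diamondop> (idt V c \<star> lu p)"
    by (simp only: V.tail[OF u1] u2)
  also have "\<dots> = idt V c \<star> (ru p \<diamondop> (idt V p \<star> Mu) \<diamondop> al p q p \<diamondop> (De \<star> idt V p) \<diamondop> lu p)"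
    by (simp add: hmerge)
  also have "\<dots> = idt V (hob c p)"
    unfolding zig_p by simp
  finally show "(ru (Cell X (fob (tensor_right X p) (md c)) A) \<diamondop> (idt V (Cell X (fob (tensor_right X p) (md c)) A) \<star> Mu) \<diamondop> al (Cell X (fob (tensor_right X p) (md c)) A) q p) \<diamondop>
      cell_map X A (tensor_right X p) ?h = idt V (Cell X (fob (tensor_right X p) (md c)) A)"
    using tensor_right_cell_map[of p ?h X] h unfolding l by (simp add: V.cmp_assoc)
next
  fix d assume d: "d \<in> obj V" "lb d = X" "rb d = A"
  note [simp] = d
  have pd [simp]: "d \<rhd> q" "d \<rhd> reg A" by (simp_all add: composable_def)
  have l: "Cell X (fob (tensor_right X q) (md d)) B = hob d q"
    using tensor_right_cell[of d X q] by simp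
  then have m: "fob (tensor_right X q) (md d) = md (hob d q)" by (metis cell.sel(2))
  let ?h = "ru d \<diamondop> (idt V d \<star> Mu) \<diamondop> al d q p"
  show h: "arr V ?h" "tgt ?h = d" by simp_all
  show "src ?h = Cell X (fob (tensor_right X p) (fob (tensor_right X q) (md d))) A"
    using tensor_right_cell[of "hob d q" X p] by (simp add: m)
  have pent: "(al d q p \<star> idt V q) \<diamondop> ali (hob d q) p q = ali d (hob q p) q \<diamondop> (idt V d \<star> ali q p q) \<diamondop> al d q (hob p q)"
    using pentagon_mcm_inverse[of d q p q] by simp
  have n1: "al d q (hob p q) \<diamondop> (idt V (hob d q) \<star> De) = (idt V d \<star> (idt V q \<star> De)) \<diamondop> al d q (reg B)"
    using al_natural[of "idt V d" "idt V q" De] by simp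
  have n2: "(idt V d \<star> Mu \<star> idt V q) \<diamondop> ali d (hob q p) q = ali d (reg A) q \<diamondop> (idt V d \<star> (Mu \<star> idt V q))"
    using ali_natural[of "idt V d" Mu "idt V q"] by simp
  have u1: "al d q (reg B) \<diamondop> ru (hob d q) = idt V d \<star> ru q"
    unfolding ru_hob_comonoid[of d q, simplified, symmetric] using V.tail[OF al_arr(4)[of d q "reg B"]] by simp
  have u2: "(ru d \<star> idt V q) \<diamondop> ali d (reg A) q = idt V d \<star> lu q"
    unfolding triangle_monoid[of d q, simplified, symmetric] by (simp add: V.cmp_assoc)
  have "(?h \<star> idt V q) \<diamondop> ali (hob d q) p q \<diamondop> (idt V (hob d q) \<star> De) \<diamondop> ru (hob d q)
      = (ru d \<star> idt V q) \<diamondop> (idt V d \<star> Mu \<star> idt V q) \<diamondop> (al d q p \<star> idt V q) \<diamondop> ali (hob d q) p q \<diamondop> (idt V (hob d q) \<star> De) \<diamondop> ru (hob d q)"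
    by (simp add: hmerge)
  also have "\<dots> = (ru d \<star> idt V q) \<diamondop> (idt V d \<star> Mu \<star> idt V q) \<diamondop> ali d (hob q p) q \<diamondop> (idt V d \<star> ali q p q) \<diamondop> al d q (hob p q) \<diamondop> (idt V (hob d q) \<star> De) \<diamondop> ru (hob d q)"
    by (simp only: V.tail[OF pent] V.cmp_assoc)
  also have "\<dots> = (ru d \<star> idt V q) \<diamondop> ali d (reg A) q \<diamondop> (idt V d \<star> (Mu \<star> idt V q)) \<diamondop> (idt V d \<star> ali q p q) \<diamondop> (idt V d \<star> (idt V q \<star> De)) \<diamondop> al d q (reg B) \<diamondop> ru (hob d q)"
    by (simp only: V.tail[OF n1] V.tail[OF n2] V.cmp_assoc)
  also have "\<dots> = (idt V d \<star> lu q) \<diamondop> (idt V d \<star> (Mu \<star> idt V q)) \<diamondop> (idt V d \<star> ali q p q) \<diamondop> (idt V d \<star> (idt V q \<star> De)) \<diamondop> (idt V d \<star> ru q)"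
    by (simp only: V.tail[OF u2] u1)
  also have "\<dots> = idt V d \<star> (lu q \<diamondop> (Mu \<star> idt V q) \<diamondop> ali q p q \<diamondop> (idt V q \<star> De) \<diamondop> ru q)"
    by (simp add: hmerge)
  also have "\<dots> = idt V (hob d q)"
    unfolding zig_q by simp
  finally show "cell_map X B (tensor_right X q) ?h \<diamondop> (ali (Cell X (fob (tensor_right X q) (md d)) B) p q \<diamondop> (idt V (Cell X (fob (tensor_right X q) (md d)) B) \<star> De) \<diamondop> ru (Cell X (fob (tensor_right X q) (md d)) B))
      = idt V (Cell X (fob (tensor_right X q) (md d)) B)"
    using tensor_right_cell_map[of q ?h X] h unfolding l by simp
next
  fix t assume t: "arr V t" "lb (src t) = X" "rb (src t) = B"
  note b = arr_V_bases[OF t(1)]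
  note [simp] = t b
  have c [simp]: "src t \<rhd> p" "tgt t \<rhd> p" "src t \<rhd> reg B" "tgt t \<rhd> reg B" by (simp_all add: composable_def)
  have n1: "ru (tgt t) \<diamondop> t = (t \<star> idt V (reg B)) \<diamondop> ru (src t)"
    using ru_natural_comonoid[of t] by simp
  have n2: "ali (tgt t) p q \<diamondop> (t \<star> idt V (hob p q)) = (t \<star> idt V p \<star> idt V q) \<diamondop> ali (src t) p q"
    using ali_natural[of t "idt V p" "idt V q"] by simp
  have "(ali (tgt t) p q \<diamondop> (idt V (tgt t) \<star> De) \<diamondop> ru (tgt t)) \<diamondop> t
      = ali (tgt t) p q \<diamondop> (idt V (tgt t) \<star> De) \<diamondop> (t \<star> idt V (reg B)) \<diamondop> ru (src t)"
    by (simp only: V.cmp_assoc n1)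
  also have "\<dots> = ali (tgt t) p q \<diamondop> (t \<star> idt V (hob p q)) \<diamondop> (idt V (src t) \<star> De) \<diamondop> ru (src t)"
    by (simp add: hmerge)
  also have "\<dots> = (t \<star> idt V p \<star> idt V q) \<diamondop> ali (src t) p q \<diamondop> (idt V (src t) \<star> De) \<diamondop> ru (src t)"
    by (simp only: V.tail[OF n2] V.cmp_assoc)
  finally show "(ali (tgt t) p q \<diamondop> (idt V (tgt t) \<star> De) \<diamondop> ru (tgt t)) \<diamondop> t
      = cell_map X B (tensor_right X q) (cell_map X A (tensor_right X p) t) \<diamondop> ali (src t) p q \<diamondop> (idt V (src t) \<star> De) \<diamondop> ru (src t)"
    using tensor_right_cell_map[of p t X] tensor_right_cell_map[of q "t \<star> idt V p" X] by simp
next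
  fix t assume t: "arr V t" "lb (src t) = X" "rb (src t) = A"
  note b = arr_V_bases[OF t(1)]
  note [simp] = t b
  have c [simp]: "src t \<rhd> q" "tgt t \<rhd> q" "src t \<rhd> reg A" "tgt t \<rhd> reg A" by (simp_all add: composable_def)
  have n1: "ru (tgt t) \<diamondop> (t \<star> idt V (reg A)) = t \<diamondop> ru (src t)"
    using ru_natural_monoid[of t] by simp
  have n2: "al (tgt t) q p \<diamondop> (t \<star> idt V q \<star> idt V p) = (t \<star> idt V (hob q p)) \<diamondop> al (src t) q p"
    using al_natural[of t "idt V q" "idt V p"] by simp
  have "(ru (tgt t) \<diamondop> (idt V (tgt t) \<star> Mu) \<diamondop> al (tgt t) q p) \<diamondop> (t \<star> idt V q \<star> idt V p)
      = ru (tgt t) \<diamondop> (idt V (tgt t) \<star> Mu) \<diamondop> (t \<star> idt V (hob q p)) \<diamondop> al (src t) q p"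
    by (simp only: V.cmp_assoc n2)
  also have "\<dots> = ru (tgt t) \<diamondop> (t \<star> idt V (reg A)) \<diamondop> (idt V (src t) \<star> Mu) \<diamondop> al (src t) q p"
    by (simp add: hmerge)
  also have "\<dots> = t \<diamondop> ru (src t) \<diamondop> (idt V (src t) \<star> Mu) \<diamondop> al (src t) q p"
    by (simp only: V.tail[OF n1] V.cmp_assoc)
  finally show "(ru (tgt t) \<diamondop> (idt V (tgt t) \<star> Mu) \<diamondop> al (tgt t) q p) \<diamondop> cell_map X A (tensor_right X p) (cell_map X B (tensor_right X q) t)
      = t \<diamondop> ru (src t) \<diamondop> (idt V (src t) \<star> Mu) \<diamondop> al (src t) q p"
    using tensor_right_cell_map[of q t X] tensor_right_cell_map[of p "t \<star> idt V q" X] by simp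
qed simp_all

end

context twistable_cat
begin

section \<open>Replacing an adjoint by an isomorphic functor\<close>

lemma invs_Mix:
  assumes i: "invs V s s'" and e: "src s = Cell X M Y" "tgt s = Cell X N Y"
  shows "invs (Mix K X Y) (Arr M (raw s) N) (Arr N (raw s') M)"
proof -
  note j = V.invsD[OF i]
  have o: "Cell X M Y \<in> obj V" "Cell X N Y \<in> obj V"
    using arr_src[OF j(1)] arr_tgt[OF j(1)] unfolding e .
  then have b: "X \<in> bases" "Y \<in> bases" "M \<in> obj (Mix K X Y)" "N \<in> obj (Mix K X Y)"
    unfolding obj_V by simp_all
  have "s = Arr (Cell X M Y) (raw s) (Cell X N Y)" "s' = Arr (Cell X N Y) (raw s') (Cell X M Y)"
    using Arr_collapse[OF j(1)] Arr_collapse[OF j(2)] unfolding j(3,4) e by simp_all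
  then have "invs V (Arr (Cell X M Y) (raw s) (Cell X N Y)) (Arr (Cell X N Y) (raw s') (Cell X M Y))"
    using i by metis
  from V.invs_inverse_arrows[OF this] have "inverse_arrows (Mix K X Y) M N (raw s) (raw s')"
    by (simp add: inverse_arrows_def hom_V)
  moreover have "cat (Mix K X Y)"
    using category_Mix[OF b(1,2)] by (simp add: cat_def)
  ultimately show ?thesis
    using cat.inverse_arrows_invs[of "Mix K X Y" M N "raw s" "raw s'"] b(3,4) by simp
qed

text \<open>Naturally isomorphic functors between categories of mixed bimodules, with the isomorphism \<open>\<theta>\<close> and its
naturality given in \<open>V\<close>.\<close>

context
  fixes X Y X' Y' F F' and \<theta> \<theta>' :: "('a, 'b) cell \<Rightarrow> (('a, 'b) cell, 'b) tarr"
  assumes b: "X \<in> bases" "Y \<in> bases" "X' \<in> bases" "Y' \<in> bases"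
    and F: "is_functor (Mix K X Y) (Mix K X' Y') F"
    and ar: "\<And>t. arr V t \<Longrightarrow> lb (src t) = X \<Longrightarrow> rb (src t) = Y \<Longrightarrow> arr V (cell_map X' Y' F' t)"
    and iso: "\<And>c. c \<in> obj V \<Longrightarrow> lb c = X \<Longrightarrow> rb c = Y \<Longrightarrow> invs V (\<theta> c) (\<theta>' c)"
    and src\<theta>: "\<And>c. c \<in> obj V \<Longrightarrow> lb c = X \<Longrightarrow> rb c = Y \<Longrightarrow> src (\<theta> c) = Cell X' (fob F (md c)) Y'"
    and tgt\<theta>: "\<And>c. c \<in> obj V \<Longrightarrow> lb c = X \<Longrightarrow> rb c = Y \<Longrightarrow> tgt (\<theta> c) = Cell X' (fob F' (md c)) Y'"
    and nat: "\<And>t. arr V t \<Longrightarrow> lb (src t) = X \<Longrightarrow> rb (src t) = Y \<Longrightarrow>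
      cell_map X' Y' F' t \<diamondop> \<theta> (src t) = \<theta> (tgt t) \<diamondop> cell_map X' Y' F t"
begin

lemma transport_obj: "M \<in> obj (Mix K X Y) \<Longrightarrow> fob F' M \<in> obj (Mix K X' Y')"
proof -
  assume M: "M \<in> obj (Mix K X Y)"
  then have c: "Cell X M Y \<in> obj V" using b by (simp add: Cell_V)
  have "arr V (cell_map X' Y' F' (idt V (Cell X M Y)))"
    using ar[of "idt V (Cell X M Y)"] c by simp
  from arr_src[OF this] show ?thesis
    using b c by (simp add: Cell_V)
qed

lemma transport_hom:
  assumes M: "M \<in> obj (Mix K X Y)" "N \<in> obj (Mix K X Y)" "f \<in> hom (Mix K X Y) M N"
  shows "far F' M N f \<in> hom (Mix K X' Y') (fob F' M) (fob F' N)"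
proof -
  have t: "arr V (Arr (Cell X M Y) f (Cell X N Y))"
    using M b by (simp only: arr_Cell)
  from ar[OF this] show ?thesis
    unfolding cell_map_def using b by (simp add: arr_Cell del: arr_Arr)
qed

lemma transport_iso:
  "M \<in> obj (Mix K X Y) \<Longrightarrow> invs (Mix K X' Y') (Arr (fob F M) (raw (\<theta> (Cell X M Y))) (fob F' M))
    (Arr (fob F' M) (raw (\<theta>' (Cell X M Y))) (fob F M))"
  using iso[of "Cell X M Y"] src\<theta>[of "Cell X M Y"] tgt\<theta>[of "Cell X M Y"] b
  by (intro invs_Mix) (simp_all add: Cell_V)

lemma transport_natural:
  assumes M: "M \<in> obj (Mix K X Y)" "N \<in> obj (Mix K X Y)" "f \<in> hom (Mix K X Y) M N"
  shows "far F' M N f \<cdot>\<^bsub>Mix K X' Y'\<^esub> raw (\<theta> (Cell X M Y)) = raw (\<theta> (Cell X N Y)) \<cdot>\<^bsub>Mix K X' Y'\<^esub> far F M N f"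
proof -
  let ?t = "Arr (Cell X M Y) f (Cell X N Y)"
  have t: "arr V ?t"
    using M b by (simp only: arr_Cell)
  have c: "Cell X M Y \<in> obj V" "Cell X N Y \<in> obj V" using M b by (simp_all add: Cell_V)
  have o: "fob F M \<in> obj (Mix K X' Y')" "fob F N \<in> obj (Mix K X' Y')"
    "far F M N f \<in> hom (Mix K X' Y') (fob F M) (fob F N)"
    using is_functorD(3,4)[OF F] M by simp_all
  have "arr V (cell_map X' Y' F ?t)"
    unfolding cell_map_def using o b by (simp add: arr_Cell del: arr_Arr)
  moreover have "arr V (cell_map X' Y' F' ?t)" using ar[OF t] by simp
  moreover note V.invsD[OF iso[OF c(1)]] V.invsD[OF iso[OF c(2)]]
  moreover have "raw (cell_map X' Y' F' ?t \<diamondop> \<theta> (src ?t)) = raw (\<theta> (tgt ?t) \<diamondop> cell_map X' Y' F ?t)"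
    using nat[OF t] by simp
  ultimately show ?thesis
    using src\<theta>[OF c(1)] tgt\<theta>[OF c(1)] src\<theta>[OF c(2)] by (simp del: arr_Arr)
qed

lemma transport_left: "adjunction (Mix K X Y) (Mix K X' Y') F G \<Longrightarrow> adjunction (Mix K X Y) (Mix K X' Y') F' G"
  by (rule adjunction_transport_left[OF _ transport_obj transport_hom transport_iso transport_natural])

lemma transport_right: "adjunction (Mix K X' Y') (Mix K X Y) G F \<Longrightarrow> adjunction (Mix K X' Y') (Mix K X Y) G F'"
  by (rule adjunction_transport_right[OF _ transport_obj transport_hom transport_iso transport_natural])

end

lemma cell_map_comp: "cell_map X'' Y'' (comp_ftor G F) t = cell_map X'' Y'' G (cell_map X' Y' F t)"
  by (simp add: cell_map_def comp_ftor_def)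

section \<open>The adjoint pair of a twisting structure\<close>

lemma raw_hc:
  "arr V s \<Longrightarrow> arr V t \<Longrightarrow> rb (src s) = lb (src t) \<Longrightarrow> raw (s \<star> t) =
    bal_map K (rb (src s)) (md (src s)) (md (src t)) (rb (src s)) (md (tgt s)) (md (tgt t)) (raw s) (raw t)"
  by (simp add: hc_def)

text \<open>The data \<open>\<delta>\<close> and \<open>\<mu>\<close> of a twisting structure form an adjoint pair.  Its zigzag identities are those of
the twisting structure because the associativity isomorphisms in them are over one monoid and one
comonoid, where \<open>associativity_eq\<close> applies.\<close>

lemma twisting_adjoint_pair:
  assumes T: "right_twisting_structure K T" and A: "A \<in> obj (Mon K)"
  shows "adjoint_pair K A (fob (tB T) A) (Cell (fob (tB T) A) (tE T A) A) (Cell A (tEt T A) (fob (tB T) A))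
    (Arr (reg (fob (tB T) A)) (tdelta T A) (hob (Cell (fob (tB T) A) (tE T A) A) (Cell A (tEt T A) (fob (tB T) A))))
    (Arr (hob (Cell A (tEt T A) (fob (tB T) A)) (Cell (fob (tB T) A) (tE T A) A)) (tmu T A) (reg A))"
proof -
  define BA where "BA = fob (tB T) A"
  define p where "p = Cell BA (tE T A) A"
  define q where "q = Cell A (tEt T A) BA"
  have B: "BA \<in> obj (Comon K)"
    using T A unfolding BA_def right_twisting_structure_def by (auto dest: is_functorD(3))
  have bA: "A \<in> bases" "isM A" and bB: "BA \<in> bases" "\<not> isM BA"
    using A B by (auto simp: bases_def Mon_def Comon_def)
  have tw: "tE T A \<in> obj (Mix K BA A)" "tEt T A \<in> obj (Mix K A BA)"
    "tdelta T A \<in> hom (Mix K BA BA) (regular BA) (mten K BA A BA (tE T A) (tEt T A))"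
    "tmu T A \<in> hom (Mix K A A) (mten K A BA A (tEt T A) (tE T A)) (regular A)"
    "zigzag_Et K T A = ident K (carr (tEt T A))" "zigzag_E K T A = ident K (carr (tE T A))"
    using T A unfolding right_twisting_structure_def BA_def Let_def by blast+
  have s [simp]: "lb p = BA" "rb p = A" "md p = tE T A" "lb q = A" "rb q = BA" "md q = tEt T A"
    unfolding p_def q_def by simp_all
  have V [simp]: "p \<in> obj V" "q \<in> obj V"
    using tw bA bB unfolding obj_V by simp_all
  note [simp] = bA bB
  have c [simp]: "p \<rhd> q" "q \<rhd> p" "reg A \<rhd> q" "reg BA \<rhd> p" "q \<rhd> reg BA" "p \<rhd> reg A"
    by (simp_all add: composable_def)
  let ?De = "Arr (reg BA) (tdelta T A) (hob p q)" and ?Mu = "Arr (hob q p) (tmu T A) (reg A)"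
  have arrs: "arr V ?De" "arr V ?Mu"
    using tw(3,4) by (simp_all add: hom_V md_hob)
  have raws: "raw (lu q) = tensor_unit_left K A (tEt T A)" "raw (ru q) = cotensor_unit_right K BA (tEt T A)"
    "raw (lu p) = cotensor_unit_left K BA (tE T A)" "raw (ru p) = tensor_unit_right K A (tE T A)"
    "raw (ali q p q) = inv_arr K (car (hob (hob q p) q)) (car (hob q (hob p q))) (al_raw q p q)"
    by (simp_all add: lu_def ru_def assoc_inv_def)
  note assoc = associativity_eq[of q p q] associativity_eq[of p q p]
  have zq: "lu q \<diamondop> (?Mu \<star> idt V q) \<diamondop> ali q p q \<diamondop> (idt V q \<star> ?De) \<diamondop> ru q = idt V q"
  proof (rule tarr_eqI[of V])
    have "raw (lu q \<diamondop> (?Mu \<star> idt V q) \<diamondop> ali q p q \<diamondop> (idt V q \<star> ?De) \<diamondop> ru q) = zigzag_Et K T A"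
      using arrs assoc(1)
      by (simp add: zigzag_Et_def Let_def raw_hc raws associativity_inv_def md_hob BA_def[symmetric] del: arr_Arr)
    then show "raw (lu q \<diamondop> (?Mu \<star> idt V q) \<diamondop> ali q p q \<diamondop> (idt V q \<star> ?De) \<diamondop> ru q) = raw (idt V q)"
      using tw(5) by simp
  qed (use arrs in \<open>simp_all del: arr_Arr\<close>)
  have zp: "ru p \<diamondop> (idt V p \<star> ?Mu) \<diamondop> al p q p \<diamondop> (?De \<star> idt V p) \<diamondop> lu p = idt V p"
  proof (rule tarr_eqI[of V])
    have "raw (ru p \<diamondop> (idt V p \<star> ?Mu) \<diamondop> al p q p \<diamondop> (?De \<star> idt V p) \<diamondop> lu p) = zigzag_E K T A"
      using arrs assoc(2)
      by (simp add: zigzag_E_def Let_def raw_hc raws md_hob BA_def[symmetric] del: arr_Arr)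
    then show "raw (ru p \<diamondop> (idt V p \<star> ?Mu) \<diamondop> al p q p \<diamondop> (?De \<star> idt V p) \<diamondop> lu p) = raw (idt V p)"
      using tw(6) by simp
  qed (use arrs in \<open>simp_all del: arr_Arr\<close>)
  have "adjoint_pair K A BA p q ?De ?Mu"
    by unfold_locales (use zq zp arrs in \<open>simp_all del: arr_Arr\<close>)
  then show ?thesis
    unfolding p_def q_def BA_def .
qed

lemma comonoid_change_of_morphism:
  assumes C: "C \<in> obj (Comon K)" and D: "D \<in> obj (Comon K)" and g: "g \<in> hom (Comon K) C D"
  shows "comonoid_change K g C D (Arr (und C) g (und D))"
proof -
  have b: "C \<in> bases" "\<not> isM C" "D \<in> bases" "\<not> isM D"
    using C D by (auto simp: bases_def Comon_def)
  have h: "g \<in> hom K (und C) (und D)" "(g \<boxtimes> g) \<cdot> mlt C = mlt D \<cdot> g" "unt D \<cdot> g = unt C"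
    using g by (simp_all add: Comon_def)
  let ?h = "Arr (und C) g (und D)"
  have a: "arr K ?h" using h(1) b by simp
  note [simp] = b
  have "(?h \<odot> ?h) \<bullet> mu C = mu D \<bullet> ?h"
    by (rule tarr_eqI[of K]) (use a h in \<open>simp_all del: arr_Arr\<close>)
  moreover have "un D \<bullet> ?h = un C"
    by (rule tarr_eqI[of K]) (use a h in \<open>simp_all del: arr_Arr\<close>)
  ultimately show ?thesis
    by unfold_locales (use a in \<open>simp_all del: arr_Arr\<close>)
qed

end

section \<open>Composing the four adjunctions\<close>

text \<open>Two comonoid morphisms \<open>g : C \<rightarrow> B\<close> and \<open>g' : C' \<rightarrow> B'\<close> with adjoint pairs between \<open>A\<close> and \<open>B\<close> and between
\<open>A'\<close> and \<open>B'\<close>.\<close>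

locale classified = twistable_cat +
  lg: comonoid_change K g C B h + rg: comonoid_change K g' C' B' h' +
  lp: adjoint_pair K A B p q De Mu + rp: adjoint_pair K A' B' p' q' De' Mu'
  for g C B h g' C' B' h' A p q De Mu A' p' q' De' Mu'
begin

lemma composables [simp]: "lg.cg \<rhd> p" "hob lg.cg p \<in> obj V" "hob (reg A) q \<in> obj V" "q' \<rhd> rg.gc"
  by (simp_all add: composable_def)

text \<open>The factor \<open>A\<close> in \<open>A \<otimes>\<^sub>g N\<close> is removed by the unit isomorphism of \<open>q\<close>.\<close>

lemma tensor_left_reg_adjunction: "adjunction (Mix K B C') (Mix K A C') (tensor_left (hob (reg A) q) C') (tensor_left p C')"
proof -
  obtain j where j: "invs V (lu q) j"
    using lu_iso[of q] by auto
  note i = V.invsD[OF j]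
  show ?thesis
  proof (rule transport_left[where F = "tensor_left q C'" and \<theta> = "\<lambda>c. j \<star> idt V c" and \<theta>' = "\<lambda>c. lu q \<star> idt V c"])
    show "adjunction (Mix K B C') (Mix K A C') (tensor_left q C') (tensor_left p C')"
      by (rule lp.tensor_left_adjunction) simp
    show "is_functor (Mix K B C') (Mix K A C') (tensor_left q C')"
      using tensor_left_functor[of q C'] by simp
  next
    fix c assume c: "c \<in> obj V" "lb c = B" "rb c = C'"
    note [simp] = c
    have "q \<rhd> c" "hob (reg A) q \<rhd> c" by (simp_all add: composable_def)
    note [simp] = this
    show "invs V (j \<star> idt V c) (lu q \<star> idt V c)"
      using i by (intro invs_hc invs_idt V.invs_sym[OF j]) simp_all
    show "src (j \<star> idt V c) = Cell A (fob (tensor_left q C') (md c)) C'"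
      "tgt (j \<star> idt V c) = Cell A (fob (tensor_left (hob (reg A) q) C') (md c)) C'"
      using i tensor_left_cell[of c q C'] tensor_left_cell[of c "hob (reg A) q" C'] by simp_all
  next
    fix t assume t: "arr V t" "lb (src t) = B" "rb (src t) = C'"
    note [simp] = t arr_V_bases[OF t(1)]
    have v: "cell_map A C' (tensor_left q C') t = idt V q \<star> t" "cell_map A C' (tensor_left (hob (reg A) q) C') t = idt V (hob (reg A) q) \<star> t"
      using tensor_left_cell_map[of q t C'] tensor_left_cell_map[of "hob (reg A) q" t C'] by simp_all
    show "arr V (cell_map A C' (tensor_left (hob (reg A) q) C') t)"
      unfolding v by simp
    show "cell_map A C' (tensor_left (hob (reg A) q) C') t \<diamondop> (j \<star> idt V (src t)) = (j \<star> idt V (tgt t)) \<diamondop> cell_map A C' (tensor_left q C') t"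
      unfolding v using i by (simp add: hc_cmp)
  qed simp_all
qed

text \<open>The left half of the theorem, \<open>A \<otimes>\<^sub>g _\<close> and \<open>C \<otimes>\<^sub>g _\<close>.  The composite right adjoint \<open>C\<^sub>g \<box> (p \<otimes> _)\<close> is
rebracketed to \<open>(C\<^sub>g \<box> p) \<otimes> _\<close>.\<close>

lemma left_adjunction:
  "adjunction (Mix K C C') (Mix K A C') (comp_ftor (tensor_left (hob (reg A) q) C') lg.push_left_ftor) (tensor_left (hob lg.cg p) C')"
proof (rule transport_right[where F = "comp_ftor (tensor_left lg.cg C') (tensor_left p C')"
      and \<theta> = "ali lg.cg p" and \<theta>' = "al lg.cg p"])
  show "adjunction (Mix K C C') (Mix K A C') (comp_ftor (tensor_left (hob (reg A) q) C') lg.push_left_ftor) (comp_ftor (tensor_left lg.cg C') (tensor_left p C'))"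
    by (rule adjunction_compose[OF lg.change_adjunction_left tensor_left_reg_adjunction]) simp
  then show "is_functor (Mix K A C') (Mix K C C') (comp_ftor (tensor_left lg.cg C') (tensor_left p C'))"
    by (simp add: adjunction_def)
next
  fix c assume c: "c \<in> obj V" "lb c = A" "rb c = C'"
  note [simp] = c
  have pc [simp]: "p \<rhd> c" by (simp add: composable_def)
  have [simp]: "lg.cg \<rhd> hob p c" "hob lg.cg p \<rhd> c" by simp_all
  show "invs V (ali lg.cg p c) (al lg.cg p c)"
    by (rule V.invs_sym[OF invs_al]) simp_all
  show "src (ali lg.cg p c) = Cell C (fob (comp_ftor (tensor_left lg.cg C') (tensor_left p C')) (md c)) C'"
    "tgt (ali lg.cg p c) = Cell C (fob (tensor_left (hob lg.cg p) C') (md c)) C'"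
    using tensor_left_cell[of c p C'] tensor_left_cell[of "hob p c" lg.cg C'] tensor_left_cell[of c "hob lg.cg p" C']
    by (simp_all add: comp_ftor_def md_hob tensor_left_def)
next
  fix t assume t: "arr V t" "lb (src t) = A" "rb (src t) = C'"
  note [simp] = t arr_V_bases[OF t(1)]
  have v: "cell_map C C' (comp_ftor (tensor_left lg.cg C') (tensor_left p C')) t = idt V lg.cg \<star> (idt V p \<star> t)"
    "cell_map C C' (tensor_left (hob lg.cg p) C') t = idt V (hob lg.cg p) \<star> t"
    unfolding cell_map_comp[where X' = B and Y' = C']
    using tensor_left_cell_map[of p t C'] tensor_left_cell_map[of lg.cg "idt V p \<star> t" C'] tensor_left_cell_map[of "hob lg.cg p" t C'] by simp_all
  show "arr V (cell_map C C' (tensor_left (hob lg.cg p) C') t)"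
    unfolding v by simp
  show "cell_map C C' (tensor_left (hob lg.cg p) C') t \<diamondop> ali lg.cg p (src t) =
      ali lg.cg p (tgt t) \<diamondop> cell_map C C' (comp_ftor (tensor_left lg.cg C') (tensor_left p C')) t"
    unfolding v using ali_natural[of "idt V lg.cg" "idt V p" t] by simp
qed simp_all

text \<open>The factor \<open>A'\<close> in \<open>N \<otimes>\<^sub>g\<^sub>' A'\<close> is removed by the unit isomorphism of the whole product.  It points away from
this factor, so \<open>\<theta>\<close> chooses its inverse.\<close>

lemma tensor_right_reg_adjunction:
  "adjunction (Mix K A B') (Mix K A A') (comp_ftor (tensor_right A (reg A')) (tensor_right A p')) (tensor_right A q')"
proof -
  define \<theta> where "\<theta> c = (SOME j. invs V (ru (hob c p')) j)" for c
  have \<theta>: "invs V (ru (hob c p')) (\<theta> c)" if "c \<rhd> p'" for c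
  proof -
    have "hob c p' \<in> obj V" "isM (rb (hob c p'))"
      using that by simp_all
    then obtain j where "invs V (ru (hob c p')) j"
      by (rule ru_iso)
    then show ?thesis unfolding \<theta>_def by (rule someI)
  qed
  show ?thesis
  proof (rule transport_left[where F = "tensor_right A p'" and \<theta> = \<theta> and \<theta>' = "\<lambda>c. ru (hob c p')"])
    show "adjunction (Mix K A B') (Mix K A A') (tensor_right A p') (tensor_right A q')"
      by (rule rp.tensor_right_adjunction) simp
    show "is_functor (Mix K A B') (Mix K A A') (tensor_right A p')"
      using tensor_right_functor[of p' A] by simp
  next
    fix c assume c: "c \<in> obj V" "lb c = A" "rb c = B'"
    note [simp] = c
    have cp [simp]: "c \<rhd> p'" by (simp add: composable_def)
    show "invs V (\<theta> c) (ru (hob c p'))"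
      by (rule V.invs_sym[OF \<theta>[OF cp]])
    show "src (\<theta> c) = Cell A (fob (tensor_right A p') (md c)) A'"
      "tgt (\<theta> c) = Cell A (fob (comp_ftor (tensor_right A (reg A')) (tensor_right A p')) (md c)) A'"
      using V.invsD[OF \<theta>[OF cp]] tensor_right_cell[of c A p'] tensor_right_cell[of "hob c p'" A "reg A'"]
      by (simp_all add: comp_ftor_def md_hob tensor_right_def)
  next
    fix t assume t: "arr V t" "lb (src t) = A" "rb (src t) = B'"
    note [simp] = t arr_V_bases[OF t(1)]
    have v: "cell_map A A' (tensor_right A p') t = t \<star> idt V p'"
      "cell_map A A' (comp_ftor (tensor_right A (reg A')) (tensor_right A p')) t = (t \<star> idt V p') \<star> idt V (reg A')"
      unfolding cell_map_comp[where X' = A and Y' = A']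
      using tensor_right_cell_map[of p' t A] tensor_right_cell_map[of "reg A'" "t \<star> idt V p'" A] by simp_all
    show "arr V (cell_map A A' (comp_ftor (tensor_right A (reg A')) (tensor_right A p')) t)"
      unfolding v by simp
    let ?s = "t \<star> idt V p'" and ?u = "(t \<star> idt V p') \<star> idt V (reg A')"
    have "src t \<rhd> p'" "tgt t \<rhd> p'" by (simp_all add: composable_def)
    note i = V.invsD[OF \<theta>[OF this(1)]] V.invsD[OF \<theta>[OF this(2)]]
    have "ru (hob (tgt t) p') \<diamondop> ?u = ?s \<diamondop> ru (hob (src t) p')"
      using ru_natural_monoid[of ?s] by simp
    note n = V.tail[OF this]
    have "?u \<diamondop> \<theta> (src t) = (\<theta> (tgt t) \<diamondop> ru (hob (tgt t) p')) \<diamondop> (?u \<diamondop> \<theta> (src t))"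
      unfolding i(11) using i by simp
    also have "\<dots> = \<theta> (tgt t) \<diamondop> ?s"
      using i(1-4,6-10) by (simp add: V.cmp_assoc n)
    finally show "cell_map A A' (comp_ftor (tensor_right A (reg A')) (tensor_right A p')) t \<diamondop> \<theta> (src t) = \<theta> (tgt t) \<diamondop> cell_map A A' (tensor_right A p') t"
      unfolding v .
  qed simp_all
qed

text \<open>The right half, \<open>_ \<otimes>\<^sub>g\<^sub>' A'\<close> and \<open>_ \<otimes>\<^sub>g\<^sub>' C'\<close>, whose bracketing to the left is already the one needed.\<close>

lemma right_adjunction:
  "adjunction (Mix K A C') (Mix K A A') (comp_ftor (comp_ftor (tensor_right A (reg A')) (tensor_right A p')) rg.push_right_ftor)
    (comp_ftor (tensor_right A rg.gc) (tensor_right A q'))"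
  by (rule adjunction_compose[OF rg.change_adjunction_right tensor_right_reg_adjunction]) simp

text \<open>The composite right adjoint first applies the right-hand functors, whereas \<open>(C \<otimes>\<^sub>g M) \<otimes>\<^sub>g\<^sub>' C'\<close> is bracketed to
the left; two associativity isomorphisms mediate.\<close>

lemma two_sided_adjunction:
  "adjunction (Mix K C C') (Mix K A A')
    (comp_ftor (comp_ftor (comp_ftor (tensor_right A (reg A')) (tensor_right A p')) rg.push_right_ftor) (comp_ftor (tensor_left (hob (reg A) q) C') lg.push_left_ftor))
    (comp_ftor (tensor_right C rg.gc) (comp_ftor (tensor_right C q') (tensor_left (hob lg.cg p) A')))"
proof -
  let ?w = "hob lg.cg p"
  let ?G = "comp_ftor (tensor_left ?w C') (comp_ftor (tensor_right A rg.gc) (tensor_right A q'))"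
    and ?G' = "comp_ftor (tensor_right C rg.gc) (comp_ftor (tensor_right C q') (tensor_left ?w A'))"
  let ?\<theta> = "\<lambda>d. (ali ?w d q' \<star> idt V rg.gc) \<diamondop> ali ?w (hob d q') rg.gc"
    and ?\<theta>' = "\<lambda>d. al ?w (hob d q') rg.gc \<diamondop> (al ?w d q' \<star> idt V rg.gc)"
  show ?thesis
  proof (rule transport_right[where F = ?G and \<theta> = ?\<theta> and \<theta>' = ?\<theta>'])
    show adj: "adjunction (Mix K C C') (Mix K A A')
        (comp_ftor (comp_ftor (comp_ftor (tensor_right A (reg A')) (tensor_right A p')) rg.push_right_ftor) (comp_ftor (tensor_left (hob (reg A) q) C') lg.push_left_ftor)) ?G"
      by (rule adjunction_compose[OF left_adjunction right_adjunction])
    then show "is_functor (Mix K A A') (Mix K C C') ?G"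
      by (simp add: adjunction_def)
  next
    fix d assume d: "d \<in> obj V" "lb d = A" "rb d = A'"
    note [simp] = d
    have wd [simp]: "?w \<rhd> d" "d \<rhd> q'" by (simp_all add: composable_def)
    have [simp]: "hob d q' \<rhd> rg.gc" "?w \<rhd> hob d q'" "hob ?w d \<rhd> q'" by simp_all
    show "invs V (?\<theta> d) (?\<theta>' d)"
      by (intro V.invs_cmp V.invs_sym[OF invs_al] invs_hc invs_idt) simp_all
    have e: "Cell C (fob ?G (md d)) C' = hob ?w (hob (hob d q') rg.gc)" "Cell C (fob ?G' (md d)) C' = hob (hob (hob ?w d) q') rg.gc"
      by (simp_all add: comp_ftor_def hob_def tensor_left_def tensor_right_def)
    show "src (?\<theta> d) = Cell C (fob ?G (md d)) C'" "tgt (?\<theta> d) = Cell C (fob ?G' (md d)) C'"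
      unfolding e by simp_all
  next
    fix t assume t: "arr V t" "lb (src t) = A" "rb (src t) = A'"
    note [simp] = t arr_V_bases[OF t(1)]
    have v: "cell_map C C' ?G t = idt V ?w \<star> ((t \<star> idt V q') \<star> idt V rg.gc)"
      "cell_map C C' ?G' t = ((idt V ?w \<star> t) \<star> idt V q') \<star> idt V rg.gc"
      unfolding cell_map_comp[where G = "tensor_left ?w C'" and X' = A and Y' = C'] cell_map_comp[where G = "tensor_right A rg.gc" and X' = A and Y' = B']
        cell_map_comp[where G = "tensor_right C rg.gc" and X' = C and Y' = B'] cell_map_comp[where G = "tensor_right C q'" and X' = C and Y' = A']
      using tensor_right_cell_map[of q' t A] tensor_right_cell_map[of rg.gc "t \<star> idt V q'" A] tensor_left_cell_map[of ?w "(t \<star> idt V q') \<star> idt V rg.gc" C']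
        tensor_left_cell_map[of ?w t A'] tensor_right_cell_map[of q' "idt V ?w \<star> t" C] tensor_right_cell_map[of rg.gc "(idt V ?w \<star> t) \<star> idt V q'" C]
      by simp_all
    show "arr V (cell_map C C' ?G' t)"
      unfolding v by simp
    have w: "?w \<rhd> src t" "?w \<rhd> tgt t" "src t \<rhd> q'" "tgt t \<rhd> q'" by (simp_all add: composable_def)
    have n: "(idt V ?w \<star> t) \<star> idt V q' \<diamondop> ali ?w (src t) q' = ali ?w (tgt t) q' \<diamondop> (idt V ?w \<star> (t \<star> idt V q'))"
      using ali_natural[of "idt V ?w" t "idt V q'"] by simp
    have m: "((idt V ?w \<star> (t \<star> idt V q')) \<star> idt V rg.gc) \<diamondop> ali ?w (hob (src t) q') rg.gc
        = ali ?w (hob (tgt t) q') rg.gc \<diamondop> (idt V ?w \<star> ((t \<star> idt V q') \<star> idt V rg.gc))"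
      using ali_natural[of "idt V ?w" "t \<star> idt V q'" "idt V rg.gc"] by simp
    show "cell_map C C' ?G' t \<diamondop> ?\<theta> (src t) = ?\<theta> (tgt t) \<diamondop> cell_map C C' ?G t"
      unfolding v V.cmp_assoc m[symmetric] using w by (simp add: hmerge n)
  qed simp_all
qed

end

section \<open>The adjunction along two classifying morphisms\<close>

theorem theorem2p9:
  fixes K :: "('o, 'a) moncat"
    and T :: "('o, 'a) twisting"
    and A A' C C' :: "('o, 'a) comon"
    and g g' :: 'a
  assumes "monoidal_category K"
    and "has_equalizers K"
    and "has_coequalizers K"
    and "twistable K"
    and "right_twisting_structure K T"
    and "C \<in> obj (Comon K)"
    and "C' \<in> obj (Comon K)"
    and "A \<in> obj (Mon K)"
    and "A' \<in> obj (Mon K)"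
    and "g \<in> hom (Comon K) C (fob (tB T) A)"
    and "g' \<in> hom (Comon K) C' (fob (tB T) A')"
  shows "adjunction (Mix K C C') (Mix K A A')
           (lower_star K T C C' A A' g g') (upper_star K T C C' A A' g g')"
proof -
  interpret twistable_cat K
    by unfold_locales (use assms in simp_all)
  let ?B = "fob (tB T) A" and ?B' = "fob (tB T) A'"
  let ?p = "Cell ?B (tE T A) A" and ?q = "Cell A (tEt T A) ?B"
    and ?p' = "Cell ?B' (tE T A') A'" and ?q' = "Cell A' (tEt T A') ?B'"
  have B: "?B \<in> obj (Comon K)" "?B' \<in> obj (Comon K)"
    using assms(5,8,9) unfolding right_twisting_structure_def by (auto dest: is_functorD(3))
  interpret classified K g C ?B "Arr (und C) g (und ?B)" g' C' ?B' "Arr (und C') g' (und ?B')"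
      A ?p ?q "Arr (reg ?B) (tdelta T A) (hob ?p ?q)" "Arr (hob ?q ?p) (tmu T A) (reg A)"
      A' ?p' ?q' "Arr (reg ?B') (tdelta T A') (hob ?p' ?q')" "Arr (hob ?q' ?p') (tmu T A') (reg A')"
    by (intro classified.intro twistable_cat_axioms comonoid_change_of_morphism twisting_adjoint_pair assms B)
  have reg: "reg A \<rhd> ?q" by simp
  \<comment> \<open>The arrow maps of \<open>(g, g')\<^sub>*\<close> and \<open>(g, g')\<^sup>*\<close> contain an identity written as a product of identities.\<close>
  have "bal_map K A (regular A) (tEt T A) A (regular A) (tEt T A) (ident K (und A)) (ident K (carr (tEt T A)))
      = ident K (carr (mten K A A ?B (regular A) (tEt T A)))"
    using arg_cong[OF hc_idt[OF reg], of raw] by (simp add: raw_hc md_hob del: hc_idt)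
  then have l: "lower_star K T C C' A A' g g' =
      comp_ftor (comp_ftor (comp_ftor (tensor_right A (reg A')) (tensor_right A ?p')) rg.push_right_ftor) (comp_ftor (tensor_left (hob (reg A) ?q) C') lg.push_left_ftor)"
    by (simp add: lower_star_def twist_E_def twist_Et_def twist_E_map_def twist_Et_map_def Let_def
        comp_ftor_def tensor_right_def tensor_left_def rg.push_right_ftor_def lg.push_left_ftor_def md_hob)
  have cg: "lg.cg \<rhd> ?p" "md lg.cg = comod_right_via K g (regular C)" "carr (comod_right_via K g (regular C)) = und C"
    by (simp_all only: composables, simp_all add: lg.cg_def push_right_def comod_right_via_def)
  have "bal_map K ?B (comod_right_via K g (regular C)) (tE T A) ?B (comod_right_via K g (regular C)) (tE T A)
      (ident K (und C)) (ident K (carr (tE T A)))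
      = ident K (carr (mten K C ?B A (comod_right_via K g (regular C)) (tE T A)))"
    using arg_cong[OF hc_idt[OF cg(1)], of raw] cg(2,3) by (simp add: raw_hc md_hob del: hc_idt)
  moreover have "carr (comod_left_via K g' (regular C')) = und C'"
    by (simp add: comod_left_via_def)
  ultimately have u: "upper_star K T C C' A A' g g' =
      comp_ftor (tensor_right C rg.gc) (comp_ftor (tensor_right C ?q') (tensor_left (hob lg.cg ?p) A'))"
    by (simp add: upper_star_def twist_E_def twist_Et_def twist_E_map_def twist_Et_map_def Let_def
        comp_ftor_def tensor_right_def tensor_left_def rg.gc_def lg.cg_def md_hob push_right_def push_left_def)
  show ?thesis
    unfolding l u by (rule two_sided_adjunction)
qed

end
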